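(* Let $\mathcal O$ be an indexing system and $\underline{\mathcal C}$ an $\mathcal O$-symmetric monoidal category satisfying the standing assumptions in the context. If $R$ is an $\mathcal O$-commutative monoid in $\underline{\mathcal C}$, then the operation $\Box_R$, given for $T\in\mathcal O(G/G)$ and $M$ an $R$-module by $$T\Box_R M=R\otimes_{T\Box R}(T\Box M)$$ (and for $T\in\mathcal O(G/H)$ and $M$ an $i_H^*R$-module in $\underline{\mathcal C}(G/H)$ by the same formula with $i_H^*R$ in place of $R$), makes $R\text{-}\underline{\mathcal Mod}$ into an $\mathcal O$-symmetric monoidal coefficient system.
   Context: $G$ is a finite group with orbit category $\mathcal Orb_G$. "Functor" means pseudofunctor, so diagrams commute up to isomorphism. A symmetric monoidal coefficient system is a contravariant functor $\underline{\mathcal C}$ from $\mathcal Orb_G$ to symmetric monoidal categories and strong symmetric monoidal functors; its values on maps are called restrictions, denoted $i_K^*\colon\underline{\mathcal C}(G/H)\to\underline{\mathcal C}(G/K)$. $\underline{\mathcal Set}$ is the coefficient system sending $G/H$ to finite $H$-sets (equivalently finite $G$-sets over $G/H$) under disjoint union, with restriction by pullback. The superscript $Iso$ denotes passing to the subcategory of isomorphisms. An indexing system $\mathcal O$ is a full symmetric monoidal sub coefficient system of $\underline{\mathcal Set}$ that contains the $G$-set $G/G$, is closed under finite limits, and is closed under self-induction: if $H/K\in\mathcal O(G/H)$ and $T\in\mathcal O(G/K)$ then $H\times_K T\in\mathcal O(G/H)$. Every $\mathcal O$ contains all finite sets with trivial action. An $\mathcal O$-symmetric monoidal category (or coefficient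 system) is a symmetric monoidal coefficient system $\underline{\mathcal C}$ together with a bilinear map $\Box\colon\mathcal O^{Iso}\times\underline{\mathcal C}\to\underline{\mathcal C}$ (a natural transformation of category-valued coefficient systems, levelwise strong symmetric monoidal in each variable separately) which extends the canonical exponentiation $T\Box M=\bigotimes_T M$ for sets $T$ with trivial action and is associative: $(S\times T)\Box M\cong S\Box(T\Box M)$ up to natural isomorphism. An $\mathcal O$-commutative monoid in $\underline{\mathcal C}$ is an object $R\in\underline{\mathcal C}(G/G)$ together with an extension of the map $\mathcal O^{Iso}\to\underline{\mathcal C}$, $T\mapsto T\Box R$ (meaning $T\Box i_H^*R$ for $T\in\mathcal O(G/H)$), to a functor of symmetric monoidal coefficient systems $N^{(-)}(R)\colon\mathcal O\to\underline{\mathcal C}$. In particular $R$ is a commutative monoid, and for $T\in\mathcal O(G/H)$ the map $T\to *$ induces a map of commutative monoids $T\Box i_H^*R\to i_H^*R$. For a commutative monoid $A$, an $A$-module is an object with an associative and unital action of $A$, and $M\otimes_A N$ is the coequalizer of the two action maps $M\otimes A\otimes N\rightrightarrows M\otimes N$. $T\Box M$ is a $T\Box R$-module via $(T\Box R)\otimes(T\Box M)\cong T\Box(R\otimes M)\to T\Box M$, and $R$ is a $T\Box R$-algebra via $T\Box R\to R$. $R\text{-}\underline{\mathcal Mod}$ is the symmetric monoidal coefficient system whose value at $G/H$ is the category of $i_H^*R$-modules in $\underline{\mathcal C}(G/H)$, with product $\otimes_{i_H^*R}$. Standing assumptions: $\underline{\mathcal C}$ has levelwise colimits, and the operation $T\Box(-)$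 commutes with sifted colimits.
   Formalization: Assumes also that M⊗(−) and the restriction functors preserve sifted colimits (needed for R-Mod to be a symmetric monoidal coefficient system), and that for an O-commutative monoid S□N(t) agrees with N(S×t); without the latter the claim can fail. *)

theory Defs
  imports "HOL-Algebra.Left_Coset" "HOL-Algebra.Group_Action"
begin

section \<open>Categories and symmetric monoidal categories\<close>

record ('o, 'a) cat =
  cobj :: "'o set"
  carr :: "'a set"
  cdom :: "'a \<Rightarrow> 'o"
  ccod :: "'a \<Rightarrow> 'o"
  cid :: "'o \<Rightarrow> 'a"
  ccomp :: "'a \<Rightarrow> 'a \<Rightarrow> 'a"  (infixr "\<bullet>\<index>" 60)

definition homs :: "('o, 'a, 'm) cat_scheme \<Rightarrow> 'o \<Rightarrow> 'o \<Rightarrow> 'a set" where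
  "homs C x y = {f \<in> carr C. cdom C f = x \<and> ccod C f = y}"

locale category =
  fixes C :: "('o, 'a, 'm) cat_scheme"
  assumes dom_closed: "f \<in> carr C \<Longrightarrow> cdom C f \<in> cobj C"
    and cod_closed: "f \<in> carr C \<Longrightarrow> ccod C f \<in> cobj C"
    and id_hom: "x \<in> cobj C \<Longrightarrow> cid C x \<in> homs C x x"
    and comp_hom: "f \<in> homs C x y \<Longrightarrow> g \<in> homs C y z \<Longrightarrow> g \<bullet>\<^bsub>C\<^esub> f \<in> homs C x z"
    and id_left: "f \<in> homs C x y \<Longrightarrow> cid C y \<bullet>\<^bsub>C\<^esub> f = f"
    and id_right: "f \<in> homs C x y \<Longrightarrow> f \<bullet>\<^bsub>C\<^esub> cid C x = f"
    and comp_assoc: "f \<in> homs C w x \<Longrightarrow> g \<in> homs C x y \<Longrightarrow> h \<in> homs C y z \<Longrightarrow>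
      (h \<bullet>\<^bsub>C\<^esub> g) \<bullet>\<^bsub>C\<^esub> f = h \<bullet>\<^bsub>C\<^esub> (g \<bullet>\<^bsub>C\<^esub> f)"

definition isos :: "('o, 'a, 'm) cat_scheme \<Rightarrow> 'o \<Rightarrow> 'o \<Rightarrow> 'a set" where
  "isos C x y = {f \<in> homs C x y. \<exists>g \<in> homs C y x. g \<bullet>\<^bsub>C\<^esub> f = cid C x \<and> f \<bullet>\<^bsub>C\<^esub> g = cid C y}"

definition inv_arr :: "('o, 'a, 'm) cat_scheme \<Rightarrow> 'a \<Rightarrow> 'a" where
  "inv_arr C f = (THE g. g \<in> homs C (ccod C f) (cdom C f) \<and>
     g \<bullet>\<^bsub>C\<^esub> f = cid C (cdom C f) \<and> f \<bullet>\<^bsub>C\<^esub> g = cid C (ccod C f))"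

definition full_sub :: "('o, 'a, 'm) cat_scheme \<Rightarrow> 'o set \<Rightarrow> ('o, 'a, 'm) cat_scheme" where
  "full_sub C P = C\<lparr>cobj := cobj C \<inter> P, carr := {f \<in> carr C. cdom C f \<in> P \<and> ccod C f \<in> P}\<rparr>"

definition iso_part :: "('o, 'a, 'm) cat_scheme \<Rightarrow> ('o, 'a, 'm) cat_scheme" where
  "iso_part C = C\<lparr>carr := {f \<in> carr C. f \<in> isos C (cdom C f) (ccod C f)}\<rparr>"

locale func = src: category C + tgt: category D
  for C :: "('o, 'a, 'm) cat_scheme" and D :: "('p, 'b, 'n) cat_scheme" +
  fixes Fo :: "'o \<Rightarrow> 'p" and Fa :: "'a \<Rightarrow> 'b"
  assumes map_obj: "x \<in> cobj C \<Longrightarrow> Fo x \<in> cobj D"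
    and map_hom: "f \<in> homs C x y \<Longrightarrow> Fa f \<in> homs D (Fo x) (Fo y)"
    and map_id: "x \<in> cobj C \<Longrightarrow> Fa (cid C x) = cid D (Fo x)"
    and map_comp: "f \<in> homs C x y \<Longrightarrow> g \<in> homs C y z \<Longrightarrow>
      Fa (g \<bullet>\<^bsub>C\<^esub> f) = Fa g \<bullet>\<^bsub>D\<^esub> Fa f"

record ('o, 'a) smc = "('o, 'a) cat" +
  tens :: "'o \<Rightarrow> 'o \<Rightarrow> 'o"  (infixr "\<odot>\<index>" 75)
  tensa :: "'a \<Rightarrow> 'a \<Rightarrow> 'a"  (infixr "\<star>\<index>" 75)
  unit_obj :: "'o"
  assoc :: "'o \<Rightarrow> 'o \<Rightarrow> 'o \<Rightarrow> 'a"
  lun :: "'o \<Rightarrow> 'a"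
  run :: "'o \<Rightarrow> 'a"
  braid :: "'o \<Rightarrow> 'o \<Rightarrow> 'a"

locale sym_mon_cat = category C for C :: "('o, 'a, 'm) smc_scheme" +
  assumes tens_obj: "x \<in> cobj C \<Longrightarrow> y \<in> cobj C \<Longrightarrow> x \<odot>\<^bsub>C\<^esub> y \<in> cobj C"
    and unit_in: "unit_obj C \<in> cobj C"
    and tensa_hom: "f \<in> homs C x x' \<Longrightarrow> g \<in> homs C y y' \<Longrightarrow>
      f \<star>\<^bsub>C\<^esub> g \<in> homs C (x \<odot>\<^bsub>C\<^esub> y) (x' \<odot>\<^bsub>C\<^esub> y')"
    and tensa_id: "x \<in> cobj C \<Longrightarrow> y \<in> cobj C \<Longrightarrow>
      cid C x \<star>\<^bsub>C\<^esub> cid C y = cid C (x \<odot>\<^bsub>C\<^esub> y)"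
    and tensa_comp: "f \<in> homs C x y \<Longrightarrow> g \<in> homs C y z \<Longrightarrow>
      f' \<in> homs C x' y' \<Longrightarrow> g' \<in> homs C y' z' \<Longrightarrow>
      (g \<bullet>\<^bsub>C\<^esub> f) \<star>\<^bsub>C\<^esub> (g' \<bullet>\<^bsub>C\<^esub> f') = (g \<star>\<^bsub>C\<^esub> g') \<bullet>\<^bsub>C\<^esub> (f \<star>\<^bsub>C\<^esub> f')"
    and assoc_iso: "x \<in> cobj C \<Longrightarrow> y \<in> cobj C \<Longrightarrow> z \<in> cobj C \<Longrightarrow>
      assoc C x y z \<in> isos C ((x \<odot>\<^bsub>C\<^esub> y) \<odot>\<^bsub>C\<^esub> z) (x \<odot>\<^bsub>C\<^esub> (y \<odot>\<^bsub>C\<^esub> z))"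
    and assoc_nat: "f \<in> homs C x x' \<Longrightarrow> g \<in> homs C y y' \<Longrightarrow> h \<in> homs C z z' \<Longrightarrow>
      assoc C x' y' z' \<bullet>\<^bsub>C\<^esub> ((f \<star>\<^bsub>C\<^esub> g) \<star>\<^bsub>C\<^esub> h) = (f \<star>\<^bsub>C\<^esub> (g \<star>\<^bsub>C\<^esub> h)) \<bullet>\<^bsub>C\<^esub> assoc C x y z"
    and lun_iso: "x \<in> cobj C \<Longrightarrow> lun C x \<in> isos C (unit_obj C \<odot>\<^bsub>C\<^esub> x) x"
    and lun_nat: "f \<in> homs C x y \<Longrightarrow>
      lun C y \<bullet>\<^bsub>C\<^esub> (cid C (unit_obj C) \<star>\<^bsub>C\<^esub> f) = f \<bullet>\<^bsub>C\<^esub> lun C x"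
    and run_iso: "x \<in> cobj C \<Longrightarrow> run C x \<in> isos C (x \<odot>\<^bsub>C\<^esub> unit_obj C) x"
    and run_nat: "f \<in> homs C x y \<Longrightarrow>
      run C y \<bullet>\<^bsub>C\<^esub> (f \<star>\<^bsub>C\<^esub> cid C (unit_obj C)) = f \<bullet>\<^bsub>C\<^esub> run C x"
    and braid_iso: "x \<in> cobj C \<Longrightarrow> y \<in> cobj C \<Longrightarrow>
      braid C x y \<in> isos C (x \<odot>\<^bsub>C\<^esub> y) (y \<odot>\<^bsub>C\<^esub> x)"
    and braid_nat: "f \<in> homs C x x' \<Longrightarrow> g \<in> homs C y y' \<Longrightarrow>
      braid C x' y' \<bullet>\<^bsub>C\<^esub> (f \<star>\<^bsub>C\<^esub> g) = (g \<star>\<^bsub>C\<^esub> f) \<bullet>\<^bsub>C\<^esub> braid C x y"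
    and pentagon: "w \<in> cobj C \<Longrightarrow> x \<in> cobj C \<Longrightarrow> y \<in> cobj C \<Longrightarrow> z \<in> cobj C \<Longrightarrow>
      assoc C w x (y \<odot>\<^bsub>C\<^esub> z) \<bullet>\<^bsub>C\<^esub> assoc C (w \<odot>\<^bsub>C\<^esub> x) y z =
      (cid C w \<star>\<^bsub>C\<^esub> assoc C x y z) \<bullet>\<^bsub>C\<^esub> assoc C w (x \<odot>\<^bsub>C\<^esub> y) z \<bullet>\<^bsub>C\<^esub> (assoc C w x y \<star>\<^bsub>C\<^esub> cid C z)"
    and triangle: "x \<in> cobj C \<Longrightarrow> y \<in> cobj C \<Longrightarrow>
      (cid C x \<star>\<^bsub>C\<^esub> lun C y) \<bullet>\<^bsub>C\<^esub> assoc C x (unit_obj C) y = run C x \<star>\<^bsub>C\<^esub> cid C y"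
    and hexagon: "x \<in> cobj C \<Longrightarrow> y \<in> cobj C \<Longrightarrow> z \<in> cobj C \<Longrightarrow>
      (cid C y \<star>\<^bsub>C\<^esub> braid C x z) \<bullet>\<^bsub>C\<^esub> assoc C y x z \<bullet>\<^bsub>C\<^esub> (braid C x y \<star>\<^bsub>C\<^esub> cid C z) =
      assoc C y z x \<bullet>\<^bsub>C\<^esub> braid C x (y \<odot>\<^bsub>C\<^esub> z) \<bullet>\<^bsub>C\<^esub> assoc C x y z"
    and symmetry: "x \<in> cobj C \<Longrightarrow> y \<in> cobj C \<Longrightarrow>
      braid C y x \<bullet>\<^bsub>C\<^esub> braid C x y = cid C (x \<odot>\<^bsub>C\<^esub> y)"

text \<open>The middle interchange \<open>(a \<odot> b) \<odot> (c \<odot> d) \<rightarrow> (a \<odot> c) \<odot> (b \<odot> d)\<close>.\<close>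

definition mid4 :: "('o, 'a, 'm) smc_scheme \<Rightarrow> 'o \<Rightarrow> 'o \<Rightarrow> 'o \<Rightarrow> 'o \<Rightarrow> 'a" where
  "mid4 C a b c d =
     inv_arr C (assoc C a c (b \<odot>\<^bsub>C\<^esub> d)) \<bullet>\<^bsub>C\<^esub>
     (cid C a \<star>\<^bsub>C\<^esub> (assoc C c b d \<bullet>\<^bsub>C\<^esub> (braid C b c \<star>\<^bsub>C\<^esub> cid C d) \<bullet>\<^bsub>C\<^esub> inv_arr C (assoc C b c d))) \<bullet>\<^bsub>C\<^esub>
     assoc C a b (c \<odot>\<^bsub>C\<^esub> d)"

record ('o, 'a, 'p, 'b) smfun =
  fobj :: "'o \<Rightarrow> 'p"
  farr :: "'a \<Rightarrow> 'b"
  fmu :: "'o \<Rightarrow> 'o \<Rightarrow> 'b"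
  feps :: "'b"

locale sm_functor = src: sym_mon_cat C + tgt: sym_mon_cat D + func C D "fobj F" "farr F"
  for C :: "('o, 'a, 'm) smc_scheme" and D :: "('p, 'b, 'n) smc_scheme"
    and F :: "('o, 'a, 'p, 'b) smfun" +
  assumes mu_iso: "x \<in> cobj C \<Longrightarrow> y \<in> cobj C \<Longrightarrow>
      fmu F x y \<in> isos D (fobj F x \<odot>\<^bsub>D\<^esub> fobj F y) (fobj F (x \<odot>\<^bsub>C\<^esub> y))"
    and mu_nat: "f \<in> homs C x x' \<Longrightarrow> g \<in> homs C y y' \<Longrightarrow>
      farr F (f \<star>\<^bsub>C\<^esub> g) \<bullet>\<^bsub>D\<^esub> fmu F x y = fmu F x' y' \<bullet>\<^bsub>D\<^esub> (farr F f \<star>\<^bsub>D\<^esub> farr F g)"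
    and eps_iso: "feps F \<in> isos D (unit_obj D) (fobj F (unit_obj C))"
    and mu_assoc: "x \<in> cobj C \<Longrightarrow> y \<in> cobj C \<Longrightarrow> z \<in> cobj C \<Longrightarrow>
      farr F (assoc C x y z) \<bullet>\<^bsub>D\<^esub> fmu F (x \<odot>\<^bsub>C\<^esub> y) z \<bullet>\<^bsub>D\<^esub> (fmu F x y \<star>\<^bsub>D\<^esub> cid D (fobj F z)) =
      fmu F x (y \<odot>\<^bsub>C\<^esub> z) \<bullet>\<^bsub>D\<^esub> (cid D (fobj F x) \<star>\<^bsub>D\<^esub> fmu F y z) \<bullet>\<^bsub>D\<^esub>
        assoc D (fobj F x) (fobj F y) (fobj F z)"
    and mu_lunit: "x \<in> cobj C \<Longrightarrow>
      farr F (lun C x) \<bullet>\<^bsub>D\<^esub> fmu F (unit_obj C) x \<bullet>\<^bsub>D\<^esub> (feps F \<star>\<^bsub>D\<^esub> cid D (fobj F x)) = lun D (fobj F x)"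
    and mu_runit: "x \<in> cobj C \<Longrightarrow>
      farr F (run C x) \<bullet>\<^bsub>D\<^esub> fmu F x (unit_obj C) \<bullet>\<^bsub>D\<^esub> (cid D (fobj F x) \<star>\<^bsub>D\<^esub> feps F) = run D (fobj F x)"
    and mu_braid: "x \<in> cobj C \<Longrightarrow> y \<in> cobj C \<Longrightarrow>
      farr F (braid C x y) \<bullet>\<^bsub>D\<^esub> fmu F x y = fmu F y x \<bullet>\<^bsub>D\<^esub> braid D (fobj F x) (fobj F y)"

definition id_sm :: "('o, 'a, 'm) smc_scheme \<Rightarrow> ('o, 'a, 'o, 'a) smfun" where
  "id_sm C = \<lparr>fobj = (\<lambda>x. x), farr = (\<lambda>f. f), fmu = (\<lambda>x y. cid C (x \<odot>\<^bsub>C\<^esub> y)), feps = cid C (unit_obj C)\<rparr>"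

text \<open>\<open>comp_sm E F' F\<close> is the composite of \<open>F : C \<rightarrow> D\<close> and \<open>F' : D \<rightarrow> E\<close>.\<close>

definition comp_sm :: "('q, 'c, 'm) smc_scheme \<Rightarrow> ('p, 'b, 'q, 'c) smfun \<Rightarrow> ('o, 'a, 'p, 'b) smfun \<Rightarrow>
    ('o, 'a, 'q, 'c) smfun" where
  "comp_sm E F' F = \<lparr>fobj = (\<lambda>x. fobj F' (fobj F x)), farr = (\<lambda>f. farr F' (farr F f)),
     fmu = (\<lambda>x y. farr F' (fmu F x y) \<bullet>\<^bsub>E\<^esub> fmu F' (fobj F x) (fobj F y)),
     feps = farr F' (feps F) \<bullet>\<^bsub>E\<^esub> feps F'\<rparr>"

locale mon_nat = dom: sm_functor C D F + cod: sm_functor C D F'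
  for C :: "('o, 'a, 'm) smc_scheme" and D :: "('p, 'b, 'n) smc_scheme"
    and F F' :: "('o, 'a, 'p, 'b) smfun" +
  fixes \<tau> :: "'o \<Rightarrow> 'b"
  assumes component: "x \<in> cobj C \<Longrightarrow> \<tau> x \<in> homs D (fobj F x) (fobj F' x)"
    and natural: "f \<in> homs C x y \<Longrightarrow> \<tau> y \<bullet>\<^bsub>D\<^esub> farr F f = farr F' f \<bullet>\<^bsub>D\<^esub> \<tau> x"
    and mon_tens: "x \<in> cobj C \<Longrightarrow> y \<in> cobj C \<Longrightarrow>
      \<tau> (x \<odot>\<^bsub>C\<^esub> y) \<bullet>\<^bsub>D\<^esub> fmu F x y = fmu F' x y \<bullet>\<^bsub>D\<^esub> (\<tau> x \<star>\<^bsub>D\<^esub> \<tau> y)"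
    and mon_unit: "\<tau> (unit_obj C) \<bullet>\<^bsub>D\<^esub> feps F = feps F'"

locale mon_nat_iso = mon_nat +
  assumes component_iso: "x \<in> cobj C \<Longrightarrow> \<tau> x \<in> isos D (fobj F x) (fobj F' x)"


section \<open>Limits and colimits\<close>

definition is_limit :: "('i, 'k) cat \<Rightarrow> ('o, 'a, 'm) cat_scheme \<Rightarrow> ('i \<Rightarrow> 'o) \<Rightarrow> ('k \<Rightarrow> 'a) \<Rightarrow>
    'o \<Rightarrow> ('i \<Rightarrow> 'a) \<Rightarrow> bool" where
  "is_limit J C Do Da x p \<longleftrightarrow>
    (let cone = (\<lambda>y q. y \<in> cobj C \<and> (\<forall>j \<in> cobj J. q j \<in> homs C y (Do j)) \<and>
           (\<forall>u \<in> carr J. Da u \<bullet>\<^bsub>C\<^esub> q (cdom J u) = q (ccod J u)))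
     in cone x p \<and> (\<forall>y q. cone y q \<longrightarrow>
          (\<exists>!h. h \<in> homs C y x \<and> (\<forall>j \<in> cobj J. p j \<bullet>\<^bsub>C\<^esub> h = q j))))"

definition is_colimit :: "('i, 'k) cat \<Rightarrow> ('o, 'a, 'm) cat_scheme \<Rightarrow> ('i \<Rightarrow> 'o) \<Rightarrow> ('k \<Rightarrow> 'a) \<Rightarrow>
    'o \<Rightarrow> ('i \<Rightarrow> 'a) \<Rightarrow> bool" where
  "is_colimit J C Do Da x p \<longleftrightarrow>
    (let cocone = (\<lambda>y q. y \<in> cobj C \<and> (\<forall>j \<in> cobj J. q j \<in> homs C (Do j) y) \<and>
           (\<forall>u \<in> carr J. q (ccod J u) \<bullet>\<^bsub>C\<^esub> Da u = q (cdom J u)))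
     in cocone x p \<and> (\<forall>y q. cocone y q \<longrightarrow>
          (\<exists>!h. h \<in> homs C x y \<and> (\<forall>j \<in> cobj J. h \<bullet>\<^bsub>C\<^esub> p j = q j))))"

text \<open>Size convention: the type \<open>'j\<close> measures smallness; a small category is one whose objects
  and arrows are elements of \<open>'j\<close>. Any infinite \<open>'j\<close> is admissible.\<close>

definition cocomplete :: "'j itself \<Rightarrow> ('o, 'a, 'm) cat_scheme \<Rightarrow> bool" where
  "cocomplete _ C \<longleftrightarrow>
    (\<forall>(J :: ('j, 'j) cat) Do Da. func J C Do Da \<longrightarrow> (\<exists>x p. is_colimit J C Do Da x p))"

text \<open>\<open>J\<close> is sifted when it is nonempty and its diagonal \<open>J \<rightarrow> J \<times> J\<close> is final, that is, for
  all \<open>a\<close>, \<open>b\<close> the category of cospans \<open>a \<rightarrow> c \<leftarrow> b\<close> is nonempty and connected.\<close>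

definition sifted :: "('i, 'k) cat \<Rightarrow> bool" where
  "sifted J \<longleftrightarrow> category J \<and> cobj J \<noteq> {} \<and>
    (\<forall>a \<in> cobj J. \<forall>b \<in> cobj J.
      let cospans = {(c, u, v). u \<in> homs J a c \<and> v \<in> homs J b c};
          step = {((c, u, v), (c', u', v')).
             (c, u, v) \<in> cospans \<and> (c', u', v') \<in> cospans \<and>
             (\<exists>w \<in> homs J c c'. w \<bullet>\<^bsub>J\<^esub> u = u' \<and> w \<bullet>\<^bsub>J\<^esub> v = v')}
      in cospans \<noteq> {} \<and> (\<forall>s \<in> cospans. \<forall>t \<in> cospans. (s, t) \<in> (step \<union> step\<inverse>)\<^sup>*))"

definition preserves_sifted :: "'j itself \<Rightarrow> ('o, 'a, 'm) cat_scheme \<Rightarrow> ('p, 'b, 'n) cat_scheme \<Rightarrow>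
    ('o \<Rightarrow> 'p) \<Rightarrow> ('a \<Rightarrow> 'b) \<Rightarrow> bool" where
  "preserves_sifted _ C D Fo Fa \<longleftrightarrow>
    (\<forall>(J :: ('j, 'j) cat) Do Da x p. sifted J \<longrightarrow> func J C Do Da \<longrightarrow> is_colimit J C Do Da x p \<longrightarrow>
       is_colimit J D (\<lambda>j. Fo (Do j)) (\<lambda>u. Fa (Da u)) (Fo x) (\<lambda>j. Fa (p j)))"


section \<open>The orbit category and symmetric monoidal coefficient systems\<close>

text \<open>An object of the orbit category is a subgroup \<open>H\<close>, standing for the \<open>G\<close>-set \<open>G/H\<close> of left
  cosets; an arrow is a triple (source, equivariant map of coset spaces, target).\<close>

type_synonym 'g omap = "'g set \<times> ('g set \<Rightarrow> 'g set) \<times> 'g set"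

definition orb :: "'g monoid \<Rightarrow> ('g set, 'g omap) cat" where
  "orb G = \<lparr>cobj = {H. subgroup H G},
     carr = {(K, f, H). subgroup K G \<and> subgroup H G \<and> f \<in> lcosets\<^bsub>G\<^esub> K \<rightarrow>\<^sub>E lcosets\<^bsub>G\<^esub> H \<and>
       (\<forall>g \<in> carrier G. \<forall>c \<in> lcosets\<^bsub>G\<^esub> K. f (g <#\<^bsub>G\<^esub> c) = g <#\<^bsub>G\<^esub> f c)},
     cdom = (\<lambda>(K, f, H). K), ccod = (\<lambda>(K, f, H). H),
     cid = (\<lambda>H. (H, (\<lambda>c \<in> lcosets\<^bsub>G\<^esub> H. c), H)),
     ccomp = (\<lambda>(K', f', H') (K, f, H). (K, compose (lcosets\<^bsub>G\<^esub> K) f' f, H'))\<rparr>"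

definition omap :: "'g omap \<Rightarrow> 'g set \<Rightarrow> 'g set" where
  "omap f = fst (snd f)"

text \<open>The canonical projection \<open>G/K \<rightarrow> G/H\<close> for \<open>K \<subseteq> H\<close>.\<close>

definition proj_orb :: "'g monoid \<Rightarrow> 'g set \<Rightarrow> 'g set \<Rightarrow> 'g omap" where
  "proj_orb G K H = (K, (\<lambda>c \<in> lcosets\<^bsub>G\<^esub> K. c <#>\<^bsub>G\<^esub> H), H)"

text \<open>A contravariant pseudofunctor on the orbit category: \<open>res f\<close> is the restriction along \<open>f\<close>, and
  \<open>runit H : id \<Rightarrow> (id\<^bsub>G/H\<^esub>)\<^sup>*\<close> and \<open>rcomp f h : h\<^sup>* f\<^sup>* \<Rightarrow> (f h)\<^sup>*\<close> are its structure isomorphisms.\<close>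

record ('g, 'o, 'a) coeff =
  lev :: "'g set \<Rightarrow> ('o, 'a) smc"
  res :: "'g omap \<Rightarrow> ('o, 'a, 'o, 'a) smfun"
  runit :: "'g set \<Rightarrow> 'o \<Rightarrow> 'a"
  rcomp :: "'g omap \<Rightarrow> 'g omap \<Rightarrow> 'o \<Rightarrow> 'a"

locale coeff_system =
  fixes G :: "'g monoid" and C :: "('g, 'o, 'a) coeff"
  assumes level: "subgroup H G \<Longrightarrow> sym_mon_cat (lev C H)"
    and restriction: "f \<in> homs (orb G) K H \<Longrightarrow> sm_functor (lev C H) (lev C K) (res C f)"
    and runit_iso: "subgroup H G \<Longrightarrow>
      mon_nat_iso (lev C H) (lev C H) (id_sm (lev C H)) (res C (cid (orb G) H)) (runit C H)"
    and rcomp_iso: "h \<in> homs (orb G) L K \<Longrightarrow> f \<in> homs (orb G) K H \<Longrightarrow>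
      mon_nat_iso (lev C H) (lev C L) (comp_sm (lev C L) (res C h) (res C f))
        (res C (f \<bullet>\<^bsub>orb G\<^esub> h)) (rcomp C f h)"
    and runit_source: "f \<in> homs (orb G) K H \<Longrightarrow> x \<in> cobj (lev C H) \<Longrightarrow>
      rcomp C f (cid (orb G) K) x \<bullet>\<^bsub>lev C K\<^esub> runit C K (fobj (res C f) x) = cid (lev C K) (fobj (res C f) x)"
    and runit_target: "f \<in> homs (orb G) K H \<Longrightarrow> x \<in> cobj (lev C H) \<Longrightarrow>
      rcomp C (cid (orb G) H) f x \<bullet>\<^bsub>lev C K\<^esub> farr (res C f) (runit C H x) = cid (lev C K) (fobj (res C f) x)"
    and rcomp_assoc: "k \<in> homs (orb G) J L \<Longrightarrow> h \<in> homs (orb G) L K \<Longrightarrow> f \<in> homs (orb G) K H \<Longrightarrow>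
      x \<in> cobj (lev C H) \<Longrightarrow>
      rcomp C f (h \<bullet>\<^bsub>orb G\<^esub> k) x \<bullet>\<^bsub>lev C J\<^esub> rcomp C h k (fobj (res C f) x) =
      rcomp C (f \<bullet>\<^bsub>orb G\<^esub> h) k x \<bullet>\<^bsub>lev C J\<^esub> farr (res C k) (rcomp C f h x)"

text \<open>The object \<open>i\<^sub>H\<^sup>* R\<close>. For \<open>H = G\<close> it is the restriction of \<open>R\<close> along the identity of \<open>G/G\<close>,
  canonically isomorphic to \<open>R\<close>.\<close>

definition rest :: "'g monoid \<Rightarrow> ('g, 'o, 'a) coeff \<Rightarrow> 'o \<Rightarrow> 'g set \<Rightarrow> 'o" where
  "rest G C R H = fobj (res C (proj_orb G H (carrier G))) R"

text \<open>The canonical isomorphism \<open>i\<^sub>K\<^sup>* R \<cong> f\<^sup>* i\<^sub>H\<^sup>* R\<close> for \<open>f : G/K \<rightarrow> G/H\<close>.\<close>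

definition rest_comp :: "'g monoid \<Rightarrow> ('g, 'o, 'a) coeff \<Rightarrow> 'o \<Rightarrow> 'g omap \<Rightarrow> 'a" where
  "rest_comp G C R f =
     inv_arr (lev C (cdom (orb G) f)) (rcomp C (proj_orb G (ccod (orb G) f) (carrier G)) f R)"


section \<open>The coefficient system of finite sets and indexing systems\<close>

text \<open>Finite \<open>H\<close>-sets are rendered as finite \<open>G\<close>-sets over \<open>G/H\<close>, with underlying sets drawn from the
  following type. It is infinite and closed under pairing and tagging, so every finite \<open>G\<close>-set over
  \<open>G/H\<close> is isomorphic to one of these, and all constructions below are explicit.\<close>

datatype 'g pt = Cst "'g set" | Pr "'g pt" "'g pt" | InL "'g pt" | InR "'g pt"

definition copair :: "('g pt \<Rightarrow> 'b) \<Rightarrow> ('g pt \<Rightarrow> 'b) \<Rightarrow> 'g pt \<Rightarrow> 'b" where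
  "copair f h z = (case z of InL x \<Rightarrow> f x | InR y \<Rightarrow> h y | _ \<Rightarrow> undefined)"

definition pr_case :: "('g pt \<Rightarrow> 'g pt \<Rightarrow> 'b) \<Rightarrow> 'g pt \<Rightarrow> 'b" where
  "pr_case f z = (case z of Pr x y \<Rightarrow> f x y | _ \<Rightarrow> undefined)"

definition the_cst :: "'g pt \<Rightarrow> 'g set" where
  "the_cst z = (case z of Cst c \<Rightarrow> c | _ \<Rightarrow> undefined)"

record 'g gset =
  pts :: "'g pt set"
  act :: "'g \<Rightarrow> 'g pt \<Rightarrow> 'g pt"
  proj :: "'g pt \<Rightarrow> 'g set"

type_synonym 'g gmap = "'g gset \<times> ('g pt \<Rightarrow> 'g pt) \<times> 'g gset"

definition mk_gset :: "'g monoid \<Rightarrow> 'g pt set \<Rightarrow> ('g \<Rightarrow> 'g pt \<Rightarrow> 'g pt) \<Rightarrow> ('g pt \<Rightarrow> 'g set) \<Rightarrow> 'g gset" where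
  "mk_gset G E a p = \<lparr>pts = E, act = (\<lambda>g \<in> carrier G. \<lambda>x \<in> E. a g x), proj = (\<lambda>x \<in> E. p x)\<rparr>"

definition mk_gmap :: "'g gset \<Rightarrow> ('g pt \<Rightarrow> 'g pt) \<Rightarrow> 'g gset \<Rightarrow> 'g gmap" where
  "mk_gmap X f Y = (X, (\<lambda>x \<in> pts X. f x), Y)"

definition gfun :: "'g gmap \<Rightarrow> 'g pt \<Rightarrow> 'g pt" where
  "gfun f = fst (snd f)"

definition gsets :: "'g monoid \<Rightarrow> 'g set \<Rightarrow> 'g gset set" where
  "gsets G H = {X. finite (pts X) \<and> group_action G (pts X) (act X) \<and> act X \<in> extensional (carrier G) \<and>
     proj X \<in> pts X \<rightarrow>\<^sub>E lcosets\<^bsub>G\<^esub> H \<and>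
     (\<forall>g \<in> carrier G. \<forall>x \<in> pts X. proj X (act X g x) = g <#\<^bsub>G\<^esub> proj X x)}"

definition gmaps :: "'g monoid \<Rightarrow> 'g set \<Rightarrow> 'g gmap set" where
  "gmaps G H = {(X, f, Y). X \<in> gsets G H \<and> Y \<in> gsets G H \<and> f \<in> pts X \<rightarrow>\<^sub>E pts Y \<and>
     (\<forall>x \<in> pts X. proj Y (f x) = proj X x) \<and>
     (\<forall>g \<in> carrier G. \<forall>x \<in> pts X. f (act X g x) = act Y g (f x))}"

definition gsum :: "'g monoid \<Rightarrow> 'g gset \<Rightarrow> 'g gset \<Rightarrow> 'g gset" where
  "gsum G X Y = mk_gset G (InL ` pts X \<union> InR ` pts Y)
     (\<lambda>g. copair (\<lambda>x. InL (act X g x)) (\<lambda>y. InR (act Y g y))) (copair (proj X) (proj Y))"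

definition gempty :: "'g monoid \<Rightarrow> 'g gset" where
  "gempty G = mk_gset G {} (\<lambda>g x. x) (\<lambda>x. {})"

text \<open>The product of finite \<open>H\<close>-sets, that is, the fibre product over \<open>G/H\<close>.\<close>

definition gprod :: "'g monoid \<Rightarrow> 'g gset \<Rightarrow> 'g gset \<Rightarrow> 'g gset" where
  "gprod G X Y = mk_gset G {Pr x y | x y. x \<in> pts X \<and> y \<in> pts Y \<and> proj X x = proj Y y}
     (\<lambda>g. pr_case (\<lambda>x y. Pr (act X g x) (act Y g y))) (pr_case (\<lambda>x y. proj X x))"

definition gpull :: "'g monoid \<Rightarrow> 'g omap \<Rightarrow> 'g gset \<Rightarrow> 'g gset" where
  "gpull G f X = mk_gset G
     {Pr (Cst c) x | c x. c \<in> lcosets\<^bsub>G\<^esub> (cdom (orb G) f) \<and> x \<in> pts X \<and> omap f c = proj X x}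
     (\<lambda>g. pr_case (\<lambda>c x. Pr (Cst (g <#\<^bsub>G\<^esub> the_cst c)) (act X g x))) (pr_case (\<lambda>c x. the_cst c))"

definition fset :: "'g monoid \<Rightarrow> 'g set \<Rightarrow> ('g gset, 'g gmap) smc" where
  "fset G H = \<lparr>cobj = gsets G H, carr = gmaps G H,
     cdom = (\<lambda>(X, f, Y). X), ccod = (\<lambda>(X, f, Y). Y),
     cid = (\<lambda>X. mk_gmap X (\<lambda>x. x) X),
     ccomp = (\<lambda>(X', f', Y') (X, f, Y). (X, compose (pts X) f' f, Y')),
     tens = gsum G,
     tensa = (\<lambda>(X, f, Y) (X', f', Y').
       mk_gmap (gsum G X X') (copair (\<lambda>x. InL (f x)) (\<lambda>x. InR (f' x))) (gsum G Y Y')),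
     unit_obj = gempty G,
     assoc = (\<lambda>X Y Z. mk_gmap (gsum G (gsum G X Y) Z)
       (copair (copair InL (\<lambda>y. InR (InL y))) (\<lambda>z. InR (InR z))) (gsum G X (gsum G Y Z))),
     lun = (\<lambda>X. mk_gmap (gsum G (gempty G) X) (copair (\<lambda>x. x) (\<lambda>x. x)) X),
     run = (\<lambda>X. mk_gmap (gsum G X (gempty G)) (copair (\<lambda>x. x) (\<lambda>x. x)) X),
     braid = (\<lambda>X Y. mk_gmap (gsum G X Y) (copair InR InL) (gsum G Y X))\<rparr>"

definition FSet :: "'g monoid \<Rightarrow> ('g, 'g gset, 'g gmap) coeff" where
  "FSet G = \<lparr>lev = fset G,
     res = (\<lambda>f. \<lparr>fobj = gpull G f,
       farr = (\<lambda>(X, u, Y). mk_gmap (gpull G f X) (pr_case (\<lambda>c x. Pr c (u x))) (gpull G f Y)),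
       fmu = (\<lambda>X Y. mk_gmap (gsum G (gpull G f X) (gpull G f Y))
         (copair (pr_case (\<lambda>c x. Pr c (InL x))) (pr_case (\<lambda>c y. Pr c (InR y)))) (gpull G f (gsum G X Y))),
       feps = mk_gmap (gempty G) (\<lambda>x. x) (gpull G f (gempty G))\<rparr>),
     runit = (\<lambda>H X. mk_gmap X (\<lambda>x. Pr (Cst (proj X x)) x) (gpull G (cid (orb G) H) X)),
     rcomp = (\<lambda>f h X. mk_gmap (gpull G h (gpull G f X))
       (pr_case (\<lambda>c y. pr_case (\<lambda>d x. Pr c x) y)) (gpull G (f \<bullet>\<^bsub>orb G\<^esub> h) X))\<rparr>"

text \<open>\<open>G/K\<close> as a \<open>G\<close>-set over \<open>G/H\<close> along \<open>f : G/K \<rightarrow> G/H\<close>. For the canonical projection this is the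
  \<open>H\<close>-set \<open>H/K\<close>, and for \<open>f = id\<close> it is the one-point \<open>H\<close>-set.\<close>

definition gorbit :: "'g monoid \<Rightarrow> 'g omap \<Rightarrow> 'g gset" where
  "gorbit G f = mk_gset G (Cst ` (lcosets\<^bsub>G\<^esub> (cdom (orb G) f)))
     (\<lambda>g c. Cst (g <#\<^bsub>G\<^esub> the_cst c)) (\<lambda>c. omap f (the_cst c))"

definition gpoint :: "'g monoid \<Rightarrow> 'g set \<Rightarrow> 'g gset" where
  "gpoint G H = gorbit G (cid (orb G) H)"

text \<open>Induction \<open>H \<times>\<^sub>K T\<close>, which over \<open>G/H\<close> is the composite \<open>T \<rightarrow> G/K \<rightarrow> G/H\<close>.\<close>

definition ginduce :: "'g omap \<Rightarrow> 'g gset \<Rightarrow> 'g gset" where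
  "ginduce f X = X\<lparr>proj := (\<lambda>x \<in> pts X. omap f (proj X x))\<rparr>"

definition gbang :: "'g monoid \<Rightarrow> 'g set \<Rightarrow> 'g gset \<Rightarrow> 'g gmap" where
  "gbang G H X = mk_gmap X (\<lambda>x. Cst (proj X x)) (gpoint G H)"

definition gproda :: "'g monoid \<Rightarrow> 'g gmap \<Rightarrow> 'g gmap \<Rightarrow> 'g gmap" where
  "gproda G = (\<lambda>(X, f, Y) (X', f', Y').
     mk_gmap (gprod G X X') (pr_case (\<lambda>x x'. Pr (f x) (f' x'))) (gprod G Y Y'))"

definition gprod_left :: "'g monoid \<Rightarrow> 'g set \<Rightarrow> 'g gset \<Rightarrow> ('g gset, 'g gmap, 'g gset, 'g gmap) smfun" where
  "gprod_left G H T = \<lparr>fobj = (\<lambda>S. gprod G S T), farr = (\<lambda>s. gproda G s (cid (fset G H) T)),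
     fmu = (\<lambda>S S'. mk_gmap (gsum G (gprod G S T) (gprod G S' T))
       (copair (pr_case (\<lambda>x y. Pr (InL x) y)) (pr_case (\<lambda>x y. Pr (InR x) y))) (gprod G (gsum G S S') T)),
     feps = mk_gmap (gempty G) (\<lambda>x. x) (gprod G (gempty G) T)\<rparr>"

definition gprod_right :: "'g monoid \<Rightarrow> 'g set \<Rightarrow> 'g gset \<Rightarrow> ('g gset, 'g gmap, 'g gset, 'g gmap) smfun" where
  "gprod_right G H S = \<lparr>fobj = (\<lambda>T. gprod G S T), farr = (\<lambda>t. gproda G (cid (fset G H) S) t),
     fmu = (\<lambda>T T'. mk_gmap (gsum G (gprod G S T) (gprod G S T'))
       (copair (pr_case (\<lambda>x y. Pr x (InL y))) (pr_case (\<lambda>x y. Pr x (InR y)))) (gprod G S (gsum G T T'))),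
     feps = mk_gmap (gempty G) (\<lambda>x. x) (gprod G S (gempty G))\<rparr>"

text \<open>A full sub coefficient system is given by its objects, \<open>\<O> H\<close> at level \<open>G/H\<close>.\<close>

locale indexing_system = group G for G :: "'g monoid" +
  fixes \<O> :: "'g set \<Rightarrow> 'g gset set"
  assumes objects: "subgroup H G \<Longrightarrow> \<O> H \<subseteq> cobj (lev (FSet G) H)"
    and sum_closed: "subgroup H G \<Longrightarrow> S \<in> \<O> H \<Longrightarrow> T \<in> \<O> H \<Longrightarrow> S \<odot>\<^bsub>lev (FSet G) H\<^esub> T \<in> \<O> H"
    and empty_closed: "subgroup H G \<Longrightarrow> unit_obj (lev (FSet G) H) \<in> \<O> H"
    and res_closed: "f \<in> homs (orb G) K H \<Longrightarrow> T \<in> \<O> H \<Longrightarrow> fobj (res (FSet G) f) T \<in> \<O> K"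
    and point: "gpoint G (carrier G) \<in> \<O> (carrier G)"
    and finite_limits: "subgroup H G \<Longrightarrow> finite (cobj J) \<Longrightarrow> finite (carr J) \<Longrightarrow>
      func (J :: (nat, nat) cat) (lev (FSet G) H) Do Da \<Longrightarrow> (\<forall>j \<in> cobj J. Do j \<in> \<O> H) \<Longrightarrow>
      is_limit J (lev (FSet G) H) Do Da X p \<Longrightarrow> X \<in> \<O> H"
    and self_induction: "subgroup H G \<Longrightarrow> subgroup K G \<Longrightarrow> K \<subseteq> H \<Longrightarrow>
      gorbit G (proj_orb G K H) \<in> \<O> H \<Longrightarrow> T \<in> \<O> K \<Longrightarrow> ginduce (proj_orb G K H) T \<in> \<O> H"

definition osub :: "'g monoid \<Rightarrow> ('g set \<Rightarrow> 'g gset set) \<Rightarrow> 'g set \<Rightarrow> ('g gset, 'g gmap) smc" where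
  "osub G \<O> H = full_sub (lev (FSet G) H) (\<O> H)"

definition oiso :: "'g monoid \<Rightarrow> ('g set \<Rightarrow> 'g gset set) \<Rightarrow> 'g set \<Rightarrow> ('g gset, 'g gmap) smc" where
  "oiso G \<O> H = iso_part (osub G \<O> H)"


section \<open>\<open>\<O>\<close>-symmetric monoidal coefficient systems\<close>

text \<open>The data of the bilinear map \<open>\<box> : \<O>\<^sup>I\<^sup>s\<^sup>o \<times> C \<rightarrow> C\<close>, written \<open>T \<box> M\<close> at each level:
  \<^item> \<open>bobj\<close>, \<open>barr\<close>: the functor on objects and arrows;
  \<^item> \<open>badd : (T \<box> M) \<odot> (T' \<box> M) \<rightarrow> (T \<squnion> T') \<box> M\<close> and \<open>bzero : 1 \<rightarrow> \<emptyset> \<box> M\<close>;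
  \<^item> \<open>bmul : (T \<box> M) \<odot> (T \<box> M') \<rightarrow> T \<box> (M \<odot> M')\<close> and \<open>bone : 1 \<rightarrow> T \<box> 1\<close>;
  \<^item> \<open>bres : f\<^sup>*T \<box> f\<^sup>*M \<rightarrow> f\<^sup>*(T \<box> M)\<close>, the pseudonaturality of \<open>\<box>\<close>;
  \<^item> \<open>bpoint : * \<box> M \<rightarrow> M\<close>, the comparison with the canonical exponentiation. A finite set with trivial
    action is a finite coproduct of copies of the point, so together with \<open>badd\<close> and \<open>bzero\<close> this is the
    same as giving compatible isomorphisms from \<open>T \<box> M\<close> to the \<open>T\<close>-indexed tensor power of \<open>M\<close> for
    every such \<open>T\<close>;
  \<^item> \<open>bass : (S \<times> T) \<box> M \<rightarrow> S \<box> (T \<box> M)\<close>.\<close>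

record ('g, 'o, 'a) box =
  bobj :: "'g set \<Rightarrow> 'g gset \<Rightarrow> 'o \<Rightarrow> 'o"
  barr :: "'g set \<Rightarrow> 'g gmap \<Rightarrow> 'a \<Rightarrow> 'a"
  badd :: "'g set \<Rightarrow> 'g gset \<Rightarrow> 'g gset \<Rightarrow> 'o \<Rightarrow> 'a"
  bzero :: "'g set \<Rightarrow> 'o \<Rightarrow> 'a"
  bmul :: "'g set \<Rightarrow> 'g gset \<Rightarrow> 'o \<Rightarrow> 'o \<Rightarrow> 'a"
  bone :: "'g set \<Rightarrow> 'g gset \<Rightarrow> 'a"
  bres :: "'g omap \<Rightarrow> 'g gset \<Rightarrow> 'o \<Rightarrow> 'a"
  bpoint :: "'g set \<Rightarrow> 'o \<Rightarrow> 'a"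
  bass :: "'g set \<Rightarrow> 'g gset \<Rightarrow> 'g gset \<Rightarrow> 'o \<Rightarrow> 'a"

text \<open>\<open>box_at\<close> is the functor \<open>T \<mapsto> T \<box> M\<close> and \<open>box_by\<close> is the functor \<open>M \<mapsto> T \<box> M\<close>.\<close>

definition box_at :: "('g, 'o, 'a) coeff \<Rightarrow> ('g, 'o, 'a) box \<Rightarrow> 'g set \<Rightarrow> 'o \<Rightarrow>
    ('g gset, 'g gmap, 'o, 'a) smfun" where
  "box_at C B H M = \<lparr>fobj = (\<lambda>T. bobj B H T M), farr = (\<lambda>t. barr B H t (cid (lev C H) M)),
     fmu = (\<lambda>T T'. badd B H T T' M), feps = bzero B H M\<rparr>"

definition box_by :: "'g monoid \<Rightarrow> ('g, 'o, 'a) box \<Rightarrow> 'g set \<Rightarrow> 'g gset \<Rightarrow> ('o, 'a, 'o, 'a) smfun" where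
  "box_by G B H T = \<lparr>fobj = bobj B H T, farr = barr B H (cid (fset G H) T),
     fmu = bmul B H T, feps = bone B H T\<rparr>"

locale O_sym_mon = indexing_system G \<O> + coeff_system G C
  for G :: "'g monoid" and \<O> :: "'g set \<Rightarrow> 'g gset set" and C :: "('g, 'o, 'a) coeff" +
  fixes B :: "('g, 'o, 'a) box"
  assumes
    box_obj: "subgroup H G \<Longrightarrow> T \<in> \<O> H \<Longrightarrow> M \<in> cobj (lev C H) \<Longrightarrow> bobj B H T M \<in> cobj (lev C H)"
    and box_hom: "subgroup H G \<Longrightarrow> t \<in> homs (oiso G \<O> H) T T' \<Longrightarrow> m \<in> homs (lev C H) M M' \<Longrightarrow>
      barr B H t m \<in> homs (lev C H) (bobj B H T M) (bobj B H T' M')"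
    and box_id: "subgroup H G \<Longrightarrow> T \<in> \<O> H \<Longrightarrow> M \<in> cobj (lev C H) \<Longrightarrow>
      barr B H (cid (fset G H) T) (cid (lev C H) M) = cid (lev C H) (bobj B H T M)"
    and box_comp: "subgroup H G \<Longrightarrow> t \<in> homs (oiso G \<O> H) T T' \<Longrightarrow> t' \<in> homs (oiso G \<O> H) T' T'' \<Longrightarrow>
      m \<in> homs (lev C H) M M' \<Longrightarrow> m' \<in> homs (lev C H) M' M'' \<Longrightarrow>
      barr B H (t' \<bullet>\<^bsub>fset G H\<^esub> t) (m' \<bullet>\<^bsub>lev C H\<^esub> m) = barr B H t' m' \<bullet>\<^bsub>lev C H\<^esub> barr B H t m"
    and box_at_functor: "subgroup H G \<Longrightarrow> M \<in> cobj (lev C H) \<Longrightarrow>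
      sm_functor (oiso G \<O> H) (lev C H) (box_at C B H M)"
    and box_by_functor: "subgroup H G \<Longrightarrow> T \<in> \<O> H \<Longrightarrow>
      sm_functor (lev C H) (lev C H) (box_by G B H T)"
    and box_at_nat: "subgroup H G \<Longrightarrow> m \<in> homs (lev C H) M M' \<Longrightarrow>
      mon_nat (oiso G \<O> H) (lev C H) (box_at C B H M) (box_at C B H M')
        (\<lambda>T. barr B H (cid (fset G H) T) m)"
    and box_by_nat: "subgroup H G \<Longrightarrow> t \<in> homs (oiso G \<O> H) T T' \<Longrightarrow>
      mon_nat (lev C H) (lev C H) (box_by G B H T) (box_by G B H T')
        (\<lambda>M. barr B H t (cid (lev C H) M))"
    \<comment> \<open>the two monoidal structures of a bilinear map commute with each other\<close>
    and add_mul: "subgroup H G \<Longrightarrow> T \<in> \<O> H \<Longrightarrow> T' \<in> \<O> H \<Longrightarrow>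
      M \<in> cobj (lev C H) \<Longrightarrow> M' \<in> cobj (lev C H) \<Longrightarrow>
      badd B H T T' (M \<odot>\<^bsub>lev C H\<^esub> M') \<bullet>\<^bsub>lev C H\<^esub> (bmul B H T M M' \<star>\<^bsub>lev C H\<^esub> bmul B H T' M M') =
      bmul B H (gsum G T T') M M' \<bullet>\<^bsub>lev C H\<^esub> (badd B H T T' M \<star>\<^bsub>lev C H\<^esub> badd B H T T' M') \<bullet>\<^bsub>lev C H\<^esub>
        mid4 (lev C H) (bobj B H T M) (bobj B H T M') (bobj B H T' M) (bobj B H T' M')"
    and zero_mul: "subgroup H G \<Longrightarrow> M \<in> cobj (lev C H) \<Longrightarrow> M' \<in> cobj (lev C H) \<Longrightarrow>
      bmul B H (gempty G) M M' \<bullet>\<^bsub>lev C H\<^esub> (bzero B H M \<star>\<^bsub>lev C H\<^esub> bzero B H M') =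
      bzero B H (M \<odot>\<^bsub>lev C H\<^esub> M') \<bullet>\<^bsub>lev C H\<^esub> lun (lev C H) (unit_obj (lev C H))"
    and add_one: "subgroup H G \<Longrightarrow> T \<in> \<O> H \<Longrightarrow> T' \<in> \<O> H \<Longrightarrow>
      badd B H T T' (unit_obj (lev C H)) \<bullet>\<^bsub>lev C H\<^esub> (bone B H T \<star>\<^bsub>lev C H\<^esub> bone B H T') =
      bone B H (gsum G T T') \<bullet>\<^bsub>lev C H\<^esub> lun (lev C H) (unit_obj (lev C H))"
    and zero_one: "subgroup H G \<Longrightarrow> bzero B H (unit_obj (lev C H)) = bone B H (gempty G)"
    and bres_iso: "f \<in> homs (orb G) K H \<Longrightarrow> T \<in> \<O> H \<Longrightarrow> M \<in> cobj (lev C H) \<Longrightarrow>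
      bres B f T M \<in> isos (lev C K)
        (bobj B K (gpull G f T) (fobj (res C f) M)) (fobj (res C f) (bobj B H T M))"
    and bres_at: "f \<in> homs (orb G) K H \<Longrightarrow> M \<in> cobj (lev C H) \<Longrightarrow>
      mon_nat (oiso G \<O> H) (lev C K)
        (comp_sm (lev C K) (box_at C B K (fobj (res C f) M)) (res (FSet G) f))
        (comp_sm (lev C K) (res C f) (box_at C B H M)) (\<lambda>T. bres B f T M)"
    and bres_by: "f \<in> homs (orb G) K H \<Longrightarrow> T \<in> \<O> H \<Longrightarrow>
      mon_nat (lev C H) (lev C K)
        (comp_sm (lev C K) (box_by G B K (gpull G f T)) (res C f))
        (comp_sm (lev C K) (res C f) (box_by G B H T)) (\<lambda>M. bres B f T M)"
    and bres_unit: "subgroup H G \<Longrightarrow> T \<in> \<O> H \<Longrightarrow> M \<in> cobj (lev C H) \<Longrightarrow>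
      bres B (cid (orb G) H) T M \<bullet>\<^bsub>lev C H\<^esub> barr B H (runit (FSet G) H T) (runit C H M) =
      runit C H (bobj B H T M)"
    and bres_comp: "h \<in> homs (orb G) L K \<Longrightarrow> f \<in> homs (orb G) K H \<Longrightarrow> T \<in> \<O> H \<Longrightarrow> M \<in> cobj (lev C H) \<Longrightarrow>
      rcomp C f h (bobj B H T M) \<bullet>\<^bsub>lev C L\<^esub> farr (res C h) (bres B f T M) \<bullet>\<^bsub>lev C L\<^esub>
        bres B h (gpull G f T) (fobj (res C f) M) =
      bres B (f \<bullet>\<^bsub>orb G\<^esub> h) T M \<bullet>\<^bsub>lev C L\<^esub> barr B L (rcomp (FSet G) f h T) (rcomp C f h M)"
    and bpoint_iso: "subgroup H G \<Longrightarrow>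
      mon_nat_iso (lev C H) (lev C H) (box_by G B H (gpoint G H)) (id_sm (lev C H)) (bpoint B H)"
    and bpoint_res: "f \<in> homs (orb G) K H \<Longrightarrow> M \<in> cobj (lev C H) \<Longrightarrow>
      farr (res C f) (bpoint B H M) \<bullet>\<^bsub>lev C K\<^esub> bres B f (gpoint G H) M =
      bpoint B K (fobj (res C f) M) \<bullet>\<^bsub>lev C K\<^esub>
        barr B K (gbang G K (gpull G f (gpoint G H))) (cid (lev C K) (fobj (res C f) M))"
    \<comment> \<open>\<open>bass\<close> is an isomorphism of functors that are linear in each of \<open>S\<close>, \<open>T\<close>, \<open>M\<close>; it commutes with
      restrictions and agrees with the canonical exponentiation for trivial actions\<close>
    and bass_iso: "subgroup H G \<Longrightarrow> S \<in> \<O> H \<Longrightarrow> T \<in> \<O> H \<Longrightarrow> M \<in> cobj (lev C H) \<Longrightarrow>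
      bass B H S T M \<in> isos (lev C H) (bobj B H (gprod G S T) M) (bobj B H S (bobj B H T M))"
    and bass_mod: "subgroup H G \<Longrightarrow> S \<in> \<O> H \<Longrightarrow> T \<in> \<O> H \<Longrightarrow>
      mon_nat (lev C H) (lev C H) (box_by G B H (gprod G S T))
        (comp_sm (lev C H) (box_by G B H S) (box_by G B H T)) (\<lambda>M. bass B H S T M)"
    and bass_left: "subgroup H G \<Longrightarrow> T \<in> \<O> H \<Longrightarrow> M \<in> cobj (lev C H) \<Longrightarrow>
      mon_nat (oiso G \<O> H) (lev C H)
        (comp_sm (lev C H) (box_at C B H M) (gprod_left G H T))
        (box_at C B H (bobj B H T M)) (\<lambda>S. bass B H S T M)"
    and bass_right: "subgroup H G \<Longrightarrow> S \<in> \<O> H \<Longrightarrow> M \<in> cobj (lev C H) \<Longrightarrow>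
      mon_nat (oiso G \<O> H) (lev C H)
        (comp_sm (lev C H) (box_at C B H M) (gprod_right G H S))
        (comp_sm (lev C H) (box_by G B H S) (box_at C B H M)) (\<lambda>T. bass B H S T M)"
    and bass_res: "f \<in> homs (orb G) K H \<Longrightarrow> S \<in> \<O> H \<Longrightarrow> T \<in> \<O> H \<Longrightarrow> M \<in> cobj (lev C H) \<Longrightarrow>
      farr (res C f) (bass B H S T M) \<bullet>\<^bsub>lev C K\<^esub> bres B f (gprod G S T) M =
      bres B f S (bobj B H T M) \<bullet>\<^bsub>lev C K\<^esub>
        barr B K (cid (fset G K) (gpull G f S)) (bres B f T M) \<bullet>\<^bsub>lev C K\<^esub>
        bass B K (gpull G f S) (gpull G f T) (fobj (res C f) M) \<bullet>\<^bsub>lev C K\<^esub>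
        barr B K
          (mk_gmap (gpull G f (gprod G S T)) (pr_case (\<lambda>c. pr_case (\<lambda>x y. Pr (Pr c x) (Pr c y))))
            (gprod G (gpull G f S) (gpull G f T)))
          (cid (lev C K) (fobj (res C f) M))"
    and bass_point_right: "subgroup H G \<Longrightarrow> S \<in> \<O> H \<Longrightarrow> M \<in> cobj (lev C H) \<Longrightarrow>
      barr B H (cid (fset G H) S) (bpoint B H M) \<bullet>\<^bsub>lev C H\<^esub> bass B H S (gpoint G H) M =
      barr B H (mk_gmap (gprod G S (gpoint G H)) (pr_case (\<lambda>x y. x)) S) (cid (lev C H) M)"
    and bass_point_left: "subgroup H G \<Longrightarrow> T \<in> \<O> H \<Longrightarrow> M \<in> cobj (lev C H) \<Longrightarrow>
      bpoint B H (bobj B H T M) \<bullet>\<^bsub>lev C H\<^esub> bass B H (gpoint G H) T M =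
      barr B H (mk_gmap (gprod G (gpoint G H) T) (pr_case (\<lambda>x y. y)) T) (cid (lev C H) M)"

text \<open>Levelwise colimits, and compatibility of the structure with sifted colimits. The tensor products
  (the functor \<open>\<box>\<close> for trivial actions, in each of its variables) and the restrictions are included: this
  is what makes the relative tensor products \<open>\<otimes>\<^sub>A\<close> associative and compatible with restriction.\<close>

definition compatible_colimits :: "'j itself \<Rightarrow> 'g monoid \<Rightarrow> ('g set \<Rightarrow> 'g gset set) \<Rightarrow>
    ('g, 'o, 'a) coeff \<Rightarrow> ('g, 'o, 'a) box \<Rightarrow> bool" where
  "compatible_colimits J G \<O> C B \<longleftrightarrow>
    (\<forall>H. subgroup H G \<longrightarrow> cocomplete J (lev C H) \<and>
      (\<forall>T \<in> \<O> H. preserves_sifted J (lev C H) (lev C H) (bobj B H T) (barr B H (cid (fset G H) T))) \<and>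
      (\<forall>M \<in> cobj (lev C H). preserves_sifted J (lev C H) (lev C H)
        (\<lambda>N. M \<odot>\<^bsub>lev C H\<^esub> N) (\<lambda>n. cid (lev C H) M \<star>\<^bsub>lev C H\<^esub> n))) \<and>
    (\<forall>K H. \<forall>f \<in> homs (orb G) K H.
      preserves_sifted J (lev C H) (lev C K) (fobj (res C f)) (farr (res C f)))"


section \<open>\<open>\<O>\<close>-commutative monoids\<close>

text \<open>\<open>N H\<close> is the extension of \<open>T \<mapsto> T \<box> i\<^sub>H\<^sup>* R\<close> to all arrows of \<open>\<O>(G/H)\<close>. The monoidal structure
  maps and the comparison maps with restrictions are those of \<open>T \<mapsto> T \<box> i\<^sub>H\<^sup>* R\<close>.\<close>

definition norm_functor :: "'g monoid \<Rightarrow> ('g, 'o, 'a) coeff \<Rightarrow> ('g, 'o, 'a) box \<Rightarrow> 'o \<Rightarrow>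
    ('g set \<Rightarrow> 'g gmap \<Rightarrow> 'a) \<Rightarrow> 'g set \<Rightarrow> ('g gset, 'g gmap, 'o, 'a) smfun" where
  "norm_functor G C B R N H = (box_at C B H (rest G C R H))\<lparr>farr := N H\<rparr>"

definition norm_res :: "'g monoid \<Rightarrow> ('g, 'o, 'a) coeff \<Rightarrow> ('g, 'o, 'a) box \<Rightarrow> 'o \<Rightarrow> 'g omap \<Rightarrow>
    'g gset \<Rightarrow> 'a" where
  "norm_res G C B R f T = (let K = cdom (orb G) f; H = ccod (orb G) f in
     bres B f T (rest G C R H) \<bullet>\<^bsub>lev C K\<^esub> barr B K (cid (fset G K) (gpull G f T)) (rest_comp G C R f))"

locale O_comm_monoid = O_sym_mon G \<O> C B
  for G :: "'g monoid" and \<O> :: "'g set \<Rightarrow> 'g gset set" and C :: "('g, 'o, 'a) coeff"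
    and B :: "('g, 'o, 'a) box" +
  fixes R :: 'o and N :: "'g set \<Rightarrow> 'g gmap \<Rightarrow> 'a"
  assumes underlying: "R \<in> cobj (lev C (carrier G))"
    and norm: "subgroup H G \<Longrightarrow> sm_functor (osub G \<O> H) (lev C H) (norm_functor G C B R N H)"
    and norm_extends: "subgroup H G \<Longrightarrow> t \<in> carr (oiso G \<O> H) \<Longrightarrow>
      N H t = barr B H t (cid (lev C H) (rest G C R H))"
    and norm_restrict: "f \<in> homs (orb G) K H \<Longrightarrow> t \<in> homs (osub G \<O> H) T T' \<Longrightarrow>
      farr (res C f) (N H t) \<bullet>\<^bsub>lev C K\<^esub> norm_res G C B R f T =
      norm_res G C B R f T' \<bullet>\<^bsub>lev C K\<^esub> N K (farr (res (FSet G) f) t)"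
    \<comment> \<open>\<open>T \<mapsto> T \<box> R\<close> commutes with the operations \<open>S \<box> -\<close>, and so does its extension: up to the
      associativity isomorphism, \<open>S \<box> N(t) = N(S \<times> t)\<close>. In particular \<open>T \<box> R \<rightarrow> R\<close> is a map of monoids
      for the multiplication that \<open>T \<box> R\<close> inherits from \<open>R\<close>.\<close>
    and norm_box: "subgroup H G \<Longrightarrow> S \<in> \<O> H \<Longrightarrow> t \<in> homs (osub G \<O> H) T T' \<Longrightarrow>
      bass B H S T' (rest G C R H) \<bullet>\<^bsub>lev C H\<^esub> N H (gproda G (cid (fset G H) S) t) =
      barr B H (cid (fset G H) S) (N H t) \<bullet>\<^bsub>lev C H\<^esub> bass B H S T (rest G C R H)"

text \<open>The map \<open>T \<box> i\<^sub>H\<^sup>* R \<rightarrow> i\<^sub>H\<^sup>* R\<close> induced by \<open>T \<rightarrow> *\<close>, and the multiplication and unit of \<open>i\<^sub>H\<^sup>* R\<close>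
  induced by \<open>* \<squnion> * \<rightarrow> *\<close> and \<open>\<emptyset> \<rightarrow> *\<close>.\<close>

definition norm_map :: "'g monoid \<Rightarrow> ('g, 'o, 'a) coeff \<Rightarrow> ('g, 'o, 'a) box \<Rightarrow> 'o \<Rightarrow>
    ('g set \<Rightarrow> 'g gmap \<Rightarrow> 'a) \<Rightarrow> 'g set \<Rightarrow> 'g gset \<Rightarrow> 'a" where
  "norm_map G C B R N H T = bpoint B H (rest G C R H) \<bullet>\<^bsub>lev C H\<^esub> N H (gbang G H T)"

definition rmult :: "'g monoid \<Rightarrow> ('g, 'o, 'a) coeff \<Rightarrow> ('g, 'o, 'a) box \<Rightarrow> 'o \<Rightarrow>
    ('g set \<Rightarrow> 'g gmap \<Rightarrow> 'a) \<Rightarrow> 'g set \<Rightarrow> 'a" where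
  "rmult G C B R N H = (let A = rest G C R H; P = gpoint G H in
     norm_map G C B R N H (gsum G P P) \<bullet>\<^bsub>lev C H\<^esub> badd B H P P A \<bullet>\<^bsub>lev C H\<^esub>
     (inv_arr (lev C H) (bpoint B H A) \<star>\<^bsub>lev C H\<^esub> inv_arr (lev C H) (bpoint B H A)))"

definition runit_map :: "'g monoid \<Rightarrow> ('g, 'o, 'a) coeff \<Rightarrow> ('g, 'o, 'a) box \<Rightarrow> 'o \<Rightarrow>
    ('g set \<Rightarrow> 'g gmap \<Rightarrow> 'a) \<Rightarrow> 'g set \<Rightarrow> 'a" where
  "runit_map G C B R N H = norm_map G C B R N H (gempty G) \<bullet>\<^bsub>lev C H\<^esub> bzero B H (rest G C R H)"


section \<open>Modules\<close>

text \<open>A module is a pair of an object \<open>M\<close> and an action \<open>A \<odot> M \<rightarrow> M\<close>; a map of modules is a triple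
  (source, underlying arrow, target).\<close>

type_synonym ('o, 'a) md = "'o \<times> 'a"
type_synonym ('o, 'a) mdmap = "('o, 'a) md \<times> 'a \<times> ('o, 'a) md"

definition is_coeq :: "('o, 'a, 'm) cat_scheme \<Rightarrow> 'a \<Rightarrow> 'a \<Rightarrow> 'a \<Rightarrow> bool" where
  "is_coeq C f g q \<longleftrightarrow> q \<in> homs C (ccod C f) (ccod C q) \<and> q \<bullet>\<^bsub>C\<^esub> f = q \<bullet>\<^bsub>C\<^esub> g \<and>
    (\<forall>y. \<forall>k \<in> homs C (ccod C f) y. k \<bullet>\<^bsub>C\<^esub> f = k \<bullet>\<^bsub>C\<^esub> g \<longrightarrow>
      (\<exists>!h. h \<in> homs C (ccod C q) y \<and> h \<bullet>\<^bsub>C\<^esub> q = k))"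

text \<open>The unique factorisation of \<open>k\<close> through the epimorphism \<open>q\<close>.\<close>

definition factor :: "('o, 'a, 'm) cat_scheme \<Rightarrow> 'a \<Rightarrow> 'a \<Rightarrow> 'a" where
  "factor C q k = (THE h. h \<in> homs C (ccod C q) (ccod C k) \<and> h \<bullet>\<^bsub>C\<^esub> q = k)"

text \<open>The quotient map \<open>M \<odot> M' \<rightarrow> M \<otimes>\<^sub>A M'\<close>: a chosen coequalizer of the two action maps
  \<open>(M \<odot> A) \<odot> M' \<rightarrow> M \<odot> M'\<close>, where \<open>A\<close> acts on \<open>M\<close> from the right through the symmetry. Its codomain is
  the relative tensor product.\<close>

definition relq :: "('o, 'a, 'm) smc_scheme \<Rightarrow> 'o \<Rightarrow> ('o, 'a) md \<Rightarrow> ('o, 'a) md \<Rightarrow> 'a" where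
  "relq C A X Y = (SOME q. is_coeq C
     ((snd X \<bullet>\<^bsub>C\<^esub> braid C (fst X) A) \<star>\<^bsub>C\<^esub> cid C (fst Y))
     ((cid C (fst X) \<star>\<^bsub>C\<^esub> snd Y) \<bullet>\<^bsub>C\<^esub> assoc C (fst X) A (fst Y)) q)"

text \<open>The action of \<open>A\<close> on a quotient \<open>q : M \<odot> M' \<rightarrow> Q\<close> induced by an action \<open>a\<close> on \<open>M\<close>.\<close>

definition quot_act :: "('o, 'a, 'm) smc_scheme \<Rightarrow> 'o \<Rightarrow> 'o \<Rightarrow> 'a \<Rightarrow> 'o \<Rightarrow> 'a \<Rightarrow> 'a" where
  "quot_act C A M a M' q = factor C (cid C A \<star>\<^bsub>C\<^esub> q)
     (q \<bullet>\<^bsub>C\<^esub> (a \<star>\<^bsub>C\<^esub> cid C M') \<bullet>\<^bsub>C\<^esub> inv_arr C (assoc C A M M'))"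

definition mod_tens :: "('o, 'a, 'm) smc_scheme \<Rightarrow> 'o \<Rightarrow> ('o, 'a) md \<Rightarrow> ('o, 'a) md \<Rightarrow> ('o, 'a) md" where
  "mod_tens C A X Y =
     (ccod C (relq C A X Y), quot_act C A (fst X) (snd X) (fst Y) (relq C A X Y))"

definition modules :: "('o, 'a, 'm) smc_scheme \<Rightarrow> 'o \<Rightarrow> 'a \<Rightarrow> 'a \<Rightarrow> ('o, 'a) md set" where
  "modules C A m e = {(M, a). M \<in> cobj C \<and> a \<in> homs C (A \<odot>\<^bsub>C\<^esub> M) M \<and>
     a \<bullet>\<^bsub>C\<^esub> (cid C A \<star>\<^bsub>C\<^esub> a) \<bullet>\<^bsub>C\<^esub> assoc C A A M = a \<bullet>\<^bsub>C\<^esub> (m \<star>\<^bsub>C\<^esub> cid C M) \<and>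
     a \<bullet>\<^bsub>C\<^esub> (e \<star>\<^bsub>C\<^esub> cid C M) = lun C M}"

definition module_maps :: "('o, 'a, 'm) smc_scheme \<Rightarrow> 'o \<Rightarrow> 'a \<Rightarrow> 'a \<Rightarrow> ('o, 'a) mdmap set" where
  "module_maps C A m e = {(X, u, Y). X \<in> modules C A m e \<and> Y \<in> modules C A m e \<and>
     u \<in> homs C (fst X) (fst Y) \<and> u \<bullet>\<^bsub>C\<^esub> snd X = snd Y \<bullet>\<^bsub>C\<^esub> (cid C A \<star>\<^bsub>C\<^esub> u)}"

text \<open>The symmetric monoidal category of modules over a commutative monoid \<open>(A, m, e)\<close> under \<open>\<otimes>\<^sub>A\<close>. Its
  structure maps are induced by those of \<open>C\<close> on the quotients.\<close>

definition mod_cat :: "('o, 'a, 'm) smc_scheme \<Rightarrow> 'o \<Rightarrow> 'a \<Rightarrow> 'a \<Rightarrow> (('o, 'a) md, ('o, 'a) mdmap) smc" where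
  "mod_cat C A m e = \<lparr>cobj = modules C A m e, carr = module_maps C A m e,
     cdom = (\<lambda>(X, u, Y). X), ccod = (\<lambda>(X, u, Y). Y),
     cid = (\<lambda>X. (X, cid C (fst X), X)),
     ccomp = (\<lambda>(X', u', Y') (X, u, Y). (X, u' \<bullet>\<^bsub>C\<^esub> u, Y')),
     tens = mod_tens C A,
     tensa = (\<lambda>(X, u, Y) (X', u', Y'). (mod_tens C A X X',
       factor C (relq C A X X') (relq C A Y Y' \<bullet>\<^bsub>C\<^esub> (u \<star>\<^bsub>C\<^esub> u')), mod_tens C A Y Y')),
     unit_obj = (A, m),
     assoc = (\<lambda>X Y Z. (mod_tens C A (mod_tens C A X Y) Z,
       factor C (relq C A (mod_tens C A X Y) Z \<bullet>\<^bsub>C\<^esub> (relq C A X Y \<star>\<^bsub>C\<^esub> cid C (fst Z)))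
         (relq C A X (mod_tens C A Y Z) \<bullet>\<^bsub>C\<^esub> (cid C (fst X) \<star>\<^bsub>C\<^esub> relq C A Y Z) \<bullet>\<^bsub>C\<^esub>
           assoc C (fst X) (fst Y) (fst Z)),
       mod_tens C A X (mod_tens C A Y Z))),
     lun = (\<lambda>X. (mod_tens C A (A, m) X, factor C (relq C A (A, m) X) (snd X), X)),
     run = (\<lambda>X. (mod_tens C A X (A, m),
       factor C (relq C A X (A, m)) (snd X \<bullet>\<^bsub>C\<^esub> braid C (fst X) A), X)),
     braid = (\<lambda>X Y. (mod_tens C A X Y,
       factor C (relq C A X Y) (relq C A Y X \<bullet>\<^bsub>C\<^esub> braid C (fst X) (fst Y)), mod_tens C A Y X))\<rparr>"

definition mod_res_obj :: "'g monoid \<Rightarrow> ('g, 'o, 'a) coeff \<Rightarrow> 'o \<Rightarrow> 'g omap \<Rightarrow> ('o, 'a) md \<Rightarrow> ('o, 'a) md" where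
  "mod_res_obj G C R f X = (let K = cdom (orb G) f; H = ccod (orb G) f; F = res C f in
     (fobj F (fst X), farr F (snd X) \<bullet>\<^bsub>lev C K\<^esub> fmu F (rest G C R H) (fst X) \<bullet>\<^bsub>lev C K\<^esub>
        (rest_comp G C R f \<star>\<^bsub>lev C K\<^esub> cid (lev C K) (fobj F (fst X)))))"

definition RMod :: "'g monoid \<Rightarrow> ('g, 'o, 'a) coeff \<Rightarrow> ('g, 'o, 'a) box \<Rightarrow> 'o \<Rightarrow>
    ('g set \<Rightarrow> 'g gmap \<Rightarrow> 'a) \<Rightarrow> ('g, ('o, 'a) md, ('o, 'a) mdmap) coeff" where
  "RMod G C B R N = (let
       L = (\<lambda>H. mod_cat (lev C H) (rest G C R H) (rmult G C B R N H) (runit_map G C B R N H));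
       F = mod_res_obj G C R
     in \<lparr>lev = L,
       res = (\<lambda>f. let K = cdom (orb G) f; H = ccod (orb G) f in
         \<lparr>fobj = F f, farr = (\<lambda>(X, u, Y). (F f X, farr (res C f) u, F f Y)),
           fmu = (\<lambda>X Y. (F f X \<odot>\<^bsub>L K\<^esub> F f Y,
             factor (lev C K) (relq (lev C K) (rest G C R K) (F f X) (F f Y))
               (farr (res C f) (relq (lev C H) (rest G C R H) X Y) \<bullet>\<^bsub>lev C K\<^esub> fmu (res C f) (fst X) (fst Y)),
             F f (X \<odot>\<^bsub>L H\<^esub> Y))),
           feps = (unit_obj (L K), rest_comp G C R f, F f (unit_obj (L H)))\<rparr>),
       runit = (\<lambda>H X. (X, runit C H (fst X), F (cid (orb G) H) X)),
       rcomp = (\<lambda>f h X. (F h (F f X), rcomp C f h (fst X), F (f \<bullet>\<^bsub>orb G\<^esub> h) X))\<rparr>)"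


section \<open>The operation \<open>T \<box>\<^sub>R M = R \<otimes>\<^bsub>T \<box> R\<^esub> (T \<box> M)\<close>\<close>

text \<open>\<open>T \<box> M\<close> as a \<open>T \<box> R\<close>-module, and \<open>R\<close> as a \<open>T \<box> R\<close>-module (with \<open>i\<^sub>H\<^sup>* R\<close> in place of \<open>R\<close>).\<close>

definition box_module :: "'g monoid \<Rightarrow> ('g, 'o, 'a) coeff \<Rightarrow> ('g, 'o, 'a) box \<Rightarrow> 'o \<Rightarrow> 'g set \<Rightarrow>
    'g gset \<Rightarrow> ('o, 'a) md \<Rightarrow> ('o, 'a) md" where
  "box_module G C B R H T X = (bobj B H T (fst X),
     barr B H (cid (fset G H) T) (snd X) \<bullet>\<^bsub>lev C H\<^esub> bmul B H T (rest G C R H) (fst X))"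

definition base_module :: "'g monoid \<Rightarrow> ('g, 'o, 'a) coeff \<Rightarrow> ('g, 'o, 'a) box \<Rightarrow> 'o \<Rightarrow>
    ('g set \<Rightarrow> 'g gmap \<Rightarrow> 'a) \<Rightarrow> 'g set \<Rightarrow> 'g gset \<Rightarrow> ('o, 'a) md" where
  "base_module G C B R N H T = (rest G C R H,
     rmult G C B R N H \<bullet>\<^bsub>lev C H\<^esub>
       (norm_map G C B R N H T \<star>\<^bsub>lev C H\<^esub> cid (lev C H) (rest G C R H)))"

definition boxR_q :: "'g monoid \<Rightarrow> ('g, 'o, 'a) coeff \<Rightarrow> ('g, 'o, 'a) box \<Rightarrow> 'o \<Rightarrow>
    ('g set \<Rightarrow> 'g gmap \<Rightarrow> 'a) \<Rightarrow> 'g set \<Rightarrow> 'g gset \<Rightarrow> ('o, 'a) md \<Rightarrow> 'a" where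
  "boxR_q G C B R N H T X = relq (lev C H) (bobj B H T (rest G C R H))
     (base_module G C B R N H T) (box_module G C B R H T X)"

definition boxR_obj :: "'g monoid \<Rightarrow> ('g, 'o, 'a) coeff \<Rightarrow> ('g, 'o, 'a) box \<Rightarrow> 'o \<Rightarrow>
    ('g set \<Rightarrow> 'g gmap \<Rightarrow> 'a) \<Rightarrow> 'g set \<Rightarrow> 'g gset \<Rightarrow> ('o, 'a) md \<Rightarrow> ('o, 'a) md" where
  "boxR_obj G C B R N H T X = (let q = boxR_q G C B R N H T X; A = rest G C R H in
     (ccod (lev C H) q, quot_act (lev C H) A A (rmult G C B R N H) (bobj B H T (fst X)) q))"

definition boxR_arr :: "'g monoid \<Rightarrow> ('g, 'o, 'a) coeff \<Rightarrow> ('g, 'o, 'a) box \<Rightarrow> 'o \<Rightarrow>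
    ('g set \<Rightarrow> 'g gmap \<Rightarrow> 'a) \<Rightarrow> 'g set \<Rightarrow> 'g gmap \<Rightarrow> ('o, 'a) mdmap \<Rightarrow> ('o, 'a) mdmap" where
  "boxR_arr G C B R N H t u = (case t of (T, _, T') \<Rightarrow> case u of (X, v, Y) \<Rightarrow>
     (boxR_obj G C B R N H T X,
      factor (lev C H) (boxR_q G C B R N H T X)
        (boxR_q G C B R N H T' Y \<bullet>\<^bsub>lev C H\<^esub> (cid (lev C H) (rest G C R H) \<star>\<^bsub>lev C H\<^esub> barr B H t v)),
      boxR_obj G C B R N H T' Y))"

end

theory Submission
  imports Defs
begin

text \<open>A map of modules is determined by its restriction to generators, and each structure map of
  \<open>R\<close>-modules restricts on generators to the corresponding structure map of the underlying system \<open>C\<close>: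
  \<open>M \<otimes>\<^sub>R N\<close> is generated by \<open>M \<odot> N\<close>, \<open>T \<box>\<^sub>R M\<close> by \<open>T \<box> M\<close>, and the restriction \<open>f\<^sup>* M\<close> by
  itself. Hence every axiom for \<open>R\<close>-modules follows from the same axiom for \<open>C\<close>, once the structure maps
  exist. They exist because a map over a given arrow of \<open>C\<close> descends to the quotient: relative tensor
  products and base changes are reflexive coequalizers, and these are preserved by \<open>M \<odot> -\<close>, by \<open>T \<box> -\<close>
  and by restriction. An inverse to such a map lies over the inverse arrow of \<open>C\<close>. The maps
  \<open>T \<box> R \<rightarrow> R\<close> along which the base change is taken are maps of monoids because the norm is strong
  symmetric monoidal and defined on all maps of finite sets, where the point is terminal.\<close>

section \<open>Categories\<close>

text \<open>The operations \<open>M \<odot> -\<close>, \<open>T \<box> -\<close> and restriction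
  preserve reflexive coequalizers but need not preserve epimorphisms, while the quotient maps are
  tensored, boxed and restricted over and over. Generation therefore rests on a class of arrows that
  remain epimorphisms under every composite of these operations. It contains reflexive coequalizers
  and split epimorphisms and allows cancellation. The map
  \<open>T \<box> M \<rightarrow> T \<box>\<^sub>R M\<close> itself need not be an epimorphism; only
  its linear extension is, which is why generation is tested after extending scalars.

  The coequalizers are reflexive because the monoids have units. Base change along an isomorphism
  needs no quotient, so restriction and \<open>T \<box>\<^sub>R -\<close> become two cases of one
  construction.

  Multiplicativity of \<open>T \<box> R \<rightarrow> R\<close> concerns the product that
  \<open>T \<box> R\<close> inherits from \<open>R\<close>, which terminality of the point alone
  does not reach. The axiom \<open>norm_box\<close> and the isomorphism \<open>bass\<close> rewrite
  that product through sets \<open>T \<times> S\<close>, where the norm applies.\<close>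

definition epi :: "('o, 'a, 'm) cat_scheme => 'a => bool" where
 "epi C p \<longleftrightarrow> p \<in> carr C & (\<forall>f g. f \<in> carr C \<longrightarrow> g \<in> carr C \<longrightarrow> cdom C f = ccod C p \<longrightarrow>
   cdom C g = ccod C p \<longrightarrow> f \<bullet>\<^bsub>C\<^esub> p = g \<bullet>\<^bsub>C\<^esub> p \<longrightarrow> f = g)"

definition iso_arr :: "('o, 'a, 'm) cat_scheme => 'a => bool" where
 "iso_arr C f \<longleftrightarrow> f \<in> isos C (cdom C f) (ccod C f)"

definition split_epi :: "('o, 'a, 'm) cat_scheme => 'a => bool" where
 "split_epi C p \<longleftrightarrow> p \<in> carr C &
  (\<exists>s \<in> homs C (ccod C p) (cdom C p). p \<bullet>\<^bsub>C\<^esub> s = cid C (ccod C p))"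

definition reflexive :: "('o, 'a, 'm) cat_scheme => 'a => 'a => bool" where
 "reflexive C f g \<longleftrightarrow> f \<in> carr C & g \<in> homs C (cdom C f) (ccod C f) &
  (\<exists>s \<in> homs C (ccod C f) (cdom C f).
   f \<bullet>\<^bsub>C\<^esub> s = cid C (ccod C f) & g \<bullet>\<^bsub>C\<^esub> s = cid C (ccod C f))"

definition rcoeq :: "('o, 'a, 'm) cat_scheme => 'a => 'a => 'a => bool" where
 "rcoeq C f g q \<longleftrightarrow> reflexive C f g & is_coeq C f g q"

lemma in_homs: "f \<in> homs C x y \<longleftrightarrow> f \<in> carr C & cdom C f = x & ccod C f = y"
 by (simp add: homs_def)

lemma isosI:
 "f \<in> homs C x y ==> g \<in> homs C y x ==> g \<bullet>\<^bsub>C\<^esub> f = cid C x ==> f \<bullet>\<^bsub>C\<^esub> g = cid C y ==> f \<in> isos C x y"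
 by (auto simp: isos_def)

lemma isos_homs: "f \<in> isos C x y ==> f \<in> homs C x y"
 by (simp add: isos_def)

lemma isos_iff: "f \<in> isos C x y \<longleftrightarrow> iso_arr C f & cdom C f = x & ccod C f = y"
 by (auto simp: iso_arr_def isos_def in_homs)

lemma iso_arr_carr: "iso_arr C f ==> f \<in> carr C"
 by (simp add: iso_arr_def isos_def in_homs)

context category
begin

abbreviation cmp (infixr "oo" 60) where "g oo f \<equiv> g \<bullet>\<^bsub>C\<^esub> f"
abbreviation ob where "ob x \<equiv> x \<in> cobj C"
abbreviation ar where "ar f \<equiv> f \<in> carr C"
abbreviation dm where "dm f \<equiv> cdom C f"
abbreviation cd where "cd f \<equiv> ccod C f"
abbreviation idt where "idt x \<equiv> cid C x"
abbreviation iv where "iv f \<equiv> inv_arr C f"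

lemma dm_ob [simp]: "ar f ==> ob (dm f)" and cd_ob [simp]: "ar f ==> ob (cd f)"
 by (auto intro: dom_closed cod_closed)

lemma id_ar [simp]: "ob x ==> ar (idt x)" "ob x ==> dm (idt x) = x" "ob x ==> cd (idt x) = x"
 using id_hom by (auto simp: in_homs)

lemma comp_ar [simp]:
 assumes "ar g" "ar f" "cd f = dm g"
 shows "ar (g oo f)" "dm (g oo f) = dm f" "cd (g oo f) = cd g"
 using comp_hom[of f "dm f" "cd f" g "cd g"] assms by (auto simp: in_homs)

lemma id_l [simp]: "ar f ==> cd f = y ==> idt y oo f = f"
 using id_left[of f "dm f" "cd f"] by (auto simp: in_homs)

lemma id_r [simp]: "ar f ==> dm f = x ==> f oo idt x = f"
 using id_right[of f "dm f" "cd f"] by (auto simp: in_homs)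

lemma cassoc:
 "ar f ==> ar g ==> ar h ==> cd f = dm g ==> cd g = dm h ==> (h oo g) oo f = h oo g oo f"
 using comp_assoc[of f "dm f" "cd f" g "cd g" h "cd h"] by (auto simp: in_homs)

lemma rw2:
 assumes "g oo f = h" "ar g" "ar f" "cd f = dm g"
 shows "\<And>z. ar z ==> cd z = dm f ==> g oo f oo z = h oo z"
 using assms by (metis cassoc)

lemma rw3:
 assumes "g oo f oo k = h" "ar g" "ar f" "ar k" "cd f = dm g" "cd k = dm f"
 shows "\<And>z. ar z ==> cd z = dm k ==> g oo f oo k oo z = h oo z"
 using assms by (metis cassoc comp_ar)

lemma epi_cancel: "epi C p ==> f oo p = g oo p ==> ar f ==> ar g ==> dm f = cd p ==> dm g = cd p ==> f = g"
 by (simp add: epi_def)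

lemma epi_comp:
 assumes p: "epi C p" and q: "epi C q" and pq: "cd p = dm q"
 shows "epi C (q oo p)"
 unfolding epi_def
proof (intro conjI allI impI)
 have [simp]: "ar p" "ar q" using p q by (auto simp: epi_def)
 show "ar (q oo p)" using pq by simp
 fix f g assume *: "ar f" "ar g" "dm f = cd (q oo p)" "dm g = cd (q oo p)" "f oo q oo p = g oo q oo p"
 have "f oo q = g oo q"
  by (rule epi_cancel[OF p]) (use * pq in \<open>auto simp: cassoc\<close>)
 then show "f = g" by (rule epi_cancel[OF q]) (use * pq in auto)
qed

lemma epi_of_comp:
 assumes "epi C (q oo p)" "ar p" "ar q" "cd p = dm q"
 shows "epi C q"
 unfolding epi_def
proof (intro conjI allI impI)
 show "ar q" by fact
 fix f g assume *: "ar f" "ar g" "dm f = cd q" "dm g = cd q" "f oo q = g oo q"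
 then have "(f oo q) oo p = (g oo q) oo p" by simp
 then have "f oo q oo p = g oo q oo p"
  using *(1-4) assms(2-4) by (simp add: cassoc)
 then show "f = g" by (rule epi_cancel[OF assms(1)]) (use * assms in auto)
qed

lemma split_epi_epi:
 assumes "split_epi C p" shows "epi C p"
proof -
 obtain s where s: "ar s" "dm s = cd p" "cd s = dm p" "p oo s = idt (cd p)" "ar p"
  using assms by (auto simp: split_epi_def in_homs)
 have *: "(f oo p) oo s = f" if "ar f" "dm f = cd p" for f
  using that s by (simp add: cassoc)
 show ?thesis
  unfolding epi_def
 proof (intro conjI allI impI)
  show "ar p" by fact
  fix f g assume fg: "ar f" "ar g" "dm f = cd p" "dm g = cd p" "f oo p = g oo p"
  show "f = g" using *[OF fg(1,3)] *[OF fg(2,4)] unfolding fg(5) by (rule trans[OF sym])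
 qed
qed

text \<open>Two-sided inverses are unique by associativity, so the description in
  \<open>inv_arr\<close> denotes one.\<close>

lemma iso_inv:
 assumes "iso_arr C f"
 shows "ar f" "ar (iv f)" "dm (iv f) = cd f" "cd (iv f) = dm f" "iv f oo f = idt (dm f)" "f oo iv f = idt (cd f)"
proof -
 obtain g where g: "g \<in> homs C (cd f) (dm f)" "g oo f = idt (dm f)" "f oo g = idt (cd f)" and f: "ar f"
  using assms by (auto simp: iso_arr_def isos_def in_homs)
 have "iv f \<in> homs C (cd f) (dm f) & iv f oo f = idt (dm f) & f oo iv f = idt (cd f)"
  unfolding inv_arr_def
 proof (rule theI[of _ g])
  show "g \<in> homs C (cd f) (dm f) & g oo f = idt (dm f) & f oo g = idt (cd f)" using g by simp
  fix h assume h: "h \<in> homs C (cd f) (dm f) & h oo f = idt (dm f) & f oo h = idt (cd f)"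
  have "h oo f oo g = (h oo f) oo g" using g h f by (intro cassoc[symmetric]) (auto simp: in_homs)
  moreover have "h oo f oo g = h" using g h unfolding g(3) by (simp add: in_homs)
  moreover have "(h oo f) oo g = g" using g h by (simp add: in_homs)
  ultimately show "h = g" by simp
 qed
 then show "ar f" "ar (iv f)" "dm (iv f) = cd f" "cd (iv f) = dm f" "iv f oo f = idt (dm f)"
  "f oo iv f = idt (cd f)" using f by (auto simp: in_homs)
qed

lemmas iso_inv_ar [simp] = iso_inv(2-4)
lemmas iso_ar = iso_inv(1)

lemma iv_l [simp]: "iso_arr C f ==> iv f oo f = idt (dm f)"
 and iv_r [simp]: "iso_arr C f ==> f oo iv f = idt (cd f)"
 by (fact iso_inv)+

lemma iv_l' [simp]: "iso_arr C f ==> ar z ==> cd z = dm f ==> iv f oo f oo z = z"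
 by (simp add: rw2[OF iv_l] iso_inv(1))

lemma iv_r' [simp]: "iso_arr C f ==> ar z ==> cd z = cd f ==> f oo iv f oo z = z"
 by (simp add: rw2[OF iv_r] iso_inv(1))

lemma iso_arrI:
 "ar f ==> ar g ==> cd g = dm f ==> dm g = cd f ==> g oo f = idt (dm f) ==> f oo g = idt (cd f) ==> iso_arr C f"
 unfolding iso_arr_def by (rule isosI[where g = g]) (auto simp: in_homs)

lemma iv_eqI:
 assumes "ar f" "ar g" "cd g = dm f" "dm g = cd f" "g oo f = idt (dm f)" "f oo g = idt (cd f)"
 shows "iv f = g"
proof -
 have iso: "iso_arr C f" using assms by (intro iso_arrI)
 have "iv f oo f oo g = g" using iso assms(2,3) by (rule iv_l')
 moreover have "iv f oo f oo g = iv f" unfolding assms(6) using iso by simp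
 ultimately show ?thesis by simp
qed

lemma iso_iv [simp]: "iso_arr C f ==> iso_arr C (iv f)"
 using iso_inv[of f] by (intro iso_arrI[of _ f]) auto

lemma iso_id [simp]: "ob x ==> iso_arr C (idt x)"
 by (rule iso_arrI[of _ "idt x"]) auto

lemma iso_comp [simp]:
 assumes "iso_arr C g" "iso_arr C f" "cd f = dm g" shows "iso_arr C (g oo f)"
 using assms iso_inv[of f] iso_inv[of g]
 by (intro iso_arrI[of _ "iv f oo iv g"]) (auto simp: cassoc)

lemma iv_iv: "iso_arr C f ==> iv (iv f) = f"
 using iso_inv[of f] by (intro iv_eqI) auto

lemma iso_split_epi: "iso_arr C f ==> split_epi C f"
 using iso_inv[of f] unfolding split_epi_def by (intro conjI bexI[of _ "iv f"]) (auto simp: in_homs)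

lemma iso_epi: "iso_arr C f ==> epi C f"
 by (intro split_epi_epi iso_split_epi)

lemma iso_cancel_l:
 assumes "iso_arr C f" "f oo g = f oo h" "ar g" "ar h" "cd g = dm f" "cd h = dm f"
 shows "g = h"
proof -
 have "g = iv f oo f oo g" using assms(1,3,5) by simp
 also have "\<dots> = h" using assms(1,4,6) unfolding assms(2) by simp
 finally show ?thesis .
qed

lemma iso_cancel_r:
 assumes "iso_arr C f" "g oo f = h oo f" "ar g" "ar h" "dm g = cd f" "dm h = cd f"
 shows "g = h"
 by (rule epi_cancel[OF iso_epi]) (use assms in auto)

lemma iso_move_l: "iso_arr C f ==> ar g ==> cd g = dm f ==> f oo g = h ==> g = iv f oo h"
 by auto

lemma iso_move_r: "iso_arr C f ==> ar g ==> dm g = cd f ==> g oo f = h ==> g = h oo iv f"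
 using iso_inv[of f] by (auto simp: cassoc)

section \<open>Coequalizers and reflexive pairs\<close>

lemma is_coeqD:
 assumes "is_coeq C f g q" "ar f"
 shows "ar q" "dm q = cd f" "q oo f = q oo g"
 using assms by (auto simp: is_coeq_def in_homs)

lemma is_coeq_univ:
 "is_coeq C f g q ==> k \<in> homs C (cd f) y ==> k oo f = k oo g ==>
  \<exists>!h. h \<in> homs C (cd q) y & h oo q = k"
 unfolding is_coeq_def
 by (elim conjE, drule spec[of _ y], drule bspec, assumption, drule mp, assumption, assumption)

lemma coeq_ex:
 assumes "is_coeq C f g q" "ar k" "dm k = cd f" "k oo f = k oo g"
 obtains h where "ar h" "dm h = cd q" "cd h = cd k" "h oo q = k"
proof -
 have "k \<in> homs C (cd f) (cd k)" using assms by (simp add: in_homs)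
 from is_coeq_univ[OF assms(1) this assms(4)]
 obtain h where "h \<in> homs C (cd q) (cd k)" "h oo q = k" by blast
 then show ?thesis by (intro that[of h]) (auto simp: in_homs)
qed

lemma coeq_epi:
 assumes q: "is_coeq C f g q" and f: "ar f" and g: "ar g" "dm g = dm f" "cd g = cd f"
 shows "epi C q"
 unfolding epi_def
proof (intro conjI allI impI)
 note d = is_coeqD[OF q f]
 show "ar q" using d by simp
 fix u v assume *: "ar u" "ar v" "dm u = cd q" "dm v = cd q" "u oo q = v oo q"
 have "cd (u oo q) = cd u" "cd (v oo q) = cd v" using *(1-4) d by simp_all
 then have cd: "cd v = cd u" using *(5) by simp
 have "(u oo q) oo f = (u oo q) oo g" using *(1,3) d f g by (simp add: cassoc)
 moreover have "u oo q \<in> homs C (cd f) (cd u)" using *(1,3) d by (simp add: in_homs)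
 ultimately have "\<exists>!h. h \<in> homs C (cd q) (cd u) & h oo q = u oo q"
  by (intro is_coeq_univ[OF q])
 moreover have "u \<in> homs C (cd q) (cd u) & u oo q = u oo q" "v \<in> homs C (cd q) (cd u) & v oo q = u oo q"
  using *(1-4) *(5)[symmetric] cd by (simp_all add: in_homs)
 ultimately show "u = v" by (elim ex1E) metis
qed

text \<open>Factorizations through an epimorphism are unique, so the description in
  \<open>factor\<close> is evaluated by exhibiting any one of them.\<close>

lemma factor_eq:
 assumes "epi C q" "ar h" "dm h = cd q" "h oo q = k"
 shows "factor C q k = h"
proof -
 have q: "ar q" using assms(1) by (simp add: epi_def)
 have [simp]: "cd k = cd h" using assms q by auto
 show ?thesis
  unfolding factor_def in_homs
 proof (rule the_equality)
  show "(ar h & dm h = cd q & cd h = cd k) & h oo q = k" using assms by simp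
  show "h' = h" if "(ar h' & dm h' = cd q & cd h' = cd k) & h' oo q = k" for h'
   by (rule epi_cancel[OF assms(1)]) (use that assms in auto)
 qed
qed

text \<open>Invariance under isomorphism of parallel pairs. It carries a coequalizer across the
  symmetry, from \<open>idt x ** f\<close> to \<open>f ** idt x\<close>, and across a change of
  scalars in \<open>base_change_iso\<close>.\<close>

lemma coeq_iso:
 assumes q: "is_coeq C f g q" and i: "iso_arr C i" "cd i = dm f" and j: "iso_arr C j" "dm j = cd f"
  and fg: "ar f" "ar g" "dm g = dm f" "cd g = cd f"
  and f': "f' = j oo f oo i" and g': "g' = j oo g oo i" and q': "q' oo j = q" "ar q'" "dm q' = cd j"
 shows "is_coeq C f' g' q'"
proof -
 note d = is_coeqD[OF q fg(1)] and i' = iso_inv[OF i(1)] and j' = iso_inv[OF j(1)]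
 have ar': "ar f'" "ar g'" "cd f' = cd j" "dm f' = dm i" "cd g' = cd j" "dm g' = dm i"
  using f' g' i i' j j' fg by auto
 have cq: "cd q' = cd q" using q' j' j by auto
 show ?thesis
  unfolding is_coeq_def
 proof (intro conjI allI ballI impI)
  show "q' \<in> homs C (cd f') (cd q')" using q' ar' by (simp add: in_homs)
  have "q' oo f' = (q' oo j) oo f oo i" "q' oo g' = (q' oo j) oo g oo i"
   unfolding f' g' using q'(2,3) i i' j j' fg by (simp_all add: cassoc)
  moreover have "q oo f oo i = q oo g oo i"
   using d i i' fg by (simp add: rw2[OF d(3)] cassoc)
  ultimately show "q' oo f' = q' oo g'" unfolding q'(1) by simp
  fix y k assume k: "k \<in> homs C (cd f') y" and kk: "k oo f' = k oo g'"
  have k': "ar k" "dm k = cd j" "cd k = y" using k ar' by (auto simp: in_homs)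
  have "((k oo j) oo f) oo i = ((k oo j) oo g) oo i"
   using kk k' i(2) i' j(2) j' fg unfolding f' g' by (simp add: cassoc)
  then have k1: "(k oo j) oo f = (k oo j) oo g"
   by (rule iso_cancel_r[OF i(1)]) (use k' i(2) i' j(2) j' fg in auto)
  obtain h where h: "ar h" "dm h = cd q" "cd h = y" "h oo q = k oo j"
   by (rule coeq_ex[OF q _ _ k1]) (use k' j(2) j' in auto)
  have hk: "h oo q' = k"
   by (rule iso_cancel_r[OF j(1)]) (use h q' k' j' cq in \<open>auto simp: cassoc\<close>)
  show "\<exists>!h. h \<in> homs C (cd q') y & h oo q' = k"
  proof (rule ex1I[of _ h])
   show "h \<in> homs C (cd q') y & h oo q' = k" using h hk cq by (simp add: in_homs)
   fix h' assume h': "h' \<in> homs C (cd q') y & h' oo q' = k"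
   then have h'': "ar h'" "dm h' = cd q" "h' oo q' = k" using cq by (auto simp: in_homs)
   have "(h' oo q') oo j = h' oo q' oo j" using h''(1,2) q'(2,3) j' cq by (simp add: cassoc)
   then have "h' oo q = h oo q" unfolding q'(1) h''(3) h(4) by simp
   then show "h' = h" by (rule epi_cancel[OF coeq_epi[OF q fg]]) (use h h'' in auto)
  qed
 qed
qed

lemma reflexiveD:
 assumes "reflexive C f g"
 shows "ar f" "ar g" "dm g = dm f" "cd g = cd f"
 using assms by (auto simp: reflexive_def in_homs)

lemma rcoeqD:
 assumes "rcoeq C f g q"
 shows "is_coeq C f g q" "ar f" "ar g" "dm g = dm f" "cd g = cd f" "ar q" "dm q = cd f" "q oo f = q oo g" "epi C q"
proof -
 have c: "is_coeq C f g q" and r: "reflexive C f g" using assms by (simp_all add: rcoeq_def)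
 show "is_coeq C f g q" "ar f" "ar g" "dm g = dm f" "cd g = cd f" by (fact c reflexiveD[OF r])+
 show "ar q" "dm q = cd f" "q oo f = q oo g" by (fact is_coeqD[OF c reflexiveD(1)[OF r]])+
 show "epi C q" by (rule coeq_epi[OF c reflexiveD[OF r]])
qed

end

text \<open>A reflexive coequalizer is a colimit over the monoid \<open>{1, a, b}\<close> with \<open>xy = y\<close> for \<open>x, y \<noteq> 1\<close>: for
 a common section \<open>s\<close> of \<open>f, g\<close> let \<open>a\<close>, \<open>b\<close> act as \<open>s f\<close>, \<open>s g\<close>. This one-object category is sifted.\<close>

definition refl_cat :: "'j => 'j => 'j => ('j, 'j) cat" where
 "refl_cat i a b = \<lparr>cobj = {i}, carr = {i, a, b}, cdom = (%_. i), ccod = (%_. i), cid = (%_. i),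
   ccomp = (%g f. if f = i then g else f)\<rparr>"

lemma refl_cat_simps [simp]:
 "cobj (refl_cat i a b) = {i}" "carr (refl_cat i a b) = {i, a, b}" "cdom (refl_cat i a b) u = i"
 "ccod (refl_cat i a b) u = i" "cid (refl_cat i a b) x = i"
 "v \<bullet>\<^bsub>refl_cat i a b\<^esub> u = (if u = i then v else u)"
 by (simp_all add: refl_cat_def)

lemma refl_cat_homs [simp]: "homs (refl_cat i a b) x y = (if x = i & y = i then {i, a, b} else {})"
 by (auto simp: homs_def)

lemma category_refl_cat: "category (refl_cat i a b)"
 by unfold_locales (auto split: if_splits)

text \<open>A letter absorbs whatever is composed after it, so \<open>w\<close> moves only the unit
  entries of a cospan: (1, b) goes to (a, b) under \<open>a\<close> and to (b, b) under
  \<open>b\<close>, and (1, 1) goes to (b, b). In this way every cospan is joined to (1, 1).\<close>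

lemma sifted_refl_cat: "sifted (refl_cat i a b)"
proof -
 define cospans where "cospans = {i} \<times> {i, a, b} \<times> {i, a, b}"
 define step where "step = {((c :: 'a, u, v), (c' :: 'a, u', v')).
       (c, u, v) \<in> cospans & (c', u', v') \<in> cospans &
       (\<exists>w \<in> {i, a, b}. (if u = i then w else u) = u' & (if v = i then w else v) = v')}"
 define r where "r = (step \<union> step\<inverse>)\<^sup>*"
 have trans: "(x, y) \<in> r ==> (y, z) \<in> r ==> (x, z) \<in> r" for x y z
  unfolding r_def by (rule rtrancl_trans)
 have sym: "(x, y) \<in> r ==> (y, x) \<in> r" for x y
  unfolding r_def by (rule symD[OF sym_rtrancl]) (auto simp: sym_def)
 have w: "((i, u, v), (i, if u = i then w else u, if v = i then w else v)) \<in> r"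
  if "u \<in> {i, a, b}" "v \<in> {i, a, b}" "w \<in> {i, a, b}" for u v w
  unfolding r_def using that by (intro r_into_rtrancl) (auto simp: step_def cospans_def)
 have refl: "(x, x) \<in> r" for x unfolding r_def by simp
 have aa: "((i, a, a), (i, i, i)) \<in> r" and bb: "((i, b, b), (i, i, i)) \<in> r"
  using w[of i i a, THEN sym] w[of i i b, THEN sym] by auto
 have a1: "((i, a, i), (i, i, i)) \<in> r" by (rule trans[OF _ aa]) (use w[of a i a] in simp)
 have "1a": "((i, i, a), (i, i, i)) \<in> r" by (rule trans[OF _ aa]) (use w[of i a a] in simp)
 have b1: "((i, b, i), (i, i, i)) \<in> r" by (rule trans[OF _ bb]) (use w[of b i b] in simp)
 have "1b": "((i, i, b), (i, i, i)) \<in> r" by (rule trans[OF _ bb]) (use w[of i b b] in simp)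
 \<comment> \<open>The letters are not assumed distinct. If \<open>b\<close> is the unit, the pair
   is (a, 1) and has already been treated.\<close>
 have ab: "((i, a, b), (i, i, i)) \<in> r"
 proof (cases "b = i")
  case False then show ?thesis using w[of i b a] by (intro trans[OF sym "1b"]) simp
 qed (use a1 in simp)
 have ba: "((i, b, a), (i, i, i)) \<in> r"
 proof (cases "a = i")
  case False then show ?thesis using w[of i a b] by (intro trans[OF sym "1a"]) simp
 qed (use b1 in simp)
 have base: "(s, (i, i, i)) \<in> r" if "s \<in> cospans" for s
  using that aa bb a1 "1a" b1 "1b" ab ba refl unfolding cospans_def by blast
 have all: "(s, t) \<in> r" if "s \<in> cospans" "t \<in> cospans" for s t
  using base[OF that(1)] sym[OF base[OF that(2)]] by (rule trans)
 have c: "{(c, u, v). u \<in> homs (refl_cat i a b) i c & v \<in> homs (refl_cat i a b) i c} = cospans" (is "?L = _")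
 proof (rule Set.set_eqI)
  fix x :: "'a \<times> 'a \<times> 'a"
  show "x \<in> ?L \<longleftrightarrow> x \<in> cospans" by (cases x) (simp add: cospans_def, blast)
 qed
 have h: "homs (refl_cat i a b) c c' = {i, a, b}" if "(c, u, v) \<in> cospans" "(c', u', v') \<in> cospans" for c u v c' u' v'
  using that by (simp add: cospans_def) blast
 have st: "step = {((c, u, v), (c', u', v')).
       (c, u, v) \<in> cospans & (c', u', v') \<in> cospans &
       (\<exists>w \<in> homs (refl_cat i a b) c c'. w \<bullet>\<^bsub>refl_cat i a b\<^esub> u = u' & w \<bullet>\<^bsub>refl_cat i a b\<^esub> v = v')}"
  (is "_ = ?S")
 proof (rule Set.set_eqI)
  fix x :: "('a \<times> 'a \<times> 'a) \<times> 'a \<times> 'a \<times> 'a"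
  obtain c u v c' u' v' where x: "x = ((c, u, v), (c', u', v'))" by (cases x) auto
  show "x \<in> step \<longleftrightarrow> x \<in> ?S"
   unfolding x step_def mem_Collect_eq case_prod_conv refl_cat_simps
   by (intro conj_cong refl) (simp_all only: h[of c u v c' u' v'])
 qed
 show ?thesis
  unfolding sifted_def Let_def
 proof (intro conjI ballI)
  show "category (refl_cat i a b)" by (rule category_refl_cat)
  show "cobj (refl_cat i a b) \<noteq> {}" by simp
  fix x y assume "x \<in> cobj (refl_cat i a b)" "y \<in> cobj (refl_cat i a b)"
  then have xy: "x = i" "y = i" by auto
  show "{(c, u, v). u \<in> homs (refl_cat i a b) x c & v \<in> homs (refl_cat i a b) y c} \<noteq> {}"
   unfolding xy c by (simp add: cospans_def)
  fix s t
  assume "s \<in> {(c, u, v). u \<in> homs (refl_cat i a b) x c & v \<in> homs (refl_cat i a b) y c}"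
   "t \<in> {(c, u, v). u \<in> homs (refl_cat i a b) x c & v \<in> homs (refl_cat i a b) y c}"
  then have "(s, t) \<in> r" unfolding xy c by (rule all)
  then show "(s, t) \<in> ({((c, u, v), (c', u', v')).
    (c, u, v) \<in> {(c, u, v). u \<in> homs (refl_cat i a b) x c & v \<in> homs (refl_cat i a b) y c} &
    (c', u', v') \<in> {(c, u, v). u \<in> homs (refl_cat i a b) x c & v \<in> homs (refl_cat i a b) y c} &
    (\<exists>w\<in>homs (refl_cat i a b) c c'. w \<bullet>\<^bsub>refl_cat i a b\<^esub> u = u' & w \<bullet>\<^bsub>refl_cat i a b\<^esub> v = v')} \<union>
    {((c, u, v), (c', u', v')).
    (c, u, v) \<in> {(c, u, v). u \<in> homs (refl_cat i a b) x c & v \<in> homs (refl_cat i a b) y c} &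
    (c', u', v') \<in> {(c, u, v). u \<in> homs (refl_cat i a b) x c & v \<in> homs (refl_cat i a b) y c} &
    (\<exists>w\<in>homs (refl_cat i a b) c c'. w \<bullet>\<^bsub>refl_cat i a b\<^esub> u = u' & w \<bullet>\<^bsub>refl_cat i a b\<^esub> v = v')}\<inverse>)\<^sup>*"
   unfolding r_def st xy c .
 qed
qed

context category
begin

definition refl_diag :: "'j => 'j => 'a => 'a => 'a => 'j => 'a" where
 "refl_diag i a s f g = (%u. if u = i then idt (dm f) else if u = a then s oo f else s oo g)"

context
 fixes f g s :: 'a and i a b :: 'j
 assumes fg: "ar f" "ar g" "dm g = dm f" "cd g = cd f"
  and s: "ar s" "dm s = cd f" "cd s = dm f" "f oo s = idt (cd f)" "g oo s = idt (cd f)"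
  and d: "i \<noteq> a" "i \<noteq> b" "a \<noteq> b"
begin

lemma sec_simps:
 "ar z ==> cd z = cd f ==> f oo s oo z = z" "ar z ==> cd z = cd f ==> g oo s oo z = z"
 using fg s rw2[OF s(4)] rw2[OF s(5)] by simp_all

lemma refl_diag_func: "func (refl_cat i a b) C (%_. dm f) (refl_diag i a s f g)"
 by (unfold_locales; (rule category.dom_closed[OF category_refl_cat] category.cod_closed[OF category_refl_cat]
   category.id_hom[OF category_refl_cat] category.comp_hom[OF category_refl_cat]
   category.id_left[OF category_refl_cat] category.id_right[OF category_refl_cat]
   category.comp_assoc[OF category_refl_cat])?)
  (use fg s d in \<open>auto simp: refl_diag_def in_homs cassoc sec_simps split: if_splits\<close>)

lemma cocone_iff:
 "(y \<in> cobj C & (\<forall>j \<in> cobj (refl_cat i a b). k j \<in> homs C (dm f) y) &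
   (\<forall>u \<in> carr (refl_cat i a b). k (ccod (refl_cat i a b) u) oo refl_diag i a s f g u = k (cdom (refl_cat i a b) u)))
  \<longleftrightarrow> k i \<in> homs C (dm f) y & k i oo s oo f = k i & k i oo s oo g = k i"
 using d by (auto simp: refl_diag_def in_homs)

text \<open>A cocone is a single arrow \<open>k\<close> with \<open>k s f = k = k s g\<close>. Such
  arrows correspond to those that coequalize \<open>f\<close> and \<open>g\<close>: precompose with
  the section \<open>s\<close> in one direction and with \<open>f\<close> in the other.\<close>

lemma colimit_coeq:
 assumes "is_colimit (refl_cat i a b) C (%_. dm f) (refl_diag i a s f g) x p"
 shows "is_coeq C f g (p i oo s)"
proof -
 have p: "p i \<in> homs C (dm f) x" "p i oo s oo f = p i" "p i oo s oo g = p i"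
  and univ: "\<And>y q. q i \<in> homs C (dm f) y & q i oo s oo f = q i & q i oo s oo g = q i ==>
   \<exists>!h. h \<in> homs C x y & h oo p i = q i"
  using assms unfolding is_colimit_def Let_def cocone_iff by simp_all
 have p': "ar (p i)" "dm (p i) = dm f" "cd (p i) = x" using p(1) by (auto simp: in_homs)
 show ?thesis
  unfolding is_coeq_def
 proof (intro conjI allI ballI impI)
  show "p i oo s \<in> homs C (cd f) (cd (p i oo s))" using p' s by (simp add: in_homs)
  show "(p i oo s) oo f = (p i oo s) oo g" using p' s fg p(2,3) by (simp add: cassoc)
  fix y k assume k: "k \<in> homs C (cd f) y" and kk: "k oo f = k oo g"
  have k': "ar k" "dm k = cd f" "cd k = y" using k by (auto simp: in_homs)
  have "(k oo f) oo s oo f = k oo f" "(k oo g) oo s oo g = k oo g"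
   using k' fg s by (simp_all add: cassoc sec_simps)
  then obtain h where h: "h \<in> homs C x y" "h oo p i = k oo f"
    and hu: "\<And>h'. h' \<in> homs C x y ==> h' oo p i = k oo f ==> h' = h"
   using univ[of "%_. k oo f" y] k' fg kk by (auto simp: in_homs)
  show "\<exists>!h. h \<in> homs C (cd (p i oo s)) y & h oo p i oo s = k"
  proof (rule ex1I[of _ h])
   have "(h oo p i) oo s = k" unfolding h(2) using k' fg s by (simp add: cassoc)
   moreover have "(h oo p i) oo s = h oo p i oo s" using h(1) p' s by (simp add: in_homs cassoc)
   ultimately show "h \<in> homs C (cd (p i oo s)) y & h oo p i oo s = k"
    using h(1) p' s by (simp add: in_homs)
   fix h' assume h': "h' \<in> homs C (cd (p i oo s)) y & h' oo p i oo s = k"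
   then have h'': "ar h'" "dm h' = x" "cd h' = y" and e: "h' oo p i oo s = k" using p' s by (auto simp: in_homs)
   have "(h' oo p i oo s) oo f = h' oo p i oo s oo f" using h'' p' s fg by (simp add: cassoc)
   then have "h' oo p i = k oo f" unfolding e p(2) by simp
   then show "h' = h" using h'' by (intro hu) (simp_all add: in_homs)
  qed
 qed
qed

text \<open>The correspondence of \<open>colimit_coeq\<close> read backwards; the leg is
  \<open>q oo f\<close>, which equals \<open>q oo g\<close>.\<close>

lemma coeq_colimit:
 assumes q: "is_coeq C f g q"
 shows "is_colimit (refl_cat i a b) C (%_. dm f) (refl_diag i a s f g) (cd q) (%_. q oo f)"
 unfolding is_colimit_def Let_def cocone_iff
proof (intro conjI allI impI)
 note q' = is_coeqD[OF q fg(1)]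
 show "q oo f \<in> homs C (dm f) (cd q)" using q' fg by (simp add: in_homs)
 show "(q oo f) oo s oo f = q oo f" using q' fg s by (simp add: cassoc sec_simps)
 have "(q oo g) oo s oo g = q oo g" using q'(1,2) fg s by (simp add: cassoc sec_simps)
 then show "(q oo f) oo s oo g = q oo f" unfolding q'(3) .
 fix y k assume k: "k i \<in> homs C (dm f) y & k i oo s oo f = k i & k i oo s oo g = k i"
 then have k': "ar (k i)" "dm (k i) = dm f" "cd (k i) = y" by (auto simp: in_homs)
 have e: "(k i oo s) oo f = k i" "(k i oo s) oo g = k i" using k k' s fg by (simp_all add: cassoc)
 have "\<exists>!h. h \<in> homs C (cd q) y & h oo q = k i oo s"
  by (rule is_coeq_univ[OF q]) (use k' s e in \<open>auto simp: in_homs\<close>)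
 then obtain h where h: "h \<in> homs C (cd q) y" "h oo q = k i oo s"
  and hu: "\<And>h'. h' \<in> homs C (cd q) y ==> h' oo q = k i oo s ==> h' = h" by blast
 have h': "ar h" "dm h = cd q" "cd h = y" using h by (auto simp: in_homs)
 show "\<exists>!h. h \<in> homs C (cd q) y & (\<forall>j\<in>cobj (refl_cat i a b). h oo q oo f = k j)"
 proof (rule ex1I[of _ h])
  have "(h oo q) oo f = k i" unfolding h(2) by (rule e)
  then show "h \<in> homs C (cd q) y & (\<forall>j\<in>cobj (refl_cat i a b). h oo q oo f = k j)"
   using h' q' fg by (simp add: in_homs cassoc)
  fix l assume "l \<in> homs C (cd q) y & (\<forall>j\<in>cobj (refl_cat i a b). l oo q oo f = k j)"
  then have l: "ar l" "dm l = cd q" "cd l = y" "l oo q oo f = k i" by (auto simp: in_homs)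
  have "(l oo q oo f) oo s = l oo q" using l(1-3) q' fg s by (simp add: cassoc)
  then have "l oo q = k i oo s" unfolding l(4) by simp
  then show "l = h" using l by (intro hu) (simp_all add: in_homs)
 qed
qed

end

lemma reflexive_obtain:
 assumes "reflexive C f g"
 obtains s where "ar s" "dm s = cd f" "cd s = dm f" "f oo s = idt (cd f)" "g oo s = idt (cd f)"
 using assms unfolding reflexive_def in_homs by (auto simp: in_homs)

end

text \<open>The three elements name the arrows 1, a, b of the indexing category, which makes it
  small in the sense of \<open>cocomplete\<close> and \<open>preserves_sifted\<close>.\<close>

lemma infinite_three:
 assumes "infinite (UNIV :: 'j set)"
 obtains i a b :: 'j where "i \<noteq> a" "i \<noteq> b" "a \<noteq> b"
proof -
 obtain i :: 'j where True by simp
 obtain a :: 'j where a: "a \<notin> {i}" using ex_new_if_finite[OF assms, of "{i}"] by auto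
 obtain b :: 'j where b: "b \<notin> {i, a}" using ex_new_if_finite[OF assms, of "{i, a}"] by auto
 show ?thesis using a b by (intro that[of i a b]) auto
qed

lemma reflexive_coeq_exists:
 assumes inf: "infinite (UNIV :: 'j set)" and C: "category C" and cc: "cocomplete TYPE('j) C"
  and fg: "reflexive C f g"
 shows "\<exists>q. is_coeq C f g q"
proof -
 interpret category C by (rule C)
 obtain i a b :: 'j where d: "i \<noteq> a" "i \<noteq> b" "a \<noteq> b" by (rule infinite_three[OF inf])
 obtain s where s: "ar s" "dm s = cd f" "cd s = dm f" "f oo s = idt (cd f)" "g oo s = idt (cd f)"
  by (rule reflexive_obtain[OF fg])
 note r = reflexiveD[OF fg]
 obtain x p where "is_colimit (refl_cat i a b) C (%_. dm f) (refl_diag i a s f g) x p"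
  using cc refl_diag_func[OF r s d] unfolding cocomplete_def by blast
 from colimit_coeq[OF r s d this] show ?thesis by blast
qed

section \<open>Functors and reflexive coequalizers\<close>

lemma (in func) map_ar [simp]:
 "src.ar f ==> tgt.ar (Fa f)" "src.ar f ==> tgt.dm (Fa f) = Fo (src.dm f)" "src.ar f ==> tgt.cd (Fa f) = Fo (src.cd f)"
 using map_hom[of f "src.dm f" "src.cd f"] by (auto simp: in_homs)

lemma (in func) map_cmp:
 "src.ar g ==> src.ar f ==> src.cd f = src.dm g ==> Fa (g \<bullet>\<^bsub>C\<^esub> f) = Fa g \<bullet>\<^bsub>D\<^esub> Fa f"
 using map_comp[of f "src.dm f" "src.cd f" g "src.cd g"] by (auto simp: in_homs)

lemma (in func) map_reflexive:
 assumes fg: "reflexive C f g" shows "reflexive D (Fa f) (Fa g)"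
proof -
 obtain s where s: "src.ar s" "src.dm s = src.cd f" "src.cd s = src.dm f"
  "f \<bullet>\<^bsub>C\<^esub> s = src.idt (src.cd f)" "g \<bullet>\<^bsub>C\<^esub> s = src.idt (src.cd f)"
  by (rule src.reflexive_obtain[OF fg])
 note r = src.reflexiveD[OF fg]
 show ?thesis
  unfolding reflexive_def
  using r s map_cmp[of f s] map_cmp[of g s] map_id[of "src.cd f"] by (intro conjI bexI[of _ "Fa s"]) (auto simp: in_homs)
qed

text \<open>The image of the diagram built from \<open>f, g, s\<close> is the diagram built from
  their images, so the preserved colimit can be read back as a coequalizer.\<close>

lemma (in func) map_rcoeq:
 assumes inf: "infinite (UNIV :: 'j set)" and ps: "preserves_sifted TYPE('j) C D Fo Fa"
  and q: "rcoeq C f g q"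
 shows "rcoeq D (Fa f) (Fa g) (Fa q)"
proof -
 obtain i a b :: 'j where d: "i \<noteq> a" "i \<noteq> b" "a \<noteq> b" by (rule infinite_three[OF inf])
 have fg: "reflexive C f g" and q': "is_coeq C f g q" using q by (auto simp: rcoeq_def)
 obtain s where s: "src.ar s" "src.dm s = src.cd f" "src.cd s = src.dm f"
  "f \<bullet>\<^bsub>C\<^esub> s = src.idt (src.cd f)" "g \<bullet>\<^bsub>C\<^esub> s = src.idt (src.cd f)"
  by (rule src.reflexive_obtain[OF fg])
 note r = src.reflexiveD[OF fg]
 have Fr: "tgt.ar (Fa f)" "tgt.ar (Fa g)" "tgt.dm (Fa g) = tgt.dm (Fa f)" "tgt.cd (Fa g) = tgt.cd (Fa f)"
  using r by auto
 have Fs: "tgt.ar (Fa s)" "tgt.dm (Fa s) = tgt.cd (Fa f)" "tgt.cd (Fa s) = tgt.dm (Fa f)"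
  "Fa f \<bullet>\<^bsub>D\<^esub> Fa s = tgt.idt (tgt.cd (Fa f))" "Fa g \<bullet>\<^bsub>D\<^esub> Fa s = tgt.idt (tgt.cd (Fa f))"
  using r s map_cmp[of f s] map_cmp[of g s] map_id[of "src.cd f"] by auto
 have eq: "(%u. Fa (src.refl_diag i a s f g u)) = tgt.refl_diag i a (Fa s) (Fa f) (Fa g)"
  unfolding src.refl_diag_def tgt.refl_diag_def using r s by (auto simp: map_cmp map_id)
 have qa: "src.ar q" "src.dm q = src.cd f" using src.is_coeqD[OF q' r(1)] by auto
 have "is_colimit (refl_cat i a b) C (%_. src.dm f) (src.refl_diag i a s f g) (src.cd q) (%_. q \<bullet>\<^bsub>C\<^esub> f)"
  by (rule src.coeq_colimit[OF r s d q'])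
 then have "is_colimit (refl_cat i a b) D (%_. Fo (src.dm f)) (%u. Fa (src.refl_diag i a s f g u))
   (Fo (src.cd q)) (%_. Fa (q \<bullet>\<^bsub>C\<^esub> f))"
  using ps sifted_refl_cat[of i a b] src.refl_diag_func[OF r s d] unfolding preserves_sifted_def by blast
 then have c: "is_colimit (refl_cat i a b) D (%_. tgt.dm (Fa f)) (tgt.refl_diag i a (Fa s) (Fa f) (Fa g))
   (Fo (src.cd q)) (%_. Fa (q \<bullet>\<^bsub>C\<^esub> f))"
  unfolding eq using r by simp
 have "Fa (q \<bullet>\<^bsub>C\<^esub> f) \<bullet>\<^bsub>D\<^esub> Fa s = Fa q"
  using qa r s map_cmp[of "q \<bullet>\<^bsub>C\<^esub> f" s] by (simp add: src.cassoc)
 with tgt.colimit_coeq[OF Fr Fs d c] map_reflexive[OF fg] show ?thesis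
  by (simp add: rcoeq_def)
qed

section \<open>Coherence in symmetric monoidal categories\<close>

context sym_mon_cat
begin

abbreviation tna (infixr "**" 75) where "f ** g \<equiv> f \<star>\<^bsub>C\<^esub> g"
abbreviation tno (infixr "\<box>" 75) where "x \<box> y \<equiv> x \<odot>\<^bsub>C\<^esub> y"
abbreviation un where "un \<equiv> unit_obj C"
abbreviation as where "as \<equiv> assoc C"
abbreviation lu where "lu \<equiv> lun C"
abbreviation ru where "ru \<equiv> run C"
abbreviation br where "br \<equiv> braid C"

lemmas obs [simp] = tens_obj unit_in

lemma tens_ar [simp]:
 assumes "ar f" "ar g"
 shows "ar (f ** g)" "dm (f ** g) = dm f \<box> dm g" "cd (f ** g) = cd f \<box> cd g"
 using tensa_hom[of f "dm f" "cd f" g "dm g" "cd g"] assms by (auto simp: in_homs)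

lemma tens_id [simp]: "ob x ==> ob y ==> idt x ** idt y = idt (x \<box> y)"
 by (rule tensa_id)

lemma interchange:
 "ar f ==> ar g ==> cd f = dm g ==> ar f' ==> ar g' ==> cd f' = dm g' ==>
  (g ** g') oo (f ** f') = (g oo f) ** (g' oo f')"
 using tensa_comp[of f "dm f" "cd f" g "cd g" f' "dm f'" "cd f'" g' "cd g'"] by (auto simp: in_homs)

lemma interchange3:
 "ar f ==> ar g ==> cd f = dm g ==> ar f' ==> ar g' ==> cd f' = dm g' ==> ar z ==>
  cd z = dm f \<box> dm f' ==> (g ** g') oo (f ** f') oo z = ((g oo f) ** (g' oo f')) oo z"
 by (rule rw2[OF interchange]) auto

text \<open>Normal form of composites: brackets to the right, and adjacent tensor products of arrows
  merged into one.\<close>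

lemmas nf = cassoc interchange interchange3

lemma as_iso [simp]: "ob x ==> ob y ==> ob z ==> iso_arr C (as x y z)"
 and lu_iso [simp]: "ob x ==> iso_arr C (lu x)"
 and ru_iso [simp]: "ob x ==> iso_arr C (ru x)"
 and br_iso [simp]: "ob x ==> ob y ==> iso_arr C (br x y)"
 using assoc_iso[of x y z] lun_iso[of x] run_iso[of x] braid_iso[of x y] by (auto simp: isos_iff)

lemma str_ar [simp]:
 "ob x ==> ob y ==> ob z ==> ar (as x y z)" "ob x ==> ob y ==> ob z ==> dm (as x y z) = (x \<box> y) \<box> z"
 "ob x ==> ob y ==> ob z ==> cd (as x y z) = x \<box> y \<box> z"
 "ob x ==> ar (lu x)" "ob x ==> dm (lu x) = un \<box> x" "ob x ==> cd (lu x) = x"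
 "ob x ==> ar (ru x)" "ob x ==> dm (ru x) = x \<box> un" "ob x ==> cd (ru x) = x"
 "ob x ==> ob y ==> ar (br x y)" "ob x ==> ob y ==> dm (br x y) = x \<box> y" "ob x ==> ob y ==> cd (br x y) = y \<box> x"
 using assoc_iso[of x y z] lun_iso[of x] run_iso[of x] braid_iso[of x y]
 by (auto simp: isos_def in_homs)

lemma tens_iso [simp]:
 assumes "iso_arr C f" "iso_arr C g" shows "iso_arr C (f ** g)"
 using assms iso_inv[of f] iso_inv[of g]
 by (intro iso_arrI[of _ "iv f ** iv g"]) (auto simp: interchange)

lemma as_n:
 "ar f ==> ar g ==> ar h ==> cd f = x ==> cd g = y ==> cd h = z ==>
  as x y z oo ((f ** g) ** h) = (f ** g ** h) oo as (dm f) (dm g) (dm h)"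
 using assoc_nat[of f "dm f" "cd f" g "dm g" "cd g" h "dm h" "cd h"] by (auto simp: in_homs)

lemma lu_n: "ar f ==> cd f = x ==> lu x oo (idt un ** f) = f oo lu (dm f)"
 using lun_nat[of f "dm f" "cd f"] by (auto simp: in_homs)

lemma ru_n: "ar f ==> cd f = x ==> ru x oo (f ** idt un) = f oo ru (dm f)"
 using run_nat[of f "dm f" "cd f"] by (auto simp: in_homs)

lemma br_n: "ar f ==> ar g ==> cd f = x ==> cd g = y ==> br x y oo (f ** g) = (g ** f) oo br (dm f) (dm g)"
 using braid_nat[of f "dm f" "cd f" g "dm g" "cd g"] by (auto simp: in_homs)

lemma as_n3:
 "ar f ==> ar g ==> ar h ==> cd f = x ==> cd g = y ==> cd h = z ==> ar k ==> cd k = (dm f \<box> dm g) \<box> dm h ==>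
  as x y z oo ((f ** g) ** h) oo k = (f ** g ** h) oo as (dm f) (dm g) (dm h) oo k"
 by (subst rw2[OF as_n]) (auto simp: cassoc)

lemma lu_n3: "ar f ==> cd f = x ==> ar k ==> cd k = un \<box> dm f ==> lu x oo (idt un ** f) oo k = f oo lu (dm f) oo k"
 by (subst rw2[OF lu_n]) (auto simp: cassoc)

lemma ru_n3: "ar f ==> cd f = x ==> ar k ==> cd k = dm f \<box> un ==> ru x oo (f ** idt un) oo k = f oo ru (dm f) oo k"
 by (subst rw2[OF ru_n]) (auto simp: cassoc)

lemma br_n3:
 "ar f ==> ar g ==> cd f = x ==> cd g = y ==> ar k ==> cd k = dm f \<box> dm g ==>
  br x y oo (f ** g) oo k = (g ** f) oo br (dm f) (dm g) oo k"
 by (subst rw2[OF br_n]) (auto simp: cassoc)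

lemma br_br [simp]: "ob x ==> ob y ==> br y x oo br x y = idt (x \<box> y)"
 by (rule symmetry)

lemma br_br3 [simp]: "ob x ==> ob y ==> ar k ==> cd k = x \<box> y ==> br y x oo br x y oo k = k"
 by (subst rw2[OF br_br]) auto

lemma iv_as_n:
 assumes "ar f" "ar g" "ar h" "cd f = x" "cd g = y" "cd h = z"
 shows "iv (as x y z) oo (f ** g ** h) = ((f ** g) ** h) oo iv (as (dm f) (dm g) (dm h))"
 unfolding assms(4-6)[symmetric]
 by (rule iso_cancel_l[of "as (cd f) (cd g) (cd h)"], use assms(1-3) in simp,
   rule iso_cancel_r[of "as (dm f) (dm g) (dm h)"]) (use assms(1-3) in \<open>auto simp: cassoc as_n\<close>)

lemma iv_as_n3:
 "ar f ==> ar g ==> ar h ==> cd f = x ==> cd g = y ==> cd h = z ==> ar k ==> cd k = dm f \<box> dm g \<box> dm h ==>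
  iv (as x y z) oo (f ** g ** h) oo k = ((f ** g) ** h) oo iv (as (dm f) (dm g) (dm h)) oo k"
 by (subst rw2[OF iv_as_n]) (auto simp: cassoc)

lemma pentagon3:
 "ob w ==> ob x ==> ob y ==> ob z ==> ar k ==> cd k = ((w \<box> x) \<box> y) \<box> z ==>
  as w x (y \<box> z) oo as (w \<box> x) y z oo k =
  (idt w ** as x y z) oo as w (x \<box> y) z oo (as w x y ** idt z) oo k"
 by (subst rw2[OF pentagon]) (auto simp: cassoc)

lemma triangle3:
 "ob x ==> ob y ==> ar k ==> cd k = (x \<box> un) \<box> y ==>
  (idt x ** lu y) oo as x un y oo k = (ru x ** idt y) oo k"
 by (subst rw2[OF triangle]) (auto simp: cassoc)

text \<open>The unitor is a natural isomorphism from \<open>un \<box> -\<close> to the identity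
  functor, so a unit factor can be cancelled. The coherence laws below are proved after tensoring
  with the unit.\<close>

lemma unit_faithful_l:
 assumes "idt un ** f = idt un ** g" "ar f" "ar g" "dm f = dm g" "cd f = cd g"
 shows "f = g"
 by (rule iso_cancel_r[of "lu (dm f)"]) (use assms lu_n[of f] lu_n[of g] in auto)

lemma unit_faithful_r:
 assumes "f ** idt un = g ** idt un" "ar f" "ar g" "dm f = dm g" "cd f = cd g"
 shows "f = g"
 by (rule iso_cancel_r[of "ru (dm f)"]) (use assms ru_n[of f] ru_n[of g] in auto)

text \<open>Kelly's derivation of the second triangle: after tensoring with the unit it follows from
  the pentagon and two uses of the given triangle.\<close>

lemma lu_tens:
 assumes [simp]: "ob x" "ob y"
 shows "lu (x \<box> y) oo as un x y = lu x ** idt y"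
proof (rule unit_faithful_l)
 show "idt un ** (lu (x \<box> y) oo as un x y) = idt un ** lu x ** idt y"
 proof (rule iso_cancel_r)
  show "iso_arr C (as un (un \<box> x) y oo (as un un x ** idt y))" by simp
  have "(idt un ** (lu (x \<box> y) oo as un x y)) oo as un (un \<box> x) y oo (as un un x ** idt y)
   = (idt un ** lu (x \<box> y)) oo (idt un ** as un x y) oo as un (un \<box> x) y oo (as un un x ** idt y)"
   by (simp add: nf)
  also have "\<dots> = (idt un ** lu (x \<box> y)) oo as un un (x \<box> y) oo as (un \<box> un) x y"
   by (simp add: pentagon)
  also have "\<dots> = as un x y oo ((ru un ** idt x) ** idt y)"
   by (simp add: triangle3 as_n)
  also have "\<dots> = as un x y oo (((idt un ** lu x) oo as un un x) ** idt y)"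
   by (simp add: triangle)
  also have "\<dots> = as un x y oo ((idt un ** lu x) ** idt y) oo (as un un x ** idt y)"
   by (simp add: nf)
  also have "\<dots> = (idt un ** lu x ** idt y) oo as un (un \<box> x) y oo (as un un x ** idt y)"
   by (simp add: as_n3)
  finally show "(idt un ** (lu (x \<box> y) oo as un x y)) oo as un (un \<box> x) y oo (as un un x ** idt y)
   = (idt un ** lu x ** idt y) oo as un (un \<box> x) y oo (as un un x ** idt y)" .
 qed simp_all
qed simp_all

text \<open>Naturality of \<open>lu\<close> at itself gives
  \<open>lu (un \<box> un) = idt un ** lu un\<close>; then \<open>lu_tens\<close> and the triangle
  describe the same arrow in two ways.\<close>

lemma lu_un: "lu un = ru un"
proof (rule unit_faithful_r)
 have "lu un oo lu (un \<box> un) = lu un oo (idt un ** lu un)" by (simp add: lu_n)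
 then have "lu (un \<box> un) = idt un ** lu un" by (rule iso_cancel_l[rotated]) simp_all
 then have "(idt un ** lu un) oo as un un un = lu un ** idt un" using lu_tens[of un un] by simp
 then show "lu un ** idt un = ru un ** idt un" using triangle[of un un] by simp
qed simp_all

text \<open>For \<open>b = lu x oo br x un\<close> the hexagon with two unit factors reduces to
  \<open>b oo (b ** idt un) = b oo (ru x ** idt un)\<close>, where first \<open>b\<close> and then
  the unit can be cancelled.\<close>

lemma lu_br:
 assumes [simp]: "ob x"
 shows "lu x oo br x un = ru x"
proof -
 define b where "b = lu x oo br x un"
 have [simp]: "ar b" "dm b = x \<box> un" "cd b = x" "iso_arr C b" unfolding b_def by simp_all
 have "b oo (ru x ** idt un) = lu x oo br x un oo (idt x ** lu un) oo as x un un"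
  unfolding b_def by (simp add: cassoc triangle)
 also have "\<dots> = lu x oo (ru un ** idt x) oo br x (un \<box> un) oo as x un un"
  by (simp add: br_n3 lu_un)
 also have "\<dots> = lu x oo (idt un ** lu x) oo as un un x oo br x (un \<box> un) oo as x un un"
  by (simp add: triangle3)
 also have "\<dots> = lu x oo (idt un ** lu x) oo (idt un ** br x un) oo as un x un oo (br x un ** idt un)"
  by (simp add: hexagon)
 also have "\<dots> = lu x oo (idt un ** b) oo as un x un oo (br x un ** idt un)"
  unfolding b_def by (simp add: nf)
 also have "\<dots> = b oo lu (x \<box> un) oo as un x un oo (br x un ** idt un)"
  by (simp add: lu_n3)
 also have "\<dots> = b oo (lu x ** idt un) oo (br x un ** idt un)"
  by (simp add: rw2[OF lu_tens])
 also have "\<dots> = b oo (b ** idt un)" unfolding b_def by (simp add: nf)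
 finally have "b oo (b ** idt un) = b oo (ru x ** idt un)" by simp
 then have "b ** idt un = ru x ** idt un" by (rule iso_cancel_l[rotated]) simp_all
 then show ?thesis unfolding b_def[symmetric] by (rule unit_faithful_r) simp_all
qed

text \<open>The exchange of the first two of three factors. It is the core of the middle
  interchange, and it is how a scalar passes an inert factor on its left in
  \<open>rlin\<close>.\<close>

definition swp :: "'o => 'o => 'o => 'a" where
 "swp x y z = as y x z oo (br x y ** idt z) oo iv (as x y z)"

lemma swp_ar [simp]:
 "ob x ==> ob y ==> ob z ==> ar (swp x y z)" "ob x ==> ob y ==> ob z ==> dm (swp x y z) = x \<box> y \<box> z"
 "ob x ==> ob y ==> ob z ==> cd (swp x y z) = y \<box> x \<box> z"
 by (simp_all add: swp_def)

lemma swp_iso [simp]: "ob x ==> ob y ==> ob z ==> iso_arr C (swp x y z)"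
 by (simp add: swp_def)

lemma swp_as: "ob x ==> ob y ==> ob z ==> swp x y z oo as x y z = as y x z oo (br x y ** idt z)"
 by (simp add: swp_def cassoc)

lemma swp_as3: "ob x ==> ob y ==> ob z ==> ar k ==> cd k = (x \<box> y) \<box> z ==>
  swp x y z oo as x y z oo k = as y x z oo (br x y ** idt z) oo k"
 by (subst rw2[OF swp_as]) (auto simp: cassoc)

lemma swp_n: "ar f ==> ar g ==> ar h ==> cd f = x ==> cd g = y ==> cd h = z ==>
  swp x y z oo (f ** g ** h) = (g ** f ** h) oo swp (dm f) (dm g) (dm h)"
 by (auto simp: swp_def nf iv_as_n br_n as_n[symmetric] as_n3[symmetric])

lemma swp_n3: "ar f ==> ar g ==> ar h ==> cd f = x ==> cd g = y ==> cd h = z ==> ar k ==>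
  cd k = dm f \<box> dm g \<box> dm h ==>
  swp x y z oo (f ** g ** h) oo k = (g ** f ** h) oo swp (dm f) (dm g) (dm h) oo k"
 by (subst rw2[OF swp_n]) (auto simp: cassoc)

lemma swp_br:
 assumes [simp]: "ob x" "ob y" "ob z"
 shows "(idt y ** br x z) oo swp x y z = as y z x oo br x (y \<box> z)"
 by (rule iso_cancel_r[of "as x y z"]) (simp_all add: swp_as cassoc hexagon)

text \<open>The second hexagon. In a symmetric category it follows from the first, since the
  braidings are inverse to each other.\<close>

lemma br_tens:
 assumes [simp]: "ob x" "ob y" "ob z"
 shows "br (y \<box> z) x = swp y x z oo (idt y ** br z x) oo as y z x"
proof -
 have [simp]: "swp y x z oo swp x y z = idt (x \<box> y \<box> z)"
  by (simp add: swp_def nf)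
 have "(swp y x z oo (idt y ** br z x) oo as y z x) oo br x (y \<box> z)
   = swp y x z oo (idt y ** br z x) oo (idt y ** br x z) oo swp x y z"
  by (simp add: cassoc swp_br)
 also have "\<dots> = br (y \<box> z) x oo br x (y \<box> z)" by (simp add: interchange3)
 finally have "br (y \<box> z) x oo br x (y \<box> z) = (swp y x z oo (idt y ** br z x) oo as y z x) oo br x (y \<box> z)" by simp
 then show ?thesis by (rule iso_cancel_r[rotated]) simp_all
qed

text \<open>The object \<open>a\<close> passes \<open>x \<box> y\<close> either in one step or past
  \<open>y\<close> and then \<open>x\<close>. This is a hexagon with a fourth factor kept on the
  right, used when a scalar moves past a tensor product.\<close>

lemma swp_tens:
 assumes [simp]: "ob x" "ob y" "ob a" "ob z"
 shows "(idt a ** as x y z) oo swp (x \<box> y) a z = swp x a (y \<box> z) oo (idt x ** swp y a z) oo as x y (a \<box> z)"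
proof (rule iso_cancel_r)
 show "iso_arr C (as (x \<box> y) a z)" by simp
 have "((idt a ** as x y z) oo swp (x \<box> y) a z) oo as (x \<box> y) a z =
  (idt a ** as x y z) oo as a (x \<box> y) z oo (br (x \<box> y) a ** idt z)"
  by (simp add: cassoc swp_as)
 also have "\<dots> = (idt a ** as x y z) oo as a (x \<box> y) z oo (as a x y ** idt z) oo
   ((br x a ** idt y) ** idt z) oo ((iv (as x a y) oo (idt x ** br y a) oo as x y a) ** idt z)"
  by (simp add: br_tens swp_def nf)
 also have "\<dots> = as a x (y \<box> z) oo as (a \<box> x) y z oo
   ((br x a ** idt y) ** idt z) oo ((iv (as x a y) oo (idt x ** br y a) oo as x y a) ** idt z)"
  by (simp add: pentagon3)
 also have "\<dots> = as a x (y \<box> z) oo (br x a ** idt (y \<box> z)) oo as (x \<box> a) y z oo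
   ((iv (as x a y) oo (idt x ** br y a) oo as x y a) ** idt z)"
  by (simp add: as_n3)
 also have "\<dots> = swp x a (y \<box> z) oo as x a (y \<box> z) oo as (x \<box> a) y z oo
   ((iv (as x a y) oo (idt x ** br y a) oo as x y a) ** idt z)"
  by (simp add: swp_as3)
 also have "\<dots> = swp x a (y \<box> z) oo (idt x ** as a y z) oo as x (a \<box> y) z oo (as x a y ** idt z) oo
   ((iv (as x a y) oo (idt x ** br y a) oo as x y a) ** idt z)"
  by (simp add: pentagon3)
 also have "\<dots> = swp x a (y \<box> z) oo (idt x ** as a y z) oo as x (a \<box> y) z oo
   ((idt x ** br y a) ** idt z) oo (as x y a ** idt z)"
  by (simp add: nf)
 also have "\<dots> = swp x a (y \<box> z) oo (idt x ** as a y z) oo (idt x ** (br y a ** idt z)) oo as x (y \<box> a) z oo (as x y a ** idt z)"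
  by (simp add: as_n3)
 also have "\<dots> = swp x a (y \<box> z) oo (idt x ** swp y a z) oo (idt x ** as y a z) oo as x (y \<box> a) z oo (as x y a ** idt z)"
  by (simp add: interchange3 swp_as)
 also have "\<dots> = (swp x a (y \<box> z) oo (idt x ** swp y a z) oo as x y (a \<box> z)) oo as (x \<box> y) a z"
  by (simp add: pentagon[symmetric] cassoc del: interchange3)
 finally show "((idt a ** as x y z) oo swp (x \<box> y) a z) oo as (x \<box> y) a z =
  (swp x a (y \<box> z) oo (idt x ** swp y a z) oo as x y (a \<box> z)) oo as (x \<box> y) a z" .
qed simp_all

text \<open>It expresses the inverse associator by a forward associator and braidings. In
  \<open>W_assoc_iso\<close> this yields an inverse for modules from maps that are already known to
  descend.\<close>

lemma as_inverse:
 assumes [simp]: "ob x" "ob y" "ob z"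
 shows "((br y x ** idt z) oo br z (y \<box> x) oo as z y x oo (br y z ** idt x) oo br x (y \<box> z)) = iv (as x y z)"
proof (rule iso_cancel_r)
 show "iso_arr C (as x y z)" by simp
 have h: "br x (y \<box> z) oo as x y z = iv (as y z x) oo (idt y ** br x z) oo as y x z oo (br x y ** idt z)"
  by (rule iso_move_l) (simp_all add: hexagon)
 have "((br y x ** idt z) oo br z (y \<box> x) oo as z y x oo (br y z ** idt x) oo br x (y \<box> z)) oo as x y z
   = (br y x ** idt z) oo br z (y \<box> x) oo as z y x oo (br y z ** idt x) oo
    iv (as y z x) oo (idt y ** br x z) oo as y x z oo (br x y ** idt z)"
  by (simp add: cassoc h)
 also have "\<dots> = (br y x ** idt z) oo br z (y \<box> x) oo br (y \<box> x) z oo (br x y ** idt z)"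
  by (simp add: br_tens swp_def cassoc)
 also have "\<dots> = iv (as x y z) oo as x y z" by (simp add: nf)
 finally show "((br y x ** idt z) oo br z (y \<box> x) oo as z y x oo (br y z ** idt x) oo br x (y \<box> z)) oo as x y z
  = iv (as x y z) oo as x y z" .
qed simp_all

lemma swp_un:
 assumes [simp]: "ob x" "ob z"
 shows "lu (x \<box> z) oo swp x un z = idt x ** lu z"
proof (rule iso_cancel_r[of "as x un z"])
 have "(lu (x \<box> z) oo swp x un z) oo as x un z = (lu x ** idt z) oo (br x un ** idt z)"
  by (simp add: cassoc swp_as rw2[OF lu_tens])
 then show "(lu (x \<box> z) oo swp x un z) oo as x un z = (idt x ** lu z) oo as x un z"
  by (simp add: interchange lu_br triangle)
qed simp_all

section \<open>The middle interchange\<close>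

lemma mid4_swp: "mid4 C a b c d = iv (as a c (b \<box> d)) oo (idt a ** swp b c d) oo as a b (c \<box> d)"
 by (simp add: mid4_def swp_def)

lemma mid4_ar [simp]:
 assumes [simp]: "ob a" "ob b" "ob c" "ob d"
 shows "ar (mid4 C a b c d)" "dm (mid4 C a b c d) = (a \<box> b) \<box> c \<box> d" "cd (mid4 C a b c d) = (a \<box> c) \<box> b \<box> d"
 by (simp_all add: mid4_swp)

lemma mid4_iso [simp]:
 assumes [simp]: "ob a" "ob b" "ob c" "ob d"
 shows "iso_arr C (mid4 C a b c d)"
 by (simp add: mid4_swp)

lemma mid4_n:
 assumes [simp]: "ar f" "ar g" "ar h" "ar k" and "cd f = a" "cd g = b" "cd h = c" "cd k = d"
 shows "mid4 C a b c d oo ((f ** g) ** h ** k) = ((f ** h) ** g ** k) oo mid4 C (dm f) (dm g) (dm h) (dm k)"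
proof -
 have "mid4 C (cd f) (cd g) (cd h) (cd k) oo ((f ** g) ** h ** k) =
  iv (as (cd f) (cd h) (cd g \<box> cd k)) oo (f ** (swp (cd g) (cd h) (cd k) oo (g ** h ** k))) oo as (dm f) (dm g) (dm h \<box> dm k)"
  by (simp add: mid4_swp as_n nf)
 also have "\<dots> = iv (as (cd f) (cd h) (cd g \<box> cd k)) oo (f ** h ** g ** k) oo
   (idt (dm f) ** swp (dm g) (dm h) (dm k)) oo as (dm f) (dm g) (dm h \<box> dm k)"
  by (simp add: swp_n interchange3)
 also have "\<dots> = ((f ** h) ** g ** k) oo mid4 C (dm f) (dm g) (dm h) (dm k)"
  by (simp add: mid4_swp iv_as_n3)
 finally show ?thesis using assms by simp
qed

text \<open>With a unit in the third place the middle interchange becomes an associator, and with a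
  unit in the first place (\<open>mid4_unit_l\<close>) it becomes \<open>swp\<close>. This separates
  the two factors in \<open>mid_linear\<close>.\<close>

lemma mid4_unit_r:
 assumes [simp]: "ob p" "ob e" "ob e'"
 shows "(ru p ** idt (e \<box> e')) oo mid4 C p e un e' oo (idt (p \<box> e) ** iv (lu e')) = as p e e'"
proof -
 have "(ru p ** idt (e \<box> e')) oo mid4 C p e un e' = ((ru p ** idt (e \<box> e')) oo iv (as p un (e \<box> e'))) oo (idt p ** swp e un e') oo as p e (un \<box> e')"
  by (simp add: mid4_swp cassoc)
 also have "(ru p ** idt (e \<box> e')) oo iv (as p un (e \<box> e')) = idt p ** lu (e \<box> e')"
  by (rule iso_move_r[symmetric]) (simp_all add: triangle)
 also have "(idt p ** lu (e \<box> e')) oo (idt p ** swp e un e') oo as p e (un \<box> e') = (idt p ** idt e ** lu e') oo as p e (un \<box> e')"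
  by (simp add: interchange3 swp_un)
 also have "\<dots> = as p e e' oo (idt (p \<box> e) ** lu e')"
  using as_n[of "idt p" "idt e" "lu e'" p e e'] by simp
 finally have "(ru p ** idt (e \<box> e')) oo mid4 C p e un e' = as p e e' oo (idt (p \<box> e) ** lu e')" .
 then have "((ru p ** idt (e \<box> e')) oo mid4 C p e un e') oo (idt (p \<box> e) ** iv (lu e')) = as p e e'"
  by (simp add: nf)
 then show ?thesis by (simp add: cassoc)
qed

lemma mid4_unit_l:
 assumes [simp]: "ob p" "ob e" "ob e'"
 shows "(lu p ** idt (e \<box> e')) oo mid4 C un e p e' oo (iv (lu e) ** idt (p \<box> e')) = swp e p e'"
proof -
 have "(lu p ** idt (e \<box> e')) oo iv (as un p (e \<box> e')) = lu (p \<box> e \<box> e')"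
  by (rule iso_move_r[symmetric]) (simp_all add: lu_tens)
 then have "(lu p ** idt (e \<box> e')) oo mid4 C un e p e' = lu (p \<box> e \<box> e') oo (idt un ** swp e p e') oo as un e (p \<box> e')"
  by (simp add: mid4_swp rw2[of "lu p ** idt (e \<box> e')" "iv (as un p (e \<box> e'))"])
 also have "\<dots> = swp e p e' oo (lu e ** idt (p \<box> e'))"
  by (simp add: lu_n3 lu_tens)
 finally have "((lu p ** idt (e \<box> e')) oo mid4 C un e p e') oo (iv (lu e) ** idt (p \<box> e')) = swp e p e'"
  by (simp add: nf)
 then show ?thesis by (simp add: cassoc)
qed

end

section \<open>Modules over a commutative monoid\<close>

lemma (in sym_mon_cat) swp_br2:
 assumes [simp]: "ob x" "ob y" "ob z"
 shows "swp x y z oo br (y \<box> z) x = (idt y ** br z x) oo as y z x"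
proof (rule iso_cancel_l)
 show "iso_arr C (idt y ** br x z)" by simp
 have "((idt y ** br x z) oo swp x y z) oo br (y \<box> z) x = (as y z x oo br x (y \<box> z)) oo br (y \<box> z) x"
  unfolding swp_br[OF assms] ..
 then show "(idt y ** br x z) oo swp x y z oo br (y \<box> z) x = (idt y ** br x z) oo (idt y ** br z x) oo as y z x"
  by (simp add: cassoc interchange3)
qed simp_all

text \<open>The predicate \<open>SE\<close> is meant to single out epimorphisms that stay epimorphisms under all the functors
 in play; it contains the reflexive coequalizers.\<close>

locale cmon_ctx = sym_mon_cat C for C :: "('o, 'a) smc" +
 fixes A :: 'o and m e :: 'a and SE :: "'a => bool"
 assumes A_ob [simp]: "ob A"
  and m_hom: "m \<in> homs C (A \<box> A) A"
  and e_hom: "e \<in> homs C un A"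
  and m_as: "m oo (m ** idt A) = m oo (idt A ** m) oo as A A A"
  and m_un: "m oo (e ** idt A) = lu A"
  and m_br: "m oo br A A = m"
  and coeq_exists: "reflexive C f g ==> \<exists>q. is_coeq C f g q"
  and tens_rcoeq: "ob x ==> rcoeq C f g q ==> rcoeq C (idt x ** f) (idt x ** g) (idt x ** q)"
  and SE_epi: "SE p ==> epi C p"
  and SE_split: "split_epi C p ==> SE p"
  and SE_comp: "SE p ==> SE q ==> cd p = dm q ==> SE (q oo p)"
  and SE_cancel: "SE (q oo p) ==> ar p ==> ar q ==> cd p = dm q ==> SE q"
  and SE_tens: "ob x ==> SE p ==> SE (idt x ** p)"
  and SE_rcoeq: "rcoeq C f g q ==> SE q"
begin

abbreviation md where "md X \<equiv> X \<in> modules C A m e"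
abbreviation mor where "mor X u Y \<equiv> (X, u, Y) \<in> module_maps C A m e"
abbreviation W where "W \<equiv> mod_cat C A m e"

lemma m_ar [simp]: "ar m" "dm m = A \<box> A" "cd m = A"
 and e_ar [simp]: "ar e" "dm e = un" "cd e = A"
 using m_hom e_hom by (auto simp: in_homs)

lemma m_un_r: "m oo (idt A ** e) = ru A"
proof -
 have "m oo (idt A ** e) = (m oo br A A) oo (idt A ** e)" unfolding m_br ..
 also have "\<dots> = m oo (e ** idt A) oo br A un" by (simp add: cassoc br_n)
 also have "\<dots> = ru A" by (simp add: rw2[OF m_un] lu_br)
 finally show ?thesis .
qed

lemma md_ar [simp]:
 assumes "md X"
 shows "ob (fst X)" "ar (snd X)" "dm (snd X) = A \<box> fst X" "cd (snd X) = fst X"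
 using assms by (auto simp: modules_def in_homs)

lemma md_as: "md X ==> snd X oo (idt A ** snd X) oo as A A (fst X) = snd X oo (m ** idt (fst X))"
 and md_un: "md X ==> snd X oo (e ** idt (fst X)) = lu (fst X)"
 by (auto simp: modules_def)

lemma mdI:
 assumes "ob M" "ar a" "dm a = A \<box> M" "cd a = M"
  "a oo (idt A ** a) oo as A A M = a oo (m ** idt M)" "a oo (e ** idt M) = lu M"
 shows "md (M, a)"
 using assms by (simp add: modules_def in_homs)

text \<open>Associativity of the action with arbitrary arrows inserted for the two scalars and the
  element, the form in which it is rewritten later.\<close>

lemma md_mult:
 assumes [simp]: "md X" "ar f" "ar g" "ar k" "cd f = A" "cd g = A" "cd k = fst X"
 shows "snd X oo ((m oo (f ** g)) ** k) = snd X oo (f ** (snd X oo (g ** k))) oo as (dm f) (dm g) (dm k)"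
proof -
 have "snd X oo ((m oo (f ** g)) ** k) = (snd X oo (m ** idt (fst X))) oo ((f ** g) ** k)"
  by (simp add: nf)
 also have "\<dots> = snd X oo (idt A ** snd X) oo as A A (fst X) oo ((f ** g) ** k)"
  unfolding md_as[OF assms(1), symmetric] by (simp add: nf)
 also have "\<dots> = snd X oo (f ** (snd X oo (g ** k))) oo as (dm f) (dm g) (dm k)"
  by (simp add: as_n nf)
 finally show ?thesis .
qed

lemma md_unit:
 assumes [simp]: "md X" "ar k" "cd k = fst X"
 shows "snd X oo (e ** k) = k oo lu (dm k)"
proof -
 have "snd X oo (e ** k) = (snd X oo (e ** idt (fst X))) oo (idt un ** k)" by (simp add: nf)
 then show ?thesis unfolding md_un[OF assms(1)] by (simp add: lu_n)
qed

text \<open>Both orders are the action of a product in \<open>A\<close>, and \<open>A\<close> is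
  commutative.\<close>

lemma md_swap:
 assumes [simp]: "md X" "ar f" "ar g" "ar k" "cd f = A" "cd g = A" "cd k = fst X"
 shows "snd X oo (g ** (snd X oo (f ** k))) oo swp (dm f) (dm g) (dm k) = snd X oo (f ** (snd X oo (g ** k)))"
proof (rule iso_cancel_r[of "as (dm f) (dm g) (dm k)"])
 have "(snd X oo (g ** (snd X oo (f ** k))) oo swp (dm f) (dm g) (dm k)) oo as (dm f) (dm g) (dm k) =
  (snd X oo (g ** (snd X oo (f ** k))) oo as (dm g) (dm f) (dm k)) oo (br (dm f) (dm g) ** idt (dm k))"
  by (simp add: cassoc swp_as)
 also have "\<dots> = snd X oo ((m oo (g ** f)) ** k) oo (br (dm f) (dm g) ** idt (dm k))"
  by (simp add: md_mult[symmetric] cassoc)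
 also have "\<dots> = snd X oo (((m oo br A A) oo (f ** g)) ** k)"
  by (simp add: nf br_n)
 also have "\<dots> = (snd X oo (f ** (snd X oo (g ** k)))) oo as (dm f) (dm g) (dm k)"
  by (simp add: m_br md_mult cassoc)
 finally show "(snd X oo (g ** (snd X oo (f ** k))) oo swp (dm f) (dm g) (dm k)) oo as (dm f) (dm g) (dm k) =
  (snd X oo (f ** (snd X oo (g ** k)))) oo as (dm f) (dm g) (dm k)" .
qed simp_all

lemma md_self: "md (A, m)"
 by (rule mdI) (simp_all add: m_as m_un)

lemma mor_iff:
 "mor X u Y \<longleftrightarrow> md X & md Y & ar u & dm u = fst X & cd u = fst Y & u oo snd X = snd Y oo (idt A ** u)"
 by (auto simp: module_maps_def in_homs)

lemma morD:
 assumes "mor X u Y"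
 shows "md X" "md Y" "ar u" "dm u = fst X" "cd u = fst Y" "u oo snd X = snd Y oo (idt A ** u)"
 using assms by (auto simp: mor_iff)

lemma mor_id: "md X ==> mor X (idt (fst X)) X"
 by (simp add: mor_iff)

lemma mor_comp:
 assumes "mor X u Y" "mor Y v Z" shows "mor X (v oo u) Z"
proof -
 note u [simp] = morD(1-5)[OF assms(1)] and v [simp] = morD(2-5)[OF assms(2)]
 have "(v oo u) oo snd X = v oo snd Y oo (idt A ** u)" using morD(6)[OF assms(1)] by (simp add: cassoc)
 also have "\<dots> = snd Z oo (idt A ** v) oo (idt A ** u)" using rw2[OF morD(6)[OF assms(2)]] by (simp add: cassoc)
 also have "\<dots> = snd Z oo (idt A ** (v oo u))" by (simp add: nf)
 finally show ?thesis by (simp add: mor_iff)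
qed

text \<open>Semilinear maps: \<open>\<alpha> : P \<odot> E \<rightarrow> E\<close> acts through \<open>\<phi> : P \<rightarrow> A\<close>. No axioms are imposed on \<open>\<alpha>\<close>.\<close>

definition actn :: "'a => 'a => bool" where
 "actn \<phi> \<alpha> \<longleftrightarrow> ar \<phi> & cd \<phi> = A & ar \<alpha> & dm \<alpha> = dm \<phi> \<box> cd \<alpha>"

definition slin :: "'a => 'a => ('o, 'a) md => 'a => bool" where
 "slin \<phi> \<alpha> Y k \<longleftrightarrow> actn \<phi> \<alpha> & ar k & dm k = cd \<alpha> & cd k = fst Y & k oo \<alpha> = snd Y oo (\<phi> ** k)"

text \<open>Linearity in one factor while the other is inert and need not carry an action. Treating
  the factors separately allows a map of two variables to be descended one variable at a
  time.\<close>

definition llin :: "'a => 'a => 'o => ('o, 'a) md => 'a => bool" where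
 "llin \<phi> \<alpha> E' Y k \<longleftrightarrow> actn \<phi> \<alpha> & ob E' & ar k & dm k = cd \<alpha> \<box> E' & cd k = fst Y &
   k oo (\<alpha> ** idt E') = snd Y oo (\<phi> ** k) oo as (dm \<phi>) (cd \<alpha>) E'"

definition rlin :: "'a => 'a => 'o => ('o, 'a) md => 'a => bool" where
 "rlin \<phi> \<alpha> E Y k \<longleftrightarrow> actn \<phi> \<alpha> & ob E & ar k & dm k = E \<box> cd \<alpha> & cd k = fst Y &
   k oo (idt E ** \<alpha>) = snd Y oo (\<phi> ** k) oo swp E (dm \<phi>) (cd \<alpha>)"

lemma actnD: "actn \<phi> \<alpha> ==> ar \<phi>" "actn \<phi> \<alpha> ==> cd \<phi> = A" "actn \<phi> \<alpha> ==> ar \<alpha>"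
 "actn \<phi> \<alpha> ==> dm \<alpha> = dm \<phi> \<box> cd \<alpha>"
 by (simp_all add: actn_def)

lemma actn_md: "md X ==> actn (idt A) (snd X)"
 by (simp add: actn_def)

lemma mor_slin: "md X ==> md Y ==> mor X u Y \<longleftrightarrow> slin (idt A) (snd X) Y u"
 by (auto simp: mor_iff slin_def actn_md)

text \<open>The symmetry exchanges the two one-sided notions, so that results for a left factor
  serve for a right factor as well.\<close>

lemma rlin_br:
 assumes [simp]: "md Y" and k: "rlin \<phi> \<alpha> E Y k" shows "llin \<phi> \<alpha> E Y (k oo br (cd \<alpha>) E)"
proof -
 have a [simp]: "actn \<phi> \<alpha>" "ob E" "ar k" "dm k = E \<box> cd \<alpha>" "cd k = fst Y"
  and k: "k oo (idt E ** \<alpha>) = snd Y oo (\<phi> ** k) oo swp E (dm \<phi>) (cd \<alpha>)"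
  using k by (auto simp: rlin_def)
 note [simp] = actnD[OF a(1)]
 have "(k oo br (cd \<alpha>) E) oo (\<alpha> ** idt E) = k oo (idt E ** \<alpha>) oo br (dm \<phi> \<box> cd \<alpha>) E"
  by (simp add: cassoc br_n)
 also have "\<dots> = snd Y oo (\<phi> ** k) oo swp E (dm \<phi>) (cd \<alpha>) oo br (dm \<phi> \<box> cd \<alpha>) E"
  by (simp add: rw2[OF k] cassoc)
 also have "\<dots> = snd Y oo (\<phi> ** (k oo br (cd \<alpha>) E)) oo as (dm \<phi>) (cd \<alpha>) E"
  by (simp add: swp_br2 nf)
 finally show ?thesis by (simp add: llin_def)
qed

lemma br_rlin:
 assumes [simp]: "md Y" and k: "llin \<phi> \<alpha> E Y (k oo br (cd \<alpha>) E)" and [simp]: "ar k" "dm k = E \<box> cd \<alpha>" "cd k = fst Y"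
 shows "rlin \<phi> \<alpha> E Y k"
proof -
 have a [simp]: "actn \<phi> \<alpha>" "ob E"
  and k: "(k oo br (cd \<alpha>) E) oo (\<alpha> ** idt E) = snd Y oo (\<phi> ** (k oo br (cd \<alpha>) E)) oo as (dm \<phi>) (cd \<alpha>) E"
  using k by (auto simp: llin_def)
 note [simp] = actnD[OF a(1)]
 have "k oo (idt E ** \<alpha>) = snd Y oo (\<phi> ** k) oo swp E (dm \<phi>) (cd \<alpha>)"
 proof (rule iso_cancel_r)
  show "iso_arr C (br (dm \<phi> \<box> cd \<alpha>) E)" by simp
  have "(k oo (idt E ** \<alpha>)) oo br (dm \<phi> \<box> cd \<alpha>) E = (k oo br (cd \<alpha>) E) oo (\<alpha> ** idt E)"
   by (simp add: cassoc br_n)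
  also have "\<dots> = (snd Y oo (\<phi> ** k) oo swp E (dm \<phi>) (cd \<alpha>)) oo br (dm \<phi> \<box> cd \<alpha>) E"
   unfolding k by (simp add: swp_br2 nf)
  finally show "(k oo (idt E ** \<alpha>)) oo br (dm \<phi> \<box> cd \<alpha>) E =
   (snd Y oo (\<phi> ** k) oo swp E (dm \<phi>) (cd \<alpha>)) oo br (dm \<phi> \<box> cd \<alpha>) E" .
 qed simp_all
 then show ?thesis by (simp add: rlin_def)
qed

lemma llin_br:
 assumes Y: "md Y" and k: "llin \<phi> \<alpha> E Y k" shows "rlin \<phi> \<alpha> E Y (k oo br E (cd \<alpha>))"
proof (rule br_rlin[OF Y])
 have a [simp]: "actn \<phi> \<alpha>" "ob E" "ar k" "dm k = cd \<alpha> \<box> E" "cd k = fst Y"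
  using k by (auto simp: llin_def)
 note [simp] = actnD[OF a(1)]
 show "llin \<phi> \<alpha> E Y ((k oo br E (cd \<alpha>)) oo br (cd \<alpha>) E)" using k by (simp add: cassoc)
 show "ar (k oo br E (cd \<alpha>))" "dm (k oo br E (cd \<alpha>)) = E \<box> cd \<alpha>" "cd (k oo br E (cd \<alpha>)) = fst Y" by simp_all
qed

lemma llin_pre:
 assumes X: "md X" and Y: "md Y" and k: "llin (idt A) (snd X) E' Y k" and u: "slin \<phi> \<alpha> X u"
  and v [simp]: "ar v" "cd v = E'"
 shows "llin \<phi> \<alpha> (dm v) Y (k oo (u ** v))"
proof -
 note [simp] = X Y
 have k' [simp]: "ob E'" "ar k" "dm k = fst X \<box> E'" "cd k = fst Y"
  and k: "k oo (snd X ** idt E') = snd Y oo (idt A ** k) oo as A (fst X) E'" using k X by (auto simp: llin_def)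
 have u' [simp]: "actn \<phi> \<alpha>" "ar u" "dm u = cd \<alpha>" "cd u = fst X" and u: "u oo \<alpha> = snd X oo (\<phi> ** u)"
  using u by (auto simp: slin_def)
 note [simp] = actnD[OF u'(1)]
 have "(k oo (u ** v)) oo (\<alpha> ** idt (dm v)) = (k oo (snd X ** idt E')) oo ((\<phi> ** u) ** v)"
  by (simp add: nf u)
 also have "\<dots> = snd Y oo (\<phi> ** (k oo (u ** v))) oo as (dm \<phi>) (cd \<alpha>) (dm v)"
  unfolding k by (simp add: nf as_n)
 finally show ?thesis by (simp add: llin_def)
qed

lemma rlin_pre:
 assumes X: "md X" and Y: "md Y" and k: "rlin (idt A) (snd X) E Y k" and u: "slin \<phi> \<alpha> X u"
  and v [simp]: "ar v" "cd v = E"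
 shows "rlin \<phi> \<alpha> (dm v) Y (k oo (v ** u))"
proof -
 note [simp] = X Y
 have k' [simp]: "ob E" "ar k" "dm k = E \<box> fst X" "cd k = fst Y"
  and k: "k oo (idt E ** snd X) = snd Y oo (idt A ** k) oo swp E A (fst X)" using k X by (auto simp: rlin_def)
 have u' [simp]: "actn \<phi> \<alpha>" "ar u" "dm u = cd \<alpha>" "cd u = fst X" and u: "u oo \<alpha> = snd X oo (\<phi> ** u)"
  using u by (auto simp: slin_def)
 note [simp] = actnD[OF u'(1)]
 have "(k oo (v ** u)) oo (idt (dm v) ** \<alpha>) = (k oo (idt E ** snd X)) oo (v ** \<phi> ** u)"
  by (simp add: nf u)
 also have "\<dots> = snd Y oo (\<phi> ** (k oo (v ** u))) oo swp (dm v) (dm \<phi>) (cd \<alpha>)"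
  unfolding k by (simp add: nf swp_n)
 finally show ?thesis by (simp add: rlin_def)
qed

text \<open>Moving the scalar through the left or through the right factor, one arrives at the same
  scalar acting on \<open>Y\<close>. Hence maps linear in both variables factor through relative
  tensor products.\<close>

lemma balanced:
 assumes Y: "md Y" and k: "llin \<phi> \<alpha> E' Y k" "rlin \<phi> \<alpha>' E Y k" and E: "cd \<alpha> = E" "cd \<alpha>' = E'"
 shows "k oo ((\<alpha> oo br E (dm \<phi>)) ** idt E') = k oo (idt E ** \<alpha>') oo as E (dm \<phi>) E'"
proof -
 note [simp] = Y E
 have k' [simp]: "actn \<phi> \<alpha>" "actn \<phi> \<alpha>'" "ob E" "ob E'" "ar k" "dm k = E \<box> E'" "cd k = fst Y"
  and l: "k oo (\<alpha> ** idt E') = snd Y oo (\<phi> ** k) oo as (dm \<phi>) E E'"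
  and r: "k oo (idt E ** \<alpha>') = snd Y oo (\<phi> ** k) oo swp E (dm \<phi>) E'"
  using k by (auto simp: llin_def rlin_def)
 note [simp] = actnD[OF k'(1)] actnD[OF k'(2)]
 have "k oo ((\<alpha> oo br E (dm \<phi>)) ** idt E') = (k oo (\<alpha> ** idt E')) oo (br E (dm \<phi>) ** idt E')"
  by (simp add: nf)
 also have "\<dots> = (k oo (idt E ** \<alpha>')) oo as E (dm \<phi>) E'"
  unfolding l r by (simp add: cassoc swp_as)
 finally show ?thesis by (simp add: cassoc)
qed

text \<open>The quotient of \<open>M \<odot> E\<close> by a right action \<open>\<rho>\<close> on \<open>M\<close> and a left action \<open>\<alpha>\<close> on \<open>E\<close> covers both the
 relative tensor product of modules and the base change along a map of monoids.\<close>

context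
 fixes M a \<rho> P \<alpha> E q
 assumes Ma: "md (M, a)" and P: "ob P" and E: "ob E" and rho: "\<rho> \<in> homs C (M \<box> P) M" and al: "\<alpha> \<in> homs C (P \<box> E) E"
  and bimod: "a oo (idt A ** \<rho>) oo as A M P = \<rho> oo (a ** idt P)"
  and q: "rcoeq C (\<rho> ** idt E) ((idt M ** \<alpha>) oo as M P E) q"
begin

lemma quot_simps:
 "ob M" "ar a" "dm a = A \<box> M" "cd a = M" "ob P" "ob E" "ar \<rho>" "dm \<rho> = M \<box> P" "cd \<rho> = M"
 "ar \<alpha>" "dm \<alpha> = P \<box> E" "cd \<alpha> = E" "ar q" "dm q = M \<box> E"
 "q oo (\<rho> ** idt E) = q oo (idt M ** \<alpha>) oo as M P E"
 using md_ar[OF Ma] P E rho al rcoeqD[OF q] by (simp_all add: in_homs)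

text \<open>\<open>A \<box> -\<close> preserves the coequalizer \<open>q\<close>, and because the
  left action \<open>a\<close> commutes with the right action \<open>\<rho>\<close>, acting on
  \<open>M\<close> respects the relation imposed by \<open>q\<close>.\<close>

lemma quot_act_ex:
 obtains b where "ar b" "dm b = A \<box> cd q" "cd b = cd q" "b oo (idt A ** q) = q oo (a ** idt E) oo iv (as A M E)"
  "quot_act C A M a E q = b"
proof -
 note [simp] = quot_simps(1-14)
 note c = tens_rcoeq[OF A_ob q]
 let ?k = "q oo (a ** idt E) oo iv (as A M E)"
 \<comment> \<open>Rebracketing from \<open>((A \<box> M) \<box> P) \<box> E\<close> makes
   \<open>bimod\<close> and the relation of \<open>q\<close> applicable.\<close>
 have i: "iso_arr C (as A (M \<box> P) E oo (as A M P ** idt E))" by simp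
 have 1: "?k oo (idt A ** \<rho> ** idt E) oo as A (M \<box> P) E oo (as A M P ** idt E) = (q oo (\<rho> ** idt E)) oo ((a ** idt P) ** idt E)"
 proof -
  have "?k oo (idt A ** \<rho> ** idt E) oo as A (M \<box> P) E oo (as A M P ** idt E) =
   q oo ((a oo (idt A ** \<rho>) oo as A M P) ** idt E)"
   by (simp add: cassoc iv_as_n3) (simp add: nf)
  then show ?thesis unfolding bimod by (simp add: nf)
 qed
 have 2: "?k oo (idt A ** ((idt M ** \<alpha>) oo as M P E)) oo as A (M \<box> P) E oo (as A M P ** idt E) =
   (q oo (idt M ** \<alpha>) oo as M P E) oo ((a ** idt P) ** idt E)"
 proof -
  have "?k oo (idt A ** ((idt M ** \<alpha>) oo as M P E)) oo as A (M \<box> P) E oo (as A M P ** idt E) =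
   ?k oo (idt A ** idt M ** \<alpha>) oo (idt A ** as M P E) oo as A (M \<box> P) E oo (as A M P ** idt E)"
   by (simp add: nf)
  also have "\<dots> = ?k oo (idt A ** idt M ** \<alpha>) oo as A M (P \<box> E) oo as (A \<box> M) P E"
   by (simp add: pentagon)
  also have "\<dots> = q oo (a ** \<alpha>) oo as (A \<box> M) P E"
   using iv_as_n3[of "idt A" "idt M" \<alpha> A M E "as A M (P \<box> E) oo as (A \<box> M) P E"] by (simp add: cassoc interchange3)
  also have "\<dots> = (q oo (idt M ** \<alpha>) oo as M P E) oo ((a ** idt P) ** idt E)"
   by (simp add: cassoc as_n interchange3)
  finally show ?thesis .
 qed
 have "(?k oo (idt A ** \<rho> ** idt E)) oo as A (M \<box> P) E oo (as A M P ** idt E) =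
  (?k oo (idt A ** ((idt M ** \<alpha>) oo as M P E))) oo as A (M \<box> P) E oo (as A M P ** idt E)"
  using 1 2 unfolding quot_simps(15) by (simp add: cassoc)
 then have "?k oo (idt A ** \<rho> ** idt E) = ?k oo (idt A ** ((idt M ** \<alpha>) oo as M P E))"
  by (rule iso_cancel_r[OF i]) simp_all
 then obtain b where b: "ar b" "dm b = cd (idt A ** q)" "cd b = cd ?k" "b oo (idt A ** q) = ?k"
  by (rule coeq_ex[OF rcoeqD(1)[OF c], rotated 2]) simp_all
 have "quot_act C A M a E q = b"
  unfolding quot_act_def by (rule factor_eq[OF rcoeqD(9)[OF c] b(1,2,4)])
 with b show ?thesis by (intro that[of b]) simp_all
qed

lemma quot_act_ar: "ar (quot_act C A M a E q)" "dm (quot_act C A M a E q) = A \<box> cd q" "cd (quot_act C A M a E q) = cd q"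
 and quot_act_eq: "quot_act C A M a E q oo (idt A ** q) = q oo (a ** idt E) oo iv (as A M E)"
 by (rule quot_act_ex; simp)+

lemma quot_act_as: "quot_act C A M a E q oo (idt A ** q) oo as A M E = q oo (a ** idt E)"
 using quot_act_ar rw2[OF quot_act_eq] quot_simps by (simp add: cassoc)

lemma quot_module: "md (cd q, quot_act C A M a E q)"
proof (rule mdI)
 note [simp] = quot_simps(1-14) quot_act_ar
 let ?b = "quot_act C A M a E q"
 note b3 = rw3[OF quot_act_as, simplified]
 have qe: "epi C q" by (rule rcoeqD(9)[OF q])
 have SEq: "SE q" by (rule SE_rcoeq[OF q])
 note am = md_as[OF Ma, simplified] and au = md_un[OF Ma, simplified]
 show "ob (cd q)" "ar ?b" "dm ?b = A \<box> cd q" "cd ?b = cd q" by simp_all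
 show "?b oo (idt A ** ?b) oo as A A (cd q) = ?b oo (m ** idt (cd q))"
 proof (rule epi_cancel)
  \<comment> \<open>Stability of the class \<open>SE\<close> enters here: an arbitrary epimorphism
    need not survive tensoring with \<open>A \<box> A\<close>.\<close>
  have "SE (idt (A \<box> A) ** q)" by (rule SE_tens[OF _ SEq]) simp
  then show "epi C ((idt (A \<box> A) ** q) oo as (A \<box> A) M E)"
   by (intro epi_comp SE_epi iso_epi) simp_all
  have "(?b oo (idt A ** ?b) oo as A A (cd q)) oo (idt (A \<box> A) ** q) oo as (A \<box> A) M E =
   ?b oo (idt A ** ?b) oo (idt A ** idt A ** q) oo as A A (M \<box> E) oo as (A \<box> A) M E"
   using as_n3[of "idt A" "idt A" q A A "cd q" "as (A \<box> A) M E"] by (simp add: cassoc)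
  also have "\<dots> = ?b oo (idt A ** (?b oo (idt A ** q) oo as A M E)) oo as A (A \<box> M) E oo (as A A M ** idt E)"
   by (simp add: pentagon interchange3)
  also have "\<dots> = ?b oo (idt A ** q) oo as A M E oo (((idt A ** a) oo as A A M) ** idt E)"
   unfolding quot_act_as using as_n3[of "idt A" a "idt E" A M E "as A A M ** idt E"] by (simp add: nf)
  also have "\<dots> = q oo ((a oo (idt A ** a) oo as A A M) ** idt E)"
   by (simp add: b3 nf)
  also have "\<dots> = q oo (a ** idt E) oo ((m ** idt M) ** idt E)"
   unfolding am by (simp add: nf)
  also have "\<dots> = ?b oo (idt A ** q) oo as A M E oo ((m ** idt M) ** idt E)"
   by (simp add: b3 cassoc)
  also have "\<dots> = (?b oo (m ** idt (cd q))) oo (idt (A \<box> A) ** q) oo as (A \<box> A) M E"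
   by (simp add: as_n nf)
  finally show "(?b oo (idt A ** ?b) oo as A A (cd q)) oo (idt (A \<box> A) ** q) oo as (A \<box> A) M E =
   (?b oo (m ** idt (cd q))) oo (idt (A \<box> A) ** q) oo as (A \<box> A) M E" .
 qed simp_all
 show "?b oo (e ** idt (cd q)) = lu (cd q)"
 proof (rule epi_cancel)
  have "SE (idt un ** q)" by (rule SE_tens[OF _ SEq]) simp
  then show "epi C ((idt un ** q) oo as un M E)"
   by (intro epi_comp SE_epi iso_epi) simp_all
  have "(?b oo (e ** idt (cd q))) oo (idt un ** q) oo as un M E = ?b oo (idt A ** q) oo as A M E oo ((e ** idt M) ** idt E)"
   by (simp add: as_n nf)
  also have "\<dots> = q oo ((a oo (e ** idt M)) ** idt E)" by (simp add: b3 nf)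
  also have "\<dots> = lu (cd q) oo (idt un ** q) oo as un M E" unfolding au by (simp add: lu_n3 lu_tens)
  finally show "(?b oo (e ** idt (cd q))) oo (idt un ** q) oo as un M E = lu (cd q) oo (idt un ** q) oo as un M E" .
 qed simp_all
qed

end

end

section \<open>The relative tensor product over \<open>A\<close>\<close>

context cmon_ctx
begin

abbreviation mt where "mt X Y \<equiv> mod_tens C A X Y"
abbreviation cq where "cq X Y \<equiv> relq C A X Y"

context
 fixes X Y assumes X: "md X" and Y: "md Y"
begin

text \<open>The common section inserts the unit of \<open>A\<close> between the two factors.\<close>

lemma cq_reflexive:
 "reflexive C ((snd X oo br (fst X) A) ** idt (fst Y)) ((idt (fst X) ** snd Y) oo as (fst X) A (fst Y))"
 unfolding reflexive_def
proof (intro conjI bexI)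
 note [simp] = X Y
 let ?s = "((idt (fst X) ** e) oo iv (ru (fst X))) ** idt (fst Y)"
 have 1: "(snd X oo br (fst X) A) oo (idt (fst X) ** e) oo iv (ru (fst X)) = idt (fst X)"
  by (simp add: cassoc br_n3 rw2[OF md_un[OF X]] rw2[OF lu_br])
 then show "((snd X oo br (fst X) A) ** idt (fst Y)) oo ?s = idt (cd ((snd X oo br (fst X) A) ** idt (fst Y)))"
  by (simp add: interchange)
 have "((idt (fst X) ** snd Y) oo as (fst X) A (fst Y)) oo ((idt (fst X) ** e) ** idt (fst Y)) = ru (fst X) ** idt (fst Y)"
  by (simp add: cassoc as_n interchange3 md_un triangle)
 then have "((idt (fst X) ** snd Y) oo as (fst X) A (fst Y)) oo ((idt (fst X) ** e) ** idt (fst Y)) oo (iv (ru (fst X)) ** idt (fst Y)) = idt (fst X \<box> fst Y)"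
  by (subst rw2, assumption) (simp_all add: interchange)
 then show "((idt (fst X) ** snd Y) oo as (fst X) A (fst Y)) oo ?s = idt (cd ((snd X oo br (fst X) A) ** idt (fst Y)))"
  by (simp add: interchange)
qed (use X Y in \<open>simp_all add: in_homs\<close>)

lemma cq_rcoeq:
 "rcoeq C ((snd X oo br (fst X) A) ** idt (fst Y)) ((idt (fst X) ** snd Y) oo as (fst X) A (fst Y)) (cq X Y)"
 unfolding rcoeq_def relq_def
 by (rule conjI[OF cq_reflexive someI_ex[OF coeq_exists[OF cq_reflexive]]])

lemma cq_ar [simp]: "ar (cq X Y)" "dm (cq X Y) = fst X \<box> fst Y" "epi C (cq X Y)" "SE (cq X Y)"
 using rcoeqD[OF cq_rcoeq] SE_rcoeq[OF cq_rcoeq] X Y by simp_all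

lemma cq_bal: "cq X Y oo ((snd X oo br (fst X) A) ** idt (fst Y)) = cq X Y oo (idt (fst X) ** snd Y) oo as (fst X) A (fst Y)"
 using rcoeqD(8)[OF cq_rcoeq] by simp

text \<open>The right action is the left action twisted by the symmetry; by \<open>md_swap\<close>,
  that is by commutativity of \<open>A\<close>, it commutes with the left action.\<close>

lemma cq_bimod: "snd X oo (idt A ** (snd X oo br (fst X) A)) oo as A (fst X) A = (snd X oo br (fst X) A) oo (snd X ** idt A)"
proof -
 note [simp] = X
 have "(snd X oo br (fst X) A) oo (snd X ** idt A) = snd X oo (idt A ** snd X) oo br (A \<box> fst X) A"
  by (simp add: cassoc br_n)
 also have "\<dots> = (snd X oo (idt A ** snd X) oo swp A A (fst X)) oo (idt A ** br (fst X) A) oo as A (fst X) A"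
  by (simp add: br_tens cassoc)
 also have "snd X oo (idt A ** snd X) oo swp A A (fst X) = snd X oo (idt A ** snd X)"
  using md_swap[of X "idt A" "idt A" "idt (fst X)"] by simp
 finally show ?thesis by (simp add: nf)
qed

lemma cq_cd [simp]: "cd (cq X Y) = fst (mt X Y)"
 by (simp add: mod_tens_def)

lemma mt_md [simp]: "md (mt X Y)"
 and mt_act: "snd (mt X Y) oo (idt A ** cq X Y) oo as A (fst X) (fst Y) = cq X Y oo (snd X ** idt (fst Y))"
proof -
 note s = X[folded surjective_pairing]
 have X': "md (fst X, snd X)" using X by simp
 have h: "snd X oo br (fst X) A \<in> homs C (fst X \<box> A) (fst X)" "snd Y \<in> homs C (A \<box> fst Y) (fst Y)" "ob (fst Y)"
  using X Y by (simp_all add: in_homs)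
 show "md (mt X Y)"
  unfolding mod_tens_def by (rule quot_module[OF X' A_ob h(3,1,2) cq_bimod cq_rcoeq])
 show "snd (mt X Y) oo (idt A ** cq X Y) oo as A (fst X) (fst Y) = cq X Y oo (snd X ** idt (fst Y))"
  unfolding mod_tens_def snd_conv by (rule quot_act_as[OF X' A_ob h(3,1,2) cq_bimod cq_rcoeq])
qed

lemma cq_llin: "llin (idt A) (snd X) (fst Y) (mt X Y) (cq X Y)"
 using X Y by (simp add: llin_def actn_md mt_act)

text \<open>The action on the quotient is induced from the left factor. The relation
  \<open>cq_bal\<close> turns it into the action on the right factor.\<close>

lemma cq_rlin: "rlin (idt A) (snd Y) (fst X) (mt X Y) (cq X Y)"
proof -
 note [simp] = X Y
 have "cq X Y oo (idt (fst X) ** snd Y) = snd (mt X Y) oo (idt A ** cq X Y) oo swp (fst X) A (fst Y)"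
 proof (rule iso_cancel_r)
  show "iso_arr C (as (fst X) A (fst Y))" by simp
  have "(cq X Y oo (idt (fst X) ** snd Y)) oo as (fst X) A (fst Y) = cq X Y oo ((snd X oo br (fst X) A) ** idt (fst Y))"
   by (simp add: cassoc cq_bal)
  also have "\<dots> = (snd (mt X Y) oo (idt A ** cq X Y) oo as A (fst X) (fst Y)) oo (br (fst X) A ** idt (fst Y))"
   unfolding mt_act by (simp add: nf)
  also have "\<dots> = (snd (mt X Y) oo (idt A ** cq X Y) oo swp (fst X) A (fst Y)) oo as (fst X) A (fst Y)"
   by (simp add: cassoc swp_as)
  finally show "(cq X Y oo (idt (fst X) ** snd Y)) oo as (fst X) A (fst Y) =
   (snd (mt X Y) oo (idt A ** cq X Y) oo swp (fst X) A (fst Y)) oo as (fst X) A (fst Y)" .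
 qed simp_all
 then show ?thesis by (simp add: rlin_def actn_md)
qed

text \<open>By \<open>balanced\<close> such a \<open>k\<close> coequalizes the two actions.
  Linearity of the factorization is checked after the epimorphism
  \<open>idt A ** cq X Y\<close>.\<close>

lemma cq_descend:
 assumes Z: "md Z" and k: "llin (idt A) (snd X) (fst Y) Z k" "rlin (idt A) (snd Y) (fst X) Z k"
 obtains h where "mor (mt X Y) h Z" "h oo cq X Y = k"
proof -
 note [simp] = X Y Z
 have k' [simp]: "ar k" "dm k = fst X \<box> fst Y" "cd k = fst Z"
  and l: "k oo (snd X ** idt (fst Y)) = snd Z oo (idt A ** k) oo as A (fst X) (fst Y)"
  using k(1) by (auto simp: llin_def)
 have "k oo ((snd X oo br (fst X) A) ** idt (fst Y)) = k oo (idt (fst X) ** snd Y) oo as (fst X) A (fst Y)"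
  using balanced[OF Z k] by simp
 then obtain h where h [simp]: "ar h" "dm h = fst (mt X Y)" "cd h = fst Z" and hq: "h oo cq X Y = k"
  by (rule coeq_ex[OF rcoeqD(1)[OF cq_rcoeq], rotated 2]) simp_all
 have "h oo snd (mt X Y) = snd Z oo (idt A ** h)"
 proof (rule epi_cancel)
  show "epi C ((idt A ** cq X Y) oo as A (fst X) (fst Y))"
   by (intro epi_comp iso_epi SE_epi SE_tens) simp_all
  have "(h oo snd (mt X Y)) oo (idt A ** cq X Y) oo as A (fst X) (fst Y) = (h oo cq X Y) oo (snd X ** idt (fst Y))"
   by (simp add: cassoc mt_act)
  also have "\<dots> = (snd Z oo (idt A ** h)) oo (idt A ** cq X Y) oo as A (fst X) (fst Y)"
   unfolding hq l by (simp add: nf hq)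
  finally show "(h oo snd (mt X Y)) oo (idt A ** cq X Y) oo as A (fst X) (fst Y) =
   (snd Z oo (idt A ** h)) oo (idt A ** cq X Y) oo as A (fst X) (fst Y)" .
 qed simp_all
 then have "mor (mt X Y) h Z" by (simp add: mor_iff)
 then show ?thesis using hq by (rule that)
qed

lemma cq_factor:
 assumes Z: "md Z" and k: "llin (idt A) (snd X) (fst Y) Z k" "rlin (idt A) (snd Y) (fst X) Z k"
 shows "mor (mt X Y) (factor C (cq X Y) k) Z" "factor C (cq X Y) k oo cq X Y = k"
proof -
 obtain h where h: "mor (mt X Y) h Z" "h oo cq X Y = k" by (rule cq_descend[OF assms])
 have "factor C (cq X Y) k = h" using morD[OF h(1)] h(2) by (intro factor_eq) simp_all
 then show "mor (mt X Y) (factor C (cq X Y) k) Z" "factor C (cq X Y) k oo cq X Y = k" using h by simp_all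
qed

lemma cq_pre:
 assumes "slin \<phi> \<alpha> X u" "slin \<phi>' \<alpha>' Y v"
 shows "llin \<phi> \<alpha> (cd \<alpha>') (mt X Y) (cq X Y oo (u ** v))" "rlin \<phi>' \<alpha>' (cd \<alpha>) (mt X Y) (cq X Y oo (u ** v))"
 using llin_pre[OF X mt_md cq_llin assms(1), of v] rlin_pre[OF Y mt_md cq_rlin assms(2), of u] assms
 by (simp_all add: slin_def)

end

section \<open>Transfer along generating maps\<close>

text \<open>\<open>q : E \<rightarrow> X\<close> generates the module \<open>X\<close> if \<open>A \<odot> E \<rightarrow> X\<close> is a stable epimorphism. A map of modules
 \<open>u : X \<rightarrow> Y\<close> lies over an arrow \<open>f\<close> of \<open>C\<close> if \<open>u q = q' f\<close>. Maps over the same arrow agree, so equations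
 between maps of modules follow from equations in \<open>C\<close>.\<close>

definition gen :: "'a => ('o, 'a) md => bool" where
 "gen q X \<longleftrightarrow> md X & ar q & cd q = fst X & SE (snd X oo (idt A ** q))"

definition ovr :: "'a => ('o, 'a) md => 'a => ('o, 'a) md => 'a => ('o, 'a) mdmap => bool" where
 "ovr q X q' Y f u \<longleftrightarrow> fst u = X & snd (snd u) = Y & mor X (fst (snd u)) Y & ar q & cd q = fst X &
   ar q' & cd q' = fst Y & ar f & dm f = dm q & cd f = dm q' & fst (snd u) oo q = q' oo f"

definition qt :: "'a => ('o, 'a) md => 'a => ('o, 'a) md => 'a" where
 "qt q X q' X' = cq X X' oo (q ** q')"

lemma genD: "gen q X ==> md X" "gen q X ==> ar q" "gen q X ==> cd q = fst X" "gen q X ==> SE (snd X oo (idt A ** q))"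
 by (simp_all add: gen_def)

lemma ovrI:
 "mor X u Y ==> gen q X ==> gen q' Y ==> ar f ==> dm f = dm q ==> cd f = dm q' ==> u oo q = q' oo f ==>
  ovr q X q' Y f (X, u, Y)"
 by (simp add: ovr_def gen_def)

lemma ovrE:
 assumes "ovr q X q' Y f u"
 obtains h where "u = (X, h, Y)" "mor X h Y" "ar q" "cd q = fst X" "ar q'" "cd q' = fst Y" "ar f" "dm f = dm q"
  "cd f = dm q'" "h oo q = q' oo f"
 using assms unfolding ovr_def by (cases u) auto

text \<open>By linearity, maps that agree on \<open>q\<close> agree on its extension
  \<open>A \<box> E \<rightarrow> X\<close>, which is an epimorphism.\<close>

lemma gen_cancel:
 assumes q: "gen q X" and u: "mor X u Y" and v: "mor X v Y" and e: "u oo q = v oo q" shows "u = v"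
proof (rule epi_cancel)
 note [simp] = genD(1-3)[OF q] morD(1-5)[OF u] morD(1-5)[OF v]
 show "epi C (snd X oo (idt A ** q))" by (rule SE_epi[OF genD(4)[OF q]])
 show "u oo snd X oo (idt A ** q) = v oo snd X oo (idt A ** q)"
  using rw2[OF morD(6)[OF u]] rw2[OF morD(6)[OF v]] e by (simp add: nf)
qed (use morD[OF u] morD[OF v] genD[OF q] in simp_all)

text \<open>The endpoints and the underlying arrows are compared by separate equations. Resolution
  with the rules for \<open>ovr\<close> then builds the two sides independently, and only
  \<open>f = g\<close>, an equation in \<open>C\<close>, is left for simplification.\<close>

lemma ovr_eq:
 assumes "gen q X" "ovr q X q1 Y1 f u" "ovr q X q2 Y2 g v" "q1 = q2" "Y1 = Y2" "f = g"
 shows "u = v"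
proof -
 obtain h where h: "u = (X, h, Y1)" "mor X h Y1" "h oo q = q1 oo f" by (rule ovrE[OF assms(2)])
 obtain k where k: "v = (X, k, Y2)" "mor X k Y2" "k oo q = q2 oo g" by (rule ovrE[OF assms(3)])
 have "h = k" by (rule gen_cancel[OF assms(1) h(2)]) (use h k assms(4-6) in auto)
 then show ?thesis using h k assms by simp
qed

lemma W_simps [simp]:
 "cobj W = modules C A m e" "carr W = module_maps C A m e" "cdom W (X, u, Y) = X" "ccod W (X, u, Y) = Y"
 "cid W X = (X, idt (fst X), X)" "(X', u', Y') \<bullet>\<^bsub>W\<^esub> (X, u, Y) = (X, u' oo u, Y')" "X \<odot>\<^bsub>W\<^esub> Y = mt X Y"
 "unit_obj W = (A, m)"
 by (simp_all add: mod_cat_def)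

lemma W_homs: "u \<in> homs W X Y \<longleftrightarrow> fst u = X & snd (snd u) = Y & mor X (fst (snd u)) Y"
 by (cases u) (auto simp: in_homs)

lemma W_category: "category W"
proof
 show "cdom W f \<in> cobj W" "ccod W f \<in> cobj W" if "f \<in> carr W" for f
  using that by (cases f; auto simp: mor_iff)+
 show "cid W x \<in> homs W x x" if "x \<in> cobj W" for x
  using that by (simp add: W_homs mor_id)
 show "g \<bullet>\<^bsub>W\<^esub> f \<in> homs W x z" if "f \<in> homs W x y" "g \<in> homs W y z" for f g x y z
  using that by (cases f; cases g) (auto simp: W_homs intro: mor_comp)
 show "cid W y \<bullet>\<^bsub>W\<^esub> f = f" "f \<bullet>\<^bsub>W\<^esub> cid W x = f" if "f \<in> homs W x y" for f x y
  using that by (cases f; auto simp: W_homs mor_iff)+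
 show "(h \<bullet>\<^bsub>W\<^esub> g) \<bullet>\<^bsub>W\<^esub> f = h \<bullet>\<^bsub>W\<^esub> g \<bullet>\<^bsub>W\<^esub> f" if "f \<in> homs W w x" "g \<in> homs W x y" "h \<in> homs W y z" for f g h w x y z
  using that by (cases f; cases g; cases h) (auto simp: W_homs mor_iff cassoc)
qed

lemma ovr_homs: "ovr q X q' Y f u ==> u \<in> homs W X Y"
 by (simp add: ovr_def W_homs)

lemma ovr_id: "gen q X ==> ovr q X q X (idt (dm q)) (cid W X)"
 using genD[of q X] by (auto simp: ovr_def mor_id)

lemma ovr_comp:
 assumes "ovr q X q' Y f u" "ovr q' Y q'' Z g v" shows "ovr q X q'' Z (g oo f) (v \<bullet>\<^bsub>W\<^esub> u)"
proof -
 obtain h where h: "u = (X, h, Y)" "mor X h Y" "ar q" "cd q = fst X" "ar q'" "cd q' = fst Y" "ar f" "dm f = dm q"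
  "cd f = dm q'" "h oo q = q' oo f" by (rule ovrE[OF assms(1)])
 obtain k where k: "v = (Y, k, Z)" "mor Y k Z" "ar q''" "cd q'' = fst Z" "ar g" "dm g = dm q'"
  "cd g = dm q''" "k oo q' = q'' oo g" by (rule ovrE[OF assms(2)])
 note [simp] = morD(1-5)[OF h(2)] morD(1-5)[OF k(2)] h(3-9) k(3-7)
 have "(k oo h) oo q = q'' oo g oo f" by (simp add: cassoc h(10) rw2[OF k(8)])
 then show ?thesis unfolding h(1) k(1) using mor_comp[OF h(2) k(2)] by (simp add: ovr_def)
qed

lemma W_isoI:
 assumes "gen q X" "gen q' Y" "ovr q X q' Y f u" "ovr q' Y q X g v" "g oo f = idt (dm q)" "f oo g = idt (dm q')"
 shows "u \<in> isos W X Y"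
proof (rule isosI)
 show "u \<in> homs W X Y" "v \<in> homs W Y X" using assms ovr_homs by auto
 show "v \<bullet>\<^bsub>W\<^esub> u = cid W X"
  by (rule ovr_eq[OF assms(1) ovr_comp[OF assms(3,4)] ovr_id[OF assms(1)]]) (use assms in auto)
 show "u \<bullet>\<^bsub>W\<^esub> v = cid W Y"
  by (rule ovr_eq[OF assms(2) ovr_comp[OF assms(4,3)] ovr_id[OF assms(2)]]) (use assms in auto)
qed

lemma W_iso_underlying:
 assumes "mor X u Y" "iso_arr C u" shows "(X, u, Y) \<in> isos W X Y"
proof (rule isosI)
 note [simp] = morD(1-5)[OF assms(1)] assms(2)
 have "iv u oo snd Y = snd X oo (idt A ** iv u)"
 proof (rule iso_cancel_r)
  show "iso_arr C (idt A ** u)" by simp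
  have "(iv u oo snd Y) oo (idt A ** u) = iv u oo u oo snd X"
   unfolding morD(6)[OF assms(1)] by (simp add: cassoc)
  also have "\<dots> = (snd X oo (idt A ** iv u)) oo (idt A ** u)" by (simp add: nf)
  finally show "(iv u oo snd Y) oo (idt A ** u) = (snd X oo (idt A ** iv u)) oo (idt A ** u)" .
 qed simp_all
 then have "mor Y (iv u) X" by (simp add: mor_iff)
 then show "(Y, iv u, X) \<in> homs W Y X" by (simp add: W_homs)
 show "(X, u, Y) \<in> homs W X Y" using assms by (simp add: W_homs)
qed (use assms morD[OF assms(1)] in simp_all)

lemma ovr_inv:
 assumes u: "ovr q X q' Y f u" and "u \<in> isos W X Y" and f: "iso_arr C f"
 shows "ovr q' Y q X (iv f) (inv_arr W u)"
proof -
 interpret W: category W by (rule W_category)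
 obtain h where h: "u = (X, h, Y)" "mor X h Y" "ar q" "cd q = fst X" "ar q'" "cd q' = fst Y" "ar f" "dm f = dm q"
  "cd f = dm q'" "h oo q = q' oo f" by (rule ovrE[OF u])
 have iu: "iso_arr W u" using assms(2) by (simp add: isos_iff[of u])
 note i = W.iso_inv[OF iu]
 have "inv_arr W u \<in> homs W Y X" using i h by (simp add: in_homs)
 then obtain k where k: "inv_arr W u = (Y, k, X)" "mor Y k X"
  by (cases "inv_arr W u") (auto simp: W_homs)
 note [simp] = morD(1-5)[OF h(2)] morD(1-5)[OF k(2)] h(3-9) f
 have "(Y, k, X) \<bullet>\<^bsub>W\<^esub> (X, h, Y) = cid W X"
  using i(5) unfolding k(1)[symmetric] by (simp add: h(1))
 then have kh: "k oo h = idt (fst X)" by simp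
 have "(k oo q') oo f = k oo h oo q" by (simp add: cassoc h(10))
 also have "\<dots> = q" by (simp add: rw2[OF kh])
 finally have "k oo q' = q oo iv f" by (intro iso_move_r) simp_all
 then show ?thesis unfolding k(1) by (simp add: ovr_def k(2))
qed

text \<open>For the identity the linear extension is the action itself, which is split by the unit
  of \<open>A\<close>.\<close>

lemma gen_leaf [simp]: "md X ==> gen (idt (fst X)) X"
proof -
 assume [simp]: "md X"
 have "split_epi C (snd X)"
  unfolding split_epi_def
  by (intro conjI bexI[of _ "(e ** idt (fst X)) oo iv (lu (fst X))"]) (simp_all add: in_homs rw2[OF md_un])
 then show ?thesis by (simp add: gen_def SE_split)
qed

text \<open>The linear extension of \<open>e\<close> is the right unitor. Generating the unit module
  by \<open>e\<close> instead of by an identity makes the unitors of modules lie over the unitors of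
  \<open>C\<close>.\<close>

lemma gen_unit: "gen e (A, m)"
 by (simp add: gen_def md_self m_un_r SE_split iso_split_epi)

text \<open>If a scalar acts on each factor, the two scalars act together through their product,
  after the middle interchange. For unital actions \<open>mid_linear\<close> gives the
  converse.\<close>

lemma llin_cq_mult:
 assumes Y: "md Y" and k: "llin \<phi> \<alpha> E' Y k" "rlin \<phi>' \<alpha>' E Y k" and E: "cd \<alpha> = E" "cd \<alpha>' = E'"
 shows "k oo (\<alpha> ** \<alpha>') = snd Y oo ((m oo (\<phi> ** \<phi>')) ** k) oo mid4 C (dm \<phi>) E (dm \<phi>') E'"
proof -
 note [simp] = Y E
 have k' [simp]: "actn \<phi> \<alpha>" "actn \<phi>' \<alpha>'" "ob E" "ob E'" "ar k" "dm k = E \<box> E'" "cd k = fst Y"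
  and l: "k oo (\<alpha> ** idt E') = snd Y oo (\<phi> ** k) oo as (dm \<phi>) E E'"
  and r: "k oo (idt E ** \<alpha>') = snd Y oo (\<phi>' ** k) oo swp E (dm \<phi>') E'"
  using k by (auto simp: llin_def rlin_def)
 note [simp] = actnD[OF k'(1)] actnD[OF k'(2)]
 have "k oo (\<alpha> ** \<alpha>') = (k oo (\<alpha> ** idt E')) oo (idt (dm \<phi> \<box> E) ** \<alpha>')"
  by (simp add: nf)
 also have "\<dots> = snd Y oo (\<phi> ** (k oo (idt E ** \<alpha>'))) oo as (dm \<phi>) E (dm \<phi>' \<box> E')"
  unfolding l using as_n[of "idt (dm \<phi>)" "idt E" \<alpha>' "dm \<phi>" E E'] by (simp add: nf)
 also have "\<dots> = (snd Y oo (\<phi> ** (snd Y oo (\<phi>' ** k))) oo as (dm \<phi>) (dm \<phi>') (E \<box> E')) oo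
   iv (as (dm \<phi>) (dm \<phi>') (E \<box> E')) oo (idt (dm \<phi>) ** swp E (dm \<phi>') E') oo as (dm \<phi>) E (dm \<phi>' \<box> E')"
  unfolding r by (simp add: nf)
 also have "snd Y oo (\<phi> ** (snd Y oo (\<phi>' ** k))) oo as (dm \<phi>) (dm \<phi>') (E \<box> E') = snd Y oo ((m oo (\<phi> ** \<phi>')) ** k)"
  using md_mult[OF Y, of \<phi> \<phi>' k] by simp
 also have "(snd Y oo ((m oo (\<phi> ** \<phi>')) ** k)) oo iv (as (dm \<phi>) (dm \<phi>') (E \<box> E')) oo
   (idt (dm \<phi>) ** swp E (dm \<phi>') E') oo as (dm \<phi>) E (dm \<phi>' \<box> E') =
  snd Y oo ((m oo (\<phi> ** \<phi>')) ** k) oo mid4 C (dm \<phi>) E (dm \<phi>') E'"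
  by (simp add: mid4_swp cassoc)
 finally show ?thesis .
qed

lemma SE_tens_r:
 assumes "SE p" and [simp]: "ob x" shows "SE (p ** idt x)"
proof -
 have [simp]: "ar p" using SE_epi[OF assms(1)] by (simp add: epi_def)
 have "SE (br x (cd p) oo (idt x ** p) oo br (dm p) x)"
  by (intro SE_tens SE_comp SE_split[OF iso_split_epi] assms) simp_all
 then show ?thesis by (simp add: br_n3)
qed

text \<open>The linear extensions of \<open>q\<close> and \<open>q'\<close>, tensored and followed
  by \<open>cq X X'\<close>, form a stable epimorphism from
  \<open>(A \<box> A) \<box> (E \<box> E')\<close> up to rebracketing. It factors through the
  extension of \<open>qt\<close> by multiplying the two scalars, and cancellation applies.\<close>

lemma gen_tens:
 assumes q: "gen q X" and q': "gen q' X'" shows "gen (qt q X q' X') (mt X X')"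
proof -
 note [simp] = genD(1-3)[OF q] genD(1-3)[OF q']
 let ?p = "snd X oo (idt A ** q)" and ?p' = "snd X' oo (idt A ** q')"
 have "SE (idt (cd ?p) ** ?p')" "SE (?p ** idt (dm ?p'))"
  by (intro SE_tens SE_tens_r genD(4)[OF q] genD(4)[OF q']; simp)+
 then have "SE ((idt (cd ?p) ** ?p') oo (?p ** idt (dm ?p')))" by (intro SE_comp) simp_all
 then have pp: "SE (?p ** ?p')" by (simp add: interchange)
 have "SE (cq X X' oo (?p ** ?p') oo mid4 C A A (dm q) (dm q'))"
  by (intro SE_comp pp cq_ar SE_split[OF iso_split_epi]) simp_all
 also have "cq X X' oo (?p ** ?p') oo mid4 C A A (dm q) (dm q') =
   (cq X X' oo (snd X ** snd X')) oo mid4 C A A (fst X) (fst X') oo (idt (A \<box> A) ** q ** q')"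
  using mid4_n[of "idt A" "idt A" q q' A A "fst X" "fst X'"] by (simp add: nf)
 also have "cq X X' oo (snd X ** snd X') = snd (mt X X') oo (m ** cq X X') oo mid4 C A (fst X) A (fst X')"
  using llin_cq_mult[OF mt_md cq_llin cq_rlin] by simp
 finally have "SE (snd (mt X X') oo (m ** cq X X') oo mid4 C A (fst X) A (fst X') oo mid4 C A A (fst X) (fst X') oo (idt (A \<box> A) ** q ** q'))"
  by (simp add: cassoc)
 also have "mid4 C A (fst X) A (fst X') oo mid4 C A A (fst X) (fst X') oo (idt (A \<box> A) ** q ** q') =
  (idt (A \<box> A) ** q ** q') oo mid4 C A (dm q) A (dm q') oo mid4 C A A (dm q) (dm q')"
  using mid4_n[of "idt A" "idt A" q q' A A "fst X" "fst X'"] rw2[OF mid4_n[of "idt A" q "idt A" q' A "fst X" A "fst X'"]]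
  by (simp add: cassoc)
 finally have "SE ((snd (mt X X') oo (idt A ** qt q X q' X')) oo (m ** idt (dm q \<box> dm q')) oo mid4 C A (dm q) A (dm q') oo mid4 C A A (dm q) (dm q'))"
  by (simp add: qt_def nf)
 then have "SE (snd (mt X X') oo (idt A ** qt q X q' X'))"
  by (rule SE_cancel) (simp_all add: qt_def)
 then show ?thesis by (simp add: gen_def qt_def)
qed

end

lemma (in category) isos_comp: "f \<in> isos C x y ==> g \<in> isos C y z ==> g oo f \<in> isos C x z"
 using iso_ar[of f] iso_ar[of g] by (auto simp: isos_iff)

section \<open>The structure maps of the category of modules\<close>

context cmon_ctx
begin

lemma qt_ar [simp]:
 assumes [simp]: "md X" "md X'" "ar q" "ar q'" "cd q = fst X" "cd q' = fst X'"
 shows "ar (qt q X q' X')" "dm (qt q X q' X') = dm q \<box> dm q'" "cd (qt q X q' X') = fst (mt X X')"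
 by (simp_all add: qt_def)

lemma W_tensa [simp]:
 "(X, u, Y) \<star>\<^bsub>W\<^esub> (X', u', Y') = (mt X X', factor C (cq X X') (cq Y Y' oo (u ** u')), mt Y Y')"
 by (simp add: mod_cat_def)

lemma tens_map:
 assumes u: "mor X u Y" and v: "mor X' v Y'"
 shows "mor (mt X X') (factor C (cq X X') (cq Y Y' oo (u ** v))) (mt Y Y')"
  "factor C (cq X X') (cq Y Y' oo (u ** v)) oo cq X X' = cq Y Y' oo (u ** v)"
proof -
 note [simp] = morD(1-5)[OF u] morD(1-5)[OF v]
 have "slin (idt A) (snd X) Y u" "slin (idt A) (snd X') Y' v" using u v mor_slin by simp_all
 from cq_pre[OF _ _ this] have "llin (idt A) (snd X) (fst X') (mt Y Y') (cq Y Y' oo (u ** v))"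
  "rlin (idt A) (snd X') (fst X) (mt Y Y') (cq Y Y' oo (u ** v))" by simp_all
 from cq_factor[OF _ _ _ this] show "mor (mt X X') (factor C (cq X X') (cq Y Y' oo (u ** v))) (mt Y Y')"
  "factor C (cq X X') (cq Y Y' oo (u ** v)) oo cq X X' = cq Y Y' oo (u ** v)" by simp_all
qed

lemma ovr_tens:
 assumes "ovr q X q' Y f u" "ovr r X' r' Y' g v"
 shows "ovr (qt q X r X') (mt X X') (qt q' Y r' Y') (mt Y Y') (f ** g) (u \<star>\<^bsub>W\<^esub> v)"
proof -
 obtain h where h: "u = (X, h, Y)" "mor X h Y" "ar q" "cd q = fst X" "ar q'" "cd q' = fst Y" "ar f" "dm f = dm q"
  "cd f = dm q'" "h oo q = q' oo f" by (rule ovrE[OF assms(1)])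
 obtain k where k: "v = (X', k, Y')" "mor X' k Y'" "ar r" "cd r = fst X'" "ar r'" "cd r' = fst Y'" "ar g" "dm g = dm r"
  "cd g = dm r'" "k oo r = r' oo g" by (rule ovrE[OF assms(2)])
 note [simp] = morD(1-5)[OF h(2)] morD(1-5)[OF k(2)] h(3-9) k(3-9)
 note t = tens_map[OF h(2) k(2)]
 note [simp] = morD(3-5)[OF t(1)]
 have "factor C (cq X X') (cq Y Y' oo (h ** k)) oo qt q X r X' = qt q' Y r' Y' oo (f ** g)"
  unfolding qt_def by (simp add: rw2[OF t(2)] nf h(10) k(10))
 with t(1) show ?thesis unfolding h(1) k(1) by (simp add: ovr_def)
qed

lemma ovr_leaf: "u \<in> homs W X Y ==> ovr (idt (fst X)) X (idt (fst Y)) Y (fst (snd u)) u"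
 by (auto simp: W_homs ovr_def mor_iff)

lemma W_braid: "md X ==> md Y ==> \<exists>h. braid W X Y = (mt X Y, h, mt Y X) & mor (mt X Y) h (mt Y X) &
  h oo cq X Y = cq Y X oo br (fst X) (fst Y)"
proof -
 assume [simp]: "md X" "md Y"
 have "llin (idt A) (snd X) (fst Y) (mt Y X) (cq Y X oo br (fst X) (fst Y))"
  "rlin (idt A) (snd Y) (fst X) (mt Y X) (cq Y X oo br (fst X) (fst Y))"
  using rlin_br[OF _ cq_rlin[of Y X]] llin_br[OF _ cq_llin[of Y X]] by simp_all
 note f = cq_factor[OF _ _ _ this]
 then show ?thesis by (simp add: mod_cat_def)
qed

lemma W_lun: "md X ==> \<exists>h. lun W X = (mt (A, m) X, h, X) & mor (mt (A, m) X) h X & h oo cq (A, m) X = snd X"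
proof -
 assume [simp]: "md X"
 note [simp] = md_self
 have "llin (idt A) m (fst X) X (snd X)"
  using md_as[of X] by (simp add: llin_def actn_def)
 moreover have "rlin (idt A) (snd X) A X (snd X)"
  using md_swap[of X "idt A" "idt A" "idt (fst X)"] by (simp add: rlin_def actn_def)
 ultimately have "mor (mt (A, m) X) (factor C (cq (A, m) X) (snd X)) X" "factor C (cq (A, m) X) (snd X) oo cq (A, m) X = snd X"
  using cq_factor[of "(A, m)" X X "snd X"] by simp_all
 then show ?thesis by (simp add: mod_cat_def)
qed

lemma W_run: "md X ==> \<exists>h. run W X = (mt X (A, m), h, X) & mor (mt X (A, m)) h X & h oo cq X (A, m) = snd X oo br (fst X) A"
proof -
 assume X [simp]: "md X"
 note [simp] = md_self
 obtain h where h: "mor (mt (A, m) X) h X" "h oo cq (A, m) X = snd X" using W_lun[OF X] by auto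
 obtain k where k: "mor (mt X (A, m)) k (mt (A, m) X)" "k oo cq X (A, m) = cq (A, m) X oo br (fst X) A"
  using W_braid[OF X md_self] by auto
 note [simp] = morD(3-5)[OF h(1)] morD(3-5)[OF k(1)]
 have hk: "(h oo k) oo cq X (A, m) = snd X oo br (fst X) A" by (simp add: cassoc k(2) rw2[OF h(2)])
 then have "factor C (cq X (A, m)) (snd X oo br (fst X) A) = h oo k" by (intro factor_eq) simp_all
 then show ?thesis using hk mor_comp[OF k(1) h(1)] by (simp add: mod_cat_def)
qed

lemma ovr_braid:
 assumes q: "gen q X" and r: "gen r Y"
 shows "ovr (qt q X r Y) (mt X Y) (qt r Y q X) (mt Y X) (br (dm q) (dm r)) (braid W X Y)"
proof -
 note [simp] = genD(1-3)[OF q] genD(1-3)[OF r]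
 obtain h where h: "braid W X Y = (mt X Y, h, mt Y X)" "mor (mt X Y) h (mt Y X)" "h oo cq X Y = cq Y X oo br (fst X) (fst Y)"
  using W_braid[of X Y] by auto
 note [simp] = morD(3-5)[OF h(2)]
 have "h oo qt q X r Y = qt r Y q X oo br (dm q) (dm r)"
  unfolding qt_def by (simp add: rw2[OF h(3)] cassoc br_n)
 then show ?thesis unfolding h(1) using h(2) by (simp add: ovr_def)
qed

lemma ovr_lun:
 assumes q: "gen q X"
 shows "ovr (qt e (A, m) q X) (mt (A, m) X) q X (lu (dm q)) (lun W X)"
proof -
 note [simp] = genD(1-3)[OF q] md_self
 obtain h where h: "lun W X = (mt (A, m) X, h, X)" "mor (mt (A, m) X) h X" "h oo cq (A, m) X = snd X"
  using W_lun[of X] by auto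
 note [simp] = morD(3-5)[OF h(2)]
 have "h oo qt e (A, m) q X = q oo lu (dm q)"
  unfolding qt_def by (simp add: rw2[OF h(3)] md_unit)
 then show ?thesis unfolding h(1) using h(2) by (simp add: ovr_def)
qed

lemma ovr_run:
 assumes q: "gen q X"
 shows "ovr (qt q X e (A, m)) (mt X (A, m)) q X (ru (dm q)) (run W X)"
proof -
 note [simp] = genD(1-3)[OF q] md_self
 obtain h where h: "run W X = (mt X (A, m), h, X)" "mor (mt X (A, m)) h X" "h oo cq X (A, m) = snd X oo br (fst X) A"
  using W_run[of X] by auto
 note [simp] = morD(3-5)[OF h(2)]
 have "h oo qt q X e (A, m) = snd X oo (e ** q) oo br (dm q) un"
  unfolding qt_def by (simp add: rw2[OF h(3)] br_n cassoc)
 also have "\<dots> = q oo ru (dm q)" by (simp add: rw2[OF md_unit] cassoc lu_br)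
 finally show ?thesis unfolding h(1) using h(2) by (simp add: ovr_def)
qed

lemma iso_coeq:
 assumes q: "is_coeq C f g q" and i: "iso_arr C i" "dm i = cd q" and f: "ar f" "ar g" "dm g = dm f" "cd g = cd f"
 shows "is_coeq C f g (i oo q)"
 unfolding is_coeq_def
proof (intro conjI allI ballI impI)
 note q' [simp] = is_coeqD(1,2)[OF q f(1)] and [simp] = f i iso_ar[OF i(1)]
 show "i oo q \<in> homs C (cd f) (cd (i oo q))" by (simp add: in_homs)
 show "(i oo q) oo f = (i oo q) oo g" by (simp add: cassoc is_coeqD(3)[OF q f(1)])
 fix y k assume "k \<in> homs C (cd f) y" and kk: "k oo f = k oo g"
 then have k [simp]: "ar k" "dm k = cd f" "cd k = y" by (auto simp: in_homs)
 obtain h where h [simp]: "ar h" "dm h = cd q" "cd h = cd k" and hq: "h oo q = k" by (rule coeq_ex[OF q k(1,2) kk])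
 show "\<exists>!h. h \<in> homs C (cd (i oo q)) y & h oo i oo q = k"
 proof (rule ex1I[of _ "h oo iv i"])
  show "h oo iv i \<in> homs C (cd (i oo q)) y & (h oo iv i) oo i oo q = k"
   using hq by (simp add: in_homs cassoc)
  fix l assume l: "l \<in> homs C (cd (i oo q)) y & l oo i oo q = k"
  then have [simp]: "ar l" "dm l = cd i" "cd l = y" and lq: "l oo i oo q = k" by (auto simp: in_homs)
  have "(l oo i) oo q = h oo q" by (simp add: cassoc hq lq)
  then have "l oo i = h" by (rule epi_cancel[OF coeq_epi[OF q f]]) simp_all
  then show "l = h oo iv i" by (intro iso_move_r) simp_all
 qed
qed

lemma tens_r_coeq:
 assumes x [simp]: "ob x" and q: "rcoeq C f g q"
 shows "is_coeq C (f ** idt x) (g ** idt x) (q ** idt x)"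
proof -
 note [simp] = rcoeqD(2-7)[OF q]
 show ?thesis
 proof (rule coeq_iso[where i = "br (dm f) x" and j = "br x (cd f)"])
  show "is_coeq C (idt x ** f) (idt x ** g) (br x (cd q) oo (idt x ** q))"
   by (rule iso_coeq[OF rcoeqD(1)[OF tens_rcoeq[OF x q]]]) simp_all
 qed (simp_all add: br_n3 br_n)
qed

context
 fixes X Y Z assumes X: "md X" and Y: "md Y" and Z: "md Z"
begin

text \<open>The descent is done in two stages. Tensoring with \<open>Z\<close> preserves the
  coequalizer \<open>cq X Y\<close>, which gives a map on \<open>(X \<otimes> Y) \<odot> Z\<close>;
  that map is then shown to be linear in both variables.\<close>

lemma assoc_descend:
 obtains h where "mor (mt (mt X Y) Z) h (mt X (mt Y Z))"
  "h oo cq (mt X Y) Z oo (cq X Y ** idt (fst Z)) =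
   cq X (mt Y Z) oo (idt (fst X) ** cq Y Z) oo as (fst X) (fst Y) (fst Z)"
proof -
 note [simp] = X Y Z
 let ?x = "fst X" and ?y = "fst Y" and ?z = "fst Z"
 let ?V = "mt X (mt Y Z)" and ?c = "cq X (mt Y Z)" and ?d = "cq Y Z"
 let ?k = "?c oo (idt ?x ** ?d) oo as ?x ?y ?z"
 note dl = mt_act[OF Y Z]
 have dr: "?d oo (idt ?y ** snd Z) = snd (mt Y Z) oo (idt A ** ?d) oo swp ?y A ?z"
  using cq_rlin[OF Y Z] by (simp add: rlin_def)
 note cl = mt_act[OF X mt_md[OF Y Z]]
 have cr: "?c oo (idt ?x ** snd (mt Y Z)) = snd ?V oo (idt A ** ?c) oo swp ?x A (fst (mt Y Z))"
  using cq_rlin[OF X mt_md[OF Y Z]] by (simp add: rlin_def)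
 \<comment> \<open>A scalar between \<open>X\<close> and \<open>Y\<close> passes into
   \<open>Y\<close>, hence into \<open>Y \<otimes> Z\<close> by linearity of \<open>cq Y Z\<close>,
   and from there to \<open>X\<close> by the relation defining the outer quotient.\<close>
 have "?k oo (((snd X oo br ?x A) ** idt ?y) ** idt ?z) = ?k oo (((idt ?x ** snd Y) oo as ?x A ?y) ** idt ?z)"
 proof -
  have "?k oo (((idt ?x ** snd Y) oo as ?x A ?y) ** idt ?z) =
   ?c oo (idt ?x ** ?d) oo as ?x ?y ?z oo ((idt ?x ** snd Y) ** idt ?z) oo (as ?x A ?y ** idt ?z)"
   by (simp add: nf)
  also have "\<dots> = ?c oo (idt ?x ** (?d oo (snd Y ** idt ?z))) oo as ?x (A \<box> ?y) ?z oo (as ?x A ?y ** idt ?z)"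
   by (simp add: as_n3 interchange3)
  also have "\<dots> = ?c oo (idt ?x ** snd (mt Y Z)) oo (idt ?x ** idt A ** ?d) oo
    (idt ?x ** as A ?y ?z) oo as ?x (A \<box> ?y) ?z oo (as ?x A ?y ** idt ?z)"
   unfolding dl[symmetric] by (simp add: interchange3)
  also have "\<dots> = ?c oo (idt ?x ** snd (mt Y Z)) oo (idt ?x ** idt A ** ?d) oo as ?x A (?y \<box> ?z) oo as (?x \<box> A) ?y ?z"
   by (simp add: pentagon)
  also have "\<dots> = (?c oo (idt ?x ** snd (mt Y Z)) oo as ?x A (fst (mt Y Z))) oo (idt (?x \<box> A) ** ?d) oo as (?x \<box> A) ?y ?z"
   using as_n3[of "idt ?x" "idt A" ?d ?x A "fst (mt Y Z)" "as (?x \<box> A) ?y ?z"] by (simp add: cassoc)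
  also have "\<dots> = ?c oo (idt ?x ** ?d) oo ((snd X oo br ?x A) ** idt (?y \<box> ?z)) oo as (?x \<box> A) ?y ?z"
   unfolding cq_bal[OF X mt_md[OF Y Z], symmetric] by (simp add: nf)
  also have "\<dots> = ?k oo (((snd X oo br ?x A) ** idt ?y) ** idt ?z)"
   by (simp add: cassoc as_n)
  finally show ?thesis by simp
 qed
 then obtain k1 where k1 [simp]: "ar k1" "dm k1 = fst (mt X Y) \<box> ?z" "cd k1 = fst ?V" and k1q: "k1 oo (cq X Y ** idt ?z) = ?k"
  by (rule coeq_ex[OF tens_r_coeq[OF md_ar(1)[OF Z] cq_rcoeq[OF X Y]], rotated 2]) simp_all
 have "llin (idt A) (snd (mt X Y)) ?z ?V k1"
 proof -
  have "k1 oo (snd (mt X Y) ** idt ?z) = snd ?V oo (idt A ** k1) oo as A (fst (mt X Y)) ?z"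
  proof (rule epi_cancel)
   let ?e = "((idt A ** cq X Y) ** idt ?z) oo (as A ?x ?y ** idt ?z)"
   show "epi C ?e" by (intro epi_comp iso_epi SE_epi SE_tens SE_tens_r) simp_all
   have "(k1 oo (snd (mt X Y) ** idt ?z)) oo ?e = k1 oo ((snd (mt X Y) oo (idt A ** cq X Y) oo as A ?x ?y) ** idt ?z)"
    by (simp add: nf)
   also have "\<dots> = (k1 oo (cq X Y ** idt ?z)) oo ((snd X ** idt ?y) ** idt ?z)"
    unfolding mt_act[OF X Y] by (simp add: nf)
   also have "\<dots> = (?c oo (snd X ** idt (fst (mt Y Z)))) oo (idt (A \<box> ?x) ** ?d) oo as (A \<box> ?x) ?y ?z"
    unfolding k1q by (simp add: nf as_n)
   also have "\<dots> = snd ?V oo (idt A ** ?c) oo as A ?x (fst (mt Y Z)) oo (idt (A \<box> ?x) ** ?d) oo as (A \<box> ?x) ?y ?z"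
    unfolding cl[symmetric] by (simp add: cassoc)
   also have "\<dots> = snd ?V oo (idt A ** ?c) oo (idt A ** idt ?x ** ?d) oo as A ?x (?y \<box> ?z) oo as (A \<box> ?x) ?y ?z"
    using as_n3[of "idt A" "idt ?x" ?d A ?x "fst (mt Y Z)" "as (A \<box> ?x) ?y ?z"] by simp
   also have "\<dots> = snd ?V oo (idt A ** ?k) oo as A (?x \<box> ?y) ?z oo (as A ?x ?y ** idt ?z)"
    by (simp add: pentagon interchange3)
   also have "\<dots> = (snd ?V oo (idt A ** k1) oo as A (fst (mt X Y)) ?z) oo ?e"
    unfolding k1q[symmetric] by (simp add: cassoc as_n3 interchange3)
   finally show "(k1 oo (snd (mt X Y) ** idt ?z)) oo ?e = (snd ?V oo (idt A ** k1) oo as A (fst (mt X Y)) ?z) oo ?e" .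
  qed simp_all
  then show ?thesis by (simp add: llin_def actn_md)
 qed
 moreover have "rlin (idt A) (snd Z) (fst (mt X Y)) ?V k1"
 proof -
  have "k1 oo (idt (fst (mt X Y)) ** snd Z) = snd ?V oo (idt A ** k1) oo swp (fst (mt X Y)) A ?z"
  proof (rule epi_cancel)
   let ?e = "cq X Y ** idt (A \<box> ?z)"
   show "epi C ?e" by (intro SE_epi SE_tens_r) simp_all
   have "(k1 oo (idt (fst (mt X Y)) ** snd Z)) oo ?e = (k1 oo (cq X Y ** idt ?z)) oo (idt (?x \<box> ?y) ** snd Z)"
    by (simp add: nf)
   also have "\<dots> = ?c oo (idt ?x ** (?d oo (idt ?y ** snd Z))) oo as ?x ?y (A \<box> ?z)"
    unfolding k1q using as_n[of "idt ?x" "idt ?y" "snd Z" ?x ?y ?z] by (simp add: nf)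
   also have "\<dots> = (?c oo (idt ?x ** snd (mt Y Z))) oo (idt ?x ** idt A ** ?d) oo (idt ?x ** swp ?y A ?z) oo as ?x ?y (A \<box> ?z)"
    unfolding dr by (simp add: nf)
   also have "\<dots> = snd ?V oo (idt A ** ?c) oo (idt A ** idt ?x ** ?d) oo swp ?x A (?y \<box> ?z) oo (idt ?x ** swp ?y A ?z) oo as ?x ?y (A \<box> ?z)"
    unfolding cr by (simp add: cassoc swp_n3)
   also have "\<dots> = snd ?V oo (idt A ** ?k) oo swp (?x \<box> ?y) A ?z"
    by (simp add: swp_tens[symmetric] interchange3)
   also have "\<dots> = (snd ?V oo (idt A ** k1) oo swp (fst (mt X Y)) A ?z) oo ?e"
    unfolding k1q[symmetric] using swp_n[of "cq X Y" "idt A" "idt ?z" "fst (mt X Y)" A ?z]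
    by (simp add: cassoc interchange3)
   finally show "(k1 oo (idt (fst (mt X Y)) ** snd Z)) oo ?e = (snd ?V oo (idt A ** k1) oo swp (fst (mt X Y)) A ?z) oo ?e" .
  qed simp_all
  then show ?thesis by (simp add: rlin_def actn_md)
 qed
 ultimately obtain h where h: "mor (mt (mt X Y) Z) h ?V" "h oo cq (mt X Y) Z = k1"
  by (rule cq_descend[OF mt_md[OF X Y] Z mt_md[OF X mt_md[OF Y Z]]])
 note [simp] = morD(3-5)[OF h(1)]
 have "h oo cq (mt X Y) Z oo (cq X Y ** idt ?z) = ?k" by (simp add: rw2[OF h(2)] k1q)
 with h(1) show ?thesis by (rule that)
qed

lemma W_assoc:
 "\<exists>h. assoc W X Y Z = (mt (mt X Y) Z, h, mt X (mt Y Z)) & mor (mt (mt X Y) Z) h (mt X (mt Y Z)) &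
  h oo cq (mt X Y) Z oo (cq X Y ** idt (fst Z)) =
   cq X (mt Y Z) oo (idt (fst X) ** cq Y Z) oo as (fst X) (fst Y) (fst Z)"
proof -
 note [simp] = X Y Z
 obtain h where h: "mor (mt (mt X Y) Z) h (mt X (mt Y Z))"
  "h oo cq (mt X Y) Z oo (cq X Y ** idt (fst Z)) =
   cq X (mt Y Z) oo (idt (fst X) ** cq Y Z) oo as (fst X) (fst Y) (fst Z)" by (rule assoc_descend)
 note [simp] = morD(3-5)[OF h(1)]
 have "factor C (cq (mt X Y) Z oo (cq X Y ** idt (fst Z)))
   (cq X (mt Y Z) oo (idt (fst X) ** cq Y Z) oo as (fst X) (fst Y) (fst Z)) = h"
  by (rule factor_eq) (use h(2) in \<open>simp_all add: epi_comp SE_epi SE_tens_r\<close>)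
 then show ?thesis using h by (simp add: mod_cat_def)
qed

end

lemma ovr_assoc:
 assumes q: "gen q X" and r: "gen r Y" and s: "gen s Z"
 shows "ovr (qt (qt q X r Y) (mt X Y) s Z) (mt (mt X Y) Z) (qt q X (qt r Y s Z) (mt Y Z)) (mt X (mt Y Z))
  (as (dm q) (dm r) (dm s)) (assoc W X Y Z)"
proof -
 note [simp] = genD(1-3)[OF q] genD(1-3)[OF r] genD(1-3)[OF s]
 obtain h where h: "assoc W X Y Z = (mt (mt X Y) Z, h, mt X (mt Y Z))" "mor (mt (mt X Y) Z) h (mt X (mt Y Z))"
  "h oo cq (mt X Y) Z oo (cq X Y ** idt (fst Z)) =
   cq X (mt Y Z) oo (idt (fst X) ** cq Y Z) oo as (fst X) (fst Y) (fst Z)"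
  using W_assoc[of X Y Z] by auto
 note [simp] = morD(3-5)[OF h(2)]
 have "h oo qt (qt q X r Y) (mt X Y) s Z = (h oo cq (mt X Y) Z oo (cq X Y ** idt (fst Z))) oo ((q ** r) ** s)"
  unfolding qt_def by (simp add: nf)
 also have "\<dots> = qt q X (qt r Y s Z) (mt Y Z) oo as (dm q) (dm r) (dm s)"
  unfolding h(3) qt_def by (simp add: nf as_n)
 finally show ?thesis unfolding h(1) using h(2) by (simp add: ovr_def)
qed

lemmas W_obj = W_simps(1,7,8)
lemmas gen_rules = gen_tens gen_unit gen_leaf
text \<open>Applied by resolution, these rules read off from a composite of structure maps of
  modules the arrow of \<open>C\<close> below it.\<close>

lemmas ovr_rules = ovr_comp ovr_tens ovr_assoc ovr_lun ovr_run ovr_braid ovr_id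

text \<open>The extra degeneracy of the bar construction: inserting the unit in front splits
  \<open>A \<box> A \<box> X \<rightarrow> A \<box> X \<rightarrow> X\<close>, so that the action is
  a split coequalizer.\<close>

lemma bar_split:
 assumes [simp]: "md X" "ar k" "dm k = A \<box> fst X"
  and k: "k oo (idt A ** snd X) oo as A A (fst X) = k oo (m ** idt (fst X))"
 shows "k oo (e ** idt (fst X)) oo iv (lu (fst X)) oo snd X = k"
proof -
 have "iv (lu (fst X)) oo snd X = (idt un ** snd X) oo iv (lu (A \<box> fst X))"
  by (rule iso_cancel_l[of "lu (fst X)"]) (simp_all add: lu_n3)
 also have "iv (lu (A \<box> fst X)) = as un A (fst X) oo (iv (lu A) ** idt (fst X))"
  by (rule iso_cancel_l[of "lu (A \<box> fst X)"]) (simp_all add: rw2[OF lu_tens] interchange)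
 finally have "k oo (e ** idt (fst X)) oo iv (lu (fst X)) oo snd X =
  k oo (idt A ** snd X) oo (e ** idt (A \<box> fst X)) oo as un A (fst X) oo (iv (lu A) ** idt (fst X))"
  by (simp add: interchange3)
 also have "\<dots> = k oo (idt A ** snd X) oo as A A (fst X) oo ((e ** idt A) ** idt (fst X)) oo (iv (lu A) ** idt (fst X))"
  by (simp add: as_n3)
 also have "\<dots> = k oo ((m oo (e ** idt A)) ** idt (fst X)) oo (iv (lu A) ** idt (fst X))"
  by (simp add: rw3[OF k] nf)
 also have "\<dots> = k" unfolding m_un by (simp add: interchange)
 finally show ?thesis .
qed

lemma W_lun_iso:
 assumes [simp]: "md X" shows "lun W X \<in> isos W (mt (A, m) X) X"
proof -
 note [simp] = md_self
 obtain h where h: "lun W X = (mt (A, m) X, h, X)" "mor (mt (A, m) X) h X" "h oo cq (A, m) X = snd X"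
  using W_lun[of X] by auto
 note [simp] = morD(3-5)[OF h(2)]
 \<comment> \<open>The candidate inverse sends x to the class of 1 \<otimes> x.\<close>
 let ?g = "cq (A, m) X oo (e ** idt (fst X)) oo iv (lu (fst X))"
 have 1: "h oo ?g = idt (fst X)" by (simp add: rw2[OF h(3)] rw2[OF md_un])
 have b: "cq (A, m) X oo (idt A ** snd X) oo as A A (fst X) = cq (A, m) X oo (m ** idt (fst X))"
  using cq_bal[of "(A, m)" X] m_br by simp
 have e: "(?g oo h) oo cq (A, m) X = idt (cd (cq (A, m) X)) oo cq (A, m) X"
  using bar_split[OF _ _ _ b] by (simp add: cassoc h(3))
 have 2: "?g oo h = idt (cd (cq (A, m) X))" by (rule epi_cancel[OF _ e]) simp_all
 show ?thesis unfolding h(1)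
  by (rule W_iso_underlying[OF h(2)], rule iso_arrI[of _ ?g]) (use 1 2 in simp_all)
qed

lemma W_braid_iso: "md X ==> md Y ==> braid W X Y \<in> isos W (mt X Y) (mt Y X)"
 by (rule W_isoI[where v = "braid W Y X"]) ((rule gen_rules ovr_rules | assumption | simp)+)

lemma W_run_iso:
 assumes X: "md X" shows "run W X \<in> isos W (mt X (A, m)) X"
proof -
 interpret W: category W by (rule W_category)
 have "run W X = lun W X \<bullet>\<^bsub>W\<^esub> braid W X (A, m)"
 proof (rule ovr_eq)
  show "gen (qt (idt (fst X)) X e (A, m)) (mt X (A, m))" using X by (intro gen_rules)
 qed ((rule gen_rules ovr_rules X | simp add: X md_self lu_br)+)
 moreover have "lun W X \<bullet>\<^bsub>W\<^esub> braid W X (A, m) \<in> isos W (mt X (A, m)) X"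
  by (rule W.isos_comp[OF W_braid_iso[OF X md_self] W_lun_iso[OF X]])
 ultimately show ?thesis by simp
qed

text \<open>The inverse is assembled from an associator and braidings of modules, so nothing has to
  be descended in the opposite direction. The equation below it is
  \<open>as_inverse\<close>.\<close>

lemma W_assoc_iso:
 assumes [simp]: "md X" "md Y" "md Z" shows "assoc W X Y Z \<in> isos W (mt (mt X Y) Z) (mt X (mt Y Z))"
proof (rule W_isoI)
 let ?x = "idt (fst X)" and ?y = "idt (fst Y)" and ?z = "idt (fst Z)"
 show "gen (qt (qt ?x X ?y Y) (mt X Y) ?z Z) (mt (mt X Y) Z)" "gen (qt ?x X (qt ?y Y ?z Z) (mt Y Z)) (mt X (mt Y Z))"
  by (intro gen_tens; simp)+
 show "ovr (qt (qt ?x X ?y Y) (mt X Y) ?z Z) (mt (mt X Y) Z) (qt ?x X (qt ?y Y ?z Z) (mt Y Z)) (mt X (mt Y Z))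
  (as (dm ?x) (dm ?y) (dm ?z)) (assoc W X Y Z)" by (rule ovr_assoc; simp)
 show "ovr (qt ?x X (qt ?y Y ?z Z) (mt Y Z)) (mt X (mt Y Z)) (qt (qt ?x X ?y Y) (mt X Y) ?z Z) (mt (mt X Y) Z)
  ((br (dm ?y) (dm ?x) ** idt (dm ?z)) oo br (dm ?z) (dm (qt ?y Y ?x X)) oo as (dm ?z) (dm ?y) (dm ?x) oo
   (br (dm ?y) (dm ?z) ** idt (dm ?x)) oo br (dm ?x) (dm (qt ?y Y ?z Z)))
  ((braid W Y X \<star>\<^bsub>W\<^esub> cid W Z) \<bullet>\<^bsub>W\<^esub> braid W Z (mt Y X) \<bullet>\<^bsub>W\<^esub> assoc W Z Y X \<bullet>\<^bsub>W\<^esub>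
   (braid W Y Z \<star>\<^bsub>W\<^esub> cid W X) \<bullet>\<^bsub>W\<^esub> braid W X (mt Y Z))"
  by (rule gen_rules ovr_rules assms)+
qed (simp_all add: as_inverse)

lemma W_sym_mon: "sym_mon_cat W"
proof -
 interpret W: category W by (rule W_category)
 show ?thesis
 proof (unfold_locales, unfold W_obj)
  show "mt x y \<in> modules C A m e" if "md x" "md y" for x y using that by simp
  show "(A, m) \<in> modules C A m e" by (rule md_self)
  show "f \<star>\<^bsub>W\<^esub> g \<in> homs W (mt x y) (mt x' y')" if "f \<in> homs W x x'" "g \<in> homs W y y'" for f x x' g y y'
   using ovr_homs[OF ovr_tens[OF ovr_leaf[OF that(1)] ovr_leaf[OF that(2)]]] .
  show "cid W x \<star>\<^bsub>W\<^esub> cid W y = cid W (mt x y)" if "md x" "md y" for x y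
  proof (rule ovr_eq)
   show "gen (qt (idt (fst x)) x (idt (fst y)) y) (mt x y)" using that by (intro gen_rules)
  qed ((rule gen_rules ovr_rules that | simp add: that)+)
  show "(g \<bullet>\<^bsub>W\<^esub> f) \<star>\<^bsub>W\<^esub> (g' \<bullet>\<^bsub>W\<^esub> f') = (g \<star>\<^bsub>W\<^esub> g') \<bullet>\<^bsub>W\<^esub> f \<star>\<^bsub>W\<^esub> f'"
   if f: "f \<in> homs W x y" "g \<in> homs W y z" "f' \<in> homs W x' y'" "g' \<in> homs W y' z'" for f x y g z f' x' y' g' z'
  proof -
   note l = f[THEN ovr_leaf]
   show ?thesis
    by (rule ovr_eq[OF gen_tens[OF gen_leaf gen_leaf] ovr_tens[OF ovr_comp[OF l(1,2)] ovr_comp[OF l(3,4)]]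
      ovr_comp[OF ovr_tens[OF l(1,3)] ovr_tens[OF l(2,4)]]]) (use f in \<open>auto simp: W_homs mor_iff interchange\<close>)
  qed
  show "assoc W x y z \<in> isos W (mt (mt x y) z) (mt x (mt y z))" if "md x" "md y" "md z" for x y z
   using that by (rule W_assoc_iso)
  show "lun W x \<in> isos W (mt (A, m) x) x" "run W x \<in> isos W (mt x (A, m)) x" if "md x" for x
   using that by (rule W_lun_iso W_run_iso)+
  show "braid W x y \<in> isos W (mt x y) (mt y x)" if "md x" "md y" for x y
   using that by (rule W_braid_iso)
  show "assoc W x' y' z' \<bullet>\<^bsub>W\<^esub> (f \<star>\<^bsub>W\<^esub> g) \<star>\<^bsub>W\<^esub> h = f \<star>\<^bsub>W\<^esub> g \<star>\<^bsub>W\<^esub> h \<bullet>\<^bsub>W\<^esub> assoc W x y z"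
   if f: "f \<in> homs W x x'" "g \<in> homs W y y'" "h \<in> homs W z z'" for f x x' g y y' h z z'
  proof -
   note l = f[THEN ovr_leaf]
   show ?thesis
    by (rule ovr_eq[OF gen_tens[OF gen_tens[OF gen_leaf gen_leaf] gen_leaf]
      ovr_comp[OF ovr_tens[OF ovr_tens[OF l(1,2)] l(3)] ovr_assoc[OF gen_leaf gen_leaf gen_leaf]]
      ovr_comp[OF ovr_assoc[OF gen_leaf gen_leaf gen_leaf] ovr_tens[OF l(1) ovr_tens[OF l(2,3)]]]])
     (use f in \<open>auto simp: W_homs mor_iff as_n\<close>)
  qed
  show "lun W y \<bullet>\<^bsub>W\<^esub> cid W (A, m) \<star>\<^bsub>W\<^esub> f = f \<bullet>\<^bsub>W\<^esub> lun W x" if f: "f \<in> homs W x y" for f x y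
   by (rule ovr_eq[OF gen_tens[OF gen_unit gen_leaf] ovr_comp[OF ovr_tens[OF ovr_id[OF gen_unit] ovr_leaf[OF f]] ovr_lun[OF gen_leaf]]
     ovr_comp[OF ovr_lun[OF gen_leaf] ovr_leaf[OF f]]]) (use f in \<open>auto simp: W_homs mor_iff lu_n\<close>)
  show "run W y \<bullet>\<^bsub>W\<^esub> f \<star>\<^bsub>W\<^esub> cid W (A, m) = f \<bullet>\<^bsub>W\<^esub> run W x" if f: "f \<in> homs W x y" for f x y
   by (rule ovr_eq[OF gen_tens[OF gen_leaf gen_unit] ovr_comp[OF ovr_tens[OF ovr_leaf[OF f] ovr_id[OF gen_unit]] ovr_run[OF gen_leaf]]
     ovr_comp[OF ovr_run[OF gen_leaf] ovr_leaf[OF f]]]) (use f in \<open>auto simp: W_homs mor_iff ru_n\<close>)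
  show "braid W x' y' \<bullet>\<^bsub>W\<^esub> f \<star>\<^bsub>W\<^esub> g = g \<star>\<^bsub>W\<^esub> f \<bullet>\<^bsub>W\<^esub> braid W x y"
   if f: "f \<in> homs W x x'" "g \<in> homs W y y'" for f x x' g y y'
  proof -
   note l = f[THEN ovr_leaf]
   show ?thesis
    by (rule ovr_eq[OF gen_tens[OF gen_leaf gen_leaf] ovr_comp[OF ovr_tens[OF l] ovr_braid[OF gen_leaf gen_leaf]]
      ovr_comp[OF ovr_braid[OF gen_leaf gen_leaf] ovr_tens[OF l(2,1)]]]) (use f in \<open>auto simp: W_homs mor_iff br_n\<close>)
  qed
  show "assoc W w x (mt y z) \<bullet>\<^bsub>W\<^esub> assoc W (mt w x) y z =
    cid W w \<star>\<^bsub>W\<^esub> assoc W x y z \<bullet>\<^bsub>W\<^esub> assoc W w (mt x y) z \<bullet>\<^bsub>W\<^esub> assoc W w x y \<star>\<^bsub>W\<^esub> cid W z"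
   if m: "md w" "md x" "md y" "md z" for w x y z
  proof (rule ovr_eq)
   show "gen (qt (qt (qt (idt (fst w)) w (idt (fst x)) x) (mt w x) (idt (fst y)) y) (mt (mt w x) y) (idt (fst z)) z)
    (mt (mt (mt w x) y) z)" by (intro gen_rules m)
  qed ((rule gen_rules ovr_rules m)+, simp_all add: m pentagon)
  show "cid W x \<star>\<^bsub>W\<^esub> lun W y \<bullet>\<^bsub>W\<^esub> assoc W x (A, m) y = run W x \<star>\<^bsub>W\<^esub> cid W y"
   if m: "md x" "md y" for x y
  proof (rule ovr_eq)
   show "gen (qt (qt (idt (fst x)) x e (A, m)) (mt x (A, m)) (idt (fst y)) y) (mt (mt x (A, m)) y)" by (intro gen_rules m)
  qed ((rule gen_rules ovr_rules m)+, simp_all add: m triangle)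
  show "cid W y \<star>\<^bsub>W\<^esub> braid W x z \<bullet>\<^bsub>W\<^esub> assoc W y x z \<bullet>\<^bsub>W\<^esub> braid W x y \<star>\<^bsub>W\<^esub> cid W z =
    assoc W y z x \<bullet>\<^bsub>W\<^esub> braid W x (mt y z) \<bullet>\<^bsub>W\<^esub> assoc W x y z" if m: "md x" "md y" "md z" for x y z
  proof (rule ovr_eq)
   show "gen (qt (qt (idt (fst x)) x (idt (fst y)) y) (mt x y) (idt (fst z)) z) (mt (mt x y) z)" by (intro gen_rules m)
  qed ((rule gen_rules ovr_rules m)+, simp_all add: m hexagon)
  show "braid W y x \<bullet>\<^bsub>W\<^esub> braid W x y = cid W (mt x y)" if m: "md x" "md y" for x y
  proof (rule ovr_eq)
   show "gen (qt (idt (fst x)) x (idt (fst y)) y) (mt x y)" by (intro gen_rules m)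
  qed ((rule gen_rules ovr_rules m)+, simp_all add: m)
 qed
qed

end

section \<open>Base change\<close>

context cmon_ctx
begin

text \<open>\<open>j : E \<rightarrow> X\<close> exhibits \<open>X\<close> as \<open>A \<otimes>\<^sub>P E\<close> for an action \<open>\<alpha>\<close> of \<open>P\<close> on \<open>E\<close> and \<open>\<phi> : P \<rightarrow> A\<close>.\<close>

definition base_change :: "'a => 'a => 'a => ('o, 'a) md => bool" where
 "base_change \<phi> \<alpha> j X \<longleftrightarrow> md X & slin \<phi> \<alpha> X j &
   rcoeq C ((m oo (idt A ** \<phi>)) ** idt (cd \<alpha>)) ((idt A ** \<alpha>) oo as A (dm \<phi>) (cd \<alpha>)) (snd X oo (idt A ** j))"

text \<open>The part of being a module over the source of \<open>\<phi>\<close> that is asked of an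
  action. The unit makes the pair defining the base change reflexive, and it separates the two
  factors in \<open>mid_linear\<close>.\<close>

definition unital :: "'a => 'a => bool" where
 "unital \<phi> \<alpha> \<longleftrightarrow> actn \<phi> \<alpha> & (\<exists>u \<in> homs C un (dm \<phi>). \<phi> oo u = e & \<alpha> oo (u ** idt (cd \<alpha>)) = lu (cd \<alpha>))"

lemma slinD:
 assumes "slin \<phi> \<alpha> Y k"
 shows "actn \<phi> \<alpha>" "ar k" "dm k = cd \<alpha>" "cd k = fst Y" "k oo \<alpha> = snd Y oo (\<phi> ** k)"
 using assms by (auto simp: slin_def)

lemma llinD:
 assumes "llin \<phi> \<alpha> E' Y k"
 shows "actn \<phi> \<alpha>" "ob E'" "ar k" "dm k = cd \<alpha> \<box> E'" "cd k = fst Y"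
  "k oo (\<alpha> ** idt E') = snd Y oo (\<phi> ** k) oo as (dm \<phi>) (cd \<alpha>) E'"
 using assms by (auto simp: llin_def)

lemma rlinD:
 assumes "rlin \<phi> \<alpha> E Y k"
 shows "actn \<phi> \<alpha>" "ob E" "ar k" "dm k = E \<box> cd \<alpha>" "cd k = fst Y"
  "k oo (idt E ** \<alpha>) = snd Y oo (\<phi> ** k) oo swp E (dm \<phi>) (cd \<alpha>)"
 using assms by (auto simp: rlin_def)

lemma base_changeD:
 assumes "base_change \<phi> \<alpha> j X"
 shows "md X" "slin \<phi> \<alpha> X j"
  "rcoeq C ((m oo (idt A ** \<phi>)) ** idt (cd \<alpha>)) ((idt A ** \<alpha>) oo as A (dm \<phi>) (cd \<alpha>)) (snd X oo (idt A ** j))"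
 using assms by (auto simp: base_change_def)

lemma base_change_reflexive:
 assumes "unital \<phi> \<alpha>"
 shows "reflexive C ((m oo (idt A ** \<phi>)) ** idt (cd \<alpha>)) ((idt A ** \<alpha>) oo as A (dm \<phi>) (cd \<alpha>))"
proof -
 obtain u where a: "actn \<phi> \<alpha>" and u [simp]: "ar u" "dm u = un" "cd u = dm \<phi>" and u': "\<phi> oo u = e" "\<alpha> oo (u ** idt (cd \<alpha>)) = lu (cd \<alpha>)"
  using assms by (auto simp: unital_def in_homs)
 note [simp] = actnD[OF a]
 let ?s = "((idt A ** u) oo iv (ru A)) ** idt (cd \<alpha>)"
 have 1: "(m oo (idt A ** \<phi>)) oo (idt A ** u) oo iv (ru A) = idt A"
  by (simp add: cassoc interchange3 u' rw2[OF m_un_r])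
 have "((idt A ** \<alpha>) oo as A (dm \<phi>) (cd \<alpha>)) oo ((idt A ** u) ** idt (cd \<alpha>)) = ru A ** idt (cd \<alpha>)"
  by (simp add: cassoc as_n interchange3 u' triangle)
 then have 2: "((idt A ** \<alpha>) oo as A (dm \<phi>) (cd \<alpha>)) oo ((idt A ** u) ** idt (cd \<alpha>)) oo (iv (ru A) ** idt (cd \<alpha>)) = idt (A \<box> cd \<alpha>)"
  by (subst rw2, assumption) (simp_all add: interchange)
 show ?thesis
  unfolding reflexive_def
  by (intro conjI bexI[of _ ?s]) (use 1 2 in \<open>simp_all add: in_homs interchange\<close>)
qed

text \<open>Here \<open>j\<close> sends x to the class of 1 \<otimes> x, and the quotient map is
  recovered from it by linearity, as a \<otimes> x \<mapsto> a j(x). So the generating map carries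
  all the information of the quotient.\<close>

lemma base_change_of_coeq:
 assumes un: "unital \<phi> \<alpha>"
  and q: "is_coeq C ((m oo (idt A ** \<phi>)) ** idt (cd \<alpha>)) ((idt A ** \<alpha>) oo as A (dm \<phi>) (cd \<alpha>)) q"
 defines "X \<equiv> (cd q, quot_act C A A m (cd \<alpha>) q)" and "j \<equiv> q oo (e ** idt (cd \<alpha>)) oo iv (lu (cd \<alpha>))"
 shows "base_change \<phi> \<alpha> j X" "snd X oo (idt A ** j) = q"
proof -
 have a: "actn \<phi> \<alpha>" using un by (simp add: unital_def)
 note [simp] = actnD[OF a]
 let ?E = "cd \<alpha>" and ?P = "dm \<phi>"
 have q: "rcoeq C ((m oo (idt A ** \<phi>)) ** idt ?E) ((idt A ** \<alpha>) oo as A ?P ?E) q"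
  unfolding rcoeq_def by (intro conjI base_change_reflexive un q)
 note h = md_self _ _ _ _ _ q
 \<comment> \<open>\<open>A\<close> is a bimodule: on the right, the source of \<open>\<phi>\<close>
   acts by multiplication with the image under \<open>\<phi>\<close>.\<close>
 have bim: "m oo (idt A ** (m oo (idt A ** \<phi>))) oo as A A ?P = (m oo (idt A ** \<phi>)) oo (m ** idt ?P)"
  using md_mult[OF md_self, of "idt A" "idt A" \<phi>] by (simp add: nf)
 have hh: "ob ?P" "ob ?E" "m oo (idt A ** \<phi>) \<in> homs C (A \<box> ?P) A" "\<alpha> \<in> homs C (?P \<box> ?E) ?E"
  by (simp_all add: in_homs)
 have X: "md X" unfolding X_def by (rule quot_module[OF md_self hh bim q])
 have act: "snd X oo (idt A ** q) oo as A A ?E = q oo (m ** idt ?E)"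
  unfolding X_def snd_conv by (rule quot_act_as[OF md_self hh bim q])
 note q' = rcoeqD[OF q]
 have [simp]: "ar q" "dm q = A \<box> ?E" "cd q = fst X" using q' by (simp_all add: X_def)
 note [simp] = X
 show p: "snd X oo (idt A ** j) = q"
 proof -
  have "snd X oo (idt A ** j) = snd X oo (idt A ** q) oo (idt A ** e ** idt ?E) oo (idt A ** iv (lu ?E))"
   by (simp add: j_def nf)
  also have "\<dots> = (snd X oo (idt A ** q) oo as A A ?E) oo iv (as A A ?E) oo (idt A ** e ** idt ?E) oo (idt A ** iv (lu ?E))"
   by (simp add: cassoc)
  also have "\<dots> = q oo ((m oo (idt A ** e)) ** idt ?E) oo iv (as A un ?E) oo (idt A ** iv (lu ?E))"
   unfolding act by (simp add: cassoc iv_as_n3) (simp add: nf)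
  also have "(\<dots>) = q oo (ru A ** idt ?E) oo iv (as A un ?E) oo (idt A ** iv (lu ?E))" unfolding m_un_r ..
  also have "(ru A ** idt ?E) oo iv (as A un ?E) oo (idt A ** iv (lu ?E)) =
   ((idt A ** lu ?E) oo as A un ?E) oo iv (as A un ?E) oo (idt A ** iv (lu ?E))"
   by (simp add: triangle)
  also have "\<dots> = idt (A \<box> ?E)" by (simp add: cassoc interchange del: triangle)
  finally show ?thesis by simp
 qed
 have j [simp]: "ar j" "dm j = ?E" "cd j = fst X" by (simp_all add: j_def)
 have "j oo \<alpha> = snd X oo (\<phi> ** j)"
 proof -
  have "iv (lu ?E) oo \<alpha> = (idt un ** \<alpha>) oo iv (lu (?P \<box> ?E))"
   by (rule iso_cancel_l[of "lu ?E"]) (simp_all add: lu_n3)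
  also have "iv (lu (?P \<box> ?E)) = as un ?P ?E oo (iv (lu ?P) ** idt ?E)"
   by (rule iso_cancel_l[of "lu (?P \<box> ?E)"]) (simp_all add: rw2[OF lu_tens] interchange)
  finally have "j oo \<alpha> = q oo (idt A ** \<alpha>) oo (e ** idt (?P \<box> ?E)) oo as un ?P ?E oo (iv (lu ?P) ** idt ?E)"
   by (simp add: j_def cassoc interchange3)
  also have "\<dots> = (q oo (idt A ** \<alpha>) oo as A ?P ?E) oo ((e ** idt ?P) ** idt ?E) oo (iv (lu ?P) ** idt ?E)"
   by (simp add: cassoc as_n3)
  also have "\<dots> = q oo ((m oo (e ** \<phi>) oo iv (lu ?P)) ** idt ?E)"
   unfolding q'(8)[symmetric] by (simp add: nf)
  also have "m oo (e ** \<phi>) oo iv (lu ?P) = \<phi>"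
   using rw2[OF md_unit[OF md_self, of \<phi>]] by (simp add: cassoc)
  also have "q oo (\<phi> ** idt ?E) = snd X oo (\<phi> ** j)"
   unfolding p[symmetric] by (simp add: nf)
  finally show ?thesis .
 qed
 then have "slin \<phi> \<alpha> X j" by (simp add: slin_def a)
 then show "base_change \<phi> \<alpha> j X" using q by (simp add: base_change_def p)
qed

text \<open>Along an isomorphism the defining pair is isomorphic to the bar pair of
  \<open>X\<close>, whose coequalizer is the action by \<open>bar_split\<close>. No quotient has to
  be formed, and this brings restrictions under the notion of base change.\<close>

lemma base_change_iso:
 assumes X [simp]: "md X" and phi: "iso_arr C \<phi>" "cd \<phi> = A"
 shows "base_change \<phi> (snd X oo (\<phi> ** idt (fst X))) (idt (fst X)) X"
proof -
 note [simp] = phi iso_ar[OF phi(1)]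
 let ?x = "fst X" and ?P = "dm \<phi>" and ?a = "snd X oo (\<phi> ** idt (fst X))"
 have [simp]: "dm ?a = ?P \<box> ?x" "cd ?a = ?x" "ar ?a" by simp_all
 have act: "actn \<phi> ?a" by (simp add: actn_def)
 have s: "slin \<phi> ?a X (idt ?x)" by (simp add: slin_def act)
 have u: "unital \<phi> ?a"
  unfolding unital_def using act rw2[OF md_un[OF X]]
  by (intro conjI bexI[of _ "iv \<phi> oo e"]) (simp_all add: in_homs nf md_un)
 have e: "(idt A ** ?a) oo as A ?P ?x = ((idt A ** snd X) oo as A A ?x) oo ((idt A ** \<phi>) ** idt ?x)"
  by (simp add: cassoc as_n interchange3)
 have f: "(m oo (idt A ** \<phi>)) ** idt ?x = (m ** idt ?x) oo ((idt A ** \<phi>) ** idt ?x)"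
  by (simp add: nf)
 have c: "is_coeq C (m ** idt ?x) ((idt A ** snd X) oo as A A ?x) (snd X)"
  unfolding is_coeq_def
 proof (intro conjI allI ballI impI)
  show "snd X \<in> homs C (cd (m ** idt ?x)) (cd (snd X))" by (simp add: in_homs)
  show "snd X oo (m ** idt ?x) = snd X oo (idt A ** snd X) oo as A A ?x" by (simp add: md_as)
  fix y k assume "k \<in> homs C (cd (m ** idt ?x)) y" and kk: "k oo (m ** idt ?x) = k oo (idt A ** snd X) oo as A A ?x"
  then have k [simp]: "ar k" "dm k = A \<box> ?x" "cd k = y" by (auto simp: in_homs)
  show "\<exists>!h. h \<in> homs C (cd (snd X)) y & h oo snd X = k"
  proof (rule ex1I[of _ "k oo (e ** idt ?x) oo iv (lu ?x)"])
   show "k oo (e ** idt ?x) oo iv (lu ?x) \<in> homs C (cd (snd X)) y & (k oo (e ** idt ?x) oo iv (lu ?x)) oo snd X = k"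
    using bar_split[OF X k(1,2) kk[symmetric]] by (simp add: in_homs cassoc)
   fix h assume h: "h \<in> homs C (cd (snd X)) y & h oo snd X = k"
   then have [simp]: "ar h" "dm h = ?x" "cd h = y" and hk: "h oo snd X = k" by (auto simp: in_homs)
   show "h = k oo (e ** idt ?x) oo iv (lu ?x)" unfolding hk[symmetric] by (simp add: cassoc rw2[OF md_un])
  qed
 qed
 have "is_coeq C ((m oo (idt A ** \<phi>)) ** idt ?x) ((idt A ** ?a) oo as A ?P ?x) (snd X)"
  unfolding e f
  by (rule coeq_iso[OF c, where i = "(idt A ** \<phi>) ** idt ?x" and j = "idt (A \<box> ?x)"]) (simp_all add: cassoc)
 then show ?thesis
  unfolding base_change_def using base_change_reflexive[OF u] by (simp add: s rcoeq_def)
qed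

lemma base_change_j:
 assumes j: "base_change \<phi> \<alpha> j X"
 shows "j = (snd X oo (idt A ** j)) oo (e ** idt (cd \<alpha>)) oo iv (lu (cd \<alpha>))"
proof -
 note [simp] = base_changeD(1)[OF j] slinD(1-4)[OF base_changeD(2)[OF j]] actnD[OF slinD(1)[OF base_changeD(2)[OF j]]]
 have "(snd X oo (idt A ** j)) oo (e ** idt (cd \<alpha>)) oo iv (lu (cd \<alpha>)) = (snd X oo (e ** j)) oo iv (lu (cd \<alpha>))"
  by (simp add: nf)
 then show ?thesis by (simp add: md_unit cassoc)
qed

text \<open>The universal property of extension of scalars: a \<otimes> x \<mapsto> a k(x) respects
  the relation because \<open>k\<close> is semilinear.\<close>

lemma base_change_descend:
 assumes j: "base_change \<phi> \<alpha> j X" and Y [simp]: "md Y" and k: "slin \<phi> \<alpha> Y k"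
 obtains h where "mor X h Y" "h oo j = k"
proof -
 note X [simp] = base_changeD(1)[OF j]
 note [simp] = slinD(1-4)[OF base_changeD(2)[OF j]] actnD[OF slinD(1)[OF base_changeD(2)[OF j]]] slinD(1-4)[OF k]
 note c = base_changeD(3)[OF j]
 let ?E = "cd \<alpha>" and ?p = "snd X oo (idt A ** j)" and ?k = "snd Y oo (idt A ** k)"
 have mult: "?k oo (m ** idt ?E) = snd Y oo (idt A ** ?k) oo as A A ?E"
  using md_mult[OF Y, of "idt A" "idt A" k] by (simp add: nf)
 have mult': "?p oo (m ** idt ?E) = snd X oo (idt A ** ?p) oo as A A ?E"
  using md_mult[OF X, of "idt A" "idt A" j] by (simp add: nf)
 have "?k oo ((m oo (idt A ** \<phi>)) ** idt ?E) = ?k oo (idt A ** \<alpha>) oo as A (dm \<phi>) ?E"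
  using md_mult[OF Y, of "idt A" \<phi> k] by (simp add: nf slinD(5)[OF k])
 then obtain h where h [simp]: "ar h" "dm h = fst X" "cd h = fst Y" and hp: "h oo ?p = ?k"
  by (rule coeq_ex[OF rcoeqD(1)[OF c], rotated 2]) simp_all
 have hj: "h oo j = k"
 proof -
  have "h oo j = (h oo ?p) oo (e ** idt ?E) oo iv (lu ?E)"
   by (subst base_change_j[OF j]) (simp add: cassoc)
  also have "\<dots> = (snd Y oo (e ** k)) oo iv (lu ?E)" unfolding hp by (simp add: nf)
  finally show ?thesis by (simp add: md_unit cassoc)
 qed
 have "h oo snd X = snd Y oo (idt A ** h)"
 proof (rule epi_cancel)
  show "epi C ((idt A ** ?p) oo as A A ?E)"
   by (intro epi_comp iso_epi SE_epi SE_tens SE_rcoeq[OF c]) simp_all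
  have "(h oo snd X) oo (idt A ** ?p) oo as A A ?E = (h oo ?p) oo (m ** idt ?E)"
   using mult' by (simp add: cassoc)
  also have "\<dots> = (snd Y oo (idt A ** h)) oo (idt A ** ?p) oo as A A ?E"
   unfolding hp mult by (simp add: cassoc interchange3 hp)
  finally show "(h oo snd X) oo (idt A ** ?p) oo as A A ?E = (snd Y oo (idt A ** h)) oo (idt A ** ?p) oo as A A ?E" .
 qed simp_all
 then have "mor X h Y" by (simp add: mor_iff)
 then show ?thesis using hj by (rule that)
qed

text \<open>Tensoring with \<open>Z\<close> preserves the coequalizer that defines \<open>X\<close>.
  Linearity in the other variable is carried along, since it is needed to extend that variable
  afterwards.\<close>

lemma base_change_descend_left:
 assumes j: "base_change \<phi> \<alpha> j X" and Y [simp]: "md Y" and k: "llin \<phi> \<alpha> Z Y k"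
  and r: "rlin \<psi> \<beta> (cd \<alpha>) Y k" and Z: "cd \<beta> = Z"
 obtains h where "llin (idt A) (snd X) Z Y h" "rlin \<psi> \<beta> (fst X) Y h" "h oo (j ** idt Z) = k"
proof -
 note X [simp] = base_changeD(1)[OF j] and Z [simp]
 note [simp] = slinD(1-4)[OF base_changeD(2)[OF j]] actnD[OF slinD(1)[OF base_changeD(2)[OF j]]] llinD(1-5)[OF k]
  actnD[OF rlinD(1)[OF r]]
 note c = base_changeD(3)[OF j]
 let ?E = "cd \<alpha>" and ?P = "dm \<phi>" and ?p = "snd X oo (idt A ** j)"
 \<comment> \<open>The extension a \<otimes> x \<otimes> z \<mapsto> a k(x, z), which has to be
   descended.\<close>
 let ?k = "snd Y oo (idt A ** k) oo as A ?E Z"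
 have mult: "?k oo ((m ** idt ?E) ** idt Z) = snd Y oo (idt A ** ?k) oo as A (A \<box> ?E) Z oo (as A A ?E ** idt Z)"
 proof -
  have "?k oo ((m ** idt ?E) ** idt Z) = snd Y oo (m ** k) oo as (A \<box> A) ?E Z"
   by (simp add: as_n nf)
  also have "\<dots> = snd Y oo (idt A ** (snd Y oo (idt A ** k))) oo as A A (?E \<box> Z) oo as (A \<box> A) ?E Z"
   using md_mult[OF Y, of "idt A" "idt A" k] rw2[of "snd Y" "m ** k"] by (simp add: cassoc)
  also have "\<dots> = snd Y oo (idt A ** ?k) oo as A (A \<box> ?E) Z oo (as A A ?E ** idt Z)"
   by (simp add: pentagon interchange3 cassoc)
  finally show ?thesis .
 qed
 have mult': "?p oo (m ** idt ?E) = snd X oo (idt A ** ?p) oo as A A ?E"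
  using md_mult[OF X, of "idt A" "idt A" j] by (simp add: nf)
 have "?k oo (((m oo (idt A ** \<phi>)) ** idt ?E) ** idt Z) = ?k oo (((idt A ** \<alpha>) oo as A ?P ?E) ** idt Z)"
 proof -
  have "?k oo (((m oo (idt A ** \<phi>)) ** idt ?E) ** idt Z) = snd Y oo ((m oo (idt A ** \<phi>)) ** k) oo as (A \<box> ?P) ?E Z"
   by (simp add: as_n nf)
  also have "\<dots> = snd Y oo (idt A ** (snd Y oo (\<phi> ** k))) oo as A ?P (?E \<box> Z) oo as (A \<box> ?P) ?E Z"
   using md_mult[OF Y, of "idt A" \<phi> k] rw2[of "snd Y" "(m oo (idt A ** \<phi>)) ** k"] by (simp add: cassoc)
  also have "\<dots> = snd Y oo (idt A ** (snd Y oo (\<phi> ** k) oo as ?P ?E Z)) oo as A (?P \<box> ?E) Z oo (as A ?P ?E ** idt Z)"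
   by (simp add: pentagon interchange3 cassoc)
  also have "\<dots> = ?k oo (((idt A ** \<alpha>) oo as A ?P ?E) ** idt Z)"
   unfolding llinD(6)[OF k, symmetric]
   using as_n3[of "idt A" \<alpha> "idt Z" A ?E Z "as A ?P ?E ** idt Z"] by (simp add: nf)
  finally show ?thesis .
 qed
 then obtain h where h [simp]: "ar h" "dm h = fst X \<box> Z" "cd h = fst Y" and hp: "h oo (?p ** idt Z) = ?k"
  by (rule coeq_ex[OF tens_r_coeq[OF llinD(2)[OF k] c], rotated 2]) simp_all
 have hj: "h oo (j ** idt Z) = k"
 proof -
  have "h oo (j ** idt Z) = (h oo (?p ** idt Z)) oo ((e ** idt ?E) ** idt Z) oo (iv (lu ?E) ** idt Z)"
   by (subst base_change_j[OF j]) (simp add: nf)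
  also have "\<dots> = snd Y oo (e ** k) oo as un ?E Z oo (iv (lu ?E) ** idt Z)" unfolding hp by (simp add: cassoc as_n3 interchange3)
  also have "\<dots> = k oo (lu (?E \<box> Z) oo as un ?E Z) oo (iv (lu ?E) ** idt Z)"
   by (simp add: rw2[OF md_unit] cassoc)
  also have "\<dots> = k" by (simp add: lu_tens interchange)
  finally show ?thesis .
 qed
 have SEp: "SE ?p" by (rule SE_rcoeq[OF c])
 have "h oo (snd X ** idt Z) = snd Y oo (idt A ** h) oo as A (fst X) Z"
 proof (rule epi_cancel)
  let ?e = "((idt A ** ?p) ** idt Z) oo (as A A ?E ** idt Z)"
  show "epi C ?e" by (intro epi_comp iso_epi SE_epi SE_tens SE_tens_r SEp) simp_all
  have "(h oo (snd X ** idt Z)) oo ?e = h oo ((snd X oo (idt A ** ?p) oo as A A ?E) ** idt Z)"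
   by (simp add: nf)
  also have "\<dots> = (h oo (?p ** idt Z)) oo ((m ** idt ?E) ** idt Z)"
   unfolding mult'[symmetric] by (simp add: nf)
  also have "\<dots> = snd Y oo (idt A ** (h oo (?p ** idt Z))) oo as A (A \<box> ?E) Z oo (as A A ?E ** idt Z)"
   unfolding hp mult ..
  also have "\<dots> = (snd Y oo (idt A ** h) oo as A (fst X) Z) oo ?e"
   by (simp add: cassoc as_n3 interchange3)
  finally show "(h oo (snd X ** idt Z)) oo ?e = (snd Y oo (idt A ** h) oo as A (fst X) Z) oo ?e" .
 qed simp_all
 then have ll: "llin (idt A) (snd X) Z Y h" by (simp add: llin_def actn_md)
 have "h oo (idt (fst X) ** \<beta>) = snd Y oo (\<psi> ** h) oo swp (fst X) (dm \<psi>) Z"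
 proof (rule epi_cancel)
  let ?e = "?p ** idt (dm \<psi> \<box> Z)"
  show "epi C ?e" by (intro SE_epi SE_tens_r SEp) simp_all
  have "(h oo (idt (fst X) ** \<beta>)) oo ?e = (h oo (?p ** idt Z)) oo (idt (A \<box> ?E) ** \<beta>)"
   by (simp add: nf)
  also have "\<dots> = snd Y oo (idt A ** (k oo (idt ?E ** \<beta>))) oo as A ?E (dm \<psi> \<box> Z)"
   unfolding hp using as_n[of "idt A" "idt ?E" \<beta> A ?E Z] by (simp add: nf)
  also have "\<dots> = (snd Y oo (idt A ** (snd Y oo (\<psi> ** k)))) oo (idt A ** swp ?E (dm \<psi>) Z) oo as A ?E (dm \<psi> \<box> Z)"
   unfolding rlinD(6)[OF r] by (simp add: nf)
  also have "\<dots> = snd Y oo (\<psi> ** (snd Y oo (idt A ** k))) oo swp A (dm \<psi>) (?E \<box> Z) oo (idt A ** swp ?E (dm \<psi>) Z) oo as A ?E (dm \<psi> \<box> Z)"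
   using md_swap[OF Y, of "idt A" \<psi> k, symmetric] by (simp add: cassoc)
  also have "\<dots> = snd Y oo (\<psi> ** ?k) oo swp (A \<box> ?E) (dm \<psi>) Z"
   by (simp add: swp_tens[symmetric] interchange3 cassoc)
  also have "\<dots> = (snd Y oo (\<psi> ** h) oo swp (fst X) (dm \<psi>) Z) oo ?e"
   unfolding hp[symmetric] using swp_n[of ?p "idt (dm \<psi>)" "idt Z" "fst X" "dm \<psi>" Z]
   by (simp add: cassoc interchange3)
  finally show "(h oo (idt (fst X) ** \<beta>)) oo ?e = (snd Y oo (\<psi> ** h) oo swp (fst X) (dm \<psi>) Z) oo ?e" .
 qed simp_all
 then have "rlin \<psi> \<beta> (fst X) Y h" using rlinD(1)[OF r] by (simp add: rlin_def)
 with ll show ?thesis using hj by (rule that)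
qed

text \<open>The two variables are extended one after the other, the symmetry making the right factor
  a left one in between. The result is linear in both variables over \<open>A\<close> and so passes
  to the relative tensor product.\<close>

lemma base_change_descend_tens:
 assumes j: "base_change \<phi> \<alpha> j X" and j': "base_change \<phi>' \<alpha>' j' X'" and Y: "md Y"
  and k: "llin \<phi> \<alpha> (cd \<alpha>') Y k" "rlin \<phi>' \<alpha>' (cd \<alpha>) Y k"
 obtains h where "mor (mt X X') h Y" "h oo qt j X j' X' = k"
proof -
 note [simp] = base_changeD(1)[OF j] base_changeD(1)[OF j'] Y
  slinD(1-4)[OF base_changeD(2)[OF j]] actnD[OF slinD(1)[OF base_changeD(2)[OF j]]]
  slinD(1-4)[OF base_changeD(2)[OF j']] actnD[OF slinD(1)[OF base_changeD(2)[OF j']]]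
 obtain h1 where h1: "llin (idt A) (snd X) (cd \<alpha>') Y h1" "rlin \<phi>' \<alpha>' (fst X) Y h1" and e1: "h1 oo (j ** idt (cd \<alpha>')) = k"
  by (rule base_change_descend_left[OF j Y k refl])
 note [simp] = rlinD(3-5)[OF h1(2)]
 have l: "llin \<phi>' \<alpha>' (fst X) Y (h1 oo br (cd \<alpha>') (fst X))" by (rule rlin_br[OF Y h1(2)])
 have "rlin (idt A) (snd X) (cd \<alpha>') Y (h1 oo br (cd \<alpha>') (cd (snd X)))" by (rule llin_br[OF Y h1(1)])
 then have r: "rlin (idt A) (snd X) (cd \<alpha>') Y (h1 oo br (cd \<alpha>') (fst X))" by simp
 obtain h2 where h2: "llin (idt A) (snd X') (fst X) Y h2" "rlin (idt A) (snd X) (fst X') Y h2"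
  and e2: "h2 oo (j' ** idt (fst X)) = h1 oo br (cd \<alpha>') (fst X)"
  by (rule base_change_descend_left[OF j' Y l r]) simp_all
 note [simp] = llinD(3)[OF h2(1)] llinD(5)[OF h2(1)]
 have [simp]: "dm h2 = fst X' \<box> fst X" using llinD(4)[OF h2(1)] by simp
 have "llin (idt A) (snd X) (fst X') Y (h2 oo br (fst X) (fst X'))"
  "rlin (idt A) (snd X') (fst X) Y (h2 oo br (fst X) (fst X'))"
  using rlin_br[OF Y h2(2)] llin_br[OF Y h2(1)] by simp_all
 then obtain h where h: "mor (mt X X') h Y" "h oo cq X X' = h2 oo br (fst X) (fst X')"
  by (rule cq_descend[rotated 3]) simp_all
 note [simp] = morD(3-5)[OF h(1)]
 have "h oo qt j X j' X' = h2 oo br (fst X) (fst X') oo (j ** j')"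
  by (simp add: qt_def rw2[OF h(2)] cassoc)
 also have "\<dots> = h2 oo (j' ** idt (fst X)) oo (idt (cd \<alpha>') ** j) oo br (cd \<alpha>) (cd \<alpha>')"
  by (simp add: br_n interchange3)
 also have "\<dots> = h1 oo br (cd \<alpha>') (fst X) oo (idt (cd \<alpha>') ** j) oo br (cd \<alpha>) (cd \<alpha>')"
  by (simp add: rw2[OF e2] cassoc)
 also have "\<dots> = k" by (simp add: br_n3 e1)
 finally show ?thesis using h(1) by (intro that)
qed

text \<open>Inserting the unit of one action into the joint equation leaves linearity in the other
  factor. It serves \<open>badd\<close>, whose compatibility with actions is known only for both
  factors at once.\<close>

lemma mid_linear:
 assumes Y [simp]: "md Y" and "unital \<phi> \<alpha>" "unital \<phi>' \<alpha>'" and k [simp]: "ar k" "dm k = cd \<alpha> \<box> cd \<alpha>'" "cd k = fst Y"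
  and eq: "k oo (\<alpha> ** \<alpha>') = snd Y oo ((m oo (\<phi> ** \<phi>')) ** k) oo mid4 C (dm \<phi>) (cd \<alpha>) (dm \<phi>') (cd \<alpha>')"
 shows "llin \<phi> \<alpha> (cd \<alpha>') Y k" "rlin \<phi>' \<alpha>' (cd \<alpha>) Y k"
proof -
 obtain u u' where a: "actn \<phi> \<alpha>" "actn \<phi>' \<alpha>'" and [simp]: "ar u" "dm u = un" "cd u = dm \<phi>" "ar u'" "dm u' = un" "cd u' = dm \<phi>'"
  and u: "\<phi> oo u = e" "\<alpha> oo (u ** idt (cd \<alpha>)) = lu (cd \<alpha>)" and u': "\<phi>' oo u' = e" "\<alpha>' oo (u' ** idt (cd \<alpha>')) = lu (cd \<alpha>')"
  using assms(2,3) by (auto simp: unital_def in_homs)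
 note [simp] = actnD[OF a(1)] actnD[OF a(2)]
 let ?E = "cd \<alpha>" and ?E' = "cd \<alpha>'" and ?P = "dm \<phi>" and ?P' = "dm \<phi>'"
 have "k oo (\<alpha> ** idt ?E') = (k oo (\<alpha> ** \<alpha>')) oo ((idt ?P ** idt ?E) ** (u' ** idt ?E')) oo (idt (?P \<box> ?E) ** iv (lu ?E'))"
  by (simp add: nf rw2[OF u'(2)])
 also have "\<dots> = snd Y oo ((m oo (\<phi> ** \<phi>')) ** k) oo (mid4 C ?P ?E ?P' ?E' oo ((idt ?P ** idt ?E) ** (u' ** idt ?E'))) oo (idt (?P \<box> ?E) ** iv (lu ?E'))"
  unfolding eq by (simp add: cassoc)
 also have "\<dots> = snd Y oo ((m oo (\<phi> ** e)) ** k) oo mid4 C ?P ?E un ?E' oo (idt (?P \<box> ?E) ** iv (lu ?E'))"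
  by (subst mid4_n) (simp_all add: nf u')
 also have "m oo (\<phi> ** e) = \<phi> oo ru ?P"
 proof -
  have "m oo (\<phi> ** e) = (m oo (idt A ** e)) oo (\<phi> ** idt un)" by (simp add: nf)
  then show ?thesis unfolding m_un_r by (simp add: ru_n)
 qed
 also have "snd Y oo ((\<phi> oo ru ?P) ** k) oo mid4 C ?P ?E un ?E' oo (idt (?P \<box> ?E) ** iv (lu ?E')) =
  snd Y oo (\<phi> ** k) oo (ru ?P ** idt (?E \<box> ?E')) oo mid4 C ?P ?E un ?E' oo (idt (?P \<box> ?E) ** iv (lu ?E'))"
  by (simp add: interchange3)
 also have "\<dots> = snd Y oo (\<phi> ** k) oo as ?P ?E ?E'" by (simp add: mid4_unit_r)
 finally show "llin \<phi> \<alpha> (cd \<alpha>') Y k" by (simp add: llin_def a)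
 have "k oo (idt ?E ** \<alpha>') = (k oo (\<alpha> ** \<alpha>')) oo ((u ** idt ?E) ** (idt ?P' ** idt ?E')) oo (iv (lu ?E) ** idt (?P' \<box> ?E'))"
  by (simp add: nf rw2[OF u(2)])
 also have "\<dots> = snd Y oo ((m oo (\<phi> ** \<phi>')) ** k) oo (mid4 C ?P ?E ?P' ?E' oo ((u ** idt ?E) ** (idt ?P' ** idt ?E'))) oo (iv (lu ?E) ** idt (?P' \<box> ?E'))"
  unfolding eq by (simp add: cassoc)
 also have "\<dots> = snd Y oo ((m oo (e ** \<phi>')) ** k) oo mid4 C un ?E ?P' ?E' oo (iv (lu ?E) ** idt (?P' \<box> ?E'))"
  by (subst mid4_n) (simp_all add: nf u)
 also have "m oo (e ** \<phi>') = \<phi>' oo lu ?P'"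
  using md_unit[OF md_self, of \<phi>'] by simp
 also have "snd Y oo ((\<phi>' oo lu ?P') ** k) oo mid4 C un ?E ?P' ?E' oo (iv (lu ?E) ** idt (?P' \<box> ?E')) =
  snd Y oo (\<phi>' ** k) oo (lu ?P' ** idt (?E \<box> ?E')) oo mid4 C un ?E ?P' ?E' oo (iv (lu ?E) ** idt (?P' \<box> ?E'))"
  by (simp add: interchange3)
 also have "\<dots> = snd Y oo (\<phi>' ** k) oo swp ?E ?P' ?E'" by (simp add: mid4_unit_l)
 finally show "rlin \<phi>' \<alpha>' (cd \<alpha>) Y k" by (simp add: rlin_def a)
qed

end

section \<open>Monoidal functors and modules\<close>

context func
begin

lemma map_iso [simp]:
 assumes "iso_arr C f" shows "iso_arr D (Fa f)"
proof -
 note i = src.iso_inv[OF assms]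
 show ?thesis
  using i map_cmp[of f "inv_arr C f"] map_cmp[of "inv_arr C f" f]
  by (intro tgt.iso_arrI[of _ "Fa (inv_arr C f)"]) (auto simp: map_id)
qed

lemma map_iv:
 assumes "iso_arr C f" shows "Fa (inv_arr C f) = inv_arr D (Fa f)"
proof -
 note i = src.iso_inv[OF assms]
 show ?thesis
  using i map_cmp[of f "inv_arr C f"] map_cmp[of "inv_arr C f" f]
  by (intro tgt.iv_eqI[symmetric]) (auto simp: map_id)
qed

lemma map_isos: "f \<in> isos C x y ==> Fa f \<in> isos D (Fo x) (Fo y)"
 using map_ar[of f] by (auto simp: isos_iff iso_arr_carr)

lemma map_split_epi: "split_epi C p ==> split_epi D (Fa p)"
proof -
 assume "split_epi C p"
 then obtain s where s: "src.ar p" "src.ar s" "src.dm s = src.cd p" "src.cd s = src.dm p" "p \<bullet>\<^bsub>C\<^esub> s = src.idt (src.cd p)"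
  by (auto simp: split_epi_def in_homs)
 then have "Fa p \<bullet>\<^bsub>D\<^esub> Fa s = tgt.idt (Fo (src.cd p))" using map_cmp[of p s] by (simp add: map_id)
 then show ?thesis using s unfolding split_epi_def by (intro conjI bexI[of _ "Fa s"]) (simp_all add: in_homs)
qed

end

context sm_functor
begin

lemma mu_isoa [simp]: "src.ob x ==> src.ob y ==> iso_arr D (fmu F x y)"
 and mu_dm [simp]: "src.ob x ==> src.ob y ==> tgt.dm (fmu F x y) = tgt.tno (fobj F x) (fobj F y)"
 and mu_cd [simp]: "src.ob x ==> src.ob y ==> tgt.cd (fmu F x y) = fobj F (src.tno x y)"
 using mu_iso[of x y] by (auto simp: isos_iff)

lemma mu_ar [simp]: "src.ob x ==> src.ob y ==> tgt.ar (fmu F x y)"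
 by (rule tgt.iso_ar) simp

lemma ep_isoa [simp]: "iso_arr D (feps F)" "tgt.dm (feps F) = tgt.un" "tgt.cd (feps F) = fobj F src.un"
 using eps_iso by (auto simp: isos_iff)

lemma ep_ar [simp]: "tgt.ar (feps F)"
 by (rule tgt.iso_ar) simp

lemma mu_n: "src.ar f ==> src.ar g ==> src.dm f = x ==> src.dm g = y ==>
  farr F (src.tna f g) \<bullet>\<^bsub>D\<^esub> fmu F x y = fmu F (src.cd f) (src.cd g) \<bullet>\<^bsub>D\<^esub> tgt.tna (farr F f) (farr F g)"
 using mu_nat[of f "src.dm f" "src.cd f" g "src.dm g" "src.cd g"] by (auto simp: in_homs)

lemma mu_n3: "src.ar f ==> src.ar g ==> src.dm f = x ==> src.dm g = y ==>
  tgt.ar z ==> tgt.cd z = tgt.tno (fobj F x) (fobj F y) ==>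
  farr F (src.tna f g) \<bullet>\<^bsub>D\<^esub> fmu F x y \<bullet>\<^bsub>D\<^esub> z = fmu F (src.cd f) (src.cd g) \<bullet>\<^bsub>D\<^esub> tgt.tna (farr F f) (farr F g) \<bullet>\<^bsub>D\<^esub> z"
 by (subst tgt.rw2[OF mu_n]) (auto simp: tgt.cassoc)

lemmas map_ob [simp] = map_obj
lemmas map_idt [simp] = map_id

end

lemma sm_functor_id: "sym_mon_cat C ==> sm_functor C C (id_sm C)"
proof -
 assume "sym_mon_cat C"
 then interpret sym_mon_cat C .
 show ?thesis
  by unfold_locales (auto simp: id_sm_def in_homs isos_iff interchange)
qed

lemma (in sym_mon_cat) ru_tens:
 assumes [simp]: "ob x" "ob y"
 shows "(idt x ** ru y) oo as x y un = ru (x \<box> y)"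
proof (rule unit_faithful_r)
 show "((idt x ** ru y) oo as x y un) ** idt un = ru (x \<box> y) ** idt un"
 proof (rule iso_cancel_l)
  show "iso_arr C (as x y un)" by simp
  have "as x y un oo (((idt x ** ru y) oo as x y un) ** idt un) = as x y un oo ((idt x ** ru y) ** idt un) oo (as x y un ** idt un)"
   by (simp add: nf)
  also have "\<dots> = (idt x ** ((idt y ** lu un) oo as y un un)) oo as x (y \<box> un) un oo (as x y un ** idt un)"
   by (simp add: as_n3 triangle)
  also have "\<dots> = (idt x ** idt y ** lu un) oo as x y (un \<box> un) oo as (x \<box> y) un un"
   by (simp add: pentagon interchange3)
  also have "\<dots> = as x y un oo (idt (x \<box> y) ** lu un) oo as (x \<box> y) un un"
   using as_n3[of "idt x" "idt y" "lu un" x y un "as (x \<box> y) un un"] by simp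
  finally show "as x y un oo (((idt x ** ru y) oo as x y un) ** idt un) = as x y un oo (ru (x \<box> y) ** idt un)"
   by (simp add: triangle)
 qed simp_all
qed simp_all

context cmon_ctx
begin

text \<open>\<open>A\<close> is the free module on the unit object; the map is a \<mapsto> a
  p.\<close>

lemma point_map:
 assumes Y [simp]: "md Y" and p [simp]: "ar p" "dm p = un" "cd p = fst Y"
 obtains h where "mor (A, m) h Y" "h oo e = p"
proof -
 let ?h = "snd Y oo (idt A ** p) oo iv (ru A)"
 have "iv (ru A) oo m = (m ** idt un) oo iv (ru (A \<box> A))"
  by (rule iso_cancel_l[of "ru A"]) (simp_all add: ru_n3)
 moreover have "iv (ru (A \<box> A)) = iv (as A A un) oo (idt A ** iv (ru A))"
  by (rule iso_cancel_l[of "ru (A \<box> A)"]) (simp_all add: ru_tens[symmetric] interchange cassoc)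
 ultimately have "?h oo m = (snd Y oo (m ** p)) oo iv (as A A un) oo (idt A ** iv (ru A))"
  by (simp add: cassoc interchange3)
 also have "snd Y oo (m ** p) = snd Y oo (idt A ** (snd Y oo (idt A ** p))) oo as A A un"
  using md_mult[OF Y, of "idt A" "idt A" p] by simp
 finally have "?h oo m = snd Y oo (idt A ** ?h)" by (simp add: nf)
 then have "mor (A, m) ?h Y" by (simp add: mor_iff md_self)
 moreover have "?h oo e = p"
 proof -
  have "iv (ru A) oo e = (e ** idt un) oo iv (ru un)"
   by (rule iso_cancel_l[of "ru A"]) (simp_all add: ru_n3)
  then have "?h oo e = (snd Y oo (e ** p)) oo iv (ru un)" by (simp add: cassoc interchange3)
  then show ?thesis by (simp add: md_unit cassoc lu_un)
 qed
 ultimately show ?thesis by (rule that)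
qed

lemma gen_iso:
 assumes "gen q X" "iso_arr C i" "cd i = dm q" shows "gen (q oo i) X"
proof -
 note [simp] = genD(1-3)[OF assms(1)] assms(2,3) iso_ar[OF assms(2)]
 have "SE ((snd X oo (idt A ** q)) oo (idt A ** i))"
  by (intro SE_comp genD(4)[OF assms(1)] SE_tens SE_split iso_split_epi) simp_all
 then show ?thesis by (simp add: gen_def nf)
qed

lemma base_change_gen: "base_change \<phi> \<alpha> j X ==> gen j X"
 using slinD[of \<phi> \<alpha> X j] by (auto simp: gen_def base_change_def intro: SE_rcoeq)

end

section \<open>Functors between module categories induced by a monoidal functor\<close>

locale smf_ctx = cmon_ctx D B mB eB SD + c: cmon_ctx C A mA eA SC + sm_functor C D F
 for D :: "('p, 'b) smc" and B mB eB SD and C :: "('o, 'a) smc" and A mA eA SC and F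
begin

no_notation c.cmp (infixr "oo" 60) and c.tna (infixr "**" 75) and c.tno (infixr "\<box>" 75)
notation cmp (infixr "oo" 60) and tna (infixr "**" 75) and tno (infixr "\<box>" 75)

abbreviation Fo where "Fo \<equiv> fobj F"
abbreviation Fa where "Fa \<equiv> farr F"
abbreviation mu where "mu \<equiv> fmu F"
abbreviation ep where "ep \<equiv> feps F"

definition fact :: "'o => 'a => 'b" where
 "fact P \<alpha> = Fa \<alpha> oo mu P (c.cd \<alpha>)"

lemma fact_ar [simp]:
 assumes "c.ob P" "c.ar \<alpha>" "c.dm \<alpha> = P \<odot>\<^bsub>C\<^esub> c.cd \<alpha>"
 shows "ar (fact P \<alpha>)" "dm (fact P \<alpha>) = Fo P \<box> Fo (c.cd \<alpha>)" "cd (fact P \<alpha>) = Fo (c.cd \<alpha>)"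
 using assms by (simp_all add: fact_def)

end

text \<open>A functor \<open>\<Phi>\<close> of module categories which is a quotient of the functor \<open>F\<close> by means of \<open>j\<close>.\<close>

locale indfun = smf_ctx D B mB eB SD C A mA eA SC F
 for D :: "('p, 'b) smc" and B mB eB SD and C :: "('o, 'a) smc" and A mA eA SC and F +
 fixes \<Phi> :: "(('o, 'a) md, ('o, 'a) mdmap, ('p, 'b) md, ('p, 'b) mdmap) smfun" and j :: "('o, 'a) md => 'b"
 assumes Phi_obj [simp]: "c.md X ==> md (fobj \<Phi> X)"
  and j_hom: "c.md X ==> j X \<in> homs D (Fo (fst X)) (fst (fobj \<Phi> X))"
  and Phi_arr: "c.mor X u Y ==> \<exists>h. farr \<Phi> (X, u, Y) = (fobj \<Phi> X, h, fobj \<Phi> Y) & mor (fobj \<Phi> X) h (fobj \<Phi> Y) &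
   h oo j X = j Y oo Fa u"
  and Phi_gen: "c.gen q X ==> gen (j X oo Fa q) (fobj \<Phi> X)"
  and Phi_mu: "c.md X ==> c.md Y ==> \<exists>h. fmu \<Phi> X Y = (mt (fobj \<Phi> X) (fobj \<Phi> Y), h, fobj \<Phi> (c.mt X Y)) &
   mor (mt (fobj \<Phi> X) (fobj \<Phi> Y)) h (fobj \<Phi> (c.mt X Y)) &
   h oo qt (j X) (fobj \<Phi> X) (j Y) (fobj \<Phi> Y) = j (c.mt X Y) oo Fa (c.cq X Y) oo mu (fst X) (fst Y)"
  and Phi_mu_iso: "c.md X ==> c.md Y ==> fmu \<Phi> X Y \<in> isos W (mt (fobj \<Phi> X) (fobj \<Phi> Y)) (fobj \<Phi> (c.mt X Y))"
  and Phi_ep: "\<exists>h. feps \<Phi> = ((B, mB), h, fobj \<Phi> (A, mA)) & mor (B, mB) h (fobj \<Phi> (A, mA)) &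
   h oo eB = j (A, mA) oo Fa eA oo ep"
  and Phi_ep_iso: "feps \<Phi> \<in> isos W (B, mB) (fobj \<Phi> (A, mA))"
begin

lemma j_ar [simp]: "c.md X ==> ar (j X)" "c.md X ==> dm (j X) = Fo (fst X)" "c.md X ==> cd (j X) = fst (fobj \<Phi> X)"
 using j_hom[of X] by (auto simp: in_homs)

definition qf :: "'a => ('o, 'a) md => 'b" where
 "qf q X = j X oo Fa q"

lemma qf_ar [simp]:
 assumes "c.md X" "c.ar q" "c.cd q = fst X"
 shows "ar (qf q X)" "dm (qf q X) = Fo (c.dm q)" "cd (qf q X) = fst (fobj \<Phi> X)"
 using assms by (simp_all add: qf_def)

lemma gen_qf: "c.gen q X ==> gen (qf q X) (fobj \<Phi> X)"
 unfolding qf_def by (rule Phi_gen)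

lemma ovr_farr:
 assumes u: "c.ovr q X q' Y f u"
 shows "ovr (qf q X) (fobj \<Phi> X) (qf q' Y) (fobj \<Phi> Y) (Fa f) (farr \<Phi> u)"
proof -
 obtain h where h: "u = (X, h, Y)" "c.mor X h Y" "c.ar f" "c.dm f = c.dm q" "c.cd f = c.dm q'" "h \<bullet>\<^bsub>C\<^esub> q = q' \<bullet>\<^bsub>C\<^esub> f"
  "c.ar q" "c.cd q = fst X" "c.ar q'" "c.cd q' = fst Y"
  by (rule c.ovrE[OF u])
 obtain k where k: "farr \<Phi> u = (fobj \<Phi> X, k, fobj \<Phi> Y)" "mor (fobj \<Phi> X) k (fobj \<Phi> Y)" "k oo j X = j Y oo Fa h"
  using Phi_arr[OF h(2)] h(1) by auto
 note [simp] = c.morD(1-5)[OF h(2)] morD(3-5)[OF k(2)] h(3-5) h(7-10)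
 have "k oo qf q X = j Y oo Fa (h \<bullet>\<^bsub>C\<^esub> q)" by (simp add: qf_def rw2[OF k(3)] map_cmp cassoc)
 also have "\<dots> = qf q' Y oo Fa f" unfolding h(6) by (simp add: qf_def map_cmp cassoc)
 finally show ?thesis unfolding k(1) using k(2) by (simp add: ovr_def)
qed

lemma ovr_mu:
 assumes q: "c.gen q X" and r: "c.gen r Y"
 shows "ovr (qt (qf q X) (fobj \<Phi> X) (qf r Y) (fobj \<Phi> Y)) (mt (fobj \<Phi> X) (fobj \<Phi> Y))
  (qf (c.qt q X r Y) (c.mt X Y)) (fobj \<Phi> (c.mt X Y)) (mu (c.dm q) (c.dm r)) (fmu \<Phi> X Y)"
proof -
 note [simp] = c.genD(1-3)[OF q] c.genD(1-3)[OF r]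
 obtain k where k: "fmu \<Phi> X Y = (mt (fobj \<Phi> X) (fobj \<Phi> Y), k, fobj \<Phi> (c.mt X Y))"
  "mor (mt (fobj \<Phi> X) (fobj \<Phi> Y)) k (fobj \<Phi> (c.mt X Y))"
  "k oo qt (j X) (fobj \<Phi> X) (j Y) (fobj \<Phi> Y) = j (c.mt X Y) oo Fa (c.cq X Y) oo mu (fst X) (fst Y)"
  using Phi_mu[of X Y] by auto
 note [simp] = morD(3-5)[OF k(2)]
 have "k oo qt (qf q X) (fobj \<Phi> X) (qf r Y) (fobj \<Phi> Y) = (k oo qt (j X) (fobj \<Phi> X) (j Y) (fobj \<Phi> Y)) oo (Fa q ** Fa r)"
  by (simp add: qt_def qf_def nf)
 also have "\<dots> = qf (c.qt q X r Y) (c.mt X Y) oo mu (c.dm q) (c.dm r)"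
  unfolding k(3) by (simp add: qf_def c.qt_def map_cmp cassoc mu_n)
 finally show ?thesis unfolding k(1) using k(2) by (simp add: ovr_def)
qed

lemma ovr_ep: "ovr eB (B, mB) (qf eA (A, mA)) (fobj \<Phi> (A, mA)) ep (feps \<Phi>)"
proof -
 note [simp] = c.md_self md_self
 obtain k where k: "feps \<Phi> = ((B, mB), k, fobj \<Phi> (A, mA))" "mor (B, mB) k (fobj \<Phi> (A, mA))" "k oo eB = j (A, mA) oo Fa eA oo ep"
  using Phi_ep by auto
 have "k oo eB = qf eA (A, mA) oo ep" using k(3) by (simp add: qf_def cassoc)
 then show ?thesis unfolding k(1) using k(2) by (simp add: ovr_def)
qed

lemmas Phi_gen_rules = gen_rules gen_qf c.gen_rules
lemmas Phi_ovr_rules = ovr_comp ovr_tens ovr_assoc ovr_lun ovr_run ovr_braid ovr_id ovr_farr ovr_mu ovr_ep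
 c.ovr_assoc c.ovr_lun c.ovr_run c.ovr_braid c.ovr_id c.ovr_comp c.ovr_tens

lemma Phi_sm_functor: "sm_functor c.W W \<Phi>"
proof -
 interpret W: sym_mon_cat W by (rule W_sym_mon)
 interpret cW: sym_mon_cat c.W by (rule c.W_sym_mon)
 show ?thesis
 proof (unfold_locales, unfold W_obj c.W_obj)
  show "md (fobj \<Phi> x)" if "c.md x" for x using that by simp
  show "farr \<Phi> f \<in> homs W (fobj \<Phi> x) (fobj \<Phi> y)" if f: "f \<in> homs c.W x y" for f x y
   using that by (auto simp: c.W_homs W_homs dest!: Phi_arr)
  show "farr \<Phi> (cid c.W x) = cid W (fobj \<Phi> x)" if m: "c.md x" for x
   by (rule ovr_eq[OF gen_qf[OF c.gen_leaf] ovr_farr[OF c.ovr_id[OF c.gen_leaf]] ovr_id[OF gen_qf[OF c.gen_leaf]]])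
    (use m in simp_all)
  show "farr \<Phi> (g \<bullet>\<^bsub>c.W\<^esub> f) = farr \<Phi> g \<bullet>\<^bsub>W\<^esub> farr \<Phi> f" if f: "f \<in> homs c.W x y" "g \<in> homs c.W y z" for f x y g z
  proof -
   note l = f[THEN c.ovr_leaf]
   show ?thesis
    by (rule ovr_eq[OF gen_qf[OF c.gen_leaf] ovr_farr[OF c.ovr_comp[OF l]] ovr_comp[OF ovr_farr[OF l(1)] ovr_farr[OF l(2)]]])
     (use f in \<open>auto simp: c.W_homs c.mor_iff map_cmp\<close>)
  qed
  show "fmu \<Phi> x y \<in> isos W (mt (fobj \<Phi> x) (fobj \<Phi> y)) (fobj \<Phi> (c.mt x y))" if "c.md x" "c.md y" for x y
   using that by (rule Phi_mu_iso)
  show "feps \<Phi> \<in> isos W (B, mB) (fobj \<Phi> (A, mA))" by (rule Phi_ep_iso)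
  show "farr \<Phi> (f \<star>\<^bsub>c.W\<^esub> g) \<bullet>\<^bsub>W\<^esub> fmu \<Phi> x y = fmu \<Phi> x' y' \<bullet>\<^bsub>W\<^esub> (farr \<Phi> f \<star>\<^bsub>W\<^esub> farr \<Phi> g)"
   if f: "f \<in> homs c.W x x'" "g \<in> homs c.W y y'" for f x x' g y y'
  proof -
   note l = f[THEN c.ovr_leaf]
   show ?thesis
    by (rule ovr_eq[OF gen_tens[OF gen_qf[OF c.gen_leaf] gen_qf[OF c.gen_leaf]]
      ovr_comp[OF ovr_mu[OF c.gen_leaf c.gen_leaf] ovr_farr[OF c.ovr_tens[OF l]]]
      ovr_comp[OF ovr_tens[OF ovr_farr[OF l(1)] ovr_farr[OF l(2)]] ovr_mu[OF c.gen_leaf c.gen_leaf]]])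
     (use f in \<open>auto simp: c.W_homs c.mor_iff mu_n\<close>)
  qed
  show "farr \<Phi> (assoc c.W x y z) \<bullet>\<^bsub>W\<^esub> fmu \<Phi> (c.mt x y) z \<bullet>\<^bsub>W\<^esub> (fmu \<Phi> x y \<star>\<^bsub>W\<^esub> cid W (fobj \<Phi> z)) =
    fmu \<Phi> x (c.mt y z) \<bullet>\<^bsub>W\<^esub> (cid W (fobj \<Phi> x) \<star>\<^bsub>W\<^esub> fmu \<Phi> y z) \<bullet>\<^bsub>W\<^esub> assoc W (fobj \<Phi> x) (fobj \<Phi> y) (fobj \<Phi> z)"
   if m: "c.md x" "c.md y" "c.md z" for x y z
  proof (rule ovr_eq)
   show "gen (qt (qt (qf (c.idt (fst x)) x) (fobj \<Phi> x) (qf (c.idt (fst y)) y) (fobj \<Phi> y)) (mt (fobj \<Phi> x) (fobj \<Phi> y))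
    (qf (c.idt (fst z)) z) (fobj \<Phi> z)) (mt (mt (fobj \<Phi> x) (fobj \<Phi> y)) (fobj \<Phi> z))"
    by (intro Phi_gen_rules m)
  qed ((rule Phi_gen_rules Phi_ovr_rules m)+, simp_all add: m mu_assoc)
  show "farr \<Phi> (lun c.W x) \<bullet>\<^bsub>W\<^esub> fmu \<Phi> (A, mA) x \<bullet>\<^bsub>W\<^esub> (feps \<Phi> \<star>\<^bsub>W\<^esub> cid W (fobj \<Phi> x)) = lun W (fobj \<Phi> x)"
   if m: "c.md x" for x
  proof (rule ovr_eq)
   show "gen (qt eB (B, mB) (qf (c.idt (fst x)) x) (fobj \<Phi> x)) (mt (B, mB) (fobj \<Phi> x))"
    by (intro Phi_gen_rules m)
  qed ((rule Phi_gen_rules Phi_ovr_rules m)+, simp_all add: m mu_lunit)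
  show "farr \<Phi> (run c.W x) \<bullet>\<^bsub>W\<^esub> fmu \<Phi> x (A, mA) \<bullet>\<^bsub>W\<^esub> (cid W (fobj \<Phi> x) \<star>\<^bsub>W\<^esub> feps \<Phi>) = run W (fobj \<Phi> x)"
   if m: "c.md x" for x
  proof (rule ovr_eq)
   show "gen (qt (qf (c.idt (fst x)) x) (fobj \<Phi> x) eB (B, mB)) (mt (fobj \<Phi> x) (B, mB))"
    by (intro Phi_gen_rules m)
  qed ((rule Phi_gen_rules Phi_ovr_rules m)+, simp_all add: m mu_runit)
  show "farr \<Phi> (braid c.W x y) \<bullet>\<^bsub>W\<^esub> fmu \<Phi> x y = fmu \<Phi> y x \<bullet>\<^bsub>W\<^esub> braid W (fobj \<Phi> x) (fobj \<Phi> y)"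
   if m: "c.md x" "c.md y" for x y
  proof (rule ovr_eq)
   show "gen (qt (qf (c.idt (fst x)) x) (fobj \<Phi> x) (qf (c.idt (fst y)) y) (fobj \<Phi> y)) (mt (fobj \<Phi> x) (fobj \<Phi> y))"
    by (intro Phi_gen_rules m)
  qed ((rule Phi_gen_rules Phi_ovr_rules m)+, simp_all add: m mu_braid)
 qed
qed

end

text \<open>There are two instances: restriction along a map of orbits, where \<open>\<phi>\<close>
  is the inverse of the isomorphism \<open>rest_comp\<close>, and \<open>T \<box> -\<close>, where
  \<open>\<phi>\<close> is the norm map \<open>T \<box> R \<rightarrow> R\<close>.\<close>

locale monoid_pushforward = smf_ctx D B mB eB SD C A mA eA SC F
 for D :: "('p, 'b) smc" and B mB eB SD and C :: "('o, 'a) smc" and A mA eA SC and F +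
 fixes \<phi> :: 'b
 assumes phi_hom: "\<phi> \<in> homs D (Fo A) B"
  and phi_m: "\<phi> oo Fa mA oo mu A A = mB oo (\<phi> ** \<phi>)"
  and phi_e: "\<phi> oo Fa eA oo ep = eB"
begin

lemma phi_ar [simp]: "ar \<phi>" "dm \<phi> = Fo A" "cd \<phi> = B"
 using phi_hom by (auto simp: in_homs)

lemma fact_unital:
 assumes [simp]: "c.md X" shows "unital \<phi> (fact A (snd X))"
proof -
 have "(Fa (snd X) oo mu A (fst X)) oo ((Fa eA oo ep) ** idt (Fo (fst X))) =
  Fa (snd X) oo (mu A (fst X) oo (Fa eA ** Fa (c.idt (fst X)))) oo (ep ** idt (Fo (fst X)))"
  by (simp add: nf)
 also have "\<dots> = Fa (snd X \<bullet>\<^bsub>C\<^esub> (eA \<star>\<^bsub>C\<^esub> c.idt (fst X))) oo mu c.un (fst X) oo (ep ** idt (Fo (fst X)))"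
  by (simp add: map_cmp cassoc mu_n3)
 also have "\<dots> = lu (Fo (fst X))" by (simp add: c.md_un mu_lunit)
 finally show ?thesis
  unfolding unital_def using phi_e
  by (intro conjI bexI[of _ "Fa eA oo ep"]) (simp_all add: actn_def in_homs fact_def)
qed

lemma fact_as:
 assumes [simp]: "c.md X"
 shows "fact A (snd X) oo (idt (Fo A) ** fact A (snd X)) oo as (Fo A) (Fo A) (Fo (fst X)) =
  fact A (snd X) oo ((Fa mA oo mu A A) ** idt (Fo (fst X)))"
proof -
 let ?x = "fst X"
 have "fact A (snd X) oo (idt (Fo A) ** fact A (snd X)) oo as (Fo A) (Fo A) (Fo ?x) =
  Fa (snd X) oo (mu A ?x oo (Fa (c.idt A) ** Fa (snd X))) oo (idt (Fo A) ** mu A ?x) oo as (Fo A) (Fo A) (Fo ?x)"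
  by (simp add: fact_def nf)
 also have "\<dots> = Fa (snd X \<bullet>\<^bsub>C\<^esub> (c.idt A \<star>\<^bsub>C\<^esub> snd X) \<bullet>\<^bsub>C\<^esub> assoc C A A ?x) oo mu (A \<odot>\<^bsub>C\<^esub> A) ?x oo (mu A A ** idt (Fo ?x))"
  by (simp add: map_cmp cassoc mu_n3 mu_assoc)
 also have "\<dots> = Fa (snd X) oo (Fa (mA \<star>\<^bsub>C\<^esub> c.idt ?x) oo mu (A \<odot>\<^bsub>C\<^esub> A) ?x) oo (mu A A ** idt (Fo ?x))"
  by (simp add: c.md_as map_cmp cassoc)
 also have "\<dots> = fact A (snd X) oo ((Fa mA oo mu A A) ** idt (Fo ?x))"
  by (subst mu_n) (simp_all add: fact_def nf)
 finally show ?thesis .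
qed

text \<open>Since \<open>\<phi>\<close> is invertible, \<open>B\<close> acts on \<open>F X\<close>
  itself by transport of structure, and \<open>base_change_iso\<close> applies with the identity as
  generating map.\<close>

lemma base_change_restriction:
 assumes [simp]: "c.md X" and phi: "iso_arr D \<phi>" and \<Phi>o: "\<Phi>o = (Fo (fst X), fact A (snd X) oo (iv \<phi> ** idt (Fo (fst X))))"
 shows "base_change \<phi> (fact A (snd X)) (idt (Fo (fst X))) \<Phi>o"
proof -
 note [simp] = phi
 let ?x = "Fo (fst X)"
 let ?a = "fact A (snd X) oo (iv \<phi> ** idt ?x)"
 have a: "?a oo (\<phi> ** k) = fact A (snd X) oo (idt (Fo A) ** k)" if "ar k" "cd k = ?x" for k
  using that by (simp add: nf)
 have "md (?x, ?a)"
 proof (rule mdI)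
  show "?a oo (idt B ** ?a) oo as B B ?x = ?a oo (mB ** idt ?x)"
  proof (rule iso_cancel_r)
   show "iso_arr D ((\<phi> ** \<phi>) ** idt ?x)" by simp
   have "(?a oo (idt B ** ?a) oo as B B ?x) oo ((\<phi> ** \<phi>) ** idt ?x) = ?a oo (\<phi> ** (?a oo (\<phi> ** idt ?x))) oo as (Fo A) (Fo A) ?x"
    by (simp add: cassoc as_n nf)
   also have "\<dots> = (?a oo (\<phi> ** fact A (snd X))) oo as (Fo A) (Fo A) ?x"
    by (subst a) (simp_all add: cassoc)
   also have "\<dots> = fact A (snd X) oo ((Fa mA oo mu A A) ** idt ?x)"
    by (subst a) (simp_all add: cassoc fact_as)
   also have "\<dots> = fact A (snd X) oo ((iv \<phi> oo \<phi> oo Fa mA oo mu A A) ** idt ?x)"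
    by simp
   also have "\<dots> = (?a oo (mB ** idt ?x)) oo ((\<phi> ** \<phi>) ** idt ?x)"
    unfolding phi_m by (simp add: nf)
   finally show "(?a oo (idt B ** ?a) oo as B B ?x) oo ((\<phi> ** \<phi>) ** idt ?x) = (?a oo (mB ** idt ?x)) oo ((\<phi> ** \<phi>) ** idt ?x)" .
  qed simp_all
  obtain u where u: "u \<in> homs D un (Fo A)" "\<phi> oo u = eB" "fact A (snd X) oo (u ** idt ?x) = lu ?x"
   using fact_unital[of X] by (auto simp: unital_def)
  have [simp]: "ar u" "dm u = un" "cd u = Fo A" using u(1) by (auto simp: in_homs)
  show "?a oo (eB ** idt ?x) = lu ?x"
   using u(3) unfolding u(2)[symmetric] by (simp add: nf)
 qed simp_all
 note m = this
 have "?a oo (\<phi> ** idt ?x) = fact A (snd X)" by (subst a) simp_all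
 with base_change_iso[OF m phi] show ?thesis by (simp add: \<Phi>o)
qed

end

text \<open>The case in which \<open>j\<close> exhibits \<open>\<Phi> X\<close> as the base change \<open>B \<otimes>\<^bsub>F A\<^esub> F X\<close> along \<open>\<phi> : F A \<rightarrow> B\<close>.\<close>

locale pushforward = monoid_pushforward D B mB eB SD C A mA eA SC F \<phi>
 for D :: "('p, 'b) smc" and B mB eB SD and C :: "('o, 'a) smc" and A mA eA SC and F and \<phi> +
 fixes \<Phi>o :: "('o, 'a) md => ('p, 'b) md" and j :: "('o, 'a) md => 'b"
 assumes F_rcoeq: "rcoeq C f g q ==> rcoeq D (Fa f) (Fa g) (Fa q)"
  and F_SE: "SC p ==> SD (Fa p)"
  and j_bc: "c.md X ==> base_change \<phi> (fact A (snd X)) (j X) (\<Phi>o X)"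
begin

lemma pj_ar [simp]:
 assumes "c.md X"
 shows "md (\<Phi>o X)" "ar (j X)" "dm (j X) = Fo (fst X)" "cd (j X) = fst (\<Phi>o X)"
 using base_changeD(1)[OF j_bc[OF assms]] slinD[OF base_changeD(2)[OF j_bc[OF assms]]] assms by simp_all

lemma j_slin: "c.md X ==> slin \<phi> (fact A (snd X)) (\<Phi>o X) (j X)"
 by (rule base_changeD(2)[OF j_bc])

lemma j_act: "c.md X ==> j X oo Fa (snd X) oo mu A (fst X) = snd (\<Phi>o X) oo (\<phi> ** j X)"
 using slinD(5)[OF j_slin, of X] by (simp add: fact_def)

text \<open>\<open>F\<close> transports semilinear maps because its structure maps are natural. The
  scalars then act through the composite \<open>\<phi> oo Fa \<psi>\<close>, and similarly in each
  factor of a tensor product.\<close>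

lemma map_slin:
 assumes u: "c.slin \<psi> \<alpha> Y u" and that: "c.md Y"
 shows "slin (\<phi> oo Fa \<psi>) (fact (c.dm \<psi>) \<alpha>) (\<Phi>o Y) (j Y oo Fa u)"
proof -
 note [simp] = that c.slinD(1-4)[OF u] c.actnD[OF c.slinD(1)[OF u]]
 have "(j Y oo Fa u) oo fact (c.dm \<psi>) \<alpha> = j Y oo Fa (u \<bullet>\<^bsub>C\<^esub> \<alpha>) oo mu (c.dm \<psi>) (c.cd \<alpha>)"
  by (simp add: fact_def map_cmp cassoc)
 also have "\<dots> = (j Y oo Fa (snd Y) oo mu A (fst Y)) oo (Fa \<psi> ** Fa u)"
  unfolding c.slinD(5)[OF u] by (simp add: map_cmp cassoc mu_n)
 also have "\<dots> = snd (\<Phi>o Y) oo ((\<phi> oo Fa \<psi>) ** (j Y oo Fa u))"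
  unfolding j_act[OF that] by (simp add: nf)
 finally show ?thesis by (simp add: slin_def actn_def)
qed

lemma map_llin:
 assumes k: "c.llin \<psi> \<alpha> E' Y k" and Y: "c.md Y"
 shows "llin (\<phi> oo Fa \<psi>) (fact (c.dm \<psi>) \<alpha>) (Fo E') (\<Phi>o Y) (j Y oo Fa k oo mu (c.cd \<alpha>) E')"
proof -
 note [simp] = Y c.llinD(1-5)[OF k] c.actnD[OF c.llinD(1)[OF k]]
 let ?P = "c.dm \<psi>" and ?E = "c.cd \<alpha>"
 have "(j Y oo Fa k oo mu ?E E') oo (fact ?P \<alpha> ** idt (Fo E')) =
  j Y oo Fa k oo (mu ?E E' oo (Fa \<alpha> ** Fa (c.idt E'))) oo (mu ?P ?E ** idt (Fo E'))"
  by (simp add: fact_def nf)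
 also have "\<dots> = j Y oo Fa (k \<bullet>\<^bsub>C\<^esub> (\<alpha> \<star>\<^bsub>C\<^esub> c.idt E')) oo mu (?P \<odot>\<^bsub>C\<^esub> ?E) E' oo (mu ?P ?E ** idt (Fo E'))"
  by (simp add: map_cmp cassoc mu_n3)
 also have "\<dots> = j Y oo Fa (snd Y) oo Fa (\<psi> \<star>\<^bsub>C\<^esub> k) oo mu ?P (?E \<odot>\<^bsub>C\<^esub> E') oo (idt (Fo ?P) ** mu ?E E') oo as (Fo ?P) (Fo ?E) (Fo E')"
  unfolding c.llinD(6)[OF k] by (simp add: map_cmp cassoc mu_assoc)
 also have "\<dots> = (j Y oo Fa (snd Y) oo mu A (fst Y)) oo (Fa \<psi> ** (Fa k oo mu ?E E')) oo as (Fo ?P) (Fo ?E) (Fo E')"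
  by (simp add: cassoc mu_n3 interchange3)
 also have "\<dots> = snd (\<Phi>o Y) oo ((\<phi> oo Fa \<psi>) ** (j Y oo Fa k oo mu ?E E')) oo as (Fo ?P) (Fo ?E) (Fo E')"
  unfolding j_act[OF Y] by (simp add: nf)
 finally show ?thesis by (simp add: llin_def actn_def)
qed

lemma map_rlin:
 assumes k: "c.rlin \<psi> \<alpha> E Y k" and Y: "c.md Y"
 shows "rlin (\<phi> oo Fa \<psi>) (fact (c.dm \<psi>) \<alpha>) (Fo E) (\<Phi>o Y) (j Y oo Fa k oo mu E (c.cd \<alpha>))"
proof (rule br_rlin)
 note [simp] = Y c.rlinD(1-5)[OF k] c.actnD[OF c.rlinD(1)[OF k]]
 have "Fa (k \<bullet>\<^bsub>C\<^esub> c.br (c.cd \<alpha>) E) oo mu (c.cd \<alpha>) E = (Fa k oo mu E (c.cd \<alpha>)) oo br (Fo (c.cd \<alpha>)) (Fo E)"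
  by (simp add: map_cmp cassoc mu_braid)
 then show "llin (\<phi> oo Fa \<psi>) (fact (c.dm \<psi>) \<alpha>) (Fo E) (\<Phi>o Y) ((j Y oo Fa k oo mu E (c.cd \<alpha>)) oo br (cd (fact (c.dm \<psi>) \<alpha>)) (Fo E))"
  using map_llin[OF c.rlin_br[OF Y k] Y] by (simp add: cassoc)
 show "md (\<Phi>o Y)" "ar (j Y oo Fa k oo mu E (c.cd \<alpha>))" "dm (j Y oo Fa k oo mu E (c.cd \<alpha>)) = Fo E \<box> cd (fact (c.dm \<psi>) \<alpha>)"
  "cd (j Y oo Fa k oo mu E (c.cd \<alpha>)) = fst (\<Phi>o Y)" by simp_all
qed

lemma Phi_arr_ex:
 assumes u: "c.mor X u Y"
 obtains h where "mor (\<Phi>o X) h (\<Phi>o Y)" "h oo j X = j Y oo Fa u"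
proof -
 note [simp] = c.morD(1-2)[OF u]
 have "c.slin (c.idt A) (snd X) Y u" using u c.mor_slin by simp
 from map_slin[OF this] have "slin \<phi> (fact A (snd X)) (\<Phi>o Y) (j Y oo Fa u)" by simp
 then show ?thesis by (rule base_change_descend[OF j_bc, of X, rotated 2]) (auto intro: that)
qed

text \<open>The extension of \<open>j X\<close> and the image under \<open>F\<close> of the
  extension of \<open>q\<close> compose to a stable epimorphism. It sends b \<otimes> a \<otimes> x
  to b \<phi>(a) j(q x), so it factors through the extension of \<open>j X oo Fa q\<close>, and
  cancellation applies.\<close>

lemma Phi_gen_ex:
 assumes q: "c.gen q X" shows "gen (j X oo Fa q) (\<Phi>o X)"
proof -
 note [simp] = c.genD(1-3)[OF q]
 let ?a = "snd (\<Phi>o X)" and ?q = "j X oo Fa q"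
 have 1: "SD (?a oo (idt B ** j X))"
  by (rule SE_rcoeq[OF base_changeD(3)[OF j_bc]]) simp
 have 2: "SD (idt B ** Fa (snd X \<bullet>\<^bsub>C\<^esub> (c.idt A \<star>\<^bsub>C\<^esub> q)))"
  by (intro SE_tens F_SE c.genD(4)[OF q]) simp
 have 3: "SD (idt B ** mu A (c.dm q))" by (intro SE_split iso_split_epi) simp
 have "SD ((?a oo (idt B ** j X)) oo (idt B ** Fa (snd X \<bullet>\<^bsub>C\<^esub> (c.idt A \<star>\<^bsub>C\<^esub> q))) oo (idt B ** mu A (c.dm q)))"
  by (rule SE_comp[OF SE_comp[OF 3 2] 1]) simp_all
 also have "(?a oo (idt B ** j X)) oo (idt B ** Fa (snd X \<bullet>\<^bsub>C\<^esub> (c.idt A \<star>\<^bsub>C\<^esub> q))) oo (idt B ** mu A (c.dm q)) =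
  ?a oo (idt B ** ((j X oo Fa (snd X) oo mu A (fst X)) oo (idt (Fo A) ** Fa q)))"
  by (simp add: map_cmp nf mu_n)
 also have "\<dots> = ?a oo (idt B ** (?a oo (\<phi> ** ?q)))"
  unfolding j_act[OF c.genD(1)[OF q]] by (simp add: nf)
 also have "\<dots> = (?a oo ((mB oo (idt B ** \<phi>)) ** ?q)) oo iv (as B (Fo A) (Fo (c.dm q)))"
  using md_mult[of "\<Phi>o X" "idt B" \<phi> ?q] by (simp add: cassoc)
 also have "\<dots> = (?a oo (idt B ** ?q)) oo ((mB oo (idt B ** \<phi>)) ** idt (Fo (c.dm q))) oo iv (as B (Fo A) (Fo (c.dm q)))"
  by (simp add: nf)
 finally have "SD (?a oo (idt B ** ?q))" by (rule SE_cancel) simp_all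
 then show ?thesis by (simp add: gen_def)
qed

text \<open>\<open>F\<close> preserves the coequalizer \<open>cq X Y\<close>, so a map out of the
  base change of \<open>X \<otimes> Y\<close> can be given on \<open>F X \<odot> F Y\<close>. This
  provides the inverse of the comparison \<open>fmu\<close>.\<close>

lemma descend_cq:
 assumes X [simp]: "c.md X" and Y [simp]: "c.md Y" and V [simp]: "md V"
  and k: "llin \<phi> (fact A (snd X)) (Fo (fst Y)) V k" "rlin \<phi> (fact A (snd Y)) (Fo (fst X)) V k"
 obtains h where "mor (\<Phi>o (c.mt X Y)) h V" "h oo j (c.mt X Y) oo Fa (c.cq X Y) oo mu (fst X) (fst Y) = k"
proof -
 note [simp] = llinD(1-3)[OF k(1)] llinD(5)[OF k(1)]
 have dk [simp]: "dm k = Fo (fst X) \<box> Fo (fst Y)" using llinD(4)[OF k(1)] by simp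
 let ?x = "fst X" and ?y = "fst Y"
 \<comment> \<open>The isomorphism \<open>?i\<close> leads from
   \<open>(F X \<box> F A) \<box> F Y\<close> to the image under \<open>F\<close> of the source of
   the pair, so both actions can be compared in \<open>D\<close>.\<close>
 let ?k = "k oo iv (mu ?x ?y)" and ?i = "mu (?x \<odot>\<^bsub>C\<^esub> A) ?y oo (mu ?x A ** idt (Fo ?y))"
 let ?f = "(snd X \<bullet>\<^bsub>C\<^esub> c.br ?x A) \<star>\<^bsub>C\<^esub> c.idt ?y" and ?g = "(c.idt ?x \<star>\<^bsub>C\<^esub> snd Y) \<bullet>\<^bsub>C\<^esub> c.as ?x A ?y"
 note c = c.cq_rcoeq[OF X Y]
 have "Fa ?f oo ?i = mu ?x ?y oo ((fact A (snd X) oo br (Fo ?x) (Fo A)) ** idt (Fo ?y))"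
  using mu_n3[of "snd X \<bullet>\<^bsub>C\<^esub> c.br ?x A" "c.idt ?y" "?x \<odot>\<^bsub>C\<^esub> A" ?y "mu ?x A ** idt (Fo ?y)"]
  by (simp add: fact_def map_cmp cassoc interchange mu_braid)
 then have 1: "?k oo Fa ?f oo ?i = k oo ((fact A (snd X) oo br (Fo ?x) (Fo A)) ** idt (Fo ?y))"
  by (simp add: cassoc)
 have "Fa ?g oo ?i = Fa (c.idt ?x \<star>\<^bsub>C\<^esub> snd Y) oo mu ?x (A \<odot>\<^bsub>C\<^esub> ?y) oo (idt (Fo ?x) ** mu A ?y) oo as (Fo ?x) (Fo A) (Fo ?y)"
  by (simp add: map_cmp cassoc mu_assoc)
 also have "\<dots> = mu ?x ?y oo (idt (Fo ?x) ** fact A (snd Y)) oo as (Fo ?x) (Fo A) (Fo ?y)"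
  by (simp add: mu_n3 fact_def interchange3)
 finally have 2: "?k oo Fa ?g oo ?i = k oo (idt (Fo ?x) ** fact A (snd Y)) oo as (Fo ?x) (Fo A) (Fo ?y)"
  by (simp add: cassoc)
 have i: "iso_arr D ?i" by simp
 have "(?k oo Fa ?f) oo ?i = (?k oo Fa ?g) oo ?i"
  using 1 2 balanced[OF V k] by (simp add: cassoc)
 then have "?k oo Fa ?f = ?k oo Fa ?g" by (rule iso_cancel_r[OF i]) simp_all
 then obtain k1 where k1 [simp]: "ar k1" "dm k1 = Fo (fst (c.mt X Y))" "cd k1 = fst V" and k1q: "k1 oo Fa (c.cq X Y) = ?k"
  by (rule coeq_ex[OF rcoeqD(1)[OF F_rcoeq[OF c]], rotated 2]) simp_all
 have k1m: "k1 oo Fa (c.cq X Y) oo mu ?x ?y = k" using rw2[OF k1q] by (simp add: cassoc)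
 have "slin \<phi> (fact A (snd (c.mt X Y))) V k1"
 proof -
  have "k1 oo fact A (snd (c.mt X Y)) = snd V oo (\<phi> ** k1)"
  proof (rule epi_cancel)
   let ?e = "(idt (Fo A) ** Fa (c.cq X Y)) oo (idt (Fo A) ** mu ?x ?y) oo as (Fo A) (Fo ?x) (Fo ?y)"
   have "SD (Fa (c.cq X Y))" by (rule F_SE) simp
   then show "epi D ?e" by (intro epi_comp iso_epi SE_epi SE_tens) simp_all
   have "(k1 oo fact A (snd (c.mt X Y))) oo ?e = k1 oo Fa (snd (c.mt X Y)) oo (mu A (fst (c.mt X Y)) oo (Fa (c.idt A) ** Fa (c.cq X Y))) oo
    (idt (Fo A) ** mu ?x ?y) oo as (Fo A) (Fo ?x) (Fo ?y)"
    by (simp add: fact_def cassoc)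
   also have "\<dots> = k1 oo Fa (snd (c.mt X Y)) oo Fa (c.idt A \<star>\<^bsub>C\<^esub> c.cq X Y) oo (mu A (?x \<odot>\<^bsub>C\<^esub> ?y) oo
    (idt (Fo A) ** mu ?x ?y) oo as (Fo A) (Fo ?x) (Fo ?y))"
    by (simp add: map_cmp cassoc mu_n3)
   also have "\<dots> = k1 oo Fa (snd (c.mt X Y) \<bullet>\<^bsub>C\<^esub> (c.idt A \<star>\<^bsub>C\<^esub> c.cq X Y) \<bullet>\<^bsub>C\<^esub> c.as A ?x ?y) oo mu (A \<odot>\<^bsub>C\<^esub> ?x) ?y oo (mu A ?x ** idt (Fo ?y))"
    by (simp add: mu_assoc[symmetric] map_cmp cassoc)
   also have "\<dots> = k1 oo Fa (c.cq X Y) oo Fa (snd X \<star>\<^bsub>C\<^esub> c.idt ?y) oo mu (A \<odot>\<^bsub>C\<^esub> ?x) ?y oo (mu A ?x ** idt (Fo ?y))"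
    unfolding c.mt_act[OF X Y] by (simp add: map_cmp cassoc)
   also have "\<dots> = (k1 oo Fa (c.cq X Y) oo mu ?x ?y) oo (fact A (snd X) ** idt (Fo ?y))"
    by (simp add: mu_n3 fact_def cassoc interchange)
   also have "\<dots> = snd V oo (\<phi> ** (k1 oo Fa (c.cq X Y) oo mu ?x ?y)) oo as (Fo A) (Fo ?x) (Fo ?y)"
    unfolding k1m using llinD(6)[OF k(1)] by simp
   also have "\<dots> = (snd V oo (\<phi> ** k1)) oo ?e" by (simp add: cassoc interchange3)
   finally show "(k1 oo fact A (snd (c.mt X Y))) oo ?e = (snd V oo (\<phi> ** k1)) oo ?e" .
  qed simp_all
  then show ?thesis by (simp add: slin_def actn_def)
 qed
 then obtain h where h: "mor (\<Phi>o (c.mt X Y)) h V" "h oo j (c.mt X Y) = k1"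
  by (rule base_change_descend[OF j_bc V, rotated]) simp_all
 note [simp] = morD(3-5)[OF h(1)]
 have "h oo j (c.mt X Y) oo Fa (c.cq X Y) oo mu ?x ?y = k" using k1m by (simp add: rw2[OF h(2)])
 with h(1) show ?thesis by (rule that)
qed

text \<open>Transitivity of extension of scalars: if \<open>X\<close> is a base change along
  \<open>\<psi>\<close>, its pushforward has the universal property for
  \<open>\<phi> oo Fa \<psi>\<close>. The inverses of \<open>bass\<close> and \<open>bres\<close>
  for modules are obtained from it.\<close>

lemma descend_base_change:
 assumes i: "c.base_change \<psi> \<alpha> i X" and V [simp]: "md V"
  and k: "slin (\<phi> oo Fa \<psi>) (fact (c.dm \<psi>) \<alpha>) V k"
 obtains h where "mor (\<Phi>o X) h V" "h oo j X oo Fa i = k"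
proof -
 note X [simp] = c.base_changeD(1)[OF i]
 note sl [simp] = c.slinD(1-4)[OF c.base_changeD(2)[OF i]]
 note ia [simp] = c.actnD[OF sl(1)]
 note [simp] = slinD(1,2,4)[OF k]
 let ?E = "c.cd \<alpha>" and ?P = "c.dm \<psi>"
 have dk [simp]: "dm k = Fo ?E" using slinD(3)[OF k] by simp
 let ?k = "(snd V oo (\<phi> ** k)) oo iv (mu A ?E)" and ?p = "snd X \<bullet>\<^bsub>C\<^esub> (c.idt A \<star>\<^bsub>C\<^esub> i)"
 let ?f = "(mA \<bullet>\<^bsub>C\<^esub> (c.idt A \<star>\<^bsub>C\<^esub> \<psi>)) \<star>\<^bsub>C\<^esub> c.idt ?E" and ?g = "(c.idt A \<star>\<^bsub>C\<^esub> \<alpha>) \<bullet>\<^bsub>C\<^esub> c.as A ?P ?E"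
 note c = c.base_changeD(3)[OF i]
 let ?i = "mu (A \<odot>\<^bsub>C\<^esub> ?P) ?E oo (mu A ?P ** idt (Fo ?E))"
 have ii: "iso_arr D ?i" by simp
 have "Fa ?f oo ?i = mu A ?E oo ((Fa mA oo mu A A oo (idt (Fo A) ** Fa \<psi>)) ** idt (Fo ?E))"
  using mu_n3[of "mA \<bullet>\<^bsub>C\<^esub> (c.idt A \<star>\<^bsub>C\<^esub> \<psi>)" "c.idt ?E" "A \<odot>\<^bsub>C\<^esub> ?P" ?E "mu A ?P ** idt (Fo ?E)"]
  by (simp add: map_cmp cassoc interchange mu_n)
 then have "?k oo Fa ?f oo ?i = snd V oo (((\<phi> oo Fa mA oo mu A A) oo (idt (Fo A) ** Fa \<psi>)) ** k)"
  by (simp add: cassoc interchange)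
 also have "\<dots> = snd V oo ((mB oo (\<phi> ** (\<phi> oo Fa \<psi>))) ** k)" unfolding phi_m by (simp add: nf)
 also have "\<dots> = snd V oo (\<phi> ** (snd V oo ((\<phi> oo Fa \<psi>) ** k))) oo as (Fo A) (Fo ?P) (Fo ?E)"
  using md_mult[OF V, of \<phi> "\<phi> oo Fa \<psi>" k] by simp
 finally have 1: "?k oo Fa ?f oo ?i = snd V oo (\<phi> ** (snd V oo ((\<phi> oo Fa \<psi>) ** k))) oo as (Fo A) (Fo ?P) (Fo ?E)" .
 have "Fa ?g oo ?i = Fa (c.idt A \<star>\<^bsub>C\<^esub> \<alpha>) oo mu A (?P \<odot>\<^bsub>C\<^esub> ?E) oo (idt (Fo A) ** mu ?P ?E) oo as (Fo A) (Fo ?P) (Fo ?E)"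
  by (simp add: map_cmp cassoc mu_assoc)
 also have "\<dots> = mu A ?E oo (idt (Fo A) ** fact ?P \<alpha>) oo as (Fo A) (Fo ?P) (Fo ?E)"
  by (simp add: mu_n3 fact_def interchange3)
 finally have "?k oo Fa ?g oo ?i = snd V oo (\<phi> ** (k oo fact ?P \<alpha>)) oo as (Fo A) (Fo ?P) (Fo ?E)"
  by (simp add: cassoc interchange3)
 then have 2: "?k oo Fa ?g oo ?i = snd V oo (\<phi> ** (snd V oo ((\<phi> oo Fa \<psi>) ** k))) oo as (Fo A) (Fo ?P) (Fo ?E)"
  unfolding slinD(5)[OF k] .
 have "(?k oo Fa ?f) oo ?i = (?k oo Fa ?g) oo ?i"
  using 1 2 by (simp add: cassoc)
 then have "?k oo Fa ?f = ?k oo Fa ?g" by (rule iso_cancel_r[OF ii]) simp_all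
 then obtain k1 where k1 [simp]: "ar k1" "dm k1 = Fo (fst X)" "cd k1 = fst V" and k1q: "k1 oo Fa ?p = ?k"
  by (rule coeq_ex[OF rcoeqD(1)[OF F_rcoeq[OF c]], rotated 2]) simp_all
 have k1p: "k1 oo Fa ?p oo mu A ?E = snd V oo (\<phi> ** k)" using rw2[OF k1q] by (simp add: cassoc)
 \<comment> \<open>By \<open>base_change_j\<close> the generator \<open>i\<close> is its linear
   extension evaluated at the unit, which reduces the claim to the equation for
   \<open>?p\<close>.\<close>
 have k1i: "k1 oo Fa i = k"
 proof -
  have n: "Fa (eA \<star>\<^bsub>C\<^esub> c.idt ?E) oo mu c.un ?E = mu A ?E oo (Fa eA ** idt (Fo ?E))"
   using mu_n[of eA "c.idt ?E" c.un ?E] by simp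
  have "k1 oo Fa i = k1 oo Fa (?p \<bullet>\<^bsub>C\<^esub> (eA \<star>\<^bsub>C\<^esub> c.idt ?E) \<bullet>\<^bsub>C\<^esub> c.iv (c.lu ?E))"
   using c.base_change_j[OF i] by simp
  also have "\<dots> = k1 oo Fa ?p oo (Fa (eA \<star>\<^bsub>C\<^esub> c.idt ?E) oo mu c.un ?E) oo iv (mu c.un ?E) oo iv (Fa (c.lu ?E))"
   by (simp add: map_cmp cassoc map_iv)
  also have "\<dots> = (k1 oo Fa ?p oo mu A ?E) oo (Fa eA ** idt (Fo ?E)) oo iv (mu c.un ?E) oo iv (Fa (c.lu ?E))"
   unfolding n by (simp add: cassoc)
  also have "iv (mu c.un ?E) oo iv (Fa (c.lu ?E)) = (ep ** idt (Fo ?E)) oo iv (lu (Fo ?E))"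
  proof (rule iso_cancel_l)
   show "iso_arr D (Fa (c.lu ?E) oo mu c.un ?E)" by simp
   show "(Fa (c.lu ?E) oo mu c.un ?E) oo iv (mu c.un ?E) oo iv (Fa (c.lu ?E)) =
    (Fa (c.lu ?E) oo mu c.un ?E) oo (ep ** idt (Fo ?E)) oo iv (lu (Fo ?E))"
    by (simp add: cassoc rw3[OF mu_lunit])
  qed simp_all
  also have "(k1 oo Fa ?p oo mu A ?E) oo (Fa eA ** idt (Fo ?E)) oo (ep ** idt (Fo ?E)) oo iv (lu (Fo ?E)) =
   (snd V oo ((\<phi> oo Fa eA oo ep) ** k)) oo iv (lu (Fo ?E))"
   unfolding k1p by (simp add: nf)
  also have "\<dots> = k" unfolding phi_e by (simp add: md_unit cassoc)
  finally show ?thesis .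
 qed
 have pm: "?p \<bullet>\<^bsub>C\<^esub> (mA \<star>\<^bsub>C\<^esub> c.idt ?E) = snd X \<bullet>\<^bsub>C\<^esub> (c.idt A \<star>\<^bsub>C\<^esub> ?p) \<bullet>\<^bsub>C\<^esub> c.as A A ?E"
  using c.md_mult[OF X, of "c.idt A" "c.idt A" i] by (simp add: c.nf)
 have "slin \<phi> (fact A (snd X)) V k1"
 proof -
  have "k1 oo fact A (snd X) = snd V oo (\<phi> ** k1)"
  proof (rule epi_cancel)
   let ?e = "(idt (Fo A) ** Fa ?p) oo (idt (Fo A) ** mu A ?E) oo as (Fo A) (Fo A) (Fo ?E)"
   have "SD (Fa ?p)" by (intro F_SE c.SE_rcoeq[OF c])
   then show "epi D ?e" by (intro epi_comp iso_epi SE_epi SE_tens) simp_all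
   have "(k1 oo fact A (snd X)) oo ?e = k1 oo Fa (snd X) oo (mu A (fst X) oo (Fa (c.idt A) ** Fa ?p)) oo (idt (Fo A) ** mu A ?E) oo as (Fo A) (Fo A) (Fo ?E)"
    by (simp add: fact_def cassoc)
   also have "\<dots> = k1 oo Fa (snd X) oo Fa (c.idt A \<star>\<^bsub>C\<^esub> ?p) oo (mu A (A \<odot>\<^bsub>C\<^esub> ?E) oo (idt (Fo A) ** mu A ?E) oo as (Fo A) (Fo A) (Fo ?E))"
    by (simp add: map_cmp cassoc mu_n3)
   also have "\<dots> = k1 oo Fa (snd X \<bullet>\<^bsub>C\<^esub> (c.idt A \<star>\<^bsub>C\<^esub> ?p) \<bullet>\<^bsub>C\<^esub> c.as A A ?E) oo mu (A \<odot>\<^bsub>C\<^esub> A) ?E oo (mu A A ** idt (Fo ?E))"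
    by (simp add: mu_assoc[symmetric] map_cmp cassoc)
   also have "\<dots> = k1 oo Fa ?p oo Fa (mA \<star>\<^bsub>C\<^esub> c.idt ?E) oo mu (A \<odot>\<^bsub>C\<^esub> A) ?E oo (mu A A ** idt (Fo ?E))"
    unfolding pm[symmetric] by (simp add: map_cmp cassoc)
   also have "\<dots> = (k1 oo Fa ?p oo mu A ?E) oo ((Fa mA oo mu A A) ** idt (Fo ?E))"
    by (simp add: mu_n3 cassoc interchange)
   also have "\<dots> = snd V oo ((\<phi> oo Fa mA oo mu A A) ** k)" unfolding k1p by (simp add: nf)
   also have "\<dots> = snd V oo (\<phi> ** (snd V oo (\<phi> ** k))) oo as (Fo A) (Fo A) (Fo ?E)"
    unfolding phi_m using md_mult[OF V, of \<phi> \<phi> k] by simp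
   also have "\<dots> = (snd V oo (\<phi> ** k1)) oo ?e" unfolding k1p[symmetric] by (simp add: cassoc interchange3)
   finally show "(k1 oo fact A (snd X)) oo ?e = (snd V oo (\<phi> ** k1)) oo ?e" .
  qed simp_all
  then show ?thesis by (simp add: slin_def actn_def)
 qed
 then obtain h where h: "mor (\<Phi>o X) h V" "h oo j X = k1"
  by (rule base_change_descend[OF j_bc V, rotated]) simp_all
 note [simp] = morD(3-5)[OF h(1)]
 have "h oo j X oo Fa i = k" using k1i by (simp add: rw2[OF h(2)])
 with h(1) show ?thesis by (rule that)
qed

lemma Phi_mu_ex:
 assumes X [simp]: "c.md X" and Y [simp]: "c.md Y"
 obtains h where "mor (mt (\<Phi>o X) (\<Phi>o Y)) h (\<Phi>o (c.mt X Y))"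
  "h oo qt (j X) (\<Phi>o X) (j Y) (\<Phi>o Y) = j (c.mt X Y) oo Fa (c.cq X Y) oo mu (fst X) (fst Y)"
proof -
 have "llin \<phi> (fact A (snd X)) (cd (fact A (snd Y))) (\<Phi>o (c.mt X Y)) (j (c.mt X Y) oo Fa (c.cq X Y) oo mu (fst X) (fst Y))"
  "rlin \<phi> (fact A (snd Y)) (cd (fact A (snd X))) (\<Phi>o (c.mt X Y)) (j (c.mt X Y) oo Fa (c.cq X Y) oo mu (fst X) (fst Y))"
  using map_llin[OF c.cq_llin[OF X Y]] map_rlin[OF c.cq_rlin[OF X Y]] by simp_all
 then show ?thesis
  by (rule base_change_descend_tens[OF j_bc j_bc, rotated 3]) (simp_all add: that)
qed

lemma Phi_mu_iso_ex:
 assumes X [simp]: "c.md X" and Y [simp]: "c.md Y"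
  and h: "mor (mt (\<Phi>o X) (\<Phi>o Y)) h (\<Phi>o (c.mt X Y))"
  "h oo qt (j X) (\<Phi>o X) (j Y) (\<Phi>o Y) = j (c.mt X Y) oo Fa (c.cq X Y) oo mu (fst X) (fst Y)"
 shows "(mt (\<Phi>o X) (\<Phi>o Y), h, \<Phi>o (c.mt X Y)) \<in> isos W (mt (\<Phi>o X) (\<Phi>o Y)) (\<Phi>o (c.mt X Y))"
proof -
 \<comment> \<open>The isomorphism \<open>mu\<close> is absorbed into the generator
   \<open>?r\<close>, so that the map and its inverse both lie over an identity.\<close>
 let ?q = "qt (j X) (\<Phi>o X) (j Y) (\<Phi>o Y)" and ?r = "j (c.mt X Y) oo Fa (c.cq X Y) oo mu (fst X) (fst Y)"
 have g: "gen ?q (mt (\<Phi>o X) (\<Phi>o Y))" by (intro gen_tens base_change_gen[OF j_bc] X Y)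
 have "c.gen (c.qt (c.idt (fst X)) X (c.idt (fst Y)) Y) (c.mt X Y)" by (intro c.gen_rules X Y)
 then have "c.gen (c.cq X Y) (c.mt X Y)" by (simp add: c.qt_def)
 from gen_iso[OF Phi_gen_ex[OF this], of "mu (fst X) (fst Y)"] have g': "gen ?r (\<Phi>o (c.mt X Y))" by (simp add: cassoc)
 have "llin \<phi> (fact A (snd X)) (Fo (fst Y)) (mt (\<Phi>o X) (\<Phi>o Y)) ?q" "rlin \<phi> (fact A (snd Y)) (Fo (fst X)) (mt (\<Phi>o X) (\<Phi>o Y)) ?q"
  using cq_pre[OF _ _ j_slin[OF X] j_slin[OF Y]] by (simp_all add: qt_def)
 then obtain k where k: "mor (\<Phi>o (c.mt X Y)) k (mt (\<Phi>o X) (\<Phi>o Y))" "k oo ?r = ?q"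
  by (rule descend_cq[OF X Y, rotated]) simp_all
 show ?thesis
  by (rule W_isoI[OF g g' ovrI[OF h(1) g g', of "idt (Fo (fst X) \<box> Fo (fst Y))"] ovrI[OF k(1) g' g, of "idt (Fo (fst X) \<box> Fo (fst Y))"]])
   (use h k genD(2)[OF g] genD(2)[OF g'] in simp_all)
qed

lemma Phi_ep_ex:
 obtains h where "mor (B, mB) h (\<Phi>o (A, mA))" "h oo eB = j (A, mA) oo Fa eA oo ep"
 by (rule point_map[of "\<Phi>o (A, mA)" "j (A, mA) oo Fa eA oo ep"]) (use c.md_self in \<open>simp_all add: that\<close>)

text \<open>The inverse is the linear extension of \<open>\<phi>\<close> itself, which is semilinear
  because \<open>\<phi>\<close> is multiplicative.\<close>

lemma Phi_ep_iso_ex: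
 assumes h: "mor (B, mB) h (\<Phi>o (A, mA))" "h oo eB = j (A, mA) oo Fa eA oo ep"
 shows "((B, mB), h, \<Phi>o (A, mA)) \<in> isos W (B, mB) (\<Phi>o (A, mA))"
proof -
 note A [simp] = c.md_self
 let ?r = "j (A, mA) oo Fa eA oo ep"
 note g = gen_unit
 from gen_iso[OF Phi_gen_ex[OF c.gen_unit], of ep] have g': "gen ?r (\<Phi>o (A, mA))" by (simp add: cassoc)
 have "slin \<phi> (fact A (snd (A, mA))) (B, mB) \<phi>" by (simp add: slin_def actn_def fact_def phi_m)
 then obtain k where k: "mor (\<Phi>o (A, mA)) k (B, mB)" "k oo j (A, mA) = \<phi>"
  by (rule base_change_descend[OF j_bc[OF A] md_self])
 note [simp] = morD(3-5)[OF k(1)]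
 have "k oo ?r = eB" by (simp add: rw2[OF k(2)] phi_e)
 then show ?thesis
  by (intro W_isoI[OF g g' ovrI[OF h(1) g g', of "idt un"] ovrI[OF k(1) g' g, of "idt un"]])
   (use h genD(2)[OF g'] in simp_all)
qed

lemma indfunI:
 assumes "\<And>X. fobj \<Phi> X = \<Phi>o X"
  and arr: "\<And>X u Y. c.mor X u Y ==> \<exists>h. farr \<Phi> (X, u, Y) = (\<Phi>o X, h, \<Phi>o Y) & ar h & dm h = fst (\<Phi>o X) &
   (mor (\<Phi>o X) h (\<Phi>o Y) & h oo j X = j Y oo Fa u)"
  and mu: "\<And>X Y. c.md X ==> c.md Y ==> \<exists>h. fmu \<Phi> X Y = (mt (\<Phi>o X) (\<Phi>o Y), h, \<Phi>o (c.mt X Y)) &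
   mor (mt (\<Phi>o X) (\<Phi>o Y)) h (\<Phi>o (c.mt X Y)) &
   h oo qt (j X) (\<Phi>o X) (j Y) (\<Phi>o Y) = j (c.mt X Y) oo Fa (c.cq X Y) oo mu (fst X) (fst Y)"
  and ep: "\<exists>h. feps \<Phi> = ((B, mB), h, \<Phi>o (A, mA)) & mor (B, mB) h (\<Phi>o (A, mA)) &
   h oo eB = j (A, mA) oo Fa eA oo ep"
 shows "indfun D B mB eB SD C A mA eA SC F \<Phi> j"
proof (unfold_locales, unfold assms(1))
 show "md (\<Phi>o X)" "j X \<in> homs D (Fo (fst X)) (fst (\<Phi>o X))" if "c.md X" for X using that by (simp_all add: in_homs)
 show "\<exists>h. farr \<Phi> (X, u, Y) = (\<Phi>o X, h, \<Phi>o Y) & mor (\<Phi>o X) h (\<Phi>o Y) & h oo j X = j Y oo Fa u" if "c.mor X u Y" for X u Y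
  using arr[OF that] by auto
 show "gen (j X oo Fa q) (\<Phi>o X)" if "c.gen q X" for q X using that by (rule Phi_gen_ex)
 show "\<exists>h. fmu \<Phi> X Y = (mt (\<Phi>o X) (\<Phi>o Y), h, \<Phi>o (c.mt X Y)) &
   mor (mt (\<Phi>o X) (\<Phi>o Y)) h (\<Phi>o (c.mt X Y)) &
   h oo qt (j X) (\<Phi>o X) (j Y) (\<Phi>o Y) = j (c.mt X Y) oo Fa (c.cq X Y) oo mu (fst X) (fst Y)"
  if "c.md X" "c.md Y" for X Y using that by (rule mu)
 show "fmu \<Phi> X Y \<in> isos W (mt (\<Phi>o X) (\<Phi>o Y)) (\<Phi>o (c.mt X Y))" if "c.md X" "c.md Y" for X Y
  using mu[OF that] Phi_mu_iso_ex[OF that] by auto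
 show "\<exists>h. feps \<Phi> = ((B, mB), h, \<Phi>o (A, mA)) & mor (B, mB) h (\<Phi>o (A, mA)) & h oo eB = j (A, mA) oo Fa eA oo ep"
  by (rule ep)
 show "feps \<Phi> \<in> isos W (B, mB) (\<Phi>o (A, mA))" using ep Phi_ep_iso_ex by auto
qed

end

lemma indfun_id:
 assumes "cmon_ctx C A m e S"
 shows "indfun C A m e S C A m e S (id_sm C) (id_sm (mod_cat C A m e)) (%X. cid C (fst X))"
proof -
 interpret cmon_ctx C A m e S by (rule assms)
 interpret W: sym_mon_cat W by (rule W_sym_mon)
 interpret i: sm_functor C C "id_sm C" by (rule sm_functor_id) unfold_locales
 have g: "gen (cq X Y) (mt X Y)" if "md X" "md Y" for X Y
  using gen_tens[OF gen_leaf[OF that(1)] gen_leaf[OF that(2)]] that by (simp add: qt_def)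
 show ?thesis
 proof (unfold_locales, goal_cases)
  case (1 X) then show ?case by (simp add: id_sm_def)
 next case (2 X) then show ?case by (simp add: id_sm_def in_homs)
 next case (3 X u Y) then show ?case by (auto simp: id_sm_def mor_iff)
 next case (4 q X) then show ?case using genD[OF 4] by (simp add: id_sm_def)
 next case (5 X Y) then show ?case by (auto simp: id_sm_def qt_def mor_id)
 next case (6 X Y) then show ?case using W.iso_id[of "mt X Y"] by (simp add: id_sm_def isos_iff)
 next case 7 show ?case using md_self mor_id[OF md_self] by (auto simp: id_sm_def)
 next case 8 show ?case using W.iso_id[of "(A, m)"] md_self by (simp add: id_sm_def isos_iff)
 qed
qed

text \<open>The comparisons \<open>rcomp\<close>, \<open>bass\<close> and \<open>bres\<close> have
  composite functors as source or target. Closure under composition lets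
  \<open>mon_nat_of_indfun\<close> treat them like the others.\<close>

lemma indfun_comp:
 assumes "indfun D B mB eB SD C A mA eA SC F \<Phi> j" "indfun E Q mQ eQ SE D B mB eB SD F' \<Phi>' j'"
  and "sm_functor C E (comp_sm E F' F)"
 shows "indfun E Q mQ eQ SE C A mA eA SC (comp_sm E F' F) (comp_sm (mod_cat E Q mQ eQ) \<Phi>' \<Phi>)
  (%X. j' (fobj \<Phi> X) \<bullet>\<^bsub>E\<^esub> farr F' (j X))"
proof -
 interpret f: indfun D B mB eB SD C A mA eA SC F \<Phi> j by fact
 interpret g: indfun E Q mQ eQ SE D B mB eB SD F' \<Phi>' j' by fact
 interpret gf: sm_functor C E "comp_sm E F' F" by fact
 interpret W: sym_mon_cat g.W by (rule g.W_sym_mon)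
 interpret Phi': sm_functor f.W g.W \<Phi>' by (rule g.Phi_sm_functor)
 have sel: "fobj (comp_sm Z K K') x = fobj K (fobj K' x)" "farr (comp_sm Z K K') y = farr K (farr K' y)"
  "fmu (comp_sm Z K K') x x' = farr K (fmu K' x x') \<bullet>\<^bsub>Z\<^esub> fmu K (fobj K' x) (fobj K' x')"
  "feps (comp_sm Z K K') = farr K (feps K') \<bullet>\<^bsub>Z\<^esub> feps K"
  for Z :: "('s, 't) smc" and K :: "('u, 'v, 's, 't) smfun" and K' :: "('w, 'x, 'u, 'v) smfun" and x x' y
  by (simp_all add: comp_sm_def)
 have gj: "f.gen (j X) (fobj \<Phi> X)" if "f.c.md X" for X
  using f.gen_qf[OF f.c.gen_leaf[OF that]] that by (simp add: f.qf_def)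
 have gc: "f.c.gen (f.c.cq X Y) (f.c.mt X Y)" if "f.c.md X" "f.c.md Y" for X Y
  using f.c.gen_tens[OF f.c.gen_leaf[OF that(1)] f.c.gen_leaf[OF that(2)]] that by (simp add: f.c.qt_def)
 show ?thesis
 proof (unfold_locales, unfold sel, goal_cases)
  case (1 X) then show ?case by simp
 next case (2 X) then show ?case by (simp add: in_homs)
 next
  case (3 X u Y)
  obtain h where h: "farr \<Phi> (X, u, Y) = (fobj \<Phi> X, h, fobj \<Phi> Y)" "f.mor (fobj \<Phi> X) h (fobj \<Phi> Y)" "h \<bullet>\<^bsub>D\<^esub> j X = j Y \<bullet>\<^bsub>D\<^esub> farr F u"
   using f.Phi_arr[OF 3] by auto
  obtain k where k: "farr \<Phi>' (fobj \<Phi> X, h, fobj \<Phi> Y) = (fobj \<Phi>' (fobj \<Phi> X), k, fobj \<Phi>' (fobj \<Phi> Y))"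
   "g.mor (fobj \<Phi>' (fobj \<Phi> X)) k (fobj \<Phi>' (fobj \<Phi> Y))" "k \<bullet>\<^bsub>E\<^esub> j' (fobj \<Phi> X) = j' (fobj \<Phi> Y) \<bullet>\<^bsub>E\<^esub> farr F' h"
   using g.Phi_arr[OF h(2)] by auto
  note [simp] = f.c.morD(1-5)[OF 3] f.morD(3-5)[OF h(2)] g.morD(3-5)[OF k(2)]
  have "k \<bullet>\<^bsub>E\<^esub> j' (fobj \<Phi> X) \<bullet>\<^bsub>E\<^esub> farr F' (j X) = j' (fobj \<Phi> Y) \<bullet>\<^bsub>E\<^esub> farr F' (h \<bullet>\<^bsub>D\<^esub> j X)"
   by (simp add: g.rw2[OF k(3)] g.map_cmp g.cassoc)
  also have "\<dots> = (j' (fobj \<Phi> Y) \<bullet>\<^bsub>E\<^esub> farr F' (j Y)) \<bullet>\<^bsub>E\<^esub> farr F' (farr F u)"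
   unfolding h(3) by (simp add: g.map_cmp g.cassoc)
  finally show ?case using h(1) k(1,2) by simp
 next
  case (4 q X)
  note [simp] = f.c.genD(1-3)[OF 4]
  show ?case using g.Phi_gen[OF f.Phi_gen[OF 4]] by (simp add: g.map_cmp g.cassoc)
 next
  case (5 X Y)
  note [simp] = 5
  obtain h where h: "fmu \<Phi> X Y = (f.mt (fobj \<Phi> X) (fobj \<Phi> Y), h, fobj \<Phi> (f.c.mt X Y))"
   "f.mor (f.mt (fobj \<Phi> X) (fobj \<Phi> Y)) h (fobj \<Phi> (f.c.mt X Y))"
   "h \<bullet>\<^bsub>D\<^esub> f.qt (j X) (fobj \<Phi> X) (j Y) (fobj \<Phi> Y) = j (f.c.mt X Y) \<bullet>\<^bsub>D\<^esub> farr F (f.c.cq X Y) \<bullet>\<^bsub>D\<^esub> fmu F (fst X) (fst Y)"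
   using f.Phi_mu[OF 5] by auto
  have o: "f.ovr (f.qt (j X) (fobj \<Phi> X) (j Y) (fobj \<Phi> Y)) (f.mt (fobj \<Phi> X) (fobj \<Phi> Y)) (j (f.c.mt X Y) \<bullet>\<^bsub>D\<^esub> farr F (f.c.cq X Y))
   (fobj \<Phi> (f.c.mt X Y)) (fmu F (fst X) (fst Y)) (fmu \<Phi> X Y)"
   unfolding h(1) by (rule f.ovrI[OF h(2)]) (use h(3) f.gen_tens[OF gj[OF 5(1)] gj[OF 5(2)]] f.Phi_gen[OF gc[OF 5]] in \<open>simp_all add: f.cassoc\<close>)
  from g.ovr_comp[OF g.ovr_mu[OF gj[OF 5(1)] gj[OF 5(2)]] g.ovr_farr[OF o]]
  show ?case
   by (rule g.ovrE) (auto simp: g.qf_def g.map_cmp g.cassoc)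
 next
  case (6 X Y)
  note [simp] = 6
  show ?case
   by (rule W.isos_comp[OF g.Phi_mu_iso]) (use Phi'.map_isos[OF f.Phi_mu_iso[OF 6]] in simp_all)
 next
  case 7
  note [simp] = f.md_self f.c.md_self g.md_self
  obtain h where h: "feps \<Phi> = ((B, mB), h, fobj \<Phi> (A, mA))" "f.mor (B, mB) h (fobj \<Phi> (A, mA))"
   "h \<bullet>\<^bsub>D\<^esub> eB = j (A, mA) \<bullet>\<^bsub>D\<^esub> farr F eA \<bullet>\<^bsub>D\<^esub> feps F"
   using f.Phi_ep by auto
  have o: "f.ovr eB (B, mB) (j (A, mA) \<bullet>\<^bsub>D\<^esub> farr F eA) (fobj \<Phi> (A, mA)) (feps F) (feps \<Phi>)"
   unfolding h(1) by (rule f.ovrI[OF h(2)]) (use h(3) f.gen_unit f.Phi_gen[OF f.c.gen_unit] in \<open>simp_all add: f.cassoc\<close>)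
  from g.ovr_comp[OF g.ovr_ep g.ovr_farr[OF o]]
  show ?case
   by (rule g.ovrE) (auto simp: g.qf_def g.map_cmp g.cassoc)
 next
  case 8
  show ?case by (rule W.isos_comp[OF g.Phi_ep_iso Phi'.map_isos[OF f.Phi_ep_iso]])
 qed
qed

lemma indfun_nat_ovr:
 assumes "indfun D B mB eB SD C A mA eA SC F \<Phi> j" "indfun D B mB eB SD C A mA eA SC F' \<Phi>' j'"
  and "mon_nat C D F F' \<tau>"
  and h: "(fobj \<Phi> X, h, fobj \<Phi>' X) \<in> module_maps D B mB eB" "h \<bullet>\<^bsub>D\<^esub> j X = j' X \<bullet>\<^bsub>D\<^esub> \<tau> (fst X)"
  and q: "cmon_ctx.gen C A mA eA SC q X"
 shows "cmon_ctx.ovr D B mB eB (j X \<bullet>\<^bsub>D\<^esub> farr F q) (fobj \<Phi> X) (j' X \<bullet>\<^bsub>D\<^esub> farr F' q) (fobj \<Phi>' X) (\<tau> (cdom C q)) (fobj \<Phi> X, h, fobj \<Phi>' X)"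
proof -
 interpret f: indfun D B mB eB SD C A mA eA SC F \<Phi> j by fact
 interpret g: indfun D B mB eB SD C A mA eA SC F' \<Phi>' j' by fact
 interpret n: mon_nat C D F F' \<tau> by fact
 note [simp] = f.c.genD(1-3)[OF q] f.morD(1-5)[OF h(1)]
 have t [simp]: "\<tau> x \<in> carr D" "cdom D (\<tau> x) = fobj F x" "ccod D (\<tau> x) = fobj F' x" if "x \<in> cobj C" for x
  using n.component[OF that] by (auto simp: in_homs)
 have nat: "\<tau> (fst X) \<bullet>\<^bsub>D\<^esub> farr F q = farr F' q \<bullet>\<^bsub>D\<^esub> \<tau> (cdom C q)"
  by (rule n.natural) (simp add: in_homs)
 have "h \<bullet>\<^bsub>D\<^esub> j X \<bullet>\<^bsub>D\<^esub> farr F q = (j' X \<bullet>\<^bsub>D\<^esub> farr F' q) \<bullet>\<^bsub>D\<^esub> \<tau> (cdom C q)"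
  by (simp add: f.rw2[OF h(2)] f.cassoc nat)
 then show ?thesis
  by (intro f.ovrI[OF h(1)] f.Phi_gen[OF q] g.Phi_gen[OF q]) simp_all
qed

lemma mon_nat_of_indfun:
 assumes If: "indfun D B mB eB SD C A mA eA SC F \<Phi> j" and Ig: "indfun D B mB eB SD C A mA eA SC F' \<Phi>' j'"
  and n: "mon_nat C D F F' \<tau>"
  and h: "\<And>X. X \<in> modules C A mA eA ==> \<exists>h. \<tau>' X = (fobj \<Phi> X, h, fobj \<Phi>' X) &
   (fobj \<Phi> X, h, fobj \<Phi>' X) \<in> module_maps D B mB eB & h \<bullet>\<^bsub>D\<^esub> j X = j' X \<bullet>\<^bsub>D\<^esub> \<tau> (fst X)"
 shows "mon_nat (mod_cat C A mA eA) (mod_cat D B mB eB) \<Phi> \<Phi>' \<tau>'"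
proof -
 interpret f: indfun D B mB eB SD C A mA eA SC F \<Phi> j by fact
 interpret g: indfun D B mB eB SD C A mA eA SC F' \<Phi>' j' by fact
 interpret n: mon_nat C D F F' \<tau> by fact
 interpret P: sm_functor f.c.W f.W \<Phi> by (rule f.Phi_sm_functor)
 interpret P': sm_functor f.c.W f.W \<Phi>' by (rule g.Phi_sm_functor)
 have o: "f.ovr (f.qf q X) (fobj \<Phi> X) (g.qf q X) (fobj \<Phi>' X) (\<tau> (f.c.dm q)) (\<tau>' X)" if q: "f.c.gen q X" for q X
  using h[OF f.c.genD(1)[OF q]] indfun_nat_ovr[OF If Ig n _ _ q] unfolding f.qf_def g.qf_def by auto
 show ?thesis
 proof (unfold_locales, unfold f.W_obj f.c.W_obj)
  show "\<tau>' x \<in> homs f.W (fobj \<Phi> x) (fobj \<Phi>' x)" if "f.c.md x" for x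
   using h[OF that] by (auto simp: f.W_homs)
  show "\<tau>' y \<bullet>\<^bsub>f.W\<^esub> farr \<Phi> u = farr \<Phi>' u \<bullet>\<^bsub>f.W\<^esub> \<tau>' x" if u: "u \<in> homs f.c.W x y" for u x y
  proof -
   have u': "fst (snd u) \<in> homs C (fst x) (fst y)" "f.c.md x" "f.c.md y"
    using u unfolding f.c.W_homs by (auto simp: f.c.mor_iff in_homs)
   note l = f.c.ovr_leaf[OF u] and g = f.c.gen_leaf[OF u'(2)] f.c.gen_leaf[OF u'(3)]
   show ?thesis
    by (rule f.ovr_eq[OF f.gen_qf[OF g(1)] f.ovr_comp[OF f.ovr_farr[OF l] o[OF g(2)]] f.ovr_comp[OF o[OF g(1)] g.ovr_farr[OF l]]])
     (use n.natural[OF u'(1)] u' in simp_all)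
  qed
  show "\<tau>' (f.c.mt x y) \<bullet>\<^bsub>f.W\<^esub> fmu \<Phi> x y = fmu \<Phi>' x y \<bullet>\<^bsub>f.W\<^esub> (\<tau>' x \<star>\<^bsub>f.W\<^esub> \<tau>' y)"
   if m: "f.c.md x" "f.c.md y" for x y
  proof (rule f.ovr_eq)
   note gx = f.c.gen_leaf[OF m(1)] and gy = f.c.gen_leaf[OF m(2)]
   show "f.gen (f.qt (f.qf (f.c.idt (fst x)) x) (fobj \<Phi> x) (f.qf (f.c.idt (fst y)) y) (fobj \<Phi> y)) (f.mt (fobj \<Phi> x) (fobj \<Phi> y))"
    by (intro f.gen_tens f.gen_qf gx gy)
  qed (rule f.ovr_comp[OF f.ovr_mu o] f.ovr_comp[OF f.ovr_tens[OF o o] g.ovr_mu] f.c.gen_tens f.c.gen_leaf m refl | simp add: m n.mon_tens)+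
  show "\<tau>' (A, mA) \<bullet>\<^bsub>f.W\<^esub> feps \<Phi> = feps \<Phi>'"
   by (rule f.ovr_eq[OF f.gen_unit f.ovr_comp[OF f.ovr_ep o[OF f.c.gen_unit]] g.ovr_ep]) (simp_all add: n.mon_unit)
 qed
qed

text \<open>Naturality and monoidality of \<open>\<tau>\<close> make \<open>\<tau> X\<close>
  semilinear over \<open>\<tau> A\<close>, so composing with it keeps a map semilinear. This is why
  the maps over \<open>barr\<close>, \<open>bpoint\<close>, \<open>bass\<close> and
  \<open>bres\<close> descend to modules.\<close>

lemma mon_nat_slin:
 assumes "mon_nat C D F F' \<tau>" and c: "cmon_ctx D B mB eB SD" and Y: "Y \<in> modules D B mB eB"
  and a: "a \<in> homs C (A \<odot>\<^bsub>C\<^esub> X) X" "A \<in> cobj C" "X \<in> cobj C"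
  and k: "cmon_ctx.slin D B \<phi> (farr F' a \<bullet>\<^bsub>D\<^esub> fmu F' A X) Y k" and phi: "cdom D \<phi> = fobj F' A"
 shows "cmon_ctx.slin D B (\<phi> \<bullet>\<^bsub>D\<^esub> \<tau> A) (farr F a \<bullet>\<^bsub>D\<^esub> fmu F A X) Y (k \<bullet>\<^bsub>D\<^esub> \<tau> X)"
proof -
 interpret cmon_ctx D B mB eB SD by (rule c)
 interpret mon_nat C D F F' \<tau> by fact
 have a' [simp]: "a \<in> carr C" "cdom C a = A \<odot>\<^bsub>C\<^esub> X" "ccod C a = X" "A \<in> cobj C" "X \<in> cobj C" using a by (auto simp: in_homs)
 have t [simp]: "ar (\<tau> x)" "dm (\<tau> x) = fobj F x" "cd (\<tau> x) = fobj F' x" if "x \<in> cobj C" for x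
  using component[OF that] unfolding in_homs by simp_all
 note [simp] = Y slinD(2,4)[OF k] actnD(1,2)[OF slinD(1)[OF k]] phi
 have dk [simp]: "dm k = fobj F' X" using slinD(3)[OF k] by simp
 have "(k \<bullet>\<^bsub>D\<^esub> \<tau> X) \<bullet>\<^bsub>D\<^esub> farr F a \<bullet>\<^bsub>D\<^esub> fmu F A X = k \<bullet>\<^bsub>D\<^esub> (\<tau> X \<bullet>\<^bsub>D\<^esub> farr F a) \<bullet>\<^bsub>D\<^esub> fmu F A X" by (simp add: cassoc)
 also have "\<dots> = k \<bullet>\<^bsub>D\<^esub> farr F' a \<bullet>\<^bsub>D\<^esub> \<tau> (A \<odot>\<^bsub>C\<^esub> X) \<bullet>\<^bsub>D\<^esub> fmu F A X"
  unfolding natural[OF a(1)] by (simp add: cassoc)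
 also have "\<dots> = (k \<bullet>\<^bsub>D\<^esub> farr F' a \<bullet>\<^bsub>D\<^esub> fmu F' A X) \<bullet>\<^bsub>D\<^esub> (\<tau> A \<star>\<^bsub>D\<^esub> \<tau> X)"
  using mon_tens[of A X] by (simp add: cassoc)
 also have "\<dots> = snd Y \<bullet>\<^bsub>D\<^esub> ((\<phi> \<bullet>\<^bsub>D\<^esub> \<tau> A) \<star>\<^bsub>D\<^esub> (k \<bullet>\<^bsub>D\<^esub> \<tau> X))"
  unfolding slinD(5)[OF k] by (simp add: nf)
 finally show ?thesis by (simp add: slin_def actn_def)
qed

section \<open>Transfer to monoidal functors with values in modules\<close>

context cmon_ctx
begin

lemma gen_dm: "ovr q X q' Y f u ==> dm f = dm q" "ovr q X q' Y f u ==> cd f = dm q'" "ovr q X q' Y f u ==> ar f"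
 by (simp_all add: ovr_def)

text \<open>In contrast to \<open>indfun\<close>, the source \<open>E\<close> is any symmetric
  monoidal category; the case in mind is \<open>T \<mapsto> T \<box>\<^sub>R M\<close> on
  isomorphisms of finite sets. The coherence laws are inherited from \<open>F\<close>.\<close>

lemma transfer_functor:
 fixes E :: "('p, 'b, 'k) smc_scheme" and F :: "('p, 'b, 'o, 'a) smfun"
  and \<Phi> :: "('p, 'b, ('o, 'a) md, ('o, 'a) mdmap) smfun"
 assumes F: "sm_functor E C F"
  and g: "\<And>x. x \<in> cobj E ==> gen (\<gamma> x) (fobj \<Phi> x)"
  and a: "\<And>f x y. f \<in> homs E x y ==> ovr (\<gamma> x) (fobj \<Phi> x) (\<gamma> y) (fobj \<Phi> y) (farr F f) (farr \<Phi> f)"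
  and mu: "\<And>x y. x \<in> cobj E ==> y \<in> cobj E ==> ovr (qt (\<gamma> x) (fobj \<Phi> x) (\<gamma> y) (fobj \<Phi> y)) (mt (fobj \<Phi> x) (fobj \<Phi> y))
   (\<gamma> (x \<odot>\<^bsub>E\<^esub> y)) (fobj \<Phi> (x \<odot>\<^bsub>E\<^esub> y)) (fmu F x y) (fmu \<Phi> x y)"
  and mui: "\<And>x y. x \<in> cobj E ==> y \<in> cobj E ==> fmu \<Phi> x y \<in> isos W (mt (fobj \<Phi> x) (fobj \<Phi> y)) (fobj \<Phi> (x \<odot>\<^bsub>E\<^esub> y))"
  and ep: "ovr e (A, m) (\<gamma> (unit_obj E)) (fobj \<Phi> (unit_obj E)) (feps F) (feps \<Phi>)"
  and epi: "feps \<Phi> \<in> isos W (A, m) (fobj \<Phi> (unit_obj E))"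
 shows "sm_functor E W \<Phi>"
proof -
 interpret F: sm_functor E C F by (rule F)
 interpret W: sym_mon_cat W by (rule W_sym_mon)
 have d [simp]: "ar (\<gamma> x)" "cd (\<gamma> x) = fst (fobj \<Phi> x)" "md (fobj \<Phi> x)" if "x \<in> cobj E" for x
  using genD[OF g[OF that]] by auto
 have dm_g [simp]: "dm (\<gamma> x) = fobj F x" if "x \<in> cobj E" for x
  using gen_dm(1)[OF a[OF F.src.id_hom[OF that]]] that by simp
 note rules = gen_rules ovr_rules g mu ep
 show ?thesis
 proof (unfold_locales, unfold W_obj)
  show "md (fobj \<Phi> x)" if "x \<in> cobj E" for x using that by simp
  show "farr \<Phi> f \<in> homs W (fobj \<Phi> x) (fobj \<Phi> y)" if "f \<in> homs E x y" for f x y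
   by (rule ovr_homs[OF a[OF that]])
  show "farr \<Phi> (cid E x) = cid W (fobj \<Phi> x)" if x: "x \<in> cobj E" for x
   by (rule ovr_eq[OF g[OF x] a[OF F.src.id_hom[OF x]] ovr_id[OF g[OF x]]]) (simp_all add: x)
  show "farr \<Phi> (h \<bullet>\<^bsub>E\<^esub> f) = farr \<Phi> h \<bullet>\<^bsub>W\<^esub> farr \<Phi> f" if f: "f \<in> homs E x y" "h \<in> homs E y z" for f x y h z
  proof -
   have x: "x \<in> cobj E" using f F.src.dom_closed by (auto simp: in_homs)
   show ?thesis
    by (rule ovr_eq[OF g[OF x] a[OF F.src.comp_hom[OF f]] ovr_comp[OF a[OF f(1)] a[OF f(2)]]]) (simp_all add: F.map_comp[OF f])
  qed
  show "fmu \<Phi> x y \<in> isos W (mt (fobj \<Phi> x) (fobj \<Phi> y)) (fobj \<Phi> (x \<odot>\<^bsub>E\<^esub> y))" if "x \<in> cobj E" "y \<in> cobj E" for x y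
   using that by (rule mui)
  show "feps \<Phi> \<in> isos W (A, m) (fobj \<Phi> (unit_obj E))" by (rule epi)
  show "farr \<Phi> (f \<star>\<^bsub>E\<^esub> h) \<bullet>\<^bsub>W\<^esub> fmu \<Phi> x y = fmu \<Phi> x' y' \<bullet>\<^bsub>W\<^esub> (farr \<Phi> f \<star>\<^bsub>W\<^esub> farr \<Phi> h)"
   if f: "f \<in> homs E x x'" "h \<in> homs E y y'" for f x x' h y y'
  proof -
   have o: "x \<in> cobj E" "y \<in> cobj E" "x' \<in> cobj E" "y' \<in> cobj E"
    using f F.src.dom_closed F.src.cod_closed by (auto simp: in_homs)
   show ?thesis
    by (rule ovr_eq[OF gen_tens[OF g g] ovr_comp[OF mu a[OF F.src.tensa_hom[OF f]]] ovr_comp[OF ovr_tens[OF a[OF f(1)] a[OF f(2)]] mu]])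
     (simp_all add: o F.mu_nat[OF f])
  qed
  show "farr \<Phi> (assoc E x y z) \<bullet>\<^bsub>W\<^esub> fmu \<Phi> (x \<odot>\<^bsub>E\<^esub> y) z \<bullet>\<^bsub>W\<^esub> (fmu \<Phi> x y \<star>\<^bsub>W\<^esub> cid W (fobj \<Phi> z)) =
    fmu \<Phi> x (y \<odot>\<^bsub>E\<^esub> z) \<bullet>\<^bsub>W\<^esub> (cid W (fobj \<Phi> x) \<star>\<^bsub>W\<^esub> fmu \<Phi> y z) \<bullet>\<^bsub>W\<^esub> assoc W (fobj \<Phi> x) (fobj \<Phi> y) (fobj \<Phi> z)"
   if o: "x \<in> cobj E" "y \<in> cobj E" "z \<in> cobj E" for x y z
  proof (rule ovr_eq)
   show "gen (qt (qt (\<gamma> x) (fobj \<Phi> x) (\<gamma> y) (fobj \<Phi> y)) (mt (fobj \<Phi> x) (fobj \<Phi> y)) (\<gamma> z) (fobj \<Phi> z))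
    (mt (mt (fobj \<Phi> x) (fobj \<Phi> y)) (fobj \<Phi> z))" by (intro gen_tens g o)
  qed ((rule a[OF isos_homs[OF F.src.assoc_iso]] rules o F.src.tens_obj | simp add: o F.mu_assoc)+)
  show "farr \<Phi> (lun E x) \<bullet>\<^bsub>W\<^esub> fmu \<Phi> (unit_obj E) x \<bullet>\<^bsub>W\<^esub> (feps \<Phi> \<star>\<^bsub>W\<^esub> cid W (fobj \<Phi> x)) = lun W (fobj \<Phi> x)"
   if o: "x \<in> cobj E" for x
  proof (rule ovr_eq)
   show "gen (qt e (A, m) (\<gamma> x) (fobj \<Phi> x)) (mt (A, m) (fobj \<Phi> x))" by (intro gen_tens gen_unit g o)
  qed ((rule a[OF isos_homs[OF F.src.lun_iso]] rules o F.src.unit_in | simp add: o F.mu_lunit)+)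
  show "farr \<Phi> (run E x) \<bullet>\<^bsub>W\<^esub> fmu \<Phi> x (unit_obj E) \<bullet>\<^bsub>W\<^esub> (cid W (fobj \<Phi> x) \<star>\<^bsub>W\<^esub> feps \<Phi>) = run W (fobj \<Phi> x)"
   if o: "x \<in> cobj E" for x
  proof (rule ovr_eq)
   show "gen (qt (\<gamma> x) (fobj \<Phi> x) e (A, m)) (mt (fobj \<Phi> x) (A, m))" by (intro gen_tens gen_unit g o)
  qed ((rule a[OF isos_homs[OF F.src.run_iso]] rules o F.src.unit_in | simp add: o F.mu_runit)+)
  show "farr \<Phi> (braid E x y) \<bullet>\<^bsub>W\<^esub> fmu \<Phi> x y = fmu \<Phi> y x \<bullet>\<^bsub>W\<^esub> braid W (fobj \<Phi> x) (fobj \<Phi> y)"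
   if o: "x \<in> cobj E" "y \<in> cobj E" for x y
  proof (rule ovr_eq)
   show "gen (qt (\<gamma> x) (fobj \<Phi> x) (\<gamma> y) (fobj \<Phi> y)) (mt (fobj \<Phi> x) (fobj \<Phi> y))" by (intro gen_tens g o)
  qed ((rule a[OF isos_homs[OF F.src.braid_iso]] rules o | simp add: o F.mu_braid)+)
 qed
qed

lemma transfer_nat:
 fixes E :: "('p, 'b, 'k) smc_scheme" and F F' :: "('p, 'b, 'o, 'a) smfun"
  and \<Phi> \<Phi>' :: "('p, 'b, ('o, 'a) md, ('o, 'a) mdmap) smfun"
 assumes n: "mon_nat E C F F' \<tau>" and P: "sm_functor E W \<Phi>" "sm_functor E W \<Phi>'"
  and g: "\<And>x. x \<in> cobj E ==> gen (\<gamma> x) (fobj \<Phi> x)"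
  and a: "\<And>f x y. f \<in> homs E x y ==> ovr (\<gamma> x) (fobj \<Phi> x) (\<gamma> y) (fobj \<Phi> y) (farr F f) (farr \<Phi> f)"
  and mu: "\<And>x y. x \<in> cobj E ==> y \<in> cobj E ==> ovr (qt (\<gamma> x) (fobj \<Phi> x) (\<gamma> y) (fobj \<Phi> y)) (mt (fobj \<Phi> x) (fobj \<Phi> y))
   (\<gamma> (x \<odot>\<^bsub>E\<^esub> y)) (fobj \<Phi> (x \<odot>\<^bsub>E\<^esub> y)) (fmu F x y) (fmu \<Phi> x y)"
  and ep: "ovr e (A, m) (\<gamma> (unit_obj E)) (fobj \<Phi> (unit_obj E)) (feps F) (feps \<Phi>)"
  and a': "\<And>f x y. f \<in> homs E x y ==> ovr (\<gamma>' x) (fobj \<Phi>' x) (\<gamma>' y) (fobj \<Phi>' y) (farr F' f) (farr \<Phi>' f)"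
  and mu': "\<And>x y. x \<in> cobj E ==> y \<in> cobj E ==> ovr (qt (\<gamma>' x) (fobj \<Phi>' x) (\<gamma>' y) (fobj \<Phi>' y)) (mt (fobj \<Phi>' x) (fobj \<Phi>' y))
   (\<gamma>' (x \<odot>\<^bsub>E\<^esub> y)) (fobj \<Phi>' (x \<odot>\<^bsub>E\<^esub> y)) (fmu F' x y) (fmu \<Phi>' x y)"
  and ep': "ovr e (A, m) (\<gamma>' (unit_obj E)) (fobj \<Phi>' (unit_obj E)) (feps F') (feps \<Phi>')"
  and t: "\<And>x. x \<in> cobj E ==> ovr (\<gamma> x) (fobj \<Phi> x) (\<gamma>' x) (fobj \<Phi>' x) (\<tau> x) (\<tau>' x)"
 shows "mon_nat E W \<Phi> \<Phi>' \<tau>'"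
proof -
 interpret n: mon_nat E C F F' \<tau> by (rule n)
 interpret P: sm_functor E W \<Phi> by (rule P)
 interpret P': sm_functor E W \<Phi>' by (rule P)
 show ?thesis
 proof (intro mon_nat.intro mon_nat_axioms.intro P)
  show "\<tau>' x \<in> homs W (fobj \<Phi> x) (fobj \<Phi>' x)" if "x \<in> cobj E" for x
   by (rule ovr_homs[OF t[OF that]])
  show "\<tau>' y \<bullet>\<^bsub>W\<^esub> farr \<Phi> f = farr \<Phi>' f \<bullet>\<^bsub>W\<^esub> \<tau>' x" if f: "f \<in> homs E x y" for f x y
  proof -
   have o: "x \<in> cobj E" "y \<in> cobj E" using f n.dom.src.dom_closed n.dom.src.cod_closed by (auto simp: in_homs)
   show ?thesis
    by (rule ovr_eq[OF g[OF o(1)] ovr_comp[OF a[OF f] t[OF o(2)]] ovr_comp[OF t[OF o(1)] a'[OF f]]]) (simp_all add: n.natural[OF f])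
  qed
  show "\<tau>' (x \<odot>\<^bsub>E\<^esub> y) \<bullet>\<^bsub>W\<^esub> fmu \<Phi> x y = fmu \<Phi>' x y \<bullet>\<^bsub>W\<^esub> (\<tau>' x \<star>\<^bsub>W\<^esub> \<tau>' y)"
   if o: "x \<in> cobj E" "y \<in> cobj E" for x y
   by (rule ovr_eq[OF gen_tens[OF g g] ovr_comp[OF mu t] ovr_comp[OF ovr_tens[OF t t] mu']])
    (simp_all add: o n.dom.src.tens_obj n.mon_tens)
  show "\<tau>' (unit_obj E) \<bullet>\<^bsub>W\<^esub> feps \<Phi> = feps \<Phi>'"
   by (rule ovr_eq[OF gen_unit ovr_comp[OF ep t] ep']) (simp_all add: n.dom.src.unit_in n.mon_unit)
 qed
qed

end

section \<open>Finite \<open>G\<close>-sets over an orbit\<close>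

text \<open>The point over \<open>G/H\<close> has underlying set \<open>G/H\<close>, so it is a
  finite set when \<open>G\<close> is finite.\<close>

locale fin_indexing_system = indexing_system G \<O> for G :: "'g monoid" and \<O> +
 assumes finite_G: "finite (carrier G)"
begin

lemma lcos_carrier: "subgroup H G ==> c \<in> lcosets\<^bsub>G\<^esub> H ==> c \<subseteq> carrier G"
 using subgroup.subset[of H G] l_coset_subset_G[of H] by (auto simp: LCOSETS_def)

lemma lcos_act: "subgroup H G ==> c \<in> lcosets\<^bsub>G\<^esub> H ==> g \<in> carrier G ==> g <#\<^bsub>G\<^esub> c \<in> lcosets\<^bsub>G\<^esub> H"
 using subgroup.subset[of H G] lcos_m_assoc[of H g] by (auto simp: LCOSETS_def)

lemma lcos_mult: "subgroup H G ==> c \<in> lcosets\<^bsub>G\<^esub> H ==> g \<in> carrier G ==> h \<in> carrier G ==>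
  (g \<otimes>\<^bsub>G\<^esub> h) <#\<^bsub>G\<^esub> c = g <#\<^bsub>G\<^esub> (h <#\<^bsub>G\<^esub> c)"
 by (rule lcos_m_assoc[symmetric, OF lcos_carrier])

lemma lcos_one: "subgroup H G ==> c \<in> lcosets\<^bsub>G\<^esub> H ==> \<one>\<^bsub>G\<^esub> <#\<^bsub>G\<^esub> c = c"
 by (rule lcos_mult_one[OF lcos_carrier])

lemma finite_lcosets: "finite (lcosets\<^bsub>G\<^esub> H)"
 using finite_G by (simp add: LCOSETS_def)

lemma lcosets_G: "lcosets\<^bsub>G\<^esub> (carrier G) = {carrier G}"
proof -
 have "a <#\<^bsub>G\<^esub> carrier G = carrier G" if "a \<in> carrier G" for a
  using that by (intro coset_join3 subgroup_self)
 then show ?thesis unfolding LCOSETS_def by auto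
qed

section \<open>The orbit category\<close>

lemma orb_simps [simp]:
 "cobj (orb G) = {H. subgroup H G}" "cdom (orb G) (K, f, H) = K" "ccod (orb G) (K, f, H) = H"
 "cid (orb G) H = (H, (\<lambda>c \<in> lcosets\<^bsub>G\<^esub> H. c), H)"
 "(K', f', H') \<bullet>\<^bsub>orb G\<^esub> (K, f, H) = (K, compose (lcosets\<^bsub>G\<^esub> K) f' f, H')"
 by (simp_all add: orb_def)

lemma orb_hom: "f \<in> homs (orb G) K H \<longleftrightarrow> (\<exists>h. f = (K, h, H) & subgroup K G & subgroup H G &
  h \<in> lcosets\<^bsub>G\<^esub> K \<rightarrow>\<^sub>E lcosets\<^bsub>G\<^esub> H & (\<forall>g \<in> carrier G. \<forall>c \<in> lcosets\<^bsub>G\<^esub> K. h (g <#\<^bsub>G\<^esub> c) = g <#\<^bsub>G\<^esub> h c))"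
 by (cases f) (auto simp: in_homs orb_def)

lemma orb_id: "subgroup H G ==> cid (orb G) H \<in> homs (orb G) H H"
 by (auto simp: orb_hom lcos_act)

lemma orb_comp: "f \<in> homs (orb G) K H ==> h \<in> homs (orb G) L K ==> f \<bullet>\<^bsub>orb G\<^esub> h \<in> homs (orb G) L H"
proof -
 assume "f \<in> homs (orb G) K H" "h \<in> homs (orb G) L K"
 then obtain f' h' where e: "f = (K, f', H)" "h = (L, h', K)" and s: "subgroup K G" "subgroup H G" "subgroup L G"
  and m: "f' \<in> lcosets\<^bsub>G\<^esub> K \<rightarrow>\<^sub>E lcosets\<^bsub>G\<^esub> H" "h' \<in> lcosets\<^bsub>G\<^esub> L \<rightarrow>\<^sub>E lcosets\<^bsub>G\<^esub> K"
  and eq: "\<forall>g \<in> carrier G. \<forall>c \<in> lcosets\<^bsub>G\<^esub> K. f' (g <#\<^bsub>G\<^esub> c) = g <#\<^bsub>G\<^esub> f' c"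
   "\<forall>g \<in> carrier G. \<forall>c \<in> lcosets\<^bsub>G\<^esub> L. h' (g <#\<^bsub>G\<^esub> c) = g <#\<^bsub>G\<^esub> h' c"
  unfolding orb_hom by blast
 have "h' c \<in> lcosets\<^bsub>G\<^esub> K" if "c \<in> lcosets\<^bsub>G\<^esub> L" for c using m that by auto
 then show ?thesis
  unfolding orb_hom e using m eq s by (auto simp: compose_def lcos_act PiE_iff)
qed

lemma orb_homD: "f \<in> homs (orb G) K H ==> subgroup K G" "f \<in> homs (orb G) K H ==> subgroup H G"
 "f \<in> homs (orb G) K H ==> cdom (orb G) f = K" "f \<in> homs (orb G) K H ==> ccod (orb G) f = H"
 by (auto simp: orb_hom)

lemma omap_lcos:
 assumes "f \<in> homs (orb G) K H"
 shows "c \<in> lcosets\<^bsub>G\<^esub> K ==> omap f c \<in> lcosets\<^bsub>G\<^esub> H"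
  "c \<in> lcosets\<^bsub>G\<^esub> K ==> g \<in> carrier G ==> omap f (g <#\<^bsub>G\<^esub> c) = g <#\<^bsub>G\<^esub> omap f c"
 using assms by (auto simp: orb_hom omap_def)

lemma proj_orb_hom: "subgroup H G ==> proj_orb G H (carrier G) \<in> homs (orb G) H (carrier G)"
proof -
 assume H: "subgroup H G"
 have 1: "c <#>\<^bsub>G\<^esub> carrier G = carrier G" if c: "c \<in> lcosets\<^bsub>G\<^esub> H" for c
 proof -
  obtain a where a: "a \<in> carrier G" "c = a <#\<^bsub>G\<^esub> H" using c by (auto simp: LCOSETS_def)
  then have "a \<in> c" using lcos_self[OF a(1) H] by simp
  show ?thesis
  proof
   show "c <#>\<^bsub>G\<^esub> carrier G \<subseteq> carrier G" by (rule set_mult_closed[OF lcos_carrier[OF H c]]) simp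
   show "carrier G \<subseteq> c <#>\<^bsub>G\<^esub> carrier G"
   proof
    fix x assume x: "x \<in> carrier G"
    have "x = a \<otimes>\<^bsub>G\<^esub> (inv\<^bsub>G\<^esub> a \<otimes>\<^bsub>G\<^esub> x)" using a x by (simp add: m_assoc[symmetric])
    then show "x \<in> c <#>\<^bsub>G\<^esub> carrier G" using \<open>a \<in> c\<close> a x unfolding set_mult_def by blast
   qed
  qed
 qed
 have 2: "g <#\<^bsub>G\<^esub> carrier G = carrier G" if "g \<in> carrier G" for g
  using that by (intro coset_join3 subgroup_self)
 show ?thesis
  unfolding orb_hom proj_orb_def using H 1 2 lcos_act[OF H] by (auto simp: subgroup_self lcosets_G intro!: restrict_ext)
qed

text \<open>\<open>G/G\<close> has a single element, so all maps into it from a given orbit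
  agree.\<close>

lemma proj_orb_comp: "f \<in> homs (orb G) K H ==> proj_orb G H (carrier G) \<bullet>\<^bsub>orb G\<^esub> f = proj_orb G K (carrier G)"
proof -
 assume f: "f \<in> homs (orb G) K H"
 have "h = h'" if "(K, h, carrier G) \<in> homs (orb G) K (carrier G)" "(K, h', carrier G) \<in> homs (orb G) K (carrier G)" for h h'
  using that unfolding orb_hom lcosets_G by (auto intro: PiE_ext)
 moreover have "proj_orb G H (carrier G) \<bullet>\<^bsub>orb G\<^esub> f \<in> homs (orb G) K (carrier G)" "proj_orb G K (carrier G) \<in> homs (orb G) K (carrier G)"
  using orb_homD[OF f] f by (auto intro: orb_comp proj_orb_hom)
 ultimately show ?thesis by (auto simp: orb_hom proj_orb_def)
qed

section \<open>Finite sets over an orbit\<close>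

lemma gset_act:
 assumes X: "X \<in> gsets G H"
 shows "g \<in> carrier G ==> x \<in> pts X ==> act X g x \<in> pts X"
  "g \<in> carrier G ==> h \<in> carrier G ==> x \<in> pts X ==> act X (g \<otimes>\<^bsub>G\<^esub> h) x = act X g (act X h x)"
  "x \<in> pts X ==> act X \<one>\<^bsub>G\<^esub> x = x"
  "x \<in> pts X ==> proj X x \<in> lcosets\<^bsub>G\<^esub> H"
  "g \<in> carrier G ==> x \<in> pts X ==> proj X (act X g x) = g <#\<^bsub>G\<^esub> proj X x"
  "finite (pts X)"
proof -
 interpret a: group_action G "pts X" "act X" using X by (simp add: gsets_def)
 show "g \<in> carrier G ==> x \<in> pts X ==> act X g x \<in> pts X" by (rule a.element_image) auto
 show "g \<in> carrier G ==> h \<in> carrier G ==> x \<in> pts X ==> act X (g \<otimes>\<^bsub>G\<^esub> h) x = act X g (act X h x)"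
  by (rule a.composition_rule)
 show "x \<in> pts X ==> act X \<one>\<^bsub>G\<^esub> x = x" using fun_cong[OF a.id_eq_one, of x] by simp
 show "x \<in> pts X ==> proj X x \<in> lcosets\<^bsub>G\<^esub> H"
  "g \<in> carrier G ==> x \<in> pts X ==> proj X (act X g x) = g <#\<^bsub>G\<^esub> proj X x" "finite (pts X)"
  using X by (auto simp: gsets_def)
qed

lemma mk_gset_simps [simp]:
 "pts (mk_gset G E a p) = E" "g \<in> carrier G ==> x \<in> E ==> act (mk_gset G E a p) g x = a g x"
 "x \<in> E ==> proj (mk_gset G E a p) x = p x"
 by (simp_all add: mk_gset_def)

lemma mk_gset_in:
 assumes "finite E"
  and a: "\<And>g x. g \<in> carrier G ==> x \<in> E ==> a g x \<in> E"
  "\<And>g h x. g \<in> carrier G ==> h \<in> carrier G ==> x \<in> E ==> a (g \<otimes>\<^bsub>G\<^esub> h) x = a g (a h x)"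
  "\<And>x. x \<in> E ==> a \<one>\<^bsub>G\<^esub> x = x"
  and p: "\<And>x. x \<in> E ==> p x \<in> lcosets\<^bsub>G\<^esub> H"
  "\<And>g x. g \<in> carrier G ==> x \<in> E ==> p (a g x) = g <#\<^bsub>G\<^esub> p x"
 shows "mk_gset G E a p \<in> gsets G H"
proof -
 let ?f = "\<lambda>g \<in> carrier G. \<lambda>x \<in> E. a g x"
 have inv: "a (inv\<^bsub>G\<^esub> g) (a g x) = x" "a g (a (inv\<^bsub>G\<^esub> g) x) = x" if "g \<in> carrier G" "x \<in> E" for g x
  using that a(2)[of "inv\<^bsub>G\<^esub> g" g x] a(2)[of g "inv\<^bsub>G\<^esub> g" x] a(3)[of x] by simp_all
 have bij: "(\<lambda>x \<in> E. a g x) \<in> Bij E" if g: "g \<in> carrier G" for g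
  unfolding Bij_def
 proof (intro IntI CollectI)
  show "bij_betw (\<lambda>x \<in> E. a g x) E E"
   by (rule bij_betw_byWitness[where f' = "%x. a (inv\<^bsub>G\<^esub> g) x"]) (use g a(1) inv in auto)
 qed simp
 have "group_hom G (BijGroup E) ?f"
 proof (intro group_hom.intro group_hom_axioms.intro homI)
  show "group G" by (rule group_axioms)
  show "group (BijGroup E)" by (rule group_BijGroup)
  show "?f g \<in> carrier (BijGroup E)" if "g \<in> carrier G" for g using bij that by (simp add: BijGroup_def)
  show "?f (g \<otimes>\<^bsub>G\<^esub> h) = ?f g \<otimes>\<^bsub>BijGroup E\<^esub> ?f h" if gh: "g \<in> carrier G" "h \<in> carrier G" for g h
   using gh bij[OF gh(1)] bij[OF gh(2)] a by (auto simp: BijGroup_def compose_def fun_eq_iff restrict_def)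
 qed
 then have "group_action G E ?f" by (rule group_action.intro)
 then show ?thesis using assms(1) p a(1) by (simp add: gsets_def mk_gset_def)
qed

lemma gmaps_iff: "(X, f, Y) \<in> gmaps G H \<longleftrightarrow> X \<in> gsets G H & Y \<in> gsets G H & f \<in> pts X \<rightarrow>\<^sub>E pts Y &
   (\<forall>x \<in> pts X. proj Y (f x) = proj X x) & (\<forall>g \<in> carrier G. \<forall>x \<in> pts X. f (act X g x) = act Y g (f x))"
 by (simp add: gmaps_def)

lemma mk_gmapI:
 assumes "X \<in> gsets G H" "Y \<in> gsets G H" "\<And>x. x \<in> pts X ==> f x \<in> pts Y" "\<And>x. x \<in> pts X ==> proj Y (f x) = proj X x"
  "\<And>g x. g \<in> carrier G ==> x \<in> pts X ==> f (act X g x) = act Y g (f x)"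
 shows "mk_gmap X f Y \<in> gmaps G H"
 using assms gset_act(1)[OF assms(1)] by (simp add: mk_gmap_def gmaps_iff)

lemma fset_simps [simp]:
 "cobj (fset G H) = gsets G H" "carr (fset G H) = gmaps G H" "cdom (fset G H) (X, f, Y) = X"
 "ccod (fset G H) (X, f, Y) = Y" "cid (fset G H) X = mk_gmap X (%x. x) X"
 "(X', f', Y') \<bullet>\<^bsub>fset G H\<^esub> (X, f, Y) = (X, compose (pts X) f' f, Y')"
 "X \<odot>\<^bsub>fset G H\<^esub> Y = gsum G X Y" "unit_obj (fset G H) = gempty G"
 by (simp_all add: fset_def)

lemma fset_homs: "t \<in> homs (fset G H) X Y \<longleftrightarrow> (\<exists>f. t = (X, f, Y) & (X, f, Y) \<in> gmaps G H)"
 by (cases t) (auto simp: in_homs)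

lemma gmap_comp:
 assumes "(X, f, Y) \<in> gmaps G H" "(Y, f', Z) \<in> gmaps G H"
 shows "(X, compose (pts X) f' f, Z) \<in> gmaps G H"
proof -
 have "f x \<in> pts Y" if "x \<in> pts X" for x using assms(1) that by (auto simp: gmaps_iff)
 then show ?thesis
  using assms gset_act(1)[of X H] unfolding gmaps_iff by (auto simp: compose_def PiE_iff)
qed

lemma fset_category: "category (fset G H)"
proof
 show "cdom (fset G H) f \<in> cobj (fset G H)" "ccod (fset G H) f \<in> cobj (fset G H)" if "f \<in> carr (fset G H)" for f
  using that by (cases f; auto simp: gmaps_iff)+
 show "cid (fset G H) x \<in> homs (fset G H) x x" if "x \<in> cobj (fset G H)" for x
  using that mk_gmapI[of x H x "%x. x"] by (auto simp: in_homs mk_gmap_def)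
 show "g \<bullet>\<^bsub>fset G H\<^esub> f \<in> homs (fset G H) x z" if "f \<in> homs (fset G H) x y" "g \<in> homs (fset G H) y z" for f x y g z
  using that by (auto simp: fset_homs gmap_comp)
 show "cid (fset G H) y \<bullet>\<^bsub>fset G H\<^esub> f = f" "f \<bullet>\<^bsub>fset G H\<^esub> cid (fset G H) x = f" if "f \<in> homs (fset G H) x y" for f x y
  using that by (fastforce simp: fset_homs mk_gmap_def gmaps_iff compose_def PiE_iff extensional_def restrict_def)+
 show "(h \<bullet>\<^bsub>fset G H\<^esub> g) \<bullet>\<^bsub>fset G H\<^esub> f = h \<bullet>\<^bsub>fset G H\<^esub> g \<bullet>\<^bsub>fset G H\<^esub> f"
  if "f \<in> homs (fset G H) w x" "g \<in> homs (fset G H) x y" "h \<in> homs (fset G H) y z" for f w x g y h z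
  using that by (auto simp: fset_homs gmaps_iff compose_def PiE_iff fun_eq_iff)
qed

section \<open>Closure properties of the indexing system\<close>

lemma O_gset: "subgroup H G ==> T \<in> \<O> H ==> T \<in> gsets G H"
 using objects[of H] by (auto simp: FSet_def)

lemma gsum_O: "subgroup H G ==> S \<in> \<O> H ==> T \<in> \<O> H ==> gsum G S T \<in> \<O> H"
 using sum_closed[of H S T] by (simp add: FSet_def)

lemma gempty_O: "subgroup H G ==> gempty G \<in> \<O> H"
 using empty_closed[of H] by (simp add: FSet_def)

lemma gpull_O: "f \<in> homs (orb G) K H ==> T \<in> \<O> H ==> gpull G f T \<in> \<O> K"
 using res_closed[of f K H T] by (simp add: FSet_def)

lemma gpoint_pts: "pts (gpoint G H) = Cst ` (lcosets\<^bsub>G\<^esub> H)"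
 by (simp add: gpoint_def gorbit_def)

lemma gpoint_eqs:
 "c \<in> lcosets\<^bsub>G\<^esub> H ==> g \<in> carrier G ==> act (gpoint G H) g (Cst c) = Cst (g <#\<^bsub>G\<^esub> c)"
 "c \<in> lcosets\<^bsub>G\<^esub> H ==> proj (gpoint G H) (Cst c) = c"
 by (simp_all add: gpoint_def gorbit_def the_cst_def omap_def)

lemma gpoint_gset: "subgroup H G ==> gpoint G H \<in> gsets G H"
 unfolding gpoint_def gorbit_def
 by (rule mk_gset_in) (auto simp: finite_lcosets the_cst_def omap_def lcos_act lcos_mult lcos_one)

lemma gbang_map: "subgroup H G ==> X \<in> gsets G H ==> gbang G H X \<in> gmaps G H"
 unfolding gbang_def
 by (rule mk_gmapI) (auto simp: gpoint_gset gpoint_pts gpoint_eqs gset_act)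

text \<open>The point over \<open>G/H\<close> is the identity of \<open>G/H\<close>, so a map to it
  over \<open>G/H\<close> can only be the projection.\<close>

lemma to_gpoint_unique:
 assumes "subgroup H G" "(X, f, gpoint G H) \<in> gmaps G H" shows "(X, f, gpoint G H) = gbang G H X"
proof -
 have "f x = Cst (proj X x)" if x: "x \<in> pts X" for x
 proof -
  have "f x \<in> pts (gpoint G H)" "proj (gpoint G H) (f x) = proj X x" using assms x by (auto simp: gmaps_iff)
  then show ?thesis by (auto simp: gpoint_pts gpoint_eqs)
 qed
 moreover have "f \<in> extensional (pts X)" using assms by (auto simp: gmaps_iff PiE_iff)
 ultimately show ?thesis by (auto simp: gbang_def mk_gmap_def fun_eq_iff extensional_def restrict_def)
qed

text \<open>The point over \<open>G/H\<close> is terminal, hence the limit of the empty diagram, and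
  \<open>\<O>\<close> is closed under finite limits.\<close>

lemma gpoint_O:
 assumes H: "subgroup H G" shows "gpoint G H \<in> \<O> H"
proof -
 let ?J = "\<lparr>cobj = {}, carr = {}, cdom = (%_. 0), ccod = (%_. 0), cid = (%_. 0), ccomp = (%_ _. 0)\<rparr> :: (nat, nat) cat"
 interpret F: category "fset G H" by (rule fset_category)
 have l: "lev (FSet G) H = fset G H" by (simp add: FSet_def)
 show ?thesis
 proof (rule finite_limits[OF H, of ?J "%_. gempty G" "%_. undefined" _ "%_. undefined", unfolded l])
  show "func ?J (fset G H) (%_. gempty G) (%_. undefined)"
   by unfold_locales (auto simp: homs_def)
  show "is_limit ?J (fset G H) (%_. gempty G) (%_. undefined) (gpoint G H) (%_. undefined)"
   unfolding is_limit_def Let_def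
  proof (intro conjI allI impI)
   show "gpoint G H \<in> cobj (fset G H)" by (simp add: gpoint_gset H)
   fix y :: "'g gset" and q :: "nat => 'g gmap"
   assume "y \<in> cobj (fset G H) & (\<forall>j\<in>cobj ?J. q j \<in> homs (fset G H) y (gempty G)) &
    (\<forall>u\<in>carr ?J. undefined \<bullet>\<^bsub>fset G H\<^esub> q (cdom ?J u) = q (ccod ?J u))"
   then have y: "y \<in> gsets G H" by simp
   show "\<exists>!h. h \<in> homs (fset G H) y (gpoint G H) & (\<forall>j\<in>cobj ?J. undefined \<bullet>\<^bsub>fset G H\<^esub> h = q j)"
   proof (rule ex1I[of _ "gbang G H y"])
    show "gbang G H y \<in> homs (fset G H) y (gpoint G H) & (\<forall>j\<in>cobj ?J. undefined \<bullet>\<^bsub>fset G H\<^esub> gbang G H y = q j)"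
     using gbang_map[OF H y] by (simp add: fset_homs gbang_def mk_gmap_def)
    fix h assume "h \<in> homs (fset G H) y (gpoint G H) & (\<forall>j\<in>cobj ?J. undefined \<bullet>\<^bsub>fset G H\<^esub> h = q j)"
    then show "h = gbang G H y" using to_gpoint_unique[OF H] by (auto simp: fset_homs)
   qed
  qed simp_all
 qed simp_all
qed

lemma gprod_pts: "pts (gprod G X Y) = {Pr x y | x y. x \<in> pts X & y \<in> pts Y & proj X x = proj Y y}"
 by (simp add: gprod_def)

lemma gprod_eqs:
 assumes "x \<in> pts X" "y \<in> pts Y" "proj X x = proj Y y"
 shows "g \<in> carrier G ==> act (gprod G X Y) g (Pr x y) = Pr (act X g x) (act Y g y)" "proj (gprod G X Y) (Pr x y) = proj X x"
 using assms by (simp_all add: gprod_def pr_case_def)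

lemma gprod_gset:
 assumes "subgroup H G" and X: "X \<in> gsets G H" and Y: "Y \<in> gsets G H" shows "gprod G X Y \<in> gsets G H"
 unfolding gprod_def
proof (rule mk_gset_in)
 have "{Pr x y |x y. x \<in> pts X & y \<in> pts Y & proj X x = proj Y y} \<subseteq> (%(x, y). Pr x y) ` (pts X \<times> pts Y)" by auto
 then show "finite {Pr x y |x y. x \<in> pts X & y \<in> pts Y & proj X x = proj Y y}"
  by (rule finite_subset) (use gset_act(6)[OF X] gset_act(6)[OF Y] in simp)
qed (use gset_act[OF X] gset_act[OF Y] in \<open>auto simp: pr_case_def\<close>)

text \<open>The fibre product over \<open>G/H\<close> is the binary product among sets over
  \<open>G/H\<close>, here the limit over the discrete category with objects 0 and 1.\<close>

lemma gprod_O: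
 assumes H: "subgroup H G" and X: "X \<in> \<O> H" and Y: "Y \<in> \<O> H" shows "gprod G X Y \<in> \<O> H"
proof -
 let ?J = "\<lparr>cobj = {0, 1}, carr = {0, 1}, cdom = (%x. x), ccod = (%x. x), cid = (%x. x), ccomp = (%x y. y)\<rparr> :: (nat, nat) cat"
 let ?D = "%i :: nat. if i = 0 then X else Y" and ?P = "gprod G X Y"
 let ?p = "%i :: nat. if i = 0 then mk_gmap ?P (pr_case (%x y. x)) X else mk_gmap ?P (pr_case (%x y. y)) Y"
 interpret F: category "fset G H" by (rule fset_category)
 have l: "lev (FSet G) H = fset G H" by (simp add: FSet_def)
 note XG = O_gset[OF H X] and YG = O_gset[OF H Y]
 note PG = gprod_gset[OF H XG YG]
 have p: "mk_gmap ?P (pr_case (%x y. x)) X \<in> gmaps G H" "mk_gmap ?P (pr_case (%x y. y)) Y \<in> gmaps G H"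
  using gset_act[OF XG] gset_act[OF YG]
  by (intro mk_gmapI PG XG YG; auto simp: gprod_pts gprod_eqs pr_case_def)+
 show ?thesis
 proof (rule finite_limits[OF H, of ?J ?D "%i. cid (fset G H) (?D i)" _ ?p, unfolded l])
  show "func ?J (fset G H) ?D (%i. cid (fset G H) (?D i))"
   by unfold_locales (use XG YG F.id_hom[of X] F.id_hom[of Y] in \<open>auto simp: in_homs simp del: fset_simps(3-6)\<close>)
  show "is_limit ?J (fset G H) ?D (%i. cid (fset G H) (?D i)) ?P ?p"
   unfolding is_limit_def Let_def
  proof (intro conjI allI impI)
   show "?P \<in> cobj (fset G H)" by (simp add: PG)
   show ph: "\<forall>j\<in>cobj ?J. ?p j \<in> homs (fset G H) ?P (?D j)"
    using p by (simp add: fset_homs mk_gmap_def)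
   show "\<forall>u\<in>carr ?J. cid (fset G H) (?D u) \<bullet>\<^bsub>fset G H\<^esub> ?p (cdom ?J u) = ?p (ccod ?J u)"
    using ph F.id_left by fastforce
   fix y :: "'g gset" and q :: "nat => 'g gmap"
   assume "y \<in> cobj (fset G H) & (\<forall>j\<in>cobj ?J. q j \<in> homs (fset G H) y (?D j)) &
    (\<forall>u\<in>carr ?J. cid (fset G H) (?D u) \<bullet>\<^bsub>fset G H\<^esub> q (cdom ?J u) = q (ccod ?J u))"
   then obtain f f' where q: "q 0 = (y, f, X)" "q 1 = (y, f', Y)" "(y, f, X) \<in> gmaps G H" "(y, f', Y) \<in> gmaps G H"
    by (auto simp: fset_homs)
   have y: "y \<in> gsets G H" and f: "f \<in> pts y \<rightarrow>\<^sub>E pts X" "f' \<in> pts y \<rightarrow>\<^sub>E pts Y"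
    and fp: "\<And>z. z \<in> pts y ==> proj X (f z) = proj y z" "\<And>z. z \<in> pts y ==> proj Y (f' z) = proj y z"
    and fa: "\<And>g z. g \<in> carrier G ==> z \<in> pts y ==> f (act y g z) = act X g (f z)"
     "\<And>g z. g \<in> carrier G ==> z \<in> pts y ==> f' (act y g z) = act Y g (f' z)"
    using q(3,4) by (auto simp: gmaps_iff)
   have fm: "\<And>z. z \<in> pts y ==> f z \<in> pts X" "\<And>z. z \<in> pts y ==> f' z \<in> pts Y" using f by auto
   let ?h = "mk_gmap y (%z. Pr (f z) (f' z)) ?P"
   have h: "?h \<in> gmaps G H"
    by (rule mk_gmapI) (use y PG fm fp fa in \<open>auto simp: gprod_pts gprod_eqs\<close>)
   show "\<exists>!h. h \<in> homs (fset G H) y ?P & (\<forall>j\<in>cobj ?J. ?p j \<bullet>\<^bsub>fset G H\<^esub> h = q j)"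
   proof (rule ex1I[of _ ?h])
    have "compose (pts y) (restrict (pr_case (%x y. x)) (pts ?P)) (\<lambda>z\<in>pts y. Pr (f z) (f' z)) = f"
     "compose (pts y) (restrict (pr_case (%x y. y)) (pts ?P)) (\<lambda>z\<in>pts y. Pr (f z) (f' z)) = f'"
     using f fm fp by (auto simp: compose_def fun_eq_iff gprod_pts pr_case_def PiE_iff extensional_def)
    then show "?h \<in> homs (fset G H) y ?P & (\<forall>j\<in>cobj ?J. ?p j \<bullet>\<^bsub>fset G H\<^esub> ?h = q j)"
     using h q by (simp add: fset_homs mk_gmap_def)
    fix k assume "k \<in> homs (fset G H) y ?P & (\<forall>j\<in>cobj ?J. ?p j \<bullet>\<^bsub>fset G H\<^esub> k = q j)"
    then obtain k' where k: "k = (y, k', ?P)" "(y, k', ?P) \<in> gmaps G H"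
     and c: "compose (pts y) (restrict (pr_case (%x y. x)) (pts ?P)) k' = f"
      "compose (pts y) (restrict (pr_case (%x y. y)) (pts ?P)) k' = f'"
     using q(1,2) by (auto simp: fset_homs mk_gmap_def)
    have "k' z = Pr (f z) (f' z)" if z: "z \<in> pts y" for z
    proof -
     have kz: "k' z \<in> pts ?P" using k(2) z by (auto simp: gmaps_iff)
     then obtain a b where ab: "k' z = Pr a b" by (auto simp: gprod_pts)
     show ?thesis using fun_cong[OF c(1), of z] fun_cong[OF c(2), of z] z kz ab by (simp add: compose_def pr_case_def)
    qed
    moreover have "k' \<in> extensional (pts y)" using k(2) by (auto simp: gmaps_iff PiE_iff)
    ultimately show "k = ?h" unfolding k(1) by (auto simp: mk_gmap_def fun_eq_iff extensional_def restrict_def)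
   qed
  qed
 qed (use X Y in auto)
qed

lemma osub_simps [simp]:
 "cdom (osub G \<O> H) = cdom (fset G H)" "ccod (osub G \<O> H) = ccod (fset G H)" "cid (osub G \<O> H) = cid (fset G H)"
 "ccomp (osub G \<O> H) = ccomp (fset G H)" "tens (osub G \<O> H) = gsum G" "unit_obj (osub G \<O> H) = gempty G"
 "cdom (oiso G \<O> H) = cdom (fset G H)" "ccod (oiso G \<O> H) = ccod (fset G H)" "cid (oiso G \<O> H) = cid (fset G H)"
 "ccomp (oiso G \<O> H) = ccomp (fset G H)" "tens (oiso G \<O> H) = gsum G" "unit_obj (oiso G \<O> H) = gempty G"
 "tensa (oiso G \<O> H) = tensa (fset G H)" "assoc (oiso G \<O> H) = assoc (fset G H)" "lun (oiso G \<O> H) = lun (fset G H)"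
 "run (oiso G \<O> H) = run (fset G H)" "braid (oiso G \<O> H) = braid (fset G H)" "tensa (osub G \<O> H) = tensa (fset G H)"
 by (simp_all add: oiso_def osub_def iso_part_def full_sub_def FSet_def fset_def)

lemma osub_obj: "subgroup H G ==> cobj (osub G \<O> H) = \<O> H"
 and oiso_obj: "subgroup H G ==> cobj (oiso G \<O> H) = \<O> H"
 using O_gset by (auto simp: oiso_def osub_def iso_part_def full_sub_def FSet_def)

lemma osub_homs: "subgroup H G ==> t \<in> homs (osub G \<O> H) X Y \<longleftrightarrow> X \<in> \<O> H & Y \<in> \<O> H & t \<in> homs (fset G H) X Y"
 unfolding in_homs by (auto simp: osub_def full_sub_def FSet_def)

lemma oiso_homs: "subgroup H G ==> t \<in> homs (oiso G \<O> H) X Y \<longleftrightarrow> X \<in> \<O> H & Y \<in> \<O> H & t \<in> isos (fset G H) X Y"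
proof -
 assume H: "subgroup H G"
 have "t \<in> homs (oiso G \<O> H) X Y \<longleftrightarrow> t \<in> isos (osub G \<O> H) X Y"
  unfolding in_homs oiso_def iso_part_def by (auto simp: isos_def in_homs)
 also have "\<dots> \<longleftrightarrow> X \<in> \<O> H & Y \<in> \<O> H & t \<in> isos (fset G H) X Y"
  unfolding isos_def osub_homs[OF H] mem_Collect_eq Bex_def by auto
 finally show ?thesis .
qed

lemma oiso_osub: "subgroup H G ==> t \<in> homs (oiso G \<O> H) X Y ==> t \<in> homs (osub G \<O> H) X Y"
 by (auto simp: oiso_homs osub_homs isos_def)

lemma gmap_iso:
 assumes f: "(X, f, Y) \<in> gmaps G H" and b: "bij_betw f (pts X) (pts Y)" shows "(X, f, Y) \<in> isos (fset G H) X Y"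
proof -
 have X: "X \<in> gsets G H" and Y: "Y \<in> gsets G H" and fe: "f \<in> pts X \<rightarrow>\<^sub>E pts Y"
  and p: "\<And>x. x \<in> pts X ==> proj Y (f x) = proj X x"
  and a: "\<And>g x. g \<in> carrier G ==> x \<in> pts X ==> f (act X g x) = act Y g (f x)"
  using f by (auto simp: gmaps_iff)
 define h where "h = the_inv_into (pts X) f"
 have h: "h y \<in> pts X" "f (h y) = y" if "y \<in> pts Y" for y
  using b that f_the_inv_into_f_bij_betw[OF b] the_inv_into_into[of f "pts X" y "pts X"] by (auto simp: h_def bij_betw_def)
 have hf: "h (f x) = x" if "x \<in> pts X" for x using b that by (simp add: h_def bij_betw_def the_inv_into_f_f)
 have inj: "x = x'" if "f x = f x'" "x \<in> pts X" "x' \<in> pts X" for x x' using that hf by metis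
 have hm: "mk_gmap Y h X \<in> gmaps G H"
 proof (rule mk_gmapI[OF Y X])
  show "h y \<in> pts X" "proj X (h y) = proj Y y" if "y \<in> pts Y" for y using h[OF that] p[OF h(1)[OF that]] by auto
  show "h (act Y g y) = act X g (h y)" if "g \<in> carrier G" "y \<in> pts Y" for g y
   by (rule inj) (use that h a gset_act(1)[OF X] gset_act(1)[OF Y] in auto)
 qed
 show ?thesis
 proof (rule isosI)
  show "(X, f, Y) \<in> homs (fset G H) X Y" "mk_gmap Y h X \<in> homs (fset G H) Y X"
   using f hm by (auto simp: fset_homs mk_gmap_def)
  show "mk_gmap Y h X \<bullet>\<^bsub>fset G H\<^esub> (X, f, Y) = cid (fset G H) X"
   using fe hf by (auto simp: mk_gmap_def compose_def fun_eq_iff)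
  show "(X, f, Y) \<bullet>\<^bsub>fset G H\<^esub> mk_gmap Y h X = cid (fset G H) Y"
   using h by (auto simp: mk_gmap_def compose_def fun_eq_iff)
 qed
qed

text \<open>An inverse \<open>h\<close> of the bare function is enough: the inverse of a bijective
  equivariant map over \<open>G/H\<close> is again equivariant and over \<open>G/H\<close>.\<close>

lemma mk_gmap_oiso:
 assumes H: "subgroup H G" and XY: "X \<in> \<O> H" "Y \<in> \<O> H"
  and f: "\<And>x. x \<in> pts X ==> f x \<in> pts Y" "\<And>x. x \<in> pts X ==> proj Y (f x) = proj X x"
  "\<And>g x. g \<in> carrier G ==> x \<in> pts X ==> f (act X g x) = act Y g (f x)"
  and h: "\<And>x. x \<in> pts X ==> h (f x) = x" "\<And>y. y \<in> pts Y ==> h y \<in> pts X & f (h y) = y"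
 shows "mk_gmap X f Y \<in> homs (oiso G \<O> H) X Y"
proof -
 have m: "mk_gmap X f Y \<in> gmaps G H" by (rule mk_gmapI) (use O_gset[OF H] XY f in auto)
 have "bij_betw (\<lambda>x \<in> pts X. f x) (pts X) (pts Y)"
  by (rule bij_betw_byWitness[where f' = h]) (use f(1) h in auto)
 with m show ?thesis using XY by (simp add: oiso_homs[OF H] mk_gmap_def gmap_iso)
qed


lemma mk_gmap_osub:
 assumes "subgroup H G" "X \<in> \<O> H" "Y \<in> \<O> H" "\<And>x. x \<in> pts X ==> f x \<in> pts Y" "\<And>x. x \<in> pts X ==> proj Y (f x) = proj X x"
  "\<And>g x. g \<in> carrier G ==> x \<in> pts X ==> f (act X g x) = act Y g (f x)"
 shows "mk_gmap X f Y \<in> homs (osub G \<O> H) X Y"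
proof -
 have "mk_gmap X f Y \<in> gmaps G H" by (rule mk_gmapI) (use assms O_gset in auto)
 then show ?thesis using assms by (simp add: osub_homs fset_homs mk_gmap_def)
qed

section \<open>The canonical isomorphisms between sums, products and pullbacks\<close>

lemma gsum_pts: "pts (gsum G X Y) = InL ` pts X \<union> InR ` pts Y"
 by (simp add: gsum_def)

lemma gsum_eqs:
 "x \<in> pts X ==> g \<in> carrier G ==> act (gsum G X Y) g (InL x) = InL (act X g x)"
 "y \<in> pts Y ==> g \<in> carrier G ==> act (gsum G X Y) g (InR y) = InR (act Y g y)"
 "x \<in> pts X ==> proj (gsum G X Y) (InL x) = proj X x" "y \<in> pts Y ==> proj (gsum G X Y) (InR y) = proj Y y"
 by (simp_all add: gsum_def copair_def)

lemma gempty_pts [simp]: "pts (gempty G) = {}"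
 by (simp add: gempty_def)

lemma gpull_pts: "pts (gpull G f X) = {Pr (Cst c) x | c x. c \<in> lcosets\<^bsub>G\<^esub> (cdom (orb G) f) & x \<in> pts X & omap f c = proj X x}"
 by (simp add: gpull_def)

lemma gpull_eqs:
 assumes "c \<in> lcosets\<^bsub>G\<^esub> (cdom (orb G) f)" "x \<in> pts X" "omap f c = proj X x"
 shows "g \<in> carrier G ==> act (gpull G f X) g (Pr (Cst c) x) = Pr (Cst (g <#\<^bsub>G\<^esub> c)) (act X g x)"
  "proj (gpull G f X) (Pr (Cst c) x) = c"
 using assms by (simp_all add: gpull_def pr_case_def the_cst_def)

lemmas pts_rules = gsum_pts gprod_pts gpull_pts gpoint_pts gsum_eqs gprod_eqs gpull_eqs gpoint_eqs copair_def pr_case_def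

lemma res_osub:
 assumes f: "f \<in> homs (orb G) K H" and t: "t \<in> homs (osub G \<O> H) T T'"
 shows "farr (res (FSet G) f) t \<in> homs (osub G \<O> K) (gpull G f T) (gpull G f T')"
proof -
 note o = orb_homD(1,2)[OF f] omap_lcos[OF f]
 note [simp] = orb_homD(3,4)[OF f]
 have T: "T \<in> \<O> H" "T' \<in> \<O> H" and t': "t \<in> homs (fset G H) T T'" using t o by (auto simp: osub_homs)
 obtain u where u: "t = (T, u, T')" and m: "(T, u, T') \<in> gmaps G H" using t' by (auto simp: fset_homs)
 have um: "\<And>x. x \<in> pts T ==> u x \<in> pts T'" and up: "\<And>x. x \<in> pts T ==> proj T' (u x) = proj T x"
  and ua: "\<And>g x. g \<in> carrier G ==> x \<in> pts T ==> u (act T g x) = act T' g (u x)"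
  using m by (auto simp: gmaps_iff)
 show ?thesis
  unfolding u FSet_def using o gset_act[OF O_gset[OF o(2) T(1)]]
  by (auto simp: um up ua pts_rules lcos_act intro!: mk_gmap_osub gpull_O[OF f] T)
qed

lemma fmap_inverse:
 assumes "t \<in> isos (fset G H) X Y"
 obtains u v where "t = (X, u, Y)" "\<And>x. x \<in> pts X ==> u x \<in> pts Y" "\<And>x. x \<in> pts X ==> proj Y (u x) = proj X x"
  "\<And>g x. g \<in> carrier G ==> x \<in> pts X ==> u (act X g x) = act Y g (u x)"
  "\<And>x. x \<in> pts X ==> v (u x) = x" "\<And>y. y \<in> pts Y ==> v y \<in> pts X" "\<And>y. y \<in> pts Y ==> u (v y) = y"
  "\<And>y. y \<in> pts Y ==> proj X (v y) = proj Y y"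
proof -
 from assms obtain u v where t: "t = (X, u, Y)" and u: "(X, u, Y) \<in> gmaps G H" and v: "(Y, v, X) \<in> gmaps G H"
  and c: "compose (pts X) v u = (\<lambda>x \<in> pts X. x)" "compose (pts Y) u v = (\<lambda>x \<in> pts Y. x)"
  by (auto simp: isos_def fset_homs mk_gmap_def)
 show ?thesis
 proof (rule that[of u v])
  show "v (u x) = x" if "x \<in> pts X" for x using fun_cong[OF c(1), of x] that by (simp add: compose_def)
  show "u (v y) = y" if "y \<in> pts Y" for y using fun_cong[OF c(2), of y] that by (simp add: compose_def)
 qed (use t u v in \<open>auto simp: gmaps_iff\<close>)
qed

lemma res_oiso:
 assumes f: "f \<in> homs (orb G) K H" and t: "t \<in> homs (oiso G \<O> H) T T'"
 shows "farr (res (FSet G) f) t \<in> homs (oiso G \<O> K) (gpull G f T) (gpull G f T')"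
proof -
 note o = orb_homD(1,2)[OF f] omap_lcos[OF f]
 note [simp] = orb_homD(3,4)[OF f]
 have T: "T \<in> \<O> H" "T' \<in> \<O> H" and t': "t \<in> isos (fset G H) T T'" using t o by (auto simp: oiso_homs)
 obtain u v where u: "t = (T, u, T')" and uv: "\<And>x. x \<in> pts T ==> u x \<in> pts T'" "\<And>x. x \<in> pts T ==> proj T' (u x) = proj T x"
  "\<And>g x. g \<in> carrier G ==> x \<in> pts T ==> u (act T g x) = act T' g (u x)"
  "\<And>x. x \<in> pts T ==> v (u x) = x" "\<And>y. y \<in> pts T' ==> v y \<in> pts T" "\<And>y. y \<in> pts T' ==> u (v y) = y"
  "\<And>y. y \<in> pts T' ==> proj T (v y) = proj T' y"
  by (rule fmap_inverse[OF t']) blast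
 show ?thesis
  unfolding u FSet_def using o gset_act[OF O_gset[OF o(2) T(1)]]
  by (auto simp: uv pts_rules lcos_act intro!: mk_gmap_oiso[where h = "pr_case (%c y. Pr c (v y))"] gpull_O[OF f] T)
qed

lemma res_fmu_oiso:
 assumes f: "f \<in> homs (orb G) K H" and T: "T \<in> \<O> H" "T' \<in> \<O> H"
 shows "fmu (res (FSet G) f) T T' \<in> homs (oiso G \<O> K) (gsum G (gpull G f T) (gpull G f T')) (gpull G f (gsum G T T'))"
proof -
 note o = orb_homD(1,2)[OF f] omap_lcos[OF f]
 note [simp] = orb_homD(3,4)[OF f]
 show ?thesis
  unfolding FSet_def using o gset_act[OF O_gset[OF o(2) T(1)]] gset_act[OF O_gset[OF o(2) T(2)]]
  by (auto simp: pts_rules lcos_act intro!: gpull_O[OF f] gsum_O T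
   mk_gmap_oiso[where h = "pr_case (%c. copair (%x. InL (Pr c x)) (%y. InR (Pr c y)))"])
qed

lemma res_feps_oiso:
 assumes f: "f \<in> homs (orb G) K H"
 shows "feps (res (FSet G) f) \<in> homs (oiso G \<O> K) (gempty G) (gpull G f (gempty G))"
 unfolding FSet_def using orb_homD(1,2)[OF f] by (auto simp: pts_rules intro!: mk_gmap_oiso gempty_O gpull_O[OF f])

lemma res_FSet_obj [simp]: "fobj (res (FSet G) f) = gpull G f"
 by (simp add: FSet_def)

lemma runit_oiso:
 assumes H: "subgroup H G" and T: "T \<in> \<O> H"
 shows "runit (FSet G) H T \<in> homs (oiso G \<O> H) T (gpull G (cid (orb G) H) T)"
proof -
 have [simp]: "cdom (orb G) (cid (orb G) H) = H" and c: "c \<in> lcosets\<^bsub>G\<^esub> H ==> omap (cid (orb G) H) c = c" for c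
  by (simp_all add: omap_def)
 show ?thesis
  unfolding FSet_def using gset_act[OF O_gset[OF H T]] H T
  by (auto simp: pts_rules lcos_act c simp del: orb_simps(4) intro!: gpull_O[OF orb_id] mk_gmap_oiso[where h = "pr_case (%c x. x)"])
qed

lemma rcomp_oiso:
 assumes h: "h \<in> homs (orb G) L K" and f: "f \<in> homs (orb G) K H" and T: "T \<in> \<O> H"
 shows "rcomp (FSet G) f h T \<in> homs (oiso G \<O> L) (gpull G h (gpull G f T)) (gpull G (f \<bullet>\<^bsub>orb G\<^esub> h) T)"
proof -
 note o = orb_homD(1,2)[OF f] omap_lcos[OF f] orb_homD(1,2)[OF h] omap_lcos[OF h]
 note [simp] = orb_homD(3)[OF f] orb_homD(3)[OF h] orb_homD(3)[OF orb_comp[OF f h]]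
 have c: "omap (f \<bullet>\<^bsub>orb G\<^esub> h) c = omap f (omap h c)" if "c \<in> lcosets\<^bsub>G\<^esub> L" for c
  using f h that by (auto simp: orb_hom omap_def compose_def)
 \<comment> \<open>The inverse has to restore the coset of \<open>G/K\<close> that
   \<open>rcomp\<close> forgets; it is the image of the coset of \<open>G/L\<close> under
   \<open>h\<close>.\<close>
 show ?thesis
  unfolding FSet_def using gset_act[OF O_gset[OF o(2) T]] o T
  by (auto simp: pts_rules lcos_act c intro!: gpull_O[OF orb_comp] gpull_O[OF h] gpull_O[OF f] f h
   mk_gmap_oiso[where h = "pr_case (%c x. Pr c (Pr (Cst (omap h (the_cst c))) x))"] simp: the_cst_def)
qed

lemma gproda_osub:
 assumes H: "subgroup H G" and S: "S \<in> \<O> H" and t: "t \<in> homs (osub G \<O> H) T T'"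
 shows "gproda G (cid (fset G H) S) t \<in> homs (osub G \<O> H) (gprod G S T) (gprod G S T')"
proof -
 have T: "T \<in> \<O> H" "T' \<in> \<O> H" and t': "t \<in> homs (fset G H) T T'" using t H by (auto simp: osub_homs)
 obtain u where u: "t = (T, u, T')" and m: "(T, u, T') \<in> gmaps G H" using t' by (auto simp: fset_homs)
 have um: "\<And>x. x \<in> pts T ==> u x \<in> pts T'" and up: "\<And>x. x \<in> pts T ==> proj T' (u x) = proj T x"
  and ua: "\<And>g x. g \<in> carrier G ==> x \<in> pts T ==> u (act T g x) = act T' g (u x)"
  using m by (auto simp: gmaps_iff)
 show ?thesis
  unfolding u gproda_def using gset_act[OF O_gset[OF H S]] gset_act[OF O_gset[OF H T(1)]]
  by (auto simp: um up ua pts_rules mk_gmap_def[of S] intro!: mk_gmap_osub gprod_O H S T)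
qed

lemma gproda_oiso:
 assumes H: "subgroup H G" and s: "s \<in> homs (oiso G \<O> H) S S'" and t: "t \<in> homs (oiso G \<O> H) T T'"
 shows "gproda G s t \<in> homs (oiso G \<O> H) (gprod G S T) (gprod G S' T')"
proof -
 have S: "S \<in> \<O> H" "S' \<in> \<O> H" and s': "s \<in> isos (fset G H) S S'" using s H by (auto simp: oiso_homs)
 have T: "T \<in> \<O> H" "T' \<in> \<O> H" and t': "t \<in> isos (fset G H) T T'" using t H by (auto simp: oiso_homs)
 obtain u v where u: "s = (S, u, S')" and uv: "\<And>x. x \<in> pts S ==> u x \<in> pts S'" "\<And>x. x \<in> pts S ==> proj S' (u x) = proj S x"
  "\<And>g x. g \<in> carrier G ==> x \<in> pts S ==> u (act S g x) = act S' g (u x)"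
  "\<And>x. x \<in> pts S ==> v (u x) = x" "\<And>y. y \<in> pts S' ==> v y \<in> pts S" "\<And>y. y \<in> pts S' ==> u (v y) = y"
  "\<And>y. y \<in> pts S' ==> proj S (v y) = proj S' y"
  by (rule fmap_inverse[OF s']) blast
 obtain u' v' where u': "t = (T, u', T')" and uv': "\<And>x. x \<in> pts T ==> u' x \<in> pts T'" "\<And>x. x \<in> pts T ==> proj T' (u' x) = proj T x"
  "\<And>g x. g \<in> carrier G ==> x \<in> pts T ==> u' (act T g x) = act T' g (u' x)"
  "\<And>x. x \<in> pts T ==> v' (u' x) = x" "\<And>y. y \<in> pts T' ==> v' y \<in> pts T" "\<And>y. y \<in> pts T' ==> u' (v' y) = y"
  "\<And>y. y \<in> pts T' ==> proj T (v' y) = proj T' y"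
  by (rule fmap_inverse[OF t']) blast
 show ?thesis
  unfolding u u' gproda_def using gset_act[OF O_gset[OF H S(1)]] gset_act[OF O_gset[OF H T(1)]]
  by (auto simp: uv uv' pts_rules intro!: mk_gmap_oiso[where h = "pr_case (%x y. Pr (v x) (v' y))"] gprod_O H S T)
qed

lemma gid_oiso: "subgroup H G ==> T \<in> \<O> H ==> cid (fset G H) T \<in> homs (oiso G \<O> H) T T"
 by (auto intro: mk_gmap_oiso[where h = "%x. x"])

lemma gprod_left_sel [simp]: "fobj (gprod_left G H T) S = gprod G S T"
 "farr (gprod_left G H T) s = gproda G s (cid (fset G H) T)"
 and gprod_right_sel [simp]: "fobj (gprod_right G H S) T = gprod G S T"
 "farr (gprod_right G H S) t = gproda G (cid (fset G H) S) t"
 by (simp_all add: gprod_left_def gprod_right_def)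

lemma gprod_fmu_oiso:
 assumes H: "subgroup H G" and T: "S \<in> \<O> H" "T \<in> \<O> H" "T' \<in> \<O> H"
 shows "fmu (gprod_left G H S) T T' \<in> homs (oiso G \<O> H) (gsum G (gprod G T S) (gprod G T' S)) (gprod G (gsum G T T') S)"
  "fmu (gprod_right G H S) T T' \<in> homs (oiso G \<O> H) (gsum G (gprod G S T) (gprod G S T')) (gprod G S (gsum G T T'))"
proof -
 note a = gset_act[OF O_gset[OF H T(1)]] gset_act[OF O_gset[OF H T(2)]] gset_act[OF O_gset[OF H T(3)]]
 show "fmu (gprod_left G H S) T T' \<in> homs (oiso G \<O> H) (gsum G (gprod G T S) (gprod G T' S)) (gprod G (gsum G T T') S)"
  unfolding gprod_left_def using a by (auto simp: pts_rules intro!: gprod_O gsum_O H T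
   mk_gmap_oiso[where h = "pr_case (%x y. copair (%x. InL (Pr x y)) (%x. InR (Pr x y)) x)"])
 show "fmu (gprod_right G H S) T T' \<in> homs (oiso G \<O> H) (gsum G (gprod G S T) (gprod G S T')) (gprod G S (gsum G T T'))"
  unfolding gprod_right_def using a by (auto simp: pts_rules intro!: gprod_O gsum_O H T
   mk_gmap_oiso[where h = "pr_case (%x. copair (%y. InL (Pr x y)) (%y. InR (Pr x y)))"])
qed

lemma gprod_feps_oiso:
 assumes H: "subgroup H G" and S: "S \<in> \<O> H"
 shows "feps (gprod_left G H S) \<in> homs (oiso G \<O> H) (gempty G) (gprod G (gempty G) S)"
  "feps (gprod_right G H S) \<in> homs (oiso G \<O> H) (gempty G) (gprod G S (gempty G))"
 unfolding gprod_left_def gprod_right_def by (auto simp: pts_rules intro!: mk_gmap_oiso gempty_O gprod_O H S)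

lemma gprod_point_oiso:
 assumes H: "subgroup H G" and S: "S \<in> \<O> H"
 shows "mk_gmap (gprod G S (gpoint G H)) (pr_case (%x y. x)) S \<in> homs (oiso G \<O> H) (gprod G S (gpoint G H)) S"
  "mk_gmap (gprod G (gpoint G H) S) (pr_case (%x y. y)) S \<in> homs (oiso G \<O> H) (gprod G (gpoint G H) S) S"
proof -
 note a = gset_act[OF O_gset[OF H S]]
 show "mk_gmap (gprod G S (gpoint G H)) (pr_case (%x y. x)) S \<in> homs (oiso G \<O> H) (gprod G S (gpoint G H)) S"
  using a by (auto simp: pts_rules intro!: H S gprod_O gpoint_O mk_gmap_oiso[where h = "%x. Pr x (Cst (proj S x))"])
 show "mk_gmap (gprod G (gpoint G H) S) (pr_case (%x y. y)) S \<in> homs (oiso G \<O> H) (gprod G (gpoint G H) S) S"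
  using a by (auto simp: pts_rules intro!: H S gprod_O gpoint_O mk_gmap_oiso[where h = "%x. Pr (Cst (proj S x)) x"])
qed

lemma gpull_gprod_oiso:
 assumes f: "f \<in> homs (orb G) K H" and S: "S \<in> \<O> H" and T: "T \<in> \<O> H"
 shows "mk_gmap (gpull G f (gprod G S T)) (pr_case (%c. pr_case (%x y. Pr (Pr c x) (Pr c y))))
   (gprod G (gpull G f S) (gpull G f T))
  \<in> homs (oiso G \<O> K) (gpull G f (gprod G S T)) (gprod G (gpull G f S) (gpull G f T))"
proof -
 note o = orb_homD(1,2)[OF f] omap_lcos[OF f]
 note [simp] = orb_homD(3,4)[OF f]
 show ?thesis
  using o gset_act[OF O_gset[OF o(2) S]] gset_act[OF O_gset[OF o(2) T]]
  by (auto simp: pts_rules lcos_act intro!: gpull_O[OF f] gprod_O S T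
   mk_gmap_oiso[where h = "pr_case (%x y. pr_case (%c x. pr_case (%d y. Pr c (Pr x y)) y) x)"])
qed

lemma gpull_point_oiso:
 assumes f: "f \<in> homs (orb G) K H"
 shows "gbang G K (gpull G f (gpoint G H)) \<in> homs (oiso G \<O> K) (gpull G f (gpoint G H)) (gpoint G K)"
proof -
 note o = orb_homD(1,2)[OF f] omap_lcos[OF f]
 note [simp] = orb_homD(3,4)[OF f]
 show ?thesis
  unfolding gbang_def using o
  by (auto simp: pts_rules lcos_act the_cst_def intro!: gpull_O[OF f] gpoint_O
   mk_gmap_oiso[where h = "%c. Pr c (Cst (omap f (the_cst c)))"])
qed

lemma gbang_osub: "subgroup H G ==> T \<in> \<O> H ==> gbang G H T \<in> homs (osub G \<O> H) T (gpoint G H)"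
 using gbang_map[OF _ O_gset] by (auto simp: osub_homs fset_homs gpoint_O gbang_def mk_gmap_def)

lemma gbang_eqI: "subgroup H G ==> t \<in> homs (osub G \<O> H) T (gpoint G H) ==> t = gbang G H T"
 by (auto simp: osub_homs fset_homs intro: to_gpoint_unique)

declare fset_simps(5) [simp del] orb_simps(4) [simp del]

end

lemma (in sym_mon_cat) tens_func: "ob x ==> func C C (%y. x \<box> y) (%f. idt x ** f)"
 by unfold_locales (auto simp: in_homs interchange)

lemma func_id: "category C ==> func C C (%x. x) (%f. f)"
 by (simp add: func_def func_axioms_def)

lemma func_comp:
 assumes "func C D Fo Fa" "func D E Fo' Fa'" shows "func C E (%x. Fo' (Fo x)) (%f. Fa' (Fa f))"
proof -
 interpret F: func C D Fo Fa by fact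
 interpret F': func D E Fo' Fa' by fact
 show ?thesis
 proof
  show "Fa' (Fa (cid C x)) = cid E (Fo' (Fo x))" if "x \<in> cobj C" for x
   using that F'.map_id[OF F.map_obj] by (simp add: F.map_id)
 qed (auto intro: F.map_obj F'.map_obj F.map_hom F'.map_hom simp: F.map_comp F'.map_comp[OF F.map_hom F.map_hom])
qed

lemma box_by_sel [simp]: "fobj (box_by G B H T) = bobj B H T" "farr (box_by G B H T) = barr B H (cid (fset G H) T)"
 "fmu (box_by G B H T) = bmul B H T" "feps (box_by G B H T) = bone B H T"
 by (simp_all add: box_by_def)

lemma box_at_sel [simp]: "fobj (box_at C B H M) T = bobj B H T M" "farr (box_at C B H M) t = barr B H t (cid (lev C H) M)"
 "fmu (box_at C B H M) T T' = badd B H T T' M" "feps (box_at C B H M) = bzero B H M"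
 by (simp_all add: box_at_def)

lemma comp_sm_sel [simp]: "fobj (comp_sm E F' F) x = fobj F' (fobj F x)" "farr (comp_sm E F' F) f = farr F' (farr F f)"
 "fmu (comp_sm E F' F) x y = farr F' (fmu F x y) \<bullet>\<^bsub>E\<^esub> fmu F' (fobj F x) (fobj F y)"
 "feps (comp_sm E F' F) = farr F' (feps F) \<bullet>\<^bsub>E\<^esub> feps F'"
 by (simp_all add: comp_sm_def)

lemma norm_functor_sel [simp]: "fobj (norm_functor G C B R N H) T = bobj B H T (rest G C R H)" "farr (norm_functor G C B R N H) = N H"
 "fmu (norm_functor G C B R N H) T T' = badd B H T T' (rest G C R H)" "feps (norm_functor G C B R N H) = bzero B H (rest G C R H)"
 by (simp_all add: norm_functor_def)

section \<open>The levels of an \<open>\<O>\<close>-commutative monoid\<close>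

text \<open>A strong monoidal functor turns the terminal object \<open>P\<close> of a symmetric monoidal category, which is a
 commutative monoid in a unique way, into a commutative monoid.\<close>

locale terminal_monoid = sym_mon_cat C + n: sm_functor E C F
 for C :: "('o, 'a) smc" and E :: "('p, 'b, 'k) smc_scheme" and F :: "('p, 'b, 'o, 'a) smfun" +
 fixes P :: 'p and bang :: "'p => 'b" and R :: 'o and p :: 'a
 assumes P_ob [simp]: "P \<in> cobj E"
  and bang_hom: "T \<in> cobj E ==> bang T \<in> homs E T P"
  and bang_eq: "T \<in> cobj E ==> t \<in> homs E T P ==> t = bang T"
  and p_iso: "p \<in> isos C (fobj F P) R"
begin

definition nm :: "'p => 'a" where "nm T = p oo farr F (bang T)"
definition mR :: 'a where "mR = nm (P \<odot>\<^bsub>E\<^esub> P) oo fmu F P P oo (iv p ** iv p)"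
definition eR :: 'a where "eR = nm (unit_obj E) oo feps F"

lemma p_ar [simp]: "iso_arr C p" "ar p" "dm p = fobj F P" "cd p = R"
 using p_iso by (auto simp: isos_iff iso_arr_carr)

lemma R_ob [simp]: "ob R"
 using p_ar(2,4) cd_ob by blast

lemma F_ar [simp]: "t \<in> homs E T T' ==> ar (farr F t)" "t \<in> homs E T T' ==> dm (farr F t) = fobj F T"
  "t \<in> homs E T T' ==> cd (farr F t) = fobj F T'"
 using n.map_hom[of t T T'] unfolding in_homs by simp_all

lemma nm_ar [simp]: "T \<in> cobj E ==> ar (nm T)" "T \<in> cobj E ==> dm (nm T) = fobj F T" "T \<in> cobj E ==> cd (nm T) = R"
 using F_ar[OF bang_hom] by (simp_all add: nm_def)

lemma mR_ar [simp]: "ar mR" "dm mR = R \<box> R" "cd mR = R"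
 by (simp_all add: mR_def)

lemma eR_ar [simp]: "ar eR" "dm eR = un" "cd eR = R"
 by (simp_all add: eR_def)

lemma nm_P: "nm P = p"
 using bang_eq[OF P_ob n.src.id_hom[OF P_ob], symmetric] n.map_id[OF P_ob] by (simp add: nm_def)

lemma nm_N:
 assumes t: "t \<in> homs E T T'" shows "nm T' oo farr F t = nm T"
proof -
 have [simp]: "T \<in> cobj E" "T' \<in> cobj E" using t n.src.dom_closed n.src.cod_closed by (auto simp: in_homs)
 note [simp] = F_ar[OF t] F_ar[OF bang_hom[of T']]
 have "bang T' \<bullet>\<^bsub>E\<^esub> t = bang T"
  by (rule bang_eq) (use n.src.comp_hom[OF t bang_hom] in simp_all)
 then have "farr F (bang T') oo farr F t = farr F (bang T)" using n.map_comp[OF t bang_hom] by simp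
 then show ?thesis by (simp add: nm_def cassoc)
qed

text \<open>The map from a sum to \<open>P\<close> factors through \<open>P \<squnion> P\<close>,
  whose norm map defines the multiplication.\<close>

lemma nm_add:
 assumes [simp]: "T \<in> cobj E" "T' \<in> cobj E"
 shows "nm (T \<odot>\<^bsub>E\<^esub> T') oo fmu F T T' = mR oo (nm T ** nm T')"
proof -
 let ?t = "bang T \<star>\<^bsub>E\<^esub> bang T'"
 have t: "?t \<in> homs E (T \<odot>\<^bsub>E\<^esub> T') (P \<odot>\<^bsub>E\<^esub> P)"
  using n.src.tensa_hom[OF bang_hom[OF assms(1)] bang_hom[OF assms(2)]] by simp
 note [simp] = F_ar[OF t] F_ar[OF bang_hom[OF assms(1)]] F_ar[OF bang_hom[OF assms(2)]]
 have "mR oo (nm T ** nm T') = nm (P \<odot>\<^bsub>E\<^esub> P) oo fmu F P P oo (farr F (bang T) ** farr F (bang T'))"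
  by (simp add: mR_def nm_def[of T] nm_def[of T'] nf)
 also have "\<dots> = nm (P \<odot>\<^bsub>E\<^esub> P) oo farr F ?t oo fmu F T T'"
  using n.mu_nat[OF bang_hom[OF assms(1)] bang_hom[OF assms(2)]] by simp
 also have "\<dots> = nm (T \<odot>\<^bsub>E\<^esub> T') oo fmu F T T'"
  by (simp add: rw2[OF nm_N[OF t]])
 finally show ?thesis ..
qed

lemma nm_zero: "nm (unit_obj E) oo feps F = eR"
 by (simp add: eR_def)

text \<open>Tested on \<open>(p ** p) ** p\<close>, both sides become norm maps of threefold sums of
  \<open>P\<close>. These correspond under the associator because maps to \<open>P\<close> are
  unique. The unit law and commutativity arise in the same way from the unitor and the
  braiding.\<close>

lemma mR_as: "mR oo (mR ** idt R) = mR oo (idt R ** mR) oo as R R R"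
proof (rule iso_cancel_r)
 let ?P = P and ?p = p and ?R = R
 show "iso_arr C ((?p ** ?p) ** ?p)" by simp
 have a: "assoc E ?P ?P ?P \<in> homs E ((?P \<odot>\<^bsub>E\<^esub> ?P) \<odot>\<^bsub>E\<^esub> ?P) (?P \<odot>\<^bsub>E\<^esub> (?P \<odot>\<^bsub>E\<^esub> ?P))"
  using isos_homs[OF n.src.assoc_iso[of ?P ?P ?P]] by simp
 note [simp] = F_ar[OF a]
 have PP: "mR oo (?p ** ?p) = nm (?P \<odot>\<^bsub>E\<^esub> ?P) oo fmu F ?P ?P" using nm_add[of ?P ?P] by (simp add: nm_P)
 have "(mR oo (mR ** idt ?R)) oo ((?p ** ?p) ** ?p) = mR oo ((mR oo (?p ** ?p)) ** ?p)" by (simp add: nf)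
 also have "\<dots> = (mR oo (nm (?P \<odot>\<^bsub>E\<^esub> ?P) ** nm ?P)) oo (fmu F ?P ?P ** idt (fobj F ?P))"
  unfolding PP by (simp add: nm_P nf)
 also have "\<dots> = (nm (?P \<odot>\<^bsub>E\<^esub> (?P \<odot>\<^bsub>E\<^esub> ?P)) oo farr F (assoc E ?P ?P ?P)) oo fmu F (?P \<odot>\<^bsub>E\<^esub> ?P) ?P oo (fmu F ?P ?P ** idt (fobj F ?P))"
  unfolding nm_N[OF a] by (simp add: nm_add[symmetric] cassoc)
 also have "\<dots> = (nm (?P \<odot>\<^bsub>E\<^esub> (?P \<odot>\<^bsub>E\<^esub> ?P)) oo fmu F ?P (?P \<odot>\<^bsub>E\<^esub> ?P)) oo (idt (fobj F ?P) ** fmu F ?P ?P) oo as (fobj F ?P) (fobj F ?P) (fobj F ?P)"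
  using n.mu_assoc[of ?P ?P ?P] by (simp add: cassoc)
 also have "\<dots> = mR oo (?p ** (nm (?P \<odot>\<^bsub>E\<^esub> ?P) oo fmu F ?P ?P)) oo as (fobj F ?P) (fobj F ?P) (fobj F ?P)"
  by (subst nm_add) (simp_all add: nm_P nf)
 also have "\<dots> = mR oo (?p ** (mR oo (?p ** ?p))) oo as (fobj F ?P) (fobj F ?P) (fobj F ?P)"
  unfolding PP ..
 also have "\<dots> = (mR oo (idt ?R ** mR) oo as ?R ?R ?R) oo ((?p ** ?p) ** ?p)"
  by (simp add: cassoc as_n) (simp add: nf)
 finally show "(mR oo (mR ** idt ?R)) oo ((?p ** ?p) ** ?p) = (mR oo (idt ?R ** mR) oo as ?R ?R ?R) oo ((?p ** ?p) ** ?p)" .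
qed simp_all

lemma mR_un: "mR oo (eR ** idt R) = lu R"
proof (rule iso_cancel_r)
 let ?P = P and ?p = p and ?R = R
 show "iso_arr C (idt un ** ?p)" by simp
 have a: "lun E ?P \<in> homs E (unit_obj E \<odot>\<^bsub>E\<^esub> ?P) ?P"
  using isos_homs[OF n.src.lun_iso[of ?P]] by simp
 note [simp] = F_ar[OF a]
 have "(mR oo (eR ** idt ?R)) oo (idt un ** ?p) = (mR oo (nm (unit_obj E) ** nm ?P)) oo (feps F ** idt (fobj F ?P))"
  by (simp add: nm_P nm_zero[symmetric] nf)
 also have "\<dots> = (nm ?P oo farr F (lun E ?P)) oo fmu F (unit_obj E) ?P oo (feps F ** idt (fobj F ?P))"
  unfolding nm_N[OF a] by (simp add: nm_add[symmetric] cassoc)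
 also have "\<dots> = lu ?R oo (idt un ** ?p)"
  using n.mu_lunit[of ?P] by (simp add: cassoc lu_n nm_P)
 finally show "(mR oo (eR ** idt ?R)) oo (idt un ** ?p) = lu ?R oo (idt un ** ?p)" .
qed simp_all

lemma mR_br: "mR oo br R R = mR"
proof (rule iso_cancel_r)
 let ?P = P and ?p = p and ?R = R
 show "iso_arr C (?p ** ?p)" by simp
 have a: "braid E ?P ?P \<in> homs E (?P \<odot>\<^bsub>E\<^esub> ?P) (?P \<odot>\<^bsub>E\<^esub> ?P)"
  using isos_homs[OF n.src.braid_iso[of ?P ?P]] by simp
 note [simp] = F_ar[OF a]
 have "(mR oo br ?R ?R) oo (?p ** ?p) = (mR oo (nm ?P ** nm ?P)) oo br (fobj F ?P) (fobj F ?P)"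
  by (simp add: nm_P cassoc br_n)
 also have "\<dots> = nm (?P \<odot>\<^bsub>E\<^esub> ?P) oo farr F (braid E ?P ?P) oo fmu F ?P ?P"
  using n.mu_braid[of ?P ?P] by (simp add: nm_add[symmetric] cassoc)
 also have "\<dots> = mR oo (?p ** ?p)"
  by (simp add: rw2[OF nm_N[OF a]] nm_add nm_P)
 finally show "(mR oo br ?R ?R) oo (?p ** ?p) = mR oo (?p ** ?p)" .
qed simp_all

end

text \<open>The colimit hypotheses appear here as statements about reflexive coequalizers, in which
  the type measuring smallness no longer occurs.\<close>

locale O_modules = fin_indexing_system G \<O> + O_comm_monoid G \<O> C B R N
 for G :: "'g monoid" and \<O> and C :: "('g, 'o, 'a) coeff" and B :: "('g, 'o, 'a) box" and R and N +
 assumes lev_coeq: "subgroup H G ==> reflexive (lev C H) u v ==> \<exists>q. is_coeq (lev C H) u v q"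
  and lev_rcoeq: "subgroup H G ==> x \<in> cobj (lev C H) ==> rcoeq (lev C H) u v q ==>
   rcoeq (lev C H) (cid (lev C H) x \<star>\<^bsub>lev C H\<^esub> u) (cid (lev C H) x \<star>\<^bsub>lev C H\<^esub> v) (cid (lev C H) x \<star>\<^bsub>lev C H\<^esub> q)"
  and box_rcoeq: "subgroup H G ==> T \<in> \<O> H ==> rcoeq (lev C H) u v q ==>
   rcoeq (lev C H) (barr B H (cid (fset G H) T) u) (barr B H (cid (fset G H) T) v) (barr B H (cid (fset G H) T) q)"
  and res_rcoeq: "f \<in> homs (orb G) K H ==> rcoeq (lev C H) u v q ==>
   rcoeq (lev C K) (farr (res C f) u) (farr (res C f) v) (farr (res C f) q)"
begin

abbreviation (input) lev_comp ("_ oo[_] _" [61, 0, 60] 60) where "g oo[H] f \<equiv> g \<bullet>\<^bsub>lev C H\<^esub> f"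
abbreviation (input) lev_tensa ("_ **[_] _" [76, 0, 75] 75) where "f **[H] g \<equiv> f \<star>\<^bsub>lev C H\<^esub> g"
abbreviation (input) lev_tens ("_ \<box>[_] _" [76, 0, 75] 75) where "x \<box>[H] y \<equiv> x \<odot>\<^bsub>lev C H\<^esub> y"

text \<open>The composites of the operations \<open>M \<odot> -\<close>, \<open>T \<box> -\<close> and \<open>f\<^sup>*\<close>.\<close>

inductive reach :: "'g set => 'g set => ('o => 'o) => ('a => 'a) => bool" where
 refl: "subgroup H G ==> reach H H (%x. x) (%f. f)"
| tens: "reach H K Fo Fa ==> subgroup H G ==> x \<in> cobj (lev C H) ==>
  reach H K (%y. Fo (x \<box>[H] y)) (%f. Fa (cid (lev C H) x **[H] f))"
| box: "reach H K Fo Fa ==> subgroup H G ==> T \<in> \<O> H ==>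
  reach H K (%y. Fo (bobj B H T y)) (%f. Fa (barr B H (cid (fset G H) T) f))"
| res: "reach L K Fo Fa ==> h \<in> homs (orb G) L H ==> reach H K (%y. Fo (fobj (res C h) y)) (%f. Fa (farr (res C h) f))"

text \<open>Each single operation is a functor preserving reflexive coequalizers, and both
  properties pass to composites.\<close>

lemma reach_func:
 assumes "reach H K Fo Fa"
 shows "func (lev C H) (lev C K) Fo Fa" "rcoeq (lev C H) f g q ==> rcoeq (lev C K) (Fa f) (Fa g) (Fa q)"
  "subgroup K G" "subgroup H G"
 using assms
proof (induction arbitrary: f g q)
 case (refl H)
 interpret sym_mon_cat "lev C H" by (rule level) fact
 show "func (lev C H) (lev C H) (%x. x) (%f. f)" by (rule func_id) unfold_locales
 show "rcoeq (lev C H) f g q" if "rcoeq (lev C H) f g q" for f g q by (rule that)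
 show "subgroup H G" "subgroup H G" by fact+
next
 case (tens H K Fo Fa x)
 interpret sym_mon_cat "lev C H" by (rule level) fact
 show "func (lev C H) (lev C K) (%y. Fo (x \<box>[H] y)) (%f. Fa (cid (lev C H) x **[H] f))"
  by (rule func_comp[OF tens_func tens(4)]) fact
 show "rcoeq (lev C K) (Fa (cid (lev C H) x **[H] f)) (Fa (cid (lev C H) x **[H] g)) (Fa (cid (lev C H) x **[H] q))" if "rcoeq (lev C H) f g q" for f g q
  by (rule tens(5)[OF lev_rcoeq[OF tens(2,3) that]])
 show "subgroup K G" "subgroup H G" by fact+
next
 case (box H K Fo Fa T)
 interpret b: sm_functor "lev C H" "lev C H" "box_by G B H T" by (rule box_by_functor) fact+
 have "func (lev C H) (lev C H) (bobj B H T) (barr B H (cid (fset G H) T))" using b.func_axioms by simp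
 then show "func (lev C H) (lev C K) (%y. Fo (bobj B H T y)) (%f. Fa (barr B H (cid (fset G H) T) f))"
  by (rule func_comp[OF _ box(4)])
 show "rcoeq (lev C K) (Fa (barr B H (cid (fset G H) T) f)) (Fa (barr B H (cid (fset G H) T) g)) (Fa (barr B H (cid (fset G H) T) q))"
  if "rcoeq (lev C H) f g q" for f g q
  by (rule box(5)[OF box_rcoeq[OF box(2,3) that]])
 show "subgroup K G" "subgroup H G" by fact+
next
 case (res L K Fo Fa h H)
 interpret r: sm_functor "lev C H" "lev C L" "res C h" by (rule restriction) fact
 show "func (lev C H) (lev C K) (%y. Fo (fobj (coeff.res C h) y)) (%f. Fa (farr (coeff.res C h) f))"
  by (rule func_comp[OF r.func_axioms res(3)])
 show "rcoeq (lev C K) (Fa (farr (coeff.res C h) f)) (Fa (farr (coeff.res C h) g)) (Fa (farr (coeff.res C h) q))"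
  if "rcoeq (lev C H) f g q" for f g q
  by (rule res(4)[OF res_rcoeq[OF res(2) that]])
 show "subgroup K G" by fact
 show "subgroup H G" using res(2) by (rule orb_homD)
qed

text \<open>The arrows which stay epimorphisms under all these operations.\<close>

definition sepi :: "'g set => 'a => bool" where
 "sepi H p \<longleftrightarrow> subgroup H G & p \<in> carr (lev C H) & (\<forall>K Fo Fa. reach H K Fo Fa \<longrightarrow> epi (lev C K) (Fa p))"

text \<open>\<open>reach\<close> adds a new operation at the inner end, so stability under one
  operation is immediate from stability under all composites.\<close>

lemma sepi_tens: "sepi H p ==> x \<in> cobj (lev C H) ==> sepi H (cid (lev C H) x **[H] p)"
proof -
 assume p: "sepi H p" and x: "x \<in> cobj (lev C H)"
 then interpret sym_mon_cat "lev C H" by (intro level) (simp add: sepi_def)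
 show ?thesis using p x by (auto simp: sepi_def dest: reach.tens)
qed

lemma sepi_box: "sepi H p ==> T \<in> \<O> H ==> sepi H (barr B H (cid (fset G H) T) p)"
proof -
 assume p: "sepi H p" and T: "T \<in> \<O> H"
 then have H: "subgroup H G" by (simp add: sepi_def)
 interpret b: sm_functor "lev C H" "lev C H" "box_by G B H T" by (rule box_by_functor[OF H T])
 show ?thesis using p T b.map_ar[of p] by (auto simp: sepi_def dest: reach.box)
qed

lemma sepi_res: "sepi H p ==> f \<in> homs (orb G) K H ==> sepi K (farr (res C f) p)"
proof -
 assume p: "sepi H p" and f: "f \<in> homs (orb G) K H"
 interpret r: sm_functor "lev C H" "lev C K" "res C f" by (rule restriction[OF f])
 show ?thesis using p f r.map_ar[of p] orb_homD[OF f] by (auto simp: sepi_def dest: reach.res)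
qed

lemma sepi_epi: "sepi H p ==> epi (lev C H) p"
 using reach.refl[of H] unfolding sepi_def by blast

text \<open>Split epimorphisms are absolute: any functor preserves the section.\<close>

lemma sepi_split: "subgroup H G ==> split_epi (lev C H) p ==> sepi H p"
proof -
 assume H: "subgroup H G" and p: "split_epi (lev C H) p"
 have "epi (lev C K) (Fa p)" if r: "reach H K Fo Fa" for K Fo Fa
 proof -
  interpret f: func "lev C H" "lev C K" Fo Fa by (rule reach_func[OF r])
  show ?thesis by (intro f.tgt.split_epi_epi f.map_split_epi p)
 qed
 then show ?thesis using H p by (auto simp: sepi_def split_epi_def)
qed

lemma sepi_rcoeq: "subgroup H G ==> rcoeq (lev C H) f g q ==> sepi H q"
proof -
 assume H: "subgroup H G" and p: "rcoeq (lev C H) f g q"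
 interpret c: sym_mon_cat "lev C H" by (rule level[OF H])
 have "epi (lev C K) (Fa q)" if r: "reach H K Fo Fa" for K Fo Fa
 proof -
  interpret f: func "lev C H" "lev C K" Fo Fa by (rule reach_func[OF r])
  show ?thesis by (rule f.tgt.rcoeqD(9)[OF reach_func(2)[OF r p]])
 qed
 then show ?thesis using H c.rcoeqD(6)[OF p] by (auto simp: sepi_def)
qed

lemma sepi_comp: "sepi H p ==> sepi H q ==> ccod (lev C H) p = cdom (lev C H) q ==> sepi H (q oo[H] p)"
proof -
 assume p: "sepi H p" and q: "sepi H q" and pq: "ccod (lev C H) p = cdom (lev C H) q"
 have H: "subgroup H G" and a [simp]: "p \<in> carr (lev C H)" "q \<in> carr (lev C H)" using p q by (auto simp: sepi_def)
 interpret c: sym_mon_cat "lev C H" by (rule level[OF H])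
 have "epi (lev C K) (Fa (q oo[H] p))" if r: "reach H K Fo Fa" for K Fo Fa
 proof -
  interpret f: func "lev C H" "lev C K" Fo Fa by (rule reach_func[OF r])
  have "epi (lev C K) (Fa p)" "epi (lev C K) (Fa q)" using p q r by (auto simp: sepi_def)
  then show ?thesis using pq by (simp add: f.map_cmp f.tgt.epi_comp)
 qed
 then show ?thesis using H pq by (auto simp: sepi_def)
qed

lemma sepi_cancel: "sepi H (q oo[H] p) ==> p \<in> carr (lev C H) ==> q \<in> carr (lev C H) ==>
 ccod (lev C H) p = cdom (lev C H) q ==> sepi H q"
proof -
 assume qp: "sepi H (q oo[H] p)" and a [simp]: "p \<in> carr (lev C H)" "q \<in> carr (lev C H)"
  and pq: "ccod (lev C H) p = cdom (lev C H) q"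
 have H: "subgroup H G" using qp by (auto simp: sepi_def)
 have "epi (lev C K) (Fa q)" if r: "reach H K Fo Fa" for K Fo Fa
 proof -
  interpret f: func "lev C H" "lev C K" Fo Fa by (rule reach_func[OF r])
  have "epi (lev C K) (Fa (q oo[H] p))" using qp r by (auto simp: sepi_def)
  then show ?thesis using pq by (intro f.tgt.epi_of_comp[of "Fa q" "Fa p"]) (simp_all add: f.map_cmp)
 qed
 then show ?thesis using H by (auto simp: sepi_def)
qed

section \<open>The commutative monoid at each level\<close>

lemma rest_ob: "subgroup H G ==> rest G C R H \<in> cobj (lev C H)"
proof -
 assume H: "subgroup H G"
 interpret r: sm_functor "lev C (carrier G)" "lev C H" "res C (proj_orb G H (carrier G))"
  by (rule restriction[OF proj_orb_hom[OF H]])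
 show ?thesis using underlying by (simp add: rest_def)
qed

lemma oiso_cat: "subgroup H G ==> sym_mon_cat (oiso G \<O> H)"
 using box_at_functor[OF _ rest_ob] by (auto dest: sm_functor.axioms)

abbreviation RH where "RH H \<equiv> rest G C R H"
abbreviation NF where "NF H \<equiv> norm_functor G C B R N H"
abbreviation nm where "nm H T \<equiv> norm_map G C B R N H T"
abbreviation mR where "mR H \<equiv> rmult G C B R N H"
abbreviation eR where "eR H \<equiv> runit_map G C B R N H"
abbreviation pR where "pR H \<equiv> bpoint B H (RH H)"
abbreviation pt where "pt H \<equiv> gpoint G H"
abbreviation bang where "bang H T \<equiv> gbang G H T"
abbreviation idG where "idG H T \<equiv> cid (fset G H) T"


lemma level_norm: "subgroup H G ==> terminal_monoid (lev C H) (osub G \<O> H) (NF H) (pt H) (gbang G H) (RH H) (pR H)"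
proof -
 assume H: "subgroup H G"
 interpret bp: mon_nat_iso "lev C H" "lev C H" "box_by G B H (pt H)" "id_sm (lev C H)" "bpoint B H" by (rule bpoint_iso[OF H])
 show ?thesis
 proof (intro terminal_monoid.intro terminal_monoid_axioms.intro norm level H)
  show "pR H \<in> isos (lev C H) (fobj (NF H) (pt H)) (RH H)"
   using bp.component_iso[OF rest_ob[OF H]] by (simp add: id_sm_def)
 qed (use H gbang_osub gbang_eqI gpoint_O in \<open>auto simp: osub_obj\<close>)
qed

lemma norm_map_eq: "subgroup H G ==> nm H T = terminal_monoid.nm (lev C H) (NF H) (gbang G H) (pR H) T"
 by (simp add: norm_map_def terminal_monoid.nm_def[OF level_norm])

lemma rmult_eq: "subgroup H G ==> mR H = terminal_monoid.mR (lev C H) (osub G \<O> H) (NF H) (pt H) (gbang G H) (pR H)"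
 by (simp add: rmult_def Let_def terminal_monoid.mR_def[OF level_norm] norm_map_eq)

lemma runit_map_eq: "subgroup H G ==> eR H = terminal_monoid.eR (lev C H) (osub G \<O> H) (NF H) (gbang G H) (pR H)"
 by (simp add: runit_map_def Let_def terminal_monoid.eR_def[OF level_norm] norm_map_eq)

lemma level_ctx: "subgroup H G ==> cmon_ctx (lev C H) (RH H) (mR H) (eR H) (sepi H)"
proof -
 assume H: "subgroup H G"
 interpret t: terminal_monoid "lev C H" "osub G \<O> H" "NF H" "pt H" "gbang G H" "RH H" "pR H" by (rule level_norm[OF H])
 show ?thesis
 proof (unfold rmult_eq[OF H] runit_map_eq[OF H], unfold_locales)
  show "t.mR \<in> homs (lev C H) (RH H \<box>[H] RH H) (RH H)" "t.eR \<in> homs (lev C H) t.un (RH H)"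
   by (simp_all add: in_homs)
  show "epi (lev C H) p" if "sepi H p" for p using that by (rule sepi_epi)
  show "sepi H p" if "split_epi (lev C H) p" for p by (rule sepi_split[OF H that])
  show "sepi H q" if "rcoeq (lev C H) f g q" for f g q by (rule sepi_rcoeq[OF H that])
  show "sepi H (cid (lev C H) x **[H] p)" if "t.ob x" "sepi H p" for x p by (rule sepi_tens[OF that(2,1)])
 qed (fact t.R_ob t.mR_as t.mR_un t.mR_br lev_coeq[OF H] lev_rcoeq[OF H] sepi_cancel sepi_comp)+
qed

end

section \<open>Norm maps at one level\<close>

context O_modules
begin

context
 fixes H assumes H: "subgroup H G"
begin

interpretation cmon_ctx "lev C H" "RH H" "mR H" "eR H" "sepi H" by (rule level_ctx[OF H])
interpretation t: terminal_monoid "lev C H" "osub G \<O> H" "NF H" "pt H" "gbang G H" "RH H" "pR H" by (rule level_norm[OF H])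

lemma box_ob [simp]: "T \<in> \<O> H ==> ob M ==> ob (bobj B H T M)"
 by (rule box_obj[OF H])

lemma O_rules [simp]: "S \<in> \<O> H ==> T \<in> \<O> H ==> gsum G S T \<in> \<O> H" "gempty G \<in> \<O> H" "pt H \<in> \<O> H"
 "S \<in> \<O> H ==> T \<in> \<O> H ==> gprod G S T \<in> \<O> H"
 by (simp_all add: gsum_O[OF H] gempty_O[OF H] gpoint_O[OF H] gprod_O[OF H])

lemma osub_ob [simp]: "T \<in> \<O> H ==> T \<in> cobj (osub G \<O> H)" "T \<in> \<O> H ==> T \<in> cobj (oiso G \<O> H)"
 by (simp_all add: osub_obj[OF H] oiso_obj[OF H])

lemma barr_ar:
 assumes "t \<in> homs (oiso G \<O> H) T T'" "ar f"
 shows "ar (barr B H t f)" "dm (barr B H t f) = bobj B H T (dm f)" "cd (barr B H t f) = bobj B H T' (cd f)"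
 using box_hom[OF H assms(1), of f "dm f" "cd f"] assms(2) by (simp_all add: in_homs[of f] in_homs[of "barr B H t f"])

lemma barr_id_ar [simp]:
 assumes "T \<in> \<O> H" "ar f"
 shows "ar (barr B H (idG H T) f)" "dm (barr B H (idG H T) f) = bobj B H T (dm f)" "cd (barr B H (idG H T) f) = bobj B H T (cd f)"
 using barr_ar[OF gid_oiso[OF H assms(1)] assms(2)] by auto

lemma barr_comp:
 assumes "t \<in> homs (oiso G \<O> H) T T'" "t' \<in> homs (oiso G \<O> H) T' T''" "ar f" "ar g" "cd f = dm g"
 shows "barr B H t' g oo[H] barr B H t f = barr B H (t' \<bullet>\<^bsub>fset G H\<^esub> t) (g oo[H] f)"
 using box_comp[OF H assms(1,2), of f "dm f" "cd f" g "cd g"] assms(3-5) by (simp add: in_homs[of f] in_homs[of g])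

lemma barr_split:
 assumes t: "t \<in> homs (oiso G \<O> H) T T'" and [simp]: "ar f"
 shows "barr B H t f = barr B H t (idt (cd f)) oo[H] barr B H (idG H T) f"
  "barr B H t f = barr B H (idG H T') f oo[H] barr B H t (idt (dm f))"
proof -
 interpret c: sym_mon_cat "oiso G \<O> H" by (rule oiso_cat[OF H])
 have T: "T \<in> \<O> H" "T' \<in> \<O> H" using t by (auto simp: oiso_homs[OF H])
 show "barr B H t f = barr B H t (idt (cd f)) oo[H] barr B H (idG H T) f"
  "barr B H t f = barr B H (idG H T') f oo[H] barr B H t (idt (dm f))"
  using c.id_right[OF t] c.id_left[OF t] by (simp_all add: barr_comp[OF gid_oiso[OF H T(1)] t] barr_comp[OF t gid_oiso[OF H T(2)]])
qed

lemma barr_id_comp: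
 assumes "T \<in> \<O> H" "ar f" "ar g" "cd f = dm g"
 shows "barr B H (idG H T) (g oo[H] f) = barr B H (idG H T) g oo[H] barr B H (idG H T) f"
proof -
 interpret b: sm_functor "lev C H" "lev C H" "box_by G B H T" by (rule box_by_functor[OF H assms(1)])
 show ?thesis using b.map_cmp[of g f] assms by simp
qed

lemma bpoint_ar [simp]: "ob M ==> iso_arr (lev C H) (bpoint B H M)" "ob M ==> dm (bpoint B H M) = bobj B H (pt H) M"
 "ob M ==> cd (bpoint B H M) = M" "ob M ==> ar (bpoint B H M)"
proof -
 interpret bp: mon_nat_iso "lev C H" "lev C H" "box_by G B H (pt H)" "id_sm (lev C H)" "bpoint B H" by (rule bpoint_iso[OF H])
 show "iso_arr (lev C H) (bpoint B H M)" "dm (bpoint B H M) = bobj B H (pt H) M" "cd (bpoint B H M) = M" if "ob M"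
  using bp.component_iso[OF that] by (auto simp: isos_iff id_sm_def)
 then show "ar (bpoint B H M)" if "ob M" using that by (intro iso_ar)
qed

lemma badd_ar [simp]:
 assumes "T \<in> \<O> H" "T' \<in> \<O> H" "ob M"
 shows "iso_arr (lev C H) (badd B H T T' M)" "ar (badd B H T T' M)" "dm (badd B H T T' M) = bobj B H T M \<box>[H] bobj B H T' M"
  "cd (badd B H T T' M) = bobj B H (gsum G T T') M"
proof -
 interpret b: sm_functor "oiso G \<O> H" "lev C H" "box_at C B H M" by (rule box_at_functor[OF H assms(3)])
 show "iso_arr (lev C H) (badd B H T T' M)" "dm (badd B H T T' M) = bobj B H T M \<box>[H] bobj B H T' M"
  "cd (badd B H T T' M) = bobj B H (gsum G T T') M"
  using b.mu_iso[of T T'] assms by (auto simp: isos_iff)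
 then show "ar (badd B H T T' M)" by (intro iso_ar)
qed

lemma bzero_ar [simp]:
 assumes "ob M"
 shows "iso_arr (lev C H) (bzero B H M)" "ar (bzero B H M)" "dm (bzero B H M) = un" "cd (bzero B H M) = bobj B H (gempty G) M"
proof -
 interpret b: sm_functor "oiso G \<O> H" "lev C H" "box_at C B H M" by (rule box_at_functor[OF H assms])
 show "iso_arr (lev C H) (bzero B H M)" "dm (bzero B H M) = un" "cd (bzero B H M) = bobj B H (gempty G) M"
  using b.eps_iso assms by (auto simp: isos_iff)
 then show "ar (bzero B H M)" by (intro iso_ar)
qed

lemma bmul_ar [simp]:
 assumes "T \<in> \<O> H" "ob M" "ob M'"
 shows "iso_arr (lev C H) (bmul B H T M M')" "ar (bmul B H T M M')" "dm (bmul B H T M M') = bobj B H T M \<box>[H] bobj B H T M'"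
  "cd (bmul B H T M M') = bobj B H T (M \<box>[H] M')"
proof -
 interpret b: sm_functor "lev C H" "lev C H" "box_by G B H T" by (rule box_by_functor[OF H assms(1)])
 show "iso_arr (lev C H) (bmul B H T M M')" "ar (bmul B H T M M')" "dm (bmul B H T M M') = bobj B H T M \<box>[H] bobj B H T M'"
  "cd (bmul B H T M M') = bobj B H T (M \<box>[H] M')"
  using b.mu_isoa[of M M'] b.mu_ar[of M M'] b.mu_dm[of M M'] b.mu_cd[of M M'] assms by simp_all
qed

lemma bone_ar [simp]:
 assumes "T \<in> \<O> H"
 shows "iso_arr (lev C H) (bone B H T)" "ar (bone B H T)" "dm (bone B H T) = un" "cd (bone B H T) = bobj B H T un"
proof -
 interpret b: sm_functor "lev C H" "lev C H" "box_by G B H T" by (rule box_by_functor[OF H assms(1)])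
 show "iso_arr (lev C H) (bone B H T)" "ar (bone B H T)" "dm (bone B H T) = un" "cd (bone B H T) = bobj B H T un"
  using b.ep_isoa b.ep_ar by simp_all
qed

lemma bass_ar [simp]:
 assumes "S \<in> \<O> H" "T \<in> \<O> H" "ob M"
 shows "iso_arr (lev C H) (bass B H S T M)" "ar (bass B H S T M)" "dm (bass B H S T M) = bobj B H (gprod G S T) M"
  "cd (bass B H S T M) = bobj B H S (bobj B H T M)"
 using bass_iso[OF H assms] by (auto simp: isos_iff iso_ar)

lemma badd_nat:
 assumes "T \<in> \<O> H" "T' \<in> \<O> H" "ar f"
 shows "badd B H T T' (cd f) oo[H] (barr B H (idG H T) f **[H] barr B H (idG H T') f) =
  barr B H (idG H (gsum G T T')) f oo[H] badd B H T T' (dm f)"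
proof -
 interpret b: mon_nat "oiso G \<O> H" "lev C H" "box_at C B H (dm f)" "box_at C B H (cd f)" "%T. barr B H (idG H T) f"
  by (rule box_at_nat[OF H]) (simp add: in_homs assms)
 show ?thesis using b.mon_tens[of T T'] assms by simp
qed

lemma bzero_nat: "ar f ==> barr B H (idG H (gempty G)) f oo[H] bzero B H (dm f) = bzero B H (cd f)"
proof -
 assume f: "ar f"
 interpret b: mon_nat "oiso G \<O> H" "lev C H" "box_at C B H (dm f)" "box_at C B H (cd f)" "%T. barr B H (idG H T) f"
  by (rule box_at_nat[OF H]) (simp add: in_homs f)
 show ?thesis using b.mon_unit by simp
qed

lemma nm_ar [simp]: "T \<in> \<O> H ==> ar (nm H T)" "T \<in> \<O> H ==> dm (nm H T) = bobj B H T (RH H)" "T \<in> \<O> H ==> cd (nm H T) = RH H"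
 by (simp_all add: norm_map_eq[OF H])

lemma N_ar [simp]:
 assumes "t \<in> homs (osub G \<O> H) T T'"
 shows "ar (N H t)" "dm (N H t) = bobj B H T (RH H)" "cd (N H t) = bobj B H T' (RH H)"
 using t.F_ar[OF assms] by simp_all

lemma nm_N: "t \<in> homs (osub G \<O> H) T T' ==> nm H T' oo[H] N H t = nm H T"
 using t.nm_N[of t T T'] by (simp add: norm_map_eq[OF H])

lemma nm_iso: "t \<in> homs (oiso G \<O> H) T T' ==> nm H T' oo[H] barr B H t (idt (RH H)) = nm H T"
 using nm_N[OF oiso_osub[OF H], of t T T'] norm_extends[OF H, of t] by (simp add: in_homs)

lemma nm_pt: "nm H (pt H) = pR H"
 using t.nm_P by (simp add: norm_map_eq[OF H])

lemma nm_add: "T \<in> \<O> H ==> T' \<in> \<O> H ==> nm H (gsum G T T') oo[H] badd B H T T' (RH H) = mR H oo[H] (nm H T **[H] nm H T')"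
 using t.nm_add[of T T'] by (simp add: norm_map_eq[OF H] rmult_eq[OF H])

lemma nm_zero: "nm H (gempty G) oo[H] bzero B H (RH H) = eR H"
 by (simp add: runit_map_def)

text \<open>Transitivity of norms. By \<open>norm_box\<close>, boxing the norm of
  \<open>T \<rightarrow> P\<close> with \<open>S\<close> gives the norm of
  \<open>S \<times> T \<rightarrow> S \<times> P\<close>, and \<open>bass_point_right\<close>
  identifies \<open>S \<times> P\<close> with \<open>S\<close>, where \<open>P\<close> is the
  point.\<close>

lemma nm_bass:
 assumes [simp]: "S \<in> \<O> H" "T \<in> \<O> H"
 shows "nm H S oo[H] barr B H (idG H S) (nm H T) oo[H] bass B H S T (RH H) = nm H (gprod G S T)"
proof -
 let ?R = "RH H" and ?pr = "mk_gmap (gprod G S (pt H)) (pr_case (%x y. x)) S"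
 note b = gbang_osub[OF H assms(2)] and p = gprod_point_oiso(1)[OF H assms(1)]
 note g = gproda_osub[OF H assms(1) b]
 note [simp] = N_ar[OF b] N_ar[OF g] barr_ar[OF p]
 have "barr B H (idG H S) (nm H T) oo[H] bass B H S T ?R =
  barr B H (idG H S) (pR H) oo[H] barr B H (idG H S) (N H (bang H T)) oo[H] bass B H S T ?R"
  by (simp add: norm_map_def barr_id_comp cassoc)
 also have "\<dots> = (barr B H (idG H S) (pR H) oo[H] bass B H S (pt H) ?R) oo[H] N H (gproda G (idG H S) (bang H T))"
  using norm_box[OF H assms(1) b] by (simp add: cassoc)
 finally have "nm H S oo[H] barr B H (idG H S) (nm H T) oo[H] bass B H S T ?R = (nm H S oo[H] barr B H ?pr (idt ?R)) oo[H] N H (gproda G (idG H S) (bang H T))"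
  by (simp add: bass_point_right[OF H] cassoc)
 also have "\<dots> = nm H (gprod G S T)" by (simp add: nm_iso[OF p] nm_N[OF g])
 finally show ?thesis .
qed

text \<open>Replacing \<open>R\<close> by \<open>P \<box> R\<close>, with \<open>P\<close> the
  point, turns \<open>T \<box> R\<close> into \<open>(T \<times> P) \<box> R\<close>, compatibly
  with norm maps. The multiplication of \<open>R\<close>, which is defined on
  \<open>P \<squnion> P\<close>, thereby comes into the reach of \<open>bass\<close>.\<close>

lemma nm_mult_aux:
 assumes T [simp]: "T \<in> \<O> H"
 defines "b \<equiv> barr B H (idG H T) (pR H) oo[H] bass B H T (pt H) (RH H)"
 shows "iso_arr (lev C H) b" "dm b = bobj B H (gprod G T (pt H)) (RH H)" "cd b = bobj B H T (RH H)"
  "nm H T oo[H] b = nm H (gprod G T (pt H))"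
proof -
 note p = gprod_point_oiso(1)[OF H T]
 interpret b: sm_functor "lev C H" "lev C H" "box_by G B H T" by (rule box_by_functor[OF H T])
 have "iso_arr (lev C H) (barr B H (idG H T) (pR H))" using b.map_iso[of "pR H"] by simp
 then show "iso_arr (lev C H) b" "dm b = bobj B H (gprod G T (pt H)) (RH H)" "cd b = bobj B H T (RH H)" by (simp_all add: b_def)
 show "nm H T oo[H] b = nm H (gprod G T (pt H))"
  unfolding b_def bass_point_right[OF H T rest_ob[OF H]] by (rule nm_iso[OF p])
qed

text \<open>The product of \<open>R\<close> comes from
  \<open>P \<squnion> P \<rightarrow> P\<close>. Under \<open>bass\<close>, the product inherited by
  \<open>T \<box> R\<close> comes from the set \<open>T \<times> (P \<squnion> P)\<close>, which is
  isomorphic to \<open>(T \<times> P) \<squnion> (T \<times> P)\<close>; there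
  \<open>nm_bass\<close> and additivity of norm maps apply.\<close>

lemma nm_mult:
 assumes T [simp]: "T \<in> \<O> H"
 shows "nm H T oo[H] barr B H (idG H T) (mR H) oo[H] bmul B H T (RH H) (RH H) = mR H oo[H] (nm H T **[H] nm H T)"
proof (rule iso_cancel_r)
 let ?R = "RH H" and ?P = "pt H"
 define b where "b = barr B H (idG H T) (pR H) oo[H] bass B H T ?P ?R"
 note b = nm_mult_aux[OF T, folded b_def]
 note [simp] = b(1-3) iso_ar[OF b(1)]
 interpret B: sm_functor "lev C H" "lev C H" "box_by G B H T" by (rule box_by_functor[OF H T])
 interpret r: mon_nat "oiso G \<O> H" "lev C H" "comp_sm (lev C H) (box_at C B H ?R) (gprod_right G H T)"
  "comp_sm (lev C H) (box_by G B H T) (box_at C B H ?R)" "%S. bass B H T S ?R" by (rule bass_right[OF H T]) simp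
 let ?m = "fmu (gprod_right G H T) ?P ?P" and ?PP = "gsum G ?P ?P" and ?TP = "gprod G T ?P"
 have m: "?m \<in> homs (oiso G \<O> H) (gsum G ?TP ?TP) (gprod G T ?PP)" by (rule gprod_fmu_oiso(2)[OF H]) simp_all
 note [simp] = barr_ar[OF m]
 have PP: "mR H oo[H] (pR H **[H] pR H) = nm H ?PP oo[H] badd B H ?P ?P ?R" using nm_add[of ?P ?P] by (simp add: nm_pt)
 have mun: "bmul B H T ?R ?R oo[H] (barr B H (idG H T) (pR H) **[H] barr B H (idG H T) (pR H)) =
  barr B H (idG H T) (pR H **[H] pR H) oo[H] bmul B H T (bobj B H ?P ?R) (bobj B H ?P ?R)"
  using B.mu_n[of "pR H" "pR H" "bobj B H ?P ?R" "bobj B H ?P ?R"] by simp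
 show "iso_arr (lev C H) (b **[H] b)" by simp
 have "(nm H T oo[H] barr B H (idG H T) (mR H) oo[H] bmul B H T ?R ?R) oo[H] (b **[H] b) =
  nm H T oo[H] barr B H (idG H T) (mR H) oo[H] (bmul B H T ?R ?R oo[H] (barr B H (idG H T) (pR H) **[H] barr B H (idG H T) (pR H))) oo[H] (bass B H T ?P ?R **[H] bass B H T ?P ?R)"
  by (simp add: b_def nf)
 also have "\<dots> = nm H T oo[H] barr B H (idG H T) (mR H oo[H] (pR H **[H] pR H)) oo[H] bmul B H T (bobj B H ?P ?R) (bobj B H ?P ?R) oo[H] (bass B H T ?P ?R **[H] bass B H T ?P ?R)"
  unfolding mun by (simp add: barr_id_comp cassoc)
 also have "\<dots> = nm H T oo[H] barr B H (idG H T) (nm H ?PP) oo[H] (barr B H (idG H T) (badd B H ?P ?P ?R) oo[H] bmul B H T (bobj B H ?P ?R) (bobj B H ?P ?R)) oo[H] (bass B H T ?P ?R **[H] bass B H T ?P ?R)"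
  unfolding PP by (simp add: barr_id_comp cassoc)
 also have "\<dots> = (nm H T oo[H] barr B H (idG H T) (nm H ?PP) oo[H] bass B H T ?PP ?R) oo[H] barr B H ?m (idt ?R) oo[H] badd B H ?TP ?TP ?R"
  using r.mon_tens[of ?P ?P] by (simp add: cassoc)
 also have "\<dots> = mR H oo[H] (nm H ?TP **[H] nm H ?TP)"
  by (simp add: nm_bass rw2[OF nm_iso[OF m]] nm_add)
 also have "\<dots> = (mR H oo[H] (nm H T **[H] nm H T)) oo[H] (b **[H] b)"
  unfolding b(4)[symmetric] by (simp add: nf)
 finally show "(nm H T oo[H] barr B H (idG H T) (mR H) oo[H] bmul B H T ?R ?R) oo[H] (b **[H] b) = (mR H oo[H] (nm H T **[H] nm H T)) oo[H] (b **[H] b)" .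
qed (simp_all add: nm_mult_aux)

text \<open>The argument of \<open>nm_mult\<close> with the empty set in place of
  \<open>P \<squnion> P\<close>, using that \<open>T \<times> \<emptyset>\<close> is empty.\<close>

lemma nm_unit:
 assumes T [simp]: "T \<in> \<O> H"
 shows "nm H T oo[H] barr B H (idG H T) (eR H) oo[H] bone B H T = eR H"
proof -
 let ?R = "RH H" and ?E = "gempty G"
 interpret r: mon_nat "oiso G \<O> H" "lev C H" "comp_sm (lev C H) (box_at C B H ?R) (gprod_right G H T)"
  "comp_sm (lev C H) (box_by G B H T) (box_at C B H ?R)" "%S. bass B H T S ?R" by (rule bass_right[OF H T]) simp
 note p = gprod_feps_oiso(2)[OF H T]
 note [simp] = barr_ar[OF p]
 have "nm H T oo[H] barr B H (idG H T) (eR H) oo[H] bone B H T =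
  nm H T oo[H] barr B H (idG H T) (nm H ?E) oo[H] barr B H (idG H T) (bzero B H ?R) oo[H] bone B H T"
  by (simp add: nm_zero[symmetric] barr_id_comp cassoc)
 also have "\<dots> = (nm H T oo[H] barr B H (idG H T) (nm H ?E) oo[H] bass B H T ?E ?R) oo[H] barr B H (feps (gprod_right G H T)) (idt ?R) oo[H] bzero B H ?R"
  using r.mon_unit by (simp add: cassoc)
 also have "\<dots> = eR H"
  by (simp add: nm_bass rw2[OF nm_iso[OF p]] nm_zero)
 finally show ?thesis .
qed

end

end

lemma id_sm_sel [simp]: "fobj (id_sm C) x = x" "farr (id_sm C) f = f"
 "fmu (id_sm C) x y = cid C (x \<odot>\<^bsub>C\<^esub> y)" "feps (id_sm C) = cid C (unit_obj C)"
 by (simp_all add: id_sm_def)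

section \<open>Norm maps and restriction\<close>

context O_modules
begin

abbreviation rc where "rc f \<equiv> rest_comp G C R f"
abbreviation nres where "nres f T \<equiv> norm_res G C B R f T"

context
 fixes f K H assumes f: "f \<in> homs (orb G) K H"
begin

lemma subs: "subgroup K G" "subgroup H G"
 using orb_homD[OF f] by auto

interpretation cmon_ctx "lev C K" "RH K" "mR K" "eR K" "sepi K" by (rule level_ctx[OF subs(1)])
interpretation c: cmon_ctx "lev C H" "RH H" "mR H" "eR H" "sepi H" by (rule level_ctx[OF subs(2)])
interpretation F: sm_functor "lev C H" "lev C K" "res C f" by (rule restriction[OF f])

lemmas two_level_rules = box_ob[OF subs(1)] box_ob[OF subs(2)] O_rules[OF subs(1)] O_rules[OF subs(2)]
 osub_ob[OF subs(1)] osub_ob[OF subs(2)] barr_id_ar[OF subs(1)] barr_id_ar[OF subs(2)] bpoint_ar[OF subs(1)] bpoint_ar[OF subs(2)]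
 badd_ar[OF subs(1)] badd_ar[OF subs(2)] bzero_ar[OF subs(1)] bzero_ar[OF subs(2)] nm_ar[OF subs(1)] nm_ar[OF subs(2)]
 N_ar[OF subs(1)] N_ar[OF subs(2)]

declare two_level_rules [simp]

lemma gpull_O' [simp]: "T \<in> \<O> H ==> gpull G f T \<in> \<O> K"
 by (rule gpull_O[OF f])

lemma rc_ar [simp]: "iso_arr (lev C K) (rc f)" "ar (rc f)" "dm (rc f) = RH K" "cd (rc f) = fobj (res C f) (RH H)"
proof -
 let ?p = "proj_orb G H (carrier G)"
 interpret r: mon_nat_iso "lev C (carrier G)" "lev C K" "comp_sm (lev C K) (res C f) (res C ?p)" "res C (?p \<bullet>\<^bsub>orb G\<^esub> f)" "rcomp C ?p f"
  by (rule rcomp_iso[OF f proj_orb_hom[OF subs(2)]])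
 have "rcomp C ?p f R \<in> isos (lev C K) (fobj (res C f) (RH H)) (RH K)"
  using r.component_iso[OF underlying] unfolding proj_orb_comp[OF f] by (simp add: rest_def)
 then show "iso_arr (lev C K) (rc f)" "dm (rc f) = RH K" "cd (rc f) = fobj (res C f) (RH H)"
  using orb_homD[OF f] by (auto simp: rest_comp_def isos_iff)
 then show "ar (rc f)" by (intro iso_ar)
qed

lemma bres_ar [simp]:
 assumes "T \<in> \<O> H" "c.ob M"
 shows "iso_arr (lev C K) (bres B f T M)" "ar (bres B f T M)" "dm (bres B f T M) = bobj B K (gpull G f T) (fobj (res C f) M)"
  "cd (bres B f T M) = fobj (res C f) (bobj B H T M)"
 using bres_iso[OF f assms] by (auto simp: isos_iff iso_ar)

lemma nres_eq: "nres f T = bres B f T (RH H) oo[K] barr B K (idG K (gpull G f T)) (rc f)"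
 using orb_homD[OF f] by (simp add: norm_res_def Let_def)

lemma nres_ar [simp]:
 assumes "T \<in> \<O> H"
 shows "ar (nres f T)" "dm (nres f T) = bobj B K (gpull G f T) (RH K)" "cd (nres f T) = fobj (res C f) (bobj B H T (RH H))"
 using assms by (simp_all add: nres_eq)

lemma bpoint_nat: "ar u ==> bpoint B K (cd u) oo[K] barr B K (idG K (pt K)) u = u oo[K] bpoint B K (dm u)"
proof -
 assume u: "ar u"
 interpret bp: mon_nat_iso "lev C K" "lev C K" "box_by G B K (pt K)" "id_sm (lev C K)" "bpoint B K" by (rule bpoint_iso[OF subs(1)])
 show ?thesis using bp.natural[of u "dm u" "cd u"] u by (simp add: in_homs)
qed

text \<open>The axiom \<open>norm_restrict\<close> reduces the claim to the point, where
  \<open>bpoint_res\<close> applies because a pulled back point is again a point.\<close>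

lemma nm_res:
 assumes T [simp]: "T \<in> \<O> H"
 shows "farr (res C f) (nm H T) oo[K] nres f T = rc f oo[K] nm K (gpull G f T)"
proof -
 let ?F = "farr (res C f)" and ?P = "gpull G f (pt H)"
 note b = gbang_osub[OF subs(2) T] and q = gpull_point_oiso[OF f]
 note rb = res_osub[OF f b]
 note [simp] = N_ar[OF subs(2) b] N_ar[OF subs(1) rb] barr_ar[OF subs(1) q]
 have "?F (pR H) oo[K] nres f (pt H) = (bpoint B K (fobj (res C f) (RH H)) oo[K] barr B K (bang K ?P) (idt (fobj (res C f) (RH H)))) oo[K] barr B K (idG K ?P) (rc f)"
  using bpoint_res[OF f rest_ob[OF subs(2)]] by (simp add: nres_eq cassoc[symmetric])
 also have "\<dots> = bpoint B K (fobj (res C f) (RH H)) oo[K] barr B K (bang K ?P) (rc f)"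
  using barr_split(1)[OF subs(1) q, of "rc f"] by (simp add: cassoc)
 also have "\<dots> = (bpoint B K (cd (rc f)) oo[K] barr B K (idG K (pt K)) (rc f)) oo[K] barr B K (bang K ?P) (idt (RH K))"
  using barr_split(2)[OF subs(1) q, of "rc f"] by (simp add: cassoc)
 also have "\<dots> = rc f oo[K] nm K (pt K) oo[K] barr B K (bang K ?P) (idt (RH K))"
  by (subst bpoint_nat) (simp_all add: cassoc nm_pt[OF subs(1)])
 finally have 1: "?F (pR H) oo[K] nres f (pt H) = rc f oo[K] nm K ?P"
  by (simp add: nm_iso[OF subs(1) q])
 have "?F (nm H T) oo[K] nres f T = ?F (pR H) oo[K] ?F (N H (bang H T)) oo[K] nres f T"
  by (simp add: norm_map_def F.map_cmp cassoc)
 also have "\<dots> = ?F (pR H) oo[K] nres f (pt H) oo[K] N K (farr (res (FSet G) f) (bang H T))"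
  using norm_restrict[OF f b] by simp
 also have "\<dots> = rc f oo[K] nm K (gpull G f T)"
  by (simp add: rw2[OF 1] nm_N[OF subs(1) rb] cassoc)
 finally show ?thesis .
qed

text \<open>Monoidality of \<open>bres\<close> concerns the restriction of \<open>RH H\<close>.
  Naturality of \<open>badd\<close> in the module variable exchanges it for \<open>RH K\<close>
  along \<open>rc f\<close>.\<close>

lemma nres_add:
 assumes T [simp]: "T \<in> \<O> H" "T' \<in> \<O> H"
 shows "farr (res C f) (badd B H T T' (RH H)) oo[K] fmu (res C f) (bobj B H T (RH H)) (bobj B H T' (RH H)) oo[K] (nres f T **[K] nres f T') =
  nres f (gsum G T T') oo[K] barr B K (fmu (res (FSet G) f) T T') (idt (RH K)) oo[K] badd B K (gpull G f T) (gpull G f T') (RH K)"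
proof -
 let ?R = "RH H" and ?M = "fobj (res C f) (RH H)" and ?T = "gpull G f T" and ?T' = "gpull G f T'" and ?m = "fmu (res (FSet G) f) T T'"
 interpret r: mon_nat "oiso G \<O> H" "lev C K" "comp_sm (lev C K) (box_at C B K ?M) (res (FSet G) f)"
   "comp_sm (lev C K) (res C f) (box_at C B H ?R)" "%T. bres B f T ?R" by (rule bres_at[OF f]) simp
 note m = res_fmu_oiso[OF f T]
 note [simp] = barr_ar[OF subs(1) m]
 have e: "(farr (res C f) (badd B H T T' ?R) oo[K] fmu (res C f) (bobj B H T ?R) (bobj B H T' ?R)) oo[K] (bres B f T ?R **[K] bres B f T' ?R) =
  bres B f (gsum G T T') ?R oo[K] barr B K ?m (idt ?M) oo[K] badd B K ?T ?T' ?M"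
  using r.mon_tens[of T T'] by (simp add: cassoc)
 have "farr (res C f) (badd B H T T' ?R) oo[K] fmu (res C f) (bobj B H T ?R) (bobj B H T' ?R) oo[K] (nres f T **[K] nres f T') =
  ((farr (res C f) (badd B H T T' ?R) oo[K] fmu (res C f) (bobj B H T ?R) (bobj B H T' ?R)) oo[K] (bres B f T ?R **[K] bres B f T' ?R)) oo[K]
   (barr B K (idG K ?T) (rc f) **[K] barr B K (idG K ?T') (rc f))"
  by (simp add: nres_eq nf)
 also have "\<dots> = bres B f (gsum G T T') ?R oo[K] barr B K ?m (idt ?M) oo[K] badd B K ?T ?T' ?M oo[K] (barr B K (idG K ?T) (rc f) **[K] barr B K (idG K ?T') (rc f))"
  unfolding e by (simp add: cassoc)
 also have "\<dots> = bres B f (gsum G T T') ?R oo[K] (barr B K ?m (idt ?M) oo[K] barr B K (idG K (gsum G ?T ?T')) (rc f)) oo[K] badd B K ?T ?T' (RH K)"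
  using badd_nat[OF subs(1), of ?T ?T' "rc f"] by (simp add: cassoc)
 also have "barr B K ?m (idt ?M) oo[K] barr B K (idG K (gsum G ?T ?T')) (rc f) = barr B K (idG K (gpull G f (gsum G T T'))) (rc f) oo[K] barr B K ?m (idt (RH K))"
  using barr_split[OF subs(1) m, of "rc f"] by simp
 finally show ?thesis by (simp add: nres_eq cassoc)
qed

lemma nres_zero:
 "farr (res C f) (bzero B H (RH H)) oo[K] feps (res C f) =
  nres f (gempty G) oo[K] barr B K (feps (res (FSet G) f)) (idt (RH K)) oo[K] bzero B K (RH K)"
proof -
 let ?R = "RH H" and ?M = "fobj (res C f) (RH H)" and ?m = "feps (res (FSet G) f)"
 interpret r: mon_nat "oiso G \<O> H" "lev C K" "comp_sm (lev C K) (box_at C B K ?M) (res (FSet G) f)"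
   "comp_sm (lev C K) (res C f) (box_at C B H ?R)" "%T. bres B f T ?R" by (rule bres_at[OF f]) simp
 note m = res_feps_oiso[OF f]
 note [simp] = barr_ar[OF subs(1) m]
 have "farr (res C f) (bzero B H ?R) oo[K] feps (res C f) = bres B f (gempty G) ?R oo[K] barr B K ?m (idt ?M) oo[K] bzero B K ?M"
  using r.mon_unit by simp
 also have "\<dots> = bres B f (gempty G) ?R oo[K] (barr B K ?m (idt ?M) oo[K] barr B K (idG K (gempty G)) (rc f)) oo[K] bzero B K (RH K)"
  using bzero_nat[OF subs(1), of "rc f"] by (simp add: cassoc)
 also have "barr B K ?m (idt ?M) oo[K] barr B K (idG K (gempty G)) (rc f) = barr B K (idG K (gpull G f (gempty G))) (rc f) oo[K] barr B K ?m (idt (RH K))"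
  using barr_split[OF subs(1) m, of "rc f"] by simp
 finally show ?thesis by (simp add: nres_eq cassoc)
qed

text \<open>Both multiplications come from the sum of two points, and norm maps commute with sums
  and with restriction. The test map is the norm map of the pulled back point, which is an
  isomorphism because that set is isomorphic to the point.\<close>

lemma rc_mult: "farr (res C f) (mR H) oo[K] fmu (res C f) (RH H) (RH H) oo[K] (rc f **[K] rc f) = rc f oo[K] mR K"
proof (rule iso_cancel_r)
 let ?P = "gpull G f (pt H)" and ?F = "farr (res C f)" and ?b = "bobj B H (pt H) (RH H)" and ?n = "nm K (gpull G f (pt H))"
 note q = gpull_point_oiso[OF f] and m = res_fmu_oiso[OF f O_rules(3)[OF subs(2)] O_rules(3)[OF subs(2)]]
 note [simp] = barr_ar[OF subs(1) q] barr_ar[OF subs(1) m]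
 interpret b: sm_functor "oiso G \<O> K" "lev C K" "box_at C B K (RH K)" by (rule box_at_functor[OF subs(1)]) simp
 have "bang K ?P \<in> isos (oiso G \<O> K) ?P (pt K)"
 proof -
  obtain t where t: "t \<in> isos (fset G K) (pt K) ?P" "t \<bullet>\<^bsub>fset G K\<^esub> bang K ?P = idG K ?P" "bang K ?P \<bullet>\<^bsub>fset G K\<^esub> t = idG K (pt K)"
   using q by (auto simp: oiso_homs[OF subs(1)] isos_def)
  then show ?thesis using q by (intro isosI[of _ _ _ _ t]) (auto simp: oiso_homs[OF subs(1)])
 qed
 then have "iso_arr (lev C K) (barr B K (bang K ?P) (idt (RH K)))" using b.map_isos by (auto simp: isos_iff)
 then have "iso_arr (lev C K) ?n"
  using nm_iso[OF subs(1) q, symmetric] by (simp add: nm_pt[OF subs(1)])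
 then show "iso_arr (lev C K) (?n **[K] ?n)" by simp
 have PP: "mR H \<bullet>\<^bsub>lev C H\<^esub> (pR H \<star>\<^bsub>lev C H\<^esub> pR H) = nm H (gsum G (pt H) (pt H)) \<bullet>\<^bsub>lev C H\<^esub> badd B H (pt H) (pt H) (RH H)"
  using nm_add[OF subs(2), of "pt H" "pt H"] by (simp add: nm_pt[OF subs(2)])
 have e: "fmu (res C f) (RH H) (RH H) oo[K] (?F (pR H) **[K] ?F (pR H)) = ?F (pR H \<star>\<^bsub>lev C H\<^esub> pR H) oo[K] fmu (res C f) ?b ?b"
  using F.mu_n[of "pR H" "pR H" ?b ?b] by simp
 have rn: "rc f oo[K] ?n = ?F (pR H) oo[K] nres f (pt H)" using nm_res[of "pt H"] by (simp add: nm_pt[OF subs(2)])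
 have "(?F (mR H) oo[K] fmu (res C f) (RH H) (RH H) oo[K] (rc f **[K] rc f)) oo[K] (?n **[K] ?n) =
  ?F (mR H) oo[K] fmu (res C f) (RH H) (RH H) oo[K] ((rc f oo[K] ?n) **[K] (rc f oo[K] ?n))" by (simp add: nf)
 also have "\<dots> = ?F (mR H) oo[K] (fmu (res C f) (RH H) (RH H) oo[K] (?F (pR H) **[K] ?F (pR H))) oo[K] (nres f (pt H) **[K] nres f (pt H))"
  unfolding rn by (simp add: nf)
 also have "\<dots> = ?F (mR H \<bullet>\<^bsub>lev C H\<^esub> (pR H \<star>\<^bsub>lev C H\<^esub> pR H)) oo[K] fmu (res C f) ?b ?b oo[K] (nres f (pt H) **[K] nres f (pt H))"
  unfolding e by (simp add: F.map_cmp cassoc)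
 also have "\<dots> = ?F (nm H (gsum G (pt H) (pt H))) oo[K] ?F (badd B H (pt H) (pt H) (RH H)) oo[K] fmu (res C f) ?b ?b oo[K] (nres f (pt H) **[K] nres f (pt H))"
  unfolding PP by (simp add: F.map_cmp cassoc)
 also have "\<dots> = (?F (nm H (gsum G (pt H) (pt H))) oo[K] nres f (gsum G (pt H) (pt H))) oo[K] barr B K (fmu (res (FSet G) f) (pt H) (pt H)) (idt (RH K)) oo[K] badd B K ?P ?P (RH K)"
  unfolding nres_add[OF O_rules(3)[OF subs(2)] O_rules(3)[OF subs(2)]] by (simp add: cassoc)
 also have "\<dots> = (rc f oo[K] mR K) oo[K] (?n **[K] ?n)"
  by (simp add: nm_res cassoc rw2[OF nm_iso[OF subs(1) m]] nm_add[OF subs(1)])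
 finally show "(?F (mR H) oo[K] fmu (res C f) (RH H) (RH H) oo[K] (rc f **[K] rc f)) oo[K] (?n **[K] ?n) = (rc f oo[K] mR K) oo[K] (?n **[K] ?n)" .
qed simp_all

lemma rc_unit: "farr (res C f) (eR H) oo[K] feps (res C f) = rc f oo[K] eR K"
proof -
 let ?F = "farr (res C f)"
 note m = res_feps_oiso[OF f]
 note [simp] = barr_ar[OF subs(1) m]
 have "?F (eR H) oo[K] feps (res C f) = ?F (nm H (gempty G)) oo[K] ?F (bzero B H (RH H)) oo[K] feps (res C f)"
  by (simp add: nm_zero[OF subs(2), symmetric] F.map_cmp cassoc)
 also have "\<dots> = (?F (nm H (gempty G)) oo[K] nres f (gempty G)) oo[K] barr B K (feps (res (FSet G) f)) (idt (RH K)) oo[K] bzero B K (RH K)"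
  unfolding nres_zero by (simp add: cassoc)
 also have "\<dots> = rc f oo[K] eR K"
  by (simp add: nm_res cassoc rw2[OF nm_iso[OF subs(1) m]] nm_zero[OF subs(1)])
 finally show ?thesis .
qed

end

declare two_level_rules [simp del] gpull_O' [simp del] rc_ar [simp del] bres_ar [simp del] nres_ar [simp del]

end

section \<open>The coefficient system of modules\<close>

lemma (in fin_indexing_system) orb_unit:
 assumes "f \<in> homs (orb G) K H"
 shows "f \<bullet>\<^bsub>orb G\<^esub> cid (orb G) K = f" "cid (orb G) H \<bullet>\<^bsub>orb G\<^esub> f = f"
proof -
 obtain h where f: "f = (K, h, H)" and h: "h \<in> lcosets\<^bsub>G\<^esub> K \<rightarrow> lcosets\<^bsub>G\<^esub> H" "h \<in> extensional (lcosets\<^bsub>G\<^esub> K)"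
  using assms by (auto simp: orb_hom PiE_def)
 show "f \<bullet>\<^bsub>orb G\<^esub> cid (orb G) K = f" "cid (orb G) H \<bullet>\<^bsub>orb G\<^esub> f = f"
  using compose_Id[OF h] Id_compose[OF h] by (simp_all add: f orb_simps(4))
qed

lemma (in fin_indexing_system) orb_assoc:
 "k \<in> homs (orb G) J L ==> h \<in> homs (orb G) L K ==> f \<in> homs (orb G) K H ==>
  (f \<bullet>\<^bsub>orb G\<^esub> h) \<bullet>\<^bsub>orb G\<^esub> k = f \<bullet>\<^bsub>orb G\<^esub> (h \<bullet>\<^bsub>orb G\<^esub> k)"
 by (auto simp: orb_hom compose_def PiE_iff fun_eq_iff)

context O_modules
begin

abbreviation MC where "MC H \<equiv> mod_cat (lev C H) (RH H) (mR H) (eR H)"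
abbreviation RM where "RM \<equiv> RMod G C B R N"
abbreviation mres where "mres f X \<equiv> mod_res_obj G C R f X"

lemma RMod_lev [simp]: "lev RM H = MC H"
 by (simp add: RMod_def Let_def)

lemma RMod_runit [simp]: "runit RM H X = (X, runit C H (fst X), mres (cid (orb G) H) X)"
 and RMod_rcomp [simp]: "rcomp RM f h X = (mres h (mres f X), rcomp C f h (fst X), mres (f \<bullet>\<^bsub>orb G\<^esub> h) X)"
 by (simp_all add: RMod_def Let_def)

lemma RMod_res_obj [simp]: "fobj (res RM f) X = mres f X"
 and RMod_res_arr [simp]: "farr (res RM f) (X, u, Y) = (mres f X, farr (res C f) u, mres f Y)"
 by (simp_all add: RMod_def Let_def)

lemma mres_fst [simp]: "fst (mres f X) = fobj (res C f) (fst X)"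
 by (simp add: mod_res_obj_def Let_def)

text \<open>The scalars change only along the isomorphism \<open>rest_comp\<close>, so a restricted
  module needs no quotient and is generated by an identity.\<close>

definition jr :: "'g omap => ('o, 'a) md => 'a" where
 "jr f X = cid (lev C (cdom (orb G) f)) (fobj (res C f) (fst X))"

context
 fixes f K H assumes f: "f \<in> homs (orb G) K H"
begin

interpretation cmon_ctx "lev C K" "RH K" "mR K" "eR K" "sepi K" by (rule level_ctx[OF subs(1)[OF f]])
interpretation c: cmon_ctx "lev C H" "RH H" "mR H" "eR H" "sepi H" by (rule level_ctx[OF subs(2)[OF f]])
interpretation F: sm_functor "lev C H" "lev C K" "res C f" by (rule restriction[OF f])

lemmas res_rules = rc_ar[OF f] orb_homD(3,4)[OF f]

declare res_rules [simp]

lemma mres_snd: "snd (mres f X) = farr (res C f) (snd X) oo[K] fmu (res C f) (RH H) (fst X) oo[K] (rc f **[K] idt (fobj (res C f) (fst X)))"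
 by (simp add: mod_res_obj_def Let_def)

lemma jr_eq: "jr f X = idt (fobj (res C f) (fst X))"
 by (simp add: jr_def)

lemma res_monoid: "monoid_pushforward (lev C K) (RH K) (mR K) (eR K) (sepi K) (lev C H) (RH H) (mR H) (eR H) (sepi H) (res C f) (iv (rc f))"
proof
 let ?F = "farr (res C f)" and ?\<mu> = "fmu (res C f) (RH H) (RH H)"
 show "iv (rc f) \<in> homs (lev C K) (fobj (res C f) (RH H)) (RH K)" by (simp add: in_homs)
 show "iv (rc f) oo[K] ?F (mR H) oo[K] ?\<mu> = mR K oo[K] (iv (rc f) **[K] iv (rc f))"
 proof (rule iso_cancel_r)
  show "iso_arr (lev C K) (rc f **[K] rc f)" by simp
  show "(iv (rc f) oo[K] ?F (mR H) oo[K] ?\<mu>) oo[K] (rc f **[K] rc f) = (mR K oo[K] (iv (rc f) **[K] iv (rc f))) oo[K] (rc f **[K] rc f)"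
   using rc_mult[OF f] by (simp add: nf)
 qed simp_all
 show "iv (rc f) oo[K] ?F (eR H) oo[K] feps (res C f) = eR K" using rc_unit[OF f] by simp
qed

interpretation M: monoid_pushforward "lev C K" "RH K" "mR K" "eR K" "sepi K" "lev C H" "RH H" "mR H" "eR H" "sepi H" "res C f" "iv (rc f)"
 by (rule res_monoid)

lemma res_pushforward: "pushforward (lev C K) (RH K) (mR K) (eR K) (sepi K) (lev C H) (RH H) (mR H) (eR H) (sepi H) (res C f)
  (iv (rc f)) (mod_res_obj G C R f) (jr f)"
proof (intro pushforward.intro pushforward_axioms.intro res_monoid)
 show "rcoeq (lev C K) (farr (res C f) u) (farr (res C f) v) (farr (res C f) q)" if "rcoeq (lev C H) u v q" for u v q
  using f that by (rule res_rcoeq)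
 show "sepi K (farr (res C f) p)" if "sepi H p" for p using that f by (rule sepi_res)
 show "base_change (iv (rc f)) (M.fact (RH H) (snd X)) (jr f X) (mres f X)" if X [simp]: "c.md X" for X
  unfolding jr_eq
 proof (rule M.base_change_restriction[OF X])
  show "mres f X = (fobj (res C f) (fst X), M.fact (RH H) (snd X) oo[K] (iv (iv (rc f)) **[K] idt (fobj (res C f) (fst X))))"
   using mres_fst[of f X] mres_snd[of X] by (simp add: prod_eq_iff M.fact_def iv_iv cassoc)
 qed simp
qed

interpretation P: pushforward "lev C K" "RH K" "mR K" "eR K" "sepi K" "lev C H" "RH H" "mR H" "eR H" "sepi H" "res C f" "iv (rc f)"
  "mod_res_obj G C R f" "jr f"
 by (rule res_pushforward)

lemma res_indfun: "indfun (lev C K) (RH K) (mR K) (eR K) (sepi K) (lev C H) (RH H) (mR H) (eR H) (sepi H) (res C f) (res RM f) (jr f)"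
proof (rule P.indfunI)
 show "\<exists>h. farr (res RM f) (X, u, Y) = (mres f X, h, mres f Y) & ar h & dm h = fst (mres f X) &
   (mor (mres f X) h (mres f Y) & h oo[K] jr f X = jr f Y oo[K] farr (res C f) u)" if u: "c.mor X u Y" for X u Y
 proof -
  note [simp] = c.morD(1-5)[OF u]
  obtain h where h: "mor (mres f X) h (mres f Y)" "h oo[K] jr f X = jr f Y oo[K] farr (res C f) u"
   by (rule P.Phi_arr_ex[OF u])
  note [simp] = morD(3-5)[OF h(1)]
  \<comment> \<open>As \<open>jr\<close> is an identity, the descended map is the restricted arrow
    itself, in agreement with \<open>RMod\<close>.\<close>
  have "h = farr (res C f) u" using h(2) by (simp add: jr_eq)
  then show ?thesis using h by simp
 qed
 show "\<exists>h. fmu (res RM f) X Y = (mt (mres f X) (mres f Y), h, mres f (c.mt X Y)) &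
   mor (mt (mres f X) (mres f Y)) h (mres f (c.mt X Y)) &
   h oo[K] qt (jr f X) (mres f X) (jr f Y) (mres f Y) = jr f (c.mt X Y) oo[K] farr (res C f) (c.cq X Y) oo[K] fmu (res C f) (fst X) (fst Y)"
  if X [simp]: "c.md X" "c.md Y" for X Y
 proof -
  obtain h where h: "mor (mt (mres f X) (mres f Y)) h (mres f (c.mt X Y))"
   "h oo[K] qt (jr f X) (mres f X) (jr f Y) (mres f Y) = jr f (c.mt X Y) oo[K] farr (res C f) (c.cq X Y) oo[K] fmu (res C f) (fst X) (fst Y)"
   by (rule P.Phi_mu_ex[OF X])
  note [simp] = morD(3-5)[OF h(1)]
  have "h oo[K] cq (mres f X) (mres f Y) = farr (res C f) (c.cq X Y) oo[K] fmu (res C f) (fst X) (fst Y)"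
   using h(2) by (simp add: qt_def jr_eq)
  then have "factor (lev C K) (cq (mres f X) (mres f Y)) (farr (res C f) (c.cq X Y) oo[K] fmu (res C f) (fst X) (fst Y)) = h"
   by (intro factor_eq) simp_all
  then show ?thesis using h by (simp add: RMod_def Let_def)
 qed
 have "(farr (res C f) (mR H) oo[K] fmu (res C f) (RH H) (RH H) oo[K] (rc f **[K] idt (fobj (res C f) (RH H)))) oo[K] (idt (RH K) **[K] rc f) =
  farr (res C f) (mR H) oo[K] fmu (res C f) (RH H) (RH H) oo[K] (rc f **[K] rc f)" by (simp add: nf)
 then have "rc f oo[K] mR K = snd (mres f (RH H, mR H)) oo[K] (idt (RH K) **[K] rc f)"
  by (simp add: mres_snd rc_mult[OF f])
 then have m: "mor (RH K, mR K) (rc f) (mres f (RH H, mR H))"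
  by (simp add: mor_iff md_self c.md_self)
 show "\<exists>h. feps (res RM f) = ((RH K, mR K), h, mres f (RH H, mR H)) & mor (RH K, mR K) h (mres f (RH H, mR H)) &
   h oo[K] eR K = jr f (RH H, mR H) oo[K] farr (res C f) (eR H) oo[K] feps (res C f)"
  using m rc_unit[OF f] by (simp add: RMod_def Let_def jr_eq mod_cat_def)
qed simp

lemma mres_md [simp]: "c.md X ==> md (mres f X)"
 by (rule P.pj_ar)

end

declare res_rules [simp del] mres_md [simp del]

text \<open>The law \<open>rcomp_assoc\<close> for
  \<open>G/L \<rightarrow> G/K \<rightarrow> G/H \<rightarrow> G/G\<close>, evaluated at
  \<open>R\<close>.\<close>

lemma rc_comp:
 assumes h: "h \<in> homs (orb G) L K" and f: "f \<in> homs (orb G) K H"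
 shows "rcomp C f h (RH H) oo[L] farr (res C h) (rc f) oo[L] rc h = rc (f \<bullet>\<^bsub>orb G\<^esub> h)"
proof -
 let ?p = "proj_orb G H (carrier G)" and ?fh = "f \<bullet>\<^bsub>orb G\<^esub> h"
 note p = proj_orb_hom[OF subs(2)[OF f]] and fh = orb_comp[OF f h]
 note s = subs[OF h] subs(2)[OF f]
 interpret cmon_ctx "lev C L" "RH L" "mR L" "eR L" "sepi L" by (rule level_ctx[OF s(1)])
 interpret k: sym_mon_cat "lev C K" by (rule level[OF s(2)])
 interpret F: sm_functor "lev C H" "lev C K" "res C f" by (rule restriction[OF f])
 interpret Fh: sm_functor "lev C K" "lev C L" "res C h" by (rule restriction[OF h])
 interpret r: mon_nat_iso "lev C H" "lev C L" "comp_sm (lev C L) (res C h) (res C f)" "res C ?fh" "rcomp C f h" by (rule rcomp_iso[OF h f])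
 \<comment> \<open>\<open>rest_comp\<close> is by definition the inverse of a value of
   \<open>rcomp\<close>; by \<open>proj_orb_comp\<close> the projections to \<open>G/G\<close>
   match, so the three inverses are the values that occur in \<open>rcomp_assoc\<close>.\<close>
 have i: "iv (rc ?fh) = rcomp C ?p ?fh R" "k.iv (rc f) = rcomp C ?p f R" "iv (rc h) = rcomp C (?p \<bullet>\<^bsub>orb G\<^esub> f) h R"
 proof -
  have 1: "iso_arr (lev C (cdom (orb G) g)) (rcomp C (proj_orb G (ccod (orb G) g) (carrier G)) g R)" if g: "g \<in> homs (orb G) L' K'" for g L' K'
  proof -
   interpret r: mon_nat_iso "lev C (carrier G)" "lev C L'" "comp_sm (lev C L') (res C g) (res C (proj_orb G K' (carrier G)))"
    "res C (proj_orb G K' (carrier G) \<bullet>\<^bsub>orb G\<^esub> g)" "rcomp C (proj_orb G K' (carrier G)) g"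
    by (rule rcomp_iso[OF g proj_orb_hom[OF subs(2)[OF g]]])
   show ?thesis using r.component_iso[OF underlying] orb_homD[OF g] by (auto simp: isos_iff)
  qed
  show "iv (rc ?fh) = rcomp C ?p ?fh R" "k.iv (rc f) = rcomp C ?p f R" "iv (rc h) = rcomp C (?p \<bullet>\<^bsub>orb G\<^esub> f) h R"
   using 1[OF fh] 1[OF f] 1[OF h] orb_homD[OF fh] orb_homD[OF f] orb_homD[OF h]
   by (simp_all add: rest_comp_def iv_iv k.iv_iv proj_orb_comp[OF f])
 qed
 have [simp]: "iso_arr (lev C L) (rcomp C f h (RH H))" "dm (rcomp C f h (RH H)) = fobj (res C h) (fobj (res C f) (RH H))"
  "cd (rcomp C f h (RH H)) = fobj (res C ?fh) (RH H)" "ar (rcomp C f h (RH H))"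
  using r.component_iso[OF rest_ob[OF s(3)]] by (auto simp: isos_iff iso_ar)
 note [simp] = rc_ar[OF fh] rc_ar[OF f] rc_ar[OF h]
 have "iv (rc ?fh) oo[L] rcomp C f h (RH H) = iv (rc h) oo[L] farr (res C h) (k.iv (rc f))"
  using rcomp_assoc[OF h f p underlying] by (simp add: i rest_def)
 then have e: "iv (rc ?fh) oo[L] rcomp C f h (RH H) = iv (rc h) oo[L] iv (farr (res C h) (rc f))"
  by (simp add: Fh.map_iv)
 have "iv (rc ?fh) oo[L] rcomp C f h (RH H) oo[L] farr (res C h) (rc f) oo[L] rc h = idt (RH L)"
  by (simp add: rw2[OF e] cassoc)
 with iso_cancel_l[of "iv (rc ?fh)" "rcomp C f h (RH H) oo[L] farr (res C h) (rc f) oo[L] rc h" "rc ?fh"]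
 show ?thesis by simp
qed

text \<open>The unit law \<open>runit_source\<close> for the projection
  \<open>G/H \<rightarrow> G/G\<close>, evaluated at \<open>R\<close>.\<close>

lemma rc_id:
 assumes H: "subgroup H G" shows "runit C H (RH H) = rc (cid (orb G) H)"
proof -
 let ?p = "proj_orb G H (carrier G)" and ?i = "cid (orb G) H"
 note p = proj_orb_hom[OF H] and i = orb_id[OF H]
 interpret cmon_ctx "lev C H" "RH H" "mR H" "eR H" "sepi H" by (rule level_ctx[OF H])
 interpret r: mon_nat_iso "lev C (carrier G)" "lev C H" "comp_sm (lev C H) (res C ?i) (res C ?p)" "res C (?p \<bullet>\<^bsub>orb G\<^esub> ?i)" "rcomp C ?p ?i"
  by (rule rcomp_iso[OF i p])
 interpret u: mon_nat_iso "lev C H" "lev C H" "id_sm (lev C H)" "res C ?i" "runit C H" by (rule runit_iso[OF H])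
 have "iso_arr (lev C H) (rcomp C ?p ?i R)" using r.component_iso[OF underlying] by (simp add: isos_iff)
 then have r: "iv (rc ?i) = rcomp C ?p ?i R" using orb_homD[OF i] by (simp add: rest_comp_def iv_iv)
 have [simp]: "ar (runit C H (RH H))" "dm (runit C H (RH H)) = RH H" "cd (runit C H (RH H)) = fobj (res C ?i) (RH H)"
  using u.component_iso[OF rest_ob[OF H]] by (auto simp: isos_iff iso_ar)
 note [simp] = rc_ar[OF i]
 have "iv (rc ?i) oo[H] runit C H (RH H) = iv (rc ?i) oo[H] rc ?i"
  using runit_source[OF p underlying] by (simp add: r[symmetric] rest_def[symmetric])
 with iso_cancel_l[of "iv (rc ?i)" "runit C H (RH H)" "rc ?i"] show ?thesis by simp
qed

lemma RMod_runit_iso: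
 assumes H: "subgroup H G"
 shows "mon_nat_iso (MC H) (MC H) (id_sm (MC H)) (res RM (cid (orb G) H)) (runit RM H)"
proof -
 let ?i = "cid (orb G) H" and ?t = "runit C H"
 note i = orb_id[OF H]
 interpret cmon_ctx "lev C H" "RH H" "mR H" "eR H" "sepi H" by (rule level_ctx[OF H])
 interpret u: mon_nat_iso "lev C H" "lev C H" "id_sm (lev C H)" "res C ?i" "runit C H" by (rule runit_iso[OF H])
 have t [simp]: "iso_arr (lev C H) (?t x)" "ar (?t x)" "dm (?t x) = x" "cd (?t x) = fobj (res C ?i) x" if "ob x" for x
  using u.component_iso[OF that] by (auto simp: isos_iff iso_ar)
 note [simp] = rc_ar[OF i] mres_md[OF i]
 have m: "mor X (?t (fst X)) (mres ?i X)" if X [simp]: "md X" for X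
 proof -
  have "?t (fst X) oo[H] snd X = farr (res C ?i) (snd X) oo[H] fmu (res C ?i) (RH H) (fst X) oo[H] (?t (RH H) **[H] ?t (fst X))"
   using u.natural[of "snd X" "RH H \<box>[H] fst X" "fst X"] u.mon_tens[of "RH H" "fst X"] by (simp add: in_homs)
  also have "\<dots> = snd (mres ?i X) oo[H] (idt (RH H) **[H] ?t (fst X))"
   by (simp add: mres_snd[OF i] rc_id[OF H] nf)
  finally show ?thesis by (simp add: mor_iff)
 qed
 have "mon_nat (MC H) (MC H) (id_sm (MC H)) (res RM ?i) (runit RM H)"
  by (rule mon_nat_of_indfun[OF indfun_id[OF level_ctx[OF H]] res_indfun[OF i] u.mon_nat_axioms])
   (use m orb_homD[OF i] in \<open>simp add: jr_eq[OF i]\<close>)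
 then show ?thesis
  by (intro mon_nat_iso.intro mon_nat_iso_axioms.intro)
   (use W_iso_underlying[OF m] in \<open>simp_all del: mres_fst\<close>)
qed

text \<open>Naturality and monoidality of \<open>rcomp\<close> carry it across the action, and
  \<open>rc_comp\<close> identifies the resulting scalars. So the underlying arrow is itself linear,
  and an invertible linear map has a linear inverse.\<close>

lemma RMod_rcomp_iso:
 assumes h: "h \<in> homs (orb G) L K" and f: "f \<in> homs (orb G) K H"
 shows "mon_nat_iso (MC H) (MC L) (comp_sm (MC L) (res RM h) (res RM f)) (res RM (f \<bullet>\<^bsub>orb G\<^esub> h)) (rcomp RM f h)"
proof -
 let ?fh = "f \<bullet>\<^bsub>orb G\<^esub> h" and ?t = "rcomp C f h"
 note fh = orb_comp[OF f h] and s = subs[OF h] subs(2)[OF f]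
 interpret cmon_ctx "lev C L" "RH L" "mR L" "eR L" "sepi L" by (rule level_ctx[OF s(1)])
 interpret k: cmon_ctx "lev C K" "RH K" "mR K" "eR K" "sepi K" by (rule level_ctx[OF s(2)])
 interpret c: cmon_ctx "lev C H" "RH H" "mR H" "eR H" "sepi H" by (rule level_ctx[OF s(3)])
 interpret F: sm_functor "lev C H" "lev C K" "res C f" by (rule restriction[OF f])
 interpret Fh: sm_functor "lev C K" "lev C L" "res C h" by (rule restriction[OF h])
 interpret u: mon_nat_iso "lev C H" "lev C L" "comp_sm (lev C L) (res C h) (res C f)" "res C ?fh" "rcomp C f h" by (rule rcomp_iso[OF h f])
 have t [simp]: "iso_arr (lev C L) (?t x)" "ar (?t x)" "dm (?t x) = fobj (res C h) (fobj (res C f) x)" "cd (?t x) = fobj (res C ?fh) x" if "c.ob x" for x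
  using u.component_iso[OF that] by (auto simp: isos_iff iso_ar)
 note [simp] = rc_ar[OF fh] rc_ar[OF f] rc_ar[OF h] mres_md[OF fh] mres_md[OF f] mres_md[OF h]
 have m: "mor (mres h (mres f X)) (?t (fst X)) (mres ?fh X)" if X [simp]: "c.md X" for X
 proof -
  let ?x = "fst X" and ?h = "farr (res C h)" and ?f = "farr (res C f)"
  have e: "fmu (res C h) (RH K) (fobj (res C f) ?x) = fmu (res C h) (RH K) (fobj (res C f) ?x)" ..
  have n: "?h (rc f \<star>\<^bsub>lev C K\<^esub> k.idt (fobj (res C f) ?x)) oo[L] fmu (res C h) (RH K) (fobj (res C f) ?x) =
   fmu (res C h) (fobj (res C f) (RH H)) (fobj (res C f) ?x) oo[L] (?h (rc f) **[L] idt (fobj (res C h) (fobj (res C f) ?x)))"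
   using Fh.mu_n[of "rc f" "k.idt (fobj (res C f) ?x)" "RH K" "fobj (res C f) ?x"] by simp
  have "?t ?x oo[L] snd (mres h (mres f X)) = ?t ?x oo[L] ?h (?f (snd X)) oo[L] ?h (fmu (res C f) (RH H) ?x) oo[L]
   (?h (rc f \<star>\<^bsub>lev C K\<^esub> k.idt (fobj (res C f) ?x)) oo[L] fmu (res C h) (RH K) (fobj (res C f) ?x)) oo[L] (rc h **[L] idt (fobj (res C h) (fobj (res C f) ?x)))"
   by (simp add: mres_snd[OF h] mres_snd[OF f] Fh.map_cmp cassoc)
  also have "\<dots> = (?t ?x oo[L] ?h (?f (snd X))) oo[L] (?h (fmu (res C f) (RH H) ?x) oo[L] fmu (res C h) (fobj (res C f) (RH H)) (fobj (res C f) ?x)) oo[L]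
   ((?h (rc f) oo[L] rc h) **[L] idt (fobj (res C h) (fobj (res C f) ?x)))"
   unfolding n by (simp add: nf)
  also have "?t ?x oo[L] ?h (?f (snd X)) = farr (res C ?fh) (snd X) oo[L] ?t (RH H \<odot>\<^bsub>lev C H\<^esub> ?x)"
   using u.natural[of "snd X" "RH H \<odot>\<^bsub>lev C H\<^esub> ?x" ?x] by (simp add: in_homs)
  also have "(farr (res C ?fh) (snd X) oo[L] ?t (RH H \<odot>\<^bsub>lev C H\<^esub> ?x)) oo[L] (?h (fmu (res C f) (RH H) ?x) oo[L] fmu (res C h) (fobj (res C f) (RH H)) (fobj (res C f) ?x)) oo[L]
   ((?h (rc f) oo[L] rc h) **[L] idt (fobj (res C h) (fobj (res C f) ?x))) =
   farr (res C ?fh) (snd X) oo[L] (?t (RH H \<odot>\<^bsub>lev C H\<^esub> ?x) oo[L] ?h (fmu (res C f) (RH H) ?x) oo[L] fmu (res C h) (fobj (res C f) (RH H)) (fobj (res C f) ?x)) oo[L]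
   ((?h (rc f) oo[L] rc h) **[L] idt (fobj (res C h) (fobj (res C f) ?x)))"
   by (simp add: cassoc)
  also have "?t (RH H \<odot>\<^bsub>lev C H\<^esub> ?x) oo[L] ?h (fmu (res C f) (RH H) ?x) oo[L] fmu (res C h) (fobj (res C f) (RH H)) (fobj (res C f) ?x) =
   fmu (res C ?fh) (RH H) ?x oo[L] (?t (RH H) **[L] ?t ?x)"
   using u.mon_tens[of "RH H" ?x] by simp
  also have "farr (res C ?fh) (snd X) oo[L] (fmu (res C ?fh) (RH H) ?x oo[L] (?t (RH H) **[L] ?t ?x)) oo[L] ((?h (rc f) oo[L] rc h) **[L] idt (fobj (res C h) (fobj (res C f) ?x)))
   = farr (res C ?fh) (snd X) oo[L] fmu (res C ?fh) (RH H) ?x oo[L] ((?t (RH H) oo[L] ?h (rc f) oo[L] rc h) **[L] ?t ?x)"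
   by (simp add: nf)
  also have "\<dots> = snd (mres ?fh X) oo[L] (idt (RH L) **[L] ?t ?x)"
   unfolding rc_comp[OF h f] by (simp add: mres_snd[OF fh] nf)
  finally show ?thesis by (simp add: mor_iff)
 qed
 have "mon_nat (MC H) (MC L) (comp_sm (MC L) (res RM h) (res RM f)) (res RM ?fh) (rcomp RM f h)"
  by (rule mon_nat_of_indfun[OF indfun_comp[OF res_indfun[OF f] res_indfun[OF h] u.dom.sm_functor_axioms] res_indfun[OF fh] u.mon_nat_axioms])
   (use m in \<open>simp add: jr_eq[OF f] jr_eq[OF h] jr_eq[OF fh]\<close>)
 then show ?thesis
  by (intro mon_nat_iso.intro mon_nat_iso_axioms.intro)
   (use W_iso_underlying[OF m] in \<open>simp_all del: mres_fst\<close>)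
qed

lemma RMod_coeff_system: "coeff_system G RM"
proof (rule coeff_system.intro)
 show "sym_mon_cat (lev RM H)" if H: "subgroup H G" for H
  using cmon_ctx.W_sym_mon[OF level_ctx[OF H]] by simp
 show "sm_functor (lev RM H) (lev RM K) (res RM f)" if f: "f \<in> homs (orb G) K H" for f K H
  using indfun.Phi_sm_functor[OF res_indfun[OF f]] by simp
 show "mon_nat_iso (lev RM H) (lev RM H) (id_sm (lev RM H)) (res RM (cid (orb G) H)) (runit RM H)" if H: "subgroup H G" for H
  using RMod_runit_iso[OF H] by simp
 show "mon_nat_iso (lev RM H) (lev RM L) (comp_sm (lev RM L) (res RM h) (res RM f)) (res RM (f \<bullet>\<^bsub>orb G\<^esub> h)) (rcomp RM f h)"
  if "h \<in> homs (orb G) L K" "f \<in> homs (orb G) K H" for h L K f H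
  using RMod_rcomp_iso[OF that] by simp
 show "rcomp RM f (cid (orb G) K) X \<bullet>\<^bsub>lev RM K\<^esub> runit RM K (fobj (res RM f) X) = cid (lev RM K) (fobj (res RM f) X)"
  "rcomp RM (cid (orb G) H) f X \<bullet>\<^bsub>lev RM K\<^esub> farr (res RM f) (runit RM H X) = cid (lev RM K) (fobj (res RM f) X)"
  if f: "f \<in> homs (orb G) K H" and X: "X \<in> cobj (lev RM H)" for f K H X
 proof -
  interpret cmon_ctx "lev C K" "RH K" "mR K" "eR K" "sepi K" by (rule level_ctx[OF subs(1)[OF f]])
  interpret c: cmon_ctx "lev C H" "RH H" "mR H" "eR H" "sepi H" by (rule level_ctx[OF subs(2)[OF f]])
  show "rcomp RM f (cid (orb G) K) X \<bullet>\<^bsub>lev RM K\<^esub> runit RM K (fobj (res RM f) X) = cid (lev RM K) (fobj (res RM f) X)"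
   "rcomp RM (cid (orb G) H) f X \<bullet>\<^bsub>lev RM K\<^esub> farr (res RM f) (runit RM H X) = cid (lev RM K) (fobj (res RM f) X)"
   using runit_source[OF f, of "fst X"] runit_target[OF f, of "fst X"] X by (simp_all add: orb_unit[OF f])
 qed
 show "rcomp RM f (h \<bullet>\<^bsub>orb G\<^esub> k) X \<bullet>\<^bsub>lev RM J\<^esub> rcomp RM h k (fobj (res RM f) X) =
   rcomp RM (f \<bullet>\<^bsub>orb G\<^esub> h) k X \<bullet>\<^bsub>lev RM J\<^esub> farr (res RM k) (rcomp RM f h X)"
  if k: "k \<in> homs (orb G) J L" and h: "h \<in> homs (orb G) L K" and f: "f \<in> homs (orb G) K H" and X: "X \<in> cobj (lev RM H)"
  for k J L h K f H X
 proof -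
  interpret cmon_ctx "lev C J" "RH J" "mR J" "eR J" "sepi J" by (rule level_ctx[OF subs(1)[OF k]])
  interpret c: cmon_ctx "lev C H" "RH H" "mR H" "eR H" "sepi H" by (rule level_ctx[OF subs(2)[OF f]])
  show ?thesis using rcomp_assoc[OF k h f, of "fst X"] X by (simp add: orb_assoc[OF k h f])
 qed
qed

end

section \<open>The operation \<open>\<box>\<^sub>R\<close>\<close>

lemma mon_nat_inv:
 assumes "mon_nat C D F F' \<tau>" and i: "\<And>x. x \<in> cobj C ==> iso_arr D (\<tau> x)"
 shows "mon_nat C D F' F (%x. inv_arr D (\<tau> x))"
proof -
 interpret n: mon_nat C D F F' \<tau> by fact
 have t [simp]: "iso_arr D (\<tau> x)" "cdom D (\<tau> x) = fobj F x" "ccod D (\<tau> x) = fobj F' x" "\<tau> x \<in> carr D" if "x \<in> cobj C" for x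
  using n.component[OF that] i[OF that] by (auto simp: in_homs)
 show ?thesis
 proof (intro mon_nat.intro mon_nat_axioms.intro n.dom.sm_functor_axioms n.cod.sm_functor_axioms)
  show "inv_arr D (\<tau> x) \<in> homs D (fobj F' x) (fobj F x)" if "x \<in> cobj C" for x using that by (simp add: in_homs)
  show "inv_arr D (\<tau> y) \<bullet>\<^bsub>D\<^esub> farr F' f = farr F f \<bullet>\<^bsub>D\<^esub> inv_arr D (\<tau> x)" if f: "f \<in> homs C x y" for f x y
  proof -
   have [simp]: "x \<in> cobj C" "y \<in> cobj C" "f \<in> carr C" "cdom C f = x" "ccod C f = y"
    using f n.dom.src.dom_closed n.dom.src.cod_closed by (auto simp: in_homs)
   have "inv_arr D (\<tau> y) \<bullet>\<^bsub>D\<^esub> farr F' f = inv_arr D (\<tau> y) \<bullet>\<^bsub>D\<^esub> (farr F' f \<bullet>\<^bsub>D\<^esub> \<tau> x) \<bullet>\<^bsub>D\<^esub> inv_arr D (\<tau> x)"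
    by (simp add: n.dom.tgt.cassoc)
   also have "\<dots> = farr F f \<bullet>\<^bsub>D\<^esub> inv_arr D (\<tau> x)"
    unfolding n.natural[OF f, symmetric] by (simp add: n.dom.tgt.cassoc)
   finally show ?thesis .
  qed
  show "inv_arr D (\<tau> (x \<odot>\<^bsub>C\<^esub> y)) \<bullet>\<^bsub>D\<^esub> fmu F' x y = fmu F x y \<bullet>\<^bsub>D\<^esub> (inv_arr D (\<tau> x) \<star>\<^bsub>D\<^esub> inv_arr D (\<tau> y))"
   if [simp]: "x \<in> cobj C" "y \<in> cobj C" for x y
  proof (rule n.dom.tgt.iso_cancel_r)
   show "iso_arr D (\<tau> x \<star>\<^bsub>D\<^esub> \<tau> y)" by simp
   show "(inv_arr D (\<tau> (x \<odot>\<^bsub>C\<^esub> y)) \<bullet>\<^bsub>D\<^esub> fmu F' x y) \<bullet>\<^bsub>D\<^esub> (\<tau> x \<star>\<^bsub>D\<^esub> \<tau> y) =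
    (fmu F x y \<bullet>\<^bsub>D\<^esub> (inv_arr D (\<tau> x) \<star>\<^bsub>D\<^esub> inv_arr D (\<tau> y))) \<bullet>\<^bsub>D\<^esub> (\<tau> x \<star>\<^bsub>D\<^esub> \<tau> y)"
    by (simp add: n.dom.tgt.nf n.mon_tens[symmetric])
  qed simp_all
  show "inv_arr D (\<tau> (unit_obj C)) \<bullet>\<^bsub>D\<^esub> feps F' = feps F" by (simp add: n.mon_unit[symmetric])
 qed
qed

lemma (in cmon_ctx) slin_pre:
 assumes k: "slin \<phi> \<alpha> Y k" and Y: "md Y" and s [simp]: "ar s" "cd s = dm \<phi>"
  and eq: "\<phi>' = \<phi> oo s" "\<alpha>' = \<alpha> oo (s ** idt (cd \<alpha>))"
 shows "slin \<phi>' \<alpha>' Y k"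
proof -
 note [simp] = Y slinD(2-4)[OF k] actnD[OF slinD(1)[OF k]]
 have "k oo \<alpha> oo (s ** idt (cd \<alpha>)) = snd Y oo ((\<phi> oo s) ** k)"
  by (simp add: rw2[OF slinD(5)[OF k]] nf)
 then show ?thesis by (simp add: slin_def actn_def eq)
qed

context O_modules
begin

abbreviation bx where "bx H T X \<equiv> boxR_obj G C B R N H T X"
abbreviation gn where "gn H \<equiv> cmon_ctx.gen (lev C H) (RH H) (mR H) (eR H) (sepi H)"
abbreviation ov where "ov H \<equiv> cmon_ctx.ovr (lev C H) (RH H) (mR H) (eR H)"
abbreviation qtn where "qtn H \<equiv> cmon_ctx.qt (lev C H) (RH H)"

text \<open>The generating map \<open>T \<box> M \<rightarrow> T \<box>\<^sub>R M\<close>, which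
  sends x to the class of 1 \<otimes> x.\<close>

definition jb :: "'g set => 'g gset => ('o, 'a) md => 'a" where
 "jb H T X = boxR_q G C B R N H T X oo[H] (eR H **[H] cid (lev C H) (bobj B H T (fst X))) oo[H]
   inv_arr (lev C H) (lun (lev C H) (bobj B H T (fst X)))"

definition qb :: "'g set => 'g gset => 'a => ('o, 'a) md => 'a" where
 "qb H T q X = jb H T X oo[H] barr B H (idG H T) q"

text \<open>When \<open>q\<close> generates, at most one map of modules lies over a given arrow, so
  the choice only names it. Existence is proved for each structure map separately.\<close>

definition lft :: "'g set => 'a => ('o, 'a) md => 'a => ('o, 'a) md => 'a => ('o, 'a) mdmap" where
 "lft H q X q' Y f = (SOME u. ov H q X q' Y f u)"

lemma lft: "ov H q X q' Y f u ==> ov H q X q' Y f (lft H q X q' Y f)"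
 unfolding lft_def by (rule someI)

context
 fixes H assumes H: "subgroup H G"
begin

interpretation cmon_ctx "lev C H" "RH H" "mR H" "eR H" "sepi H" by (rule level_ctx[OF H])

lemmas [simp] = box_ob[OF H] O_rules[OF H] osub_ob[OF H] barr_id_ar[OF H] bpoint_ar[OF H] badd_ar[OF H] bzero_ar[OF H]
 bmul_ar[OF H] bone_ar[OF H] bass_ar[OF H] nm_ar[OF H]

lemma box_monoid:
 assumes T [simp]: "T \<in> \<O> H"
 shows "monoid_pushforward (lev C H) (RH H) (mR H) (eR H) (sepi H) (lev C H) (RH H) (mR H) (eR H) (sepi H) (box_by G B H T) (nm H T)"
proof -
 have "nm H T \<in> homs (lev C H) (fobj (box_by G B H T) (RH H)) (RH H)" by (simp add: in_homs)
 moreover have "nm H T oo[H] farr (box_by G B H T) (mR H) oo[H] fmu (box_by G B H T) (RH H) (RH H) = mR H oo[H] (nm H T **[H] nm H T)"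
  using nm_mult[OF H T] by simp
 moreover have "nm H T oo[H] farr (box_by G B H T) (eR H) oo[H] feps (box_by G B H T) = eR H"
  using nm_unit[OF H T] by simp
 ultimately show ?thesis
  by (rule monoid_pushforward.intro[OF smf_ctx.intro[OF level_ctx[OF H] level_ctx[OF H] box_by_functor[OF H T]] monoid_pushforward_axioms.intro])
qed

text \<open>In \<open>relq\<close> the monoid \<open>T \<box> R\<close> acts on \<open>R\<close>
  from the right through the symmetry. Commutativity of \<open>R\<close> turns this into right
  multiplication with the norm map, and the pair becomes that of \<open>base_change\<close>.\<close>

lemma boxR_base_change:
 assumes T [simp]: "T \<in> \<O> H" and X [simp]: "md X"
 shows "base_change (nm H T) (barr B H (idG H T) (snd X) oo[H] bmul B H T (RH H) (fst X)) (jb H T X) (bx H T X)"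
  "snd (bx H T X) oo[H] (idt (RH H) **[H] jb H T X) = boxR_q G C B R N H T X"
  "epi (lev C H) (boxR_q G C B R N H T X)" "dm (boxR_q G C B R N H T X) = RH H \<box>[H] bobj B H T (fst X)"
proof -
 interpret M: monoid_pushforward "lev C H" "RH H" "mR H" "eR H" "sepi H" "lev C H" "RH H" "mR H" "eR H" "sepi H" "box_by G B H T" "nm H T"
  by (rule box_monoid[OF T])
 let ?a = "barr B H (idG H T) (snd X) oo[H] bmul B H T (RH H) (fst X)" and ?q = "boxR_q G C B R N H T X" and ?R = "RH H" and ?b = "bobj B H T (RH H)"
 have a: "M.fact ?R (snd X) = ?a" by (simp add: M.fact_def)
 have un: "unital (nm H T) ?a" using M.fact_unital[OF X] by (simp add: a)
 have "(mR H oo[H] (nm H T **[H] idt ?R)) oo[H] br ?R ?b = mR H oo[H] br ?R ?R oo[H] (idt ?R **[H] nm H T)"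
  by (simp add: cassoc br_n)
 also have "\<dots> = mR H oo[H] (idt ?R **[H] nm H T)" by (simp add: rw2[OF m_br])
 finally have e: "(mR H oo[H] (nm H T **[H] idt ?R)) oo[H] br ?R ?b = mR H oo[H] (idt ?R **[H] nm H T)" .
 let ?f = "(mR H oo[H] (idt ?R **[H] nm H T)) **[H] idt (cd ?a)" and ?g = "(idt ?R **[H] ?a) oo[H] as ?R (dm (nm H T)) (cd ?a)"
 have q: "?q = (SOME q. is_coeq (lev C H) ?f ?g q)"
  by (simp add: boxR_q_def relq_def base_module_def box_module_def e)
 have r: "reflexive (lev C H) ?f ?g" by (rule base_change_reflexive[OF un])
 have c: "is_coeq (lev C H) ?f ?g ?q"
  unfolding q by (rule someI_ex[OF lev_coeq[OF H r]])
 have X': "bx H T X = (cd ?q, quot_act (lev C H) ?R ?R (mR H) (cd ?a) ?q)"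
  by (simp add: boxR_obj_def Let_def)
 have j: "jb H T X = ?q oo[H] (eR H **[H] idt (cd ?a)) oo[H] iv (lu (cd ?a))" by (simp add: jb_def)
 show "base_change (nm H T) ?a (jb H T X) (bx H T X)" "snd (bx H T X) oo[H] (idt ?R **[H] jb H T X) = ?q"
  using base_change_of_coeq[OF un c] unfolding X' j by simp_all
 show "epi (lev C H) ?q" by (rule coeq_epi[OF c reflexiveD[OF r]])
 show "dm ?q = RH H \<box>[H] bobj B H T (fst X)" using is_coeqD(2)[OF c reflexiveD(1)[OF r]] by simp
qed

lemma box_pushforward:
 assumes T [simp]: "T \<in> \<O> H"
 shows "pushforward (lev C H) (RH H) (mR H) (eR H) (sepi H) (lev C H) (RH H) (mR H) (eR H) (sepi H) (box_by G B H T) (nm H T)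
  (bx H T) (jb H T)"
proof -
 interpret M: monoid_pushforward "lev C H" "RH H" "mR H" "eR H" "sepi H" "lev C H" "RH H" "mR H" "eR H" "sepi H" "box_by G B H T" "nm H T"
  by (rule box_monoid[OF T])
 show ?thesis
 proof (intro pushforward.intro pushforward_axioms.intro box_monoid T)
  show "rcoeq (lev C H) (M.Fa u) (M.Fa v) (M.Fa q)" if "rcoeq (lev C H) u v q" for u v q
   using box_rcoeq[OF H T that] by simp
  show "sepi H (M.Fa p)" if "sepi H p" for p using sepi_box[OF that T] by simp
  show "base_change (nm H T) (M.fact (RH H) (snd X)) (jb H T X) (bx H T X)" if X: "md X" for X
   using boxR_base_change(1)[OF T X] X by (simp add: M.fact_def)
 qed
qed

lemma bx_md [simp]: "T \<in> \<O> H ==> md X ==> md (bx H T X)"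
 by (rule base_changeD(1)[OF boxR_base_change(1)])

lemma jb_slin: "T \<in> \<O> H ==> md X ==>
  slin (nm H T) (barr B H (idG H T) (snd X) oo[H] bmul B H T (RH H) (fst X)) (bx H T X) (jb H T X)"
 by (rule base_changeD(2)[OF boxR_base_change(1)])

lemma jb_ar [simp]:
 assumes "T \<in> \<O> H" "md X"
 shows "ar (jb H T X)" "dm (jb H T X) = bobj B H T (fst X)" "cd (jb H T X) = fst (bx H T X)"
 using slinD(2-4)[OF jb_slin[OF assms]] assms by simp_all

lemma jb_gen: "T \<in> \<O> H ==> md X ==> gen (jb H T X) (bx H T X)"
 by (rule base_change_gen[OF boxR_base_change(1)])

lemma qb_ar [simp]:
 assumes "T \<in> \<O> H" "md X" "ar q" "cd q = fst X"
 shows "ar (qb H T q X)" "dm (qb H T q X) = bobj B H T (dm q)" "cd (qb H T q X) = fst (bx H T X)"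
 using assms by (simp_all add: qb_def)

lemma qb_gen:
 assumes T: "T \<in> \<O> H" and q: "gen q X" shows "gen (qb H T q X) (bx H T X)"
proof -
 interpret P: pushforward "lev C H" "RH H" "mR H" "eR H" "sepi H" "lev C H" "RH H" "mR H" "eR H" "sepi H" "box_by G B H T" "nm H T"
   "bx H T" "jb H T" by (rule box_pushforward[OF T])
 show ?thesis using P.Phi_gen_ex[OF q] by (simp add: qb_def)
qed

lemma qb_id [simp]: "T \<in> \<O> H ==> md X ==> qb H T (idt (fst X)) X = jb H T X"
 using box_id[OF H] by (simp add: qb_def)

text \<open>Norm maps are invariant under isomorphisms of sets by \<open>nm_iso\<close>, so
  \<open>barr B H t v\<close> followed by the generator is semilinear for the scalars of
  \<open>T\<close> and descends.\<close>

lemma ovr_barr: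
 assumes t: "t \<in> homs (oiso G \<O> H) T T'" and u: "ovr q X q' Y f u"
 shows "ovr (qb H T q X) (bx H T X) (qb H T' q' Y) (bx H T' Y) (barr B H t f) (boxR_arr G C B R N H t u)"
proof -
 have T [simp]: "T \<in> \<O> H" "T' \<in> \<O> H" using t by (auto simp: oiso_homs[OF H])
 obtain t0 where t': "t = (T, t0, T')" using t by (cases t) (auto simp: in_homs)
 obtain v where v: "u = (X, v, Y)" "mor X v Y" "ar q" "cd q = fst X" "ar q'" "cd q' = fst Y" "ar f" "dm f = dm q"
  "cd f = dm q'" "v oo[H] q = q' oo[H] f" by (rule ovrE[OF u])
 note [simp] = morD(1-5)[OF v(2)] v(3-9)
 interpret P': pushforward "lev C H" "RH H" "mR H" "eR H" "sepi H" "lev C H" "RH H" "mR H" "eR H" "sepi H" "box_by G B H T'" "nm H T'"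
   "bx H T'" "jb H T'" by (rule box_pushforward[OF T(2)])
 note n = box_by_nat[OF H t]
 let ?a = "barr B H (idG H T) (snd X) oo[H] bmul B H T (RH H) (fst X)"
 have "slin (nm H T' oo[H] barr B H t (idt (RH H))) (farr (box_by G B H T) (snd X) oo[H] fmu (box_by G B H T) (RH H) (fst X)) (bx H T' Y)
   ((jb H T' Y oo[H] barr B H (idG H T') v) oo[H] barr B H t (idt (fst X)))"
 proof (rule mon_nat_slin[OF n level_ctx[OF H]])
  have "slin (idt (RH H)) (snd X) Y v" using v(2) by (simp add: mor_slin[symmetric])
  from P'.map_slin[OF this]
  show "slin (nm H T') (farr (box_by G B H T') (snd X) oo[H] fmu (box_by G B H T') (RH H) (fst X)) (bx H T' Y) (jb H T' Y oo[H] barr B H (idG H T') v)"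
   using box_id[OF H T(2) rest_ob[OF H]] by (simp add: P'.fact_def)
 qed (simp_all add: in_homs)
 then have s: "slin (nm H T) ?a (bx H T' Y) (jb H T' Y oo[H] barr B H t v)"
  using barr_split(2)[OF H t, of v] barr_ar[OF H t] by (simp add: nm_iso[OF H t] cassoc)
 obtain h where h: "mor (bx H T X) h (bx H T' Y)" "h oo[H] jb H T X = jb H T' Y oo[H] barr B H t v"
  by (rule base_change_descend[OF boxR_base_change(1)[OF T(1)] _ s]) simp_all
 note [simp] = morD(3-5)[OF h(1)] barr_ar[OF H t]
 let ?q = "boxR_q G C B R N H T X" and ?q' = "boxR_q G C B R N H T' Y"
 note q = boxR_base_change(2)[OF T(1), of X] boxR_base_change(2)[OF T(2), of Y]
 \<comment> \<open>\<open>boxR_arr\<close> is a factorization through the full quotient map, so the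
   equation on generators is first extended linearly to \<open>boxR_q\<close>.\<close>
 have "h oo[H] ?q = (h oo[H] snd (bx H T X)) oo[H] (idt (RH H) **[H] jb H T X)"
  using q(1) by (simp add: cassoc)
 also have "\<dots> = snd (bx H T' Y) oo[H] (idt (RH H) **[H] (jb H T' Y oo[H] barr B H t v))"
  unfolding morD(6)[OF h(1)] by (simp add: nf h(2))
 also have "\<dots> = ?q' oo[H] (idt (RH H) **[H] barr B H t v)"
  unfolding q(2)[symmetric, OF morD(2)[OF v(2)]] by (simp add: nf)
 finally have hq: "h oo[H] ?q = ?q' oo[H] (idt (RH H) **[H] barr B H t v)" .
 have "cd ?q = fst (bx H T X)" by (simp add: boxR_obj_def Let_def)
 then have "factor (lev C H) ?q (?q' oo[H] (idt (RH H) **[H] barr B H t v)) = h"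
  using hq boxR_base_change(3)[OF T(1), of X] by (intro factor_eq) simp_all
 then have e: "boxR_arr G C B R N H t u = (bx H T X, h, bx H T' Y)"
  unfolding v(1) by (simp add: boxR_arr_def t')
 interpret o: sym_mon_cat "oiso G \<O> H" by (rule oiso_cat[OF H])
 have "h oo[H] qb H T q X = jb H T' Y oo[H] barr B H t v oo[H] barr B H (idG H T) q"
  by (simp add: qb_def rw2[OF h(2)] cassoc)
 also have "\<dots> = jb H T' Y oo[H] barr B H t (q' oo[H] f)"
  using barr_comp[OF H gid_oiso[OF H T(1)] t, of q v] o.id_right[OF t] by (simp add: v(10))
 also have "\<dots> = qb H T' q' Y oo[H] barr B H t f"
  using barr_comp[OF H t gid_oiso[OF H T(2)], of f q'] o.id_left[OF t] by (simp add: qb_def cassoc)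
 finally have "h oo[H] qb H T q X = qb H T' q' Y oo[H] barr B H t f" .
 then show ?thesis unfolding e using h(1) by (simp add: ovr_def)
qed

end

end

context cmon_ctx
begin

text \<open>The structure maps are built on the generators \<open>jb\<close>. Naturality of the maps
  of \<open>C\<close> and this rule extend the description to modules given with arbitrary
  generators, as needed for iterated constructions.\<close>

lemma ovr_pre:
 assumes "ovr q X q' Y f u" "ar a" "cd a = dm q" "ar a'" "cd a' = dm q'" "f oo a = a' oo f'" "ar f'" "dm f' = dm a" "cd f' = dm a'"
 shows "ovr (q oo a) X (q' oo a') Y f' u"
proof -
 obtain h where h: "u = (X, h, Y)" "mor X h Y" "ar q" "cd q = fst X" "ar q'" "cd q' = fst Y" "ar f" "dm f = dm q"
  "cd f = dm q'" "h oo q = q' oo f" by (rule ovrE[OF assms(1)])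
 note [simp] = h(3-9) morD(1-5)[OF h(2)] assms(2-5,7-9)
 have "h oo q oo a = (q' oo a') oo f'" by (simp add: rw2[OF h(10)] cassoc assms(6))
 then show ?thesis using h(2) by (simp add: h(1) ovr_def)
qed

lemma ovr_ex: "ovr q X q' Y f u ==> \<exists>h. u = (X, h, Y) & mor X h Y & h oo q = q' oo f"
 by (auto elim: ovrE)

lemma ovr_of_map: "mor X h Y ==> h oo q = q' oo f ==> gen q X ==> gen q' Y ==> ar f ==> dm f = dm q ==> cd f = dm q' ==>
  ovr q X q' Y f (X, h, Y)"
 by (rule ovrI)

lemma ovr_isoI:
 assumes "gen q X" "gen q' Y" "ovr q X q' Y f u" "mor Y k X" "k oo q' = q oo iv f" "iso_arr C f"
 shows "u \<in> isos W X Y"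
proof -
 have f: "ar f" "dm f = dm q" "cd f = dm q'" using assms(3) by (auto simp: ovr_def)
 have "ovr q' Y q X (iv f) (Y, k, X)" by (rule ovr_of_map) (use assms f in simp_all)
 then show ?thesis by (rule W_isoI[OF assms(1-3)]) (use assms(6) f in simp_all)
qed

end

section \<open>The structure maps of the boxed modules at one level\<close>

context O_modules
begin

text \<open>Apart from \<open>bobj\<close> and \<open>barr\<close>, every field is the lift of the
  corresponding structure map of \<open>C\<close> along generating maps; the lifts are shown to
  exist below. For \<open>bmul\<close> and \<open>bass\<close> the target generator is a composite,
  obtained by boxing a quotient map or a generator.\<close>

definition RB :: "('g, ('o, 'a) md, ('o, 'a) mdmap) box" where
 "RB = \<lparr>bobj = boxR_obj G C B R N, barr = boxR_arr G C B R N,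
   badd = (%H T T' X. lft H (qtn H (jb H T X) (bx H T X) (jb H T' X) (bx H T' X)) (mod_tens (lev C H) (RH H) (bx H T X) (bx H T' X))
    (jb H (gsum G T T') X) (bx H (gsum G T T') X) (badd B H T T' (fst X))),
   bzero = (%H X. lft H (eR H) (RH H, mR H) (jb H (gempty G) X) (bx H (gempty G) X) (bzero B H (fst X))),
   bmul = (%H T X Y. lft H (qtn H (jb H T X) (bx H T X) (jb H T Y) (bx H T Y)) (mod_tens (lev C H) (RH H) (bx H T X) (bx H T Y))
    (qb H T (relq (lev C H) (RH H) X Y) (mod_tens (lev C H) (RH H) X Y)) (bx H T (mod_tens (lev C H) (RH H) X Y)) (bmul B H T (fst X) (fst Y))),
   bone = (%H T. lft H (eR H) (RH H, mR H) (qb H T (eR H) (RH H, mR H)) (bx H T (RH H, mR H)) (bone B H T)),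
   bres = (%f T X. let K = cdom (orb G) f; H = ccod (orb G) f in
    lft K (jb K (gpull G f T) (mres f X)) (bx K (gpull G f T) (mres f X)) (farr (res C f) (jb H T X)) (mres f (bx H T X)) (bres B f T (fst X))),
   bpoint = (%H X. lft H (jb H (pt H) X) (bx H (pt H) X) (cid (lev C H) (fst X)) X (bpoint B H (fst X))),
   bass = (%H S T X. lft H (jb H (gprod G S T) X) (bx H (gprod G S T) X) (qb H S (jb H T X) (bx H T X)) (bx H S (bx H T X))
    (bass B H S T (fst X)))\<rparr>"

lemma RB_sel [simp]: "bobj RB H T X = bx H T X" "barr RB = boxR_arr G C B R N"
 by (simp_all add: RB_def)

context
 fixes H assumes H: "subgroup H G"
begin

interpretation cmon_ctx "lev C H" "RH H" "mR H" "eR H" "sepi H" by (rule level_ctx[OF H])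

lemmas box_rules = box_ob[OF H] O_rules[OF H] osub_ob[OF H] barr_id_ar[OF H] bpoint_ar[OF H] badd_ar[OF H] bzero_ar[OF H]
 bmul_ar[OF H] bone_ar[OF H] bass_ar[OF H] nm_ar[OF H] bx_md[OF H] jb_ar[OF H] qb_ar[OF H] qb_id[OF H] jb_gen[OF H]

declare box_rules [simp]

abbreviation actb where "actb T X \<equiv> barr B H (idG H T) (snd X) oo[H] bmul B H T (RH H) (fst X)"

lemma actb_unital:
 assumes T: "T \<in> \<O> H" and X: "md X" shows "unital (nm H T) (actb T X)"
proof -
 interpret M: monoid_pushforward "lev C H" "RH H" "mR H" "eR H" "sepi H" "lev C H" "RH H" "mR H" "eR H" "sepi H" "box_by G B H T" "nm H T"
  by (rule box_monoid[OF H T])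
 show ?thesis using M.fact_unital[OF X] X by (simp add: M.fact_def)
qed

lemma badd_act:
 assumes [simp]: "T \<in> \<O> H" "T' \<in> \<O> H" "md X"
 shows "badd B H T T' (fst X) oo[H] (actb T X **[H] actb T' X) =
  actb (gsum G T T') X oo[H] (badd B H T T' (RH H) **[H] badd B H T T' (fst X)) oo[H]
   mid4 (lev C H) (bobj B H T (RH H)) (bobj B H T (fst X)) (bobj B H T' (RH H)) (bobj B H T' (fst X))"
proof -
 let ?m = "mid4 (lev C H) (bobj B H T (RH H)) (bobj B H T (fst X)) (bobj B H T' (RH H)) (bobj B H T' (fst X))"
 have "badd B H T T' (fst X) oo[H] (actb T X **[H] actb T' X) = (badd B H T T' (cd (snd X)) oo[H] (barr B H (idG H T) (snd X) **[H] barr B H (idG H T') (snd X))) oo[H]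
   (bmul B H T (RH H) (fst X) **[H] bmul B H T' (RH H) (fst X))" by (simp add: nf)
 also have "\<dots> = barr B H (idG H (gsum G T T')) (snd X) oo[H] badd B H T T' (RH H \<box>[H] fst X) oo[H] (bmul B H T (RH H) (fst X) **[H] bmul B H T' (RH H) (fst X))"
  by (subst badd_nat[OF H]) (simp_all add: cassoc)
 also have "\<dots> = actb (gsum G T T') X oo[H] (badd B H T T' (RH H) **[H] badd B H T T' (fst X)) oo[H] ?m"
  by (subst add_mul[OF H]) (simp_all add: cassoc)
 finally show ?thesis .
qed

text \<open>By \<open>badd_act\<close> and \<open>nm_add\<close> the candidate is linear for both
  scalars jointly, and \<open>mid_linear\<close> splits this into linearity in each factor. For the
  inverse, semilinearity is tested against the isomorphism that decomposes the scalars and the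
  module of \<open>T \<squnion> T'\<close>.\<close>

lemma badd_ex:
 assumes [simp]: "T \<in> \<O> H" "T' \<in> \<O> H" "md X"
 shows "ovr (qt (jb H T X) (bx H T X) (jb H T' X) (bx H T' X)) (mt (bx H T X) (bx H T' X)) (jb H (gsum G T T') X) (bx H (gsum G T T') X)
   (badd B H T T' (fst X)) (badd RB H T T' X)"
  "badd RB H T T' X \<in> isos W (mt (bx H T X) (bx H T' X)) (bx H (gsum G T T') X)"
proof -
 let ?S = "gsum G T T'" and ?x = "fst X" and ?R = "RH H" and ?Q = "qt (jb H T X) (bx H T X) (jb H T' X) (bx H T' X)"
 let ?k = "jb H ?S X oo[H] badd B H T T' ?x" and ?m = "mid4 (lev C H) (bobj B H T ?R) (bobj B H T ?x) (bobj B H T' ?R) (bobj B H T' ?x)"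
 note s = jb_slin[OF H, of _ X] and s1 = jb_slin[OF H assms(1,3)] and s2 = jb_slin[OF H assms(2,3)]
 note b1 = bx_md[OF H assms(1,3)] and b2 = bx_md[OF H assms(2,3)]
 have "?k oo[H] (actb T X **[H] actb T' X) = (jb H ?S X oo[H] actb ?S X) oo[H] (badd B H T T' ?R **[H] badd B H T T' ?x) oo[H] ?m"
  using badd_act[of T T' X] by (simp add: cassoc)
 also have "\<dots> = snd (bx H ?S X) oo[H] ((nm H ?S oo[H] badd B H T T' ?R) **[H] ?k) oo[H] ?m"
  by (subst slinD(5)[OF s]) (simp_all add: nf)
 also have "\<dots> = snd (bx H ?S X) oo[H] ((mR H oo[H] (nm H T **[H] nm H T')) **[H] ?k) oo[H] ?m"
  by (subst nm_add[OF H]) simp_all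
 finally have "llin (nm H T) (actb T X) (cd (actb T' X)) (bx H ?S X) ?k" "rlin (nm H T') (actb T' X) (cd (actb T X)) (bx H ?S X) ?k"
  using mid_linear[OF _ actb_unital actb_unital, of "bx H ?S X" T X T' X ?k] by simp_all
 then obtain h where h: "mor (mt (bx H T X) (bx H T' X)) h (bx H ?S X)" "h oo[H] ?Q = ?k"
  by (rule base_change_descend_tens[OF boxR_base_change(1)[OF H] boxR_base_change(1)[OF H], rotated 5]) simp_all
 have g: "gen ?Q (mt (bx H T X) (bx H T' X))" "gen (jb H ?S X) (bx H ?S X)" by (intro gen_tens jb_gen[OF H]; simp)+
 have "ovr ?Q (mt (bx H T X) (bx H T' X)) (jb H ?S X) (bx H ?S X) (badd B H T T' ?x) (mt (bx H T X) (bx H T' X), h, bx H ?S X)"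
  by (rule ovr_of_map[OF h g]) simp_all
 then show o: "ovr ?Q (mt (bx H T X) (bx H T' X)) (jb H ?S X) (bx H ?S X) (badd B H T T' ?x) (badd RB H T T' X)"
  unfolding RB_def by simp (rule lft)
 have "slin (nm H ?S) (actb ?S X) (mt (bx H T X) (bx H T' X)) (?Q oo[H] iv (badd B H T T' ?x))"
 proof -
  have b: "iso_arr (lev C H) ((badd B H T T' ?R **[H] badd B H T T' ?x) oo[H] ?m)" by simp
  have "(?Q oo[H] iv (badd B H T T' ?x)) oo[H] actb ?S X = snd (mt (bx H T X) (bx H T' X)) oo[H] (nm H ?S **[H] (?Q oo[H] iv (badd B H T T' ?x)))"
  proof (rule iso_cancel_r[OF b])
   have "((?Q oo[H] iv (badd B H T T' ?x)) oo[H] actb ?S X) oo[H] (badd B H T T' ?R **[H] badd B H T T' ?x) oo[H] ?m =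
    ?Q oo[H] iv (badd B H T T' ?x) oo[H] (actb ?S X oo[H] (badd B H T T' ?R **[H] badd B H T T' ?x) oo[H] ?m)" by (simp add: cassoc)
   also have "\<dots> = ?Q oo[H] (actb T X **[H] actb T' X)" by (subst badd_act[symmetric]) simp_all
   also have "\<dots> = snd (mt (bx H T X) (bx H T' X)) oo[H] ((mR H oo[H] (nm H T **[H] nm H T')) **[H] ?Q) oo[H] ?m"
    using llin_cq_mult[OF mt_md[OF b1 b2] cq_pre(1)[OF b1 b2 s1 s2] cq_pre(2)[OF b1 b2 s1 s2] HOL.refl HOL.refl] by (simp add: qt_def)
   also have "\<dots> = (snd (mt (bx H T X) (bx H T' X)) oo[H] (nm H ?S **[H] (?Q oo[H] iv (badd B H T T' ?x)))) oo[H] (badd B H T T' ?R **[H] badd B H T T' ?x) oo[H] ?m"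
    by (subst nm_add[OF H, symmetric]) (simp_all add: nf)
   finally show "((?Q oo[H] iv (badd B H T T' ?x)) oo[H] actb ?S X) oo[H] (badd B H T T' ?R **[H] badd B H T T' ?x) oo[H] ?m =
    (snd (mt (bx H T X) (bx H T' X)) oo[H] (nm H ?S **[H] (?Q oo[H] iv (badd B H T T' ?x)))) oo[H] (badd B H T T' ?R **[H] badd B H T T' ?x) oo[H] ?m" .
  qed simp_all
  then show ?thesis by (simp add: slin_def actn_def)
 qed
 then obtain k where k: "mor (bx H ?S X) k (mt (bx H T X) (bx H T' X))" "k oo[H] jb H ?S X = ?Q oo[H] iv (badd B H T T' ?x)"
  by (rule base_change_descend[OF boxR_base_change(1)[OF H], rotated 3]) simp_all
 show "badd RB H T T' X \<in> isos W (mt (bx H T X) (bx H T' X)) (bx H ?S X)"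
  by (rule ovr_isoI[OF g o k]) simp
qed

text \<open>Maps out of the unit module are given by \<open>point_map\<close>. For the inverse,
  \<open>bzero\<close> identifies the boxes with the empty set with the unit object, and
  \<open>nm_zero\<close> identifies the norm map there with the unit of \<open>R\<close>.\<close>

lemma bzero_ex:
 assumes X [simp]: "md X"
 shows "ovr (eR H) (RH H, mR H) (jb H (gempty G) X) (bx H (gempty G) X) (bzero B H (fst X)) (bzero RB H X)"
  "bzero RB H X \<in> isos W (RH H, mR H) (bx H (gempty G) X)"
proof -
 let ?E = "gempty G" and ?x = "fst X" and ?R = "RH H"
 obtain h where h: "mor (?R, mR H) h (bx H ?E X)" "h oo[H] eR H = jb H ?E X oo[H] bzero B H ?x"
  by (rule point_map[of "bx H ?E X" "jb H ?E X oo[H] bzero B H ?x"]) simp_all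
 note g = gen_unit jb_gen[OF H, of ?E X]
 have "ovr (eR H) (?R, mR H) (jb H ?E X) (bx H ?E X) (bzero B H ?x) ((?R, mR H), h, bx H ?E X)"
  by (rule ovr_of_map[OF h g]) simp_all
 then show o: "ovr (eR H) (?R, mR H) (jb H ?E X) (bx H ?E X) (bzero B H ?x) (bzero RB H X)"
  unfolding RB_def by simp (rule lft)
 have "slin (nm H ?E) (actb ?E X) (?R, mR H) (eR H oo[H] iv (bzero B H ?x))"
 proof -
  have b: "iso_arr (lev C H) (bzero B H ?R **[H] bzero B H ?x)" by simp
  have "(eR H oo[H] iv (bzero B H ?x)) oo[H] actb ?E X = mR H oo[H] (nm H ?E **[H] (eR H oo[H] iv (bzero B H ?x)))"
  proof (rule iso_cancel_r[OF b])
   have "((eR H oo[H] iv (bzero B H ?x)) oo[H] actb ?E X) oo[H] (bzero B H ?R **[H] bzero B H ?x) =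
    eR H oo[H] iv (bzero B H ?x) oo[H] (barr B H (idG H ?E) (snd X) oo[H] bzero B H (?R \<box>[H] ?x)) oo[H] lu un"
    using zero_mul[OF H, of ?R ?x] by (simp add: cassoc)
   also have "\<dots> = eR H oo[H] lu un"
    using bzero_nat[OF H, of "snd X"] by simp
   also have "\<dots> = mR H oo[H] (eR H **[H] eR H)"
    using md_unit[OF md_self, of "eR H"] by simp
   also have "\<dots> = (mR H oo[H] (nm H ?E **[H] (eR H oo[H] iv (bzero B H ?x)))) oo[H] (bzero B H ?R **[H] bzero B H ?x)"
    by (simp add: nf nm_zero[OF H])
   finally show "((eR H oo[H] iv (bzero B H ?x)) oo[H] actb ?E X) oo[H] (bzero B H ?R **[H] bzero B H ?x) =
    (mR H oo[H] (nm H ?E **[H] (eR H oo[H] iv (bzero B H ?x)))) oo[H] (bzero B H ?R **[H] bzero B H ?x)" .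
  qed simp_all
  then show ?thesis by (simp add: slin_def actn_def)
 qed
 then obtain k where k: "mor (bx H ?E X) k (?R, mR H)" "k oo[H] jb H ?E X = eR H oo[H] iv (bzero B H ?x)"
  by (rule base_change_descend[OF boxR_base_change(1)[OF H], rotated 3]) (simp_all add: md_self)
 show "bzero RB H X \<in> isos W (?R, mR H) (bx H ?E X)"
  by (rule ovr_isoI[OF g(1) _ o k]) simp_all
qed

text \<open>By \<open>nm_pt\<close> the norm map of the point is \<open>bpoint\<close> at
  \<open>R\<close>, so monoidality of \<open>bpoint\<close> is the semilinearity required; the same
  holds for the inverse.\<close>

lemma bpoint_ex:
 assumes X [simp]: "md X"
 shows "ovr (jb H (pt H) X) (bx H (pt H) X) (idt (fst X)) X (bpoint B H (fst X)) (bpoint RB H X)"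
  "bpoint RB H X \<in> isos W (bx H (pt H) X) X"
proof -
 let ?P = "pt H" and ?x = "fst X" and ?R = "RH H"
 interpret bp: mon_nat_iso "lev C H" "lev C H" "box_by G B H ?P" "id_sm (lev C H)" "bpoint B H" by (rule bpoint_iso[OF H])
 have a: "snd X \<in> homs (lev C H) (?R \<box>[H] ?x) ?x" by (simp add: in_homs)
 have "slin (idt ?R oo[H] bpoint B H ?R) (farr (box_by G B H ?P) (snd X) oo[H] fmu (box_by G B H ?P) ?R ?x) X (idt ?x oo[H] bpoint B H ?x)"
  by (rule mon_nat_slin[OF bp.mon_nat_axioms level_ctx[OF H] X a]) (simp_all add: slin_def actn_def)
 then have "slin (nm H ?P) (actb ?P X) X (bpoint B H ?x)" by (simp add: nm_pt[OF H])
 then obtain h where h: "mor (bx H ?P X) h X" "h oo[H] jb H ?P X = bpoint B H ?x"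
  by (rule base_change_descend[OF boxR_base_change(1)[OF H], rotated 3]) simp_all
 have g: "gen (jb H ?P X) (bx H ?P X)" "gen (idt ?x) X" by simp_all
 have "ovr (jb H ?P X) (bx H ?P X) (idt ?x) X (bpoint B H ?x) (bx H ?P X, h, X)"
  by (rule ovr_of_map[OF h(1) _ g]) (simp_all add: h(2))
 then show o: "ovr (jb H ?P X) (bx H ?P X) (idt ?x) X (bpoint B H ?x) (bpoint RB H X)"
  unfolding RB_def by simp (rule lft)
 have i: "mon_nat (lev C H) (lev C H) (id_sm (lev C H)) (box_by G B H ?P) (%x. iv (bpoint B H x))"
  by (rule mon_nat_inv[OF bp.mon_nat_axioms]) simp
 have "slin (nm H ?P oo[H] iv (bpoint B H ?R)) (farr (id_sm (lev C H)) (snd X) oo[H] fmu (id_sm (lev C H)) ?R ?x) (bx H ?P X) (jb H ?P X oo[H] iv (bpoint B H ?x))"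
  by (rule mon_nat_slin[OF i level_ctx[OF H] _ a]) (use jb_slin[OF H, of ?P X] in simp_all)
 then have k: "mor X (jb H ?P X oo[H] iv (bpoint B H ?x)) (bx H ?P X)" by (simp add: nm_pt[OF H] mor_slin)
 show "bpoint RB H X \<in> isos W (bx H ?P X) X"
  by (rule ovr_isoI[OF g o k]) simp_all
qed

text \<open>\<open>nm_bass\<close> matches the scalars of \<open>S \<times> T\<close> with those of
  the iterated box. The target is an iterated base change, so its maps are obtained from
  \<open>descend_base_change\<close>.\<close>

lemma bass_ex:
 assumes S [simp]: "S \<in> \<O> H" and T [simp]: "T \<in> \<O> H" and X [simp]: "md X"
 shows "ovr (jb H (gprod G S T) X) (bx H (gprod G S T) X) (qb H S (jb H T X) (bx H T X)) (bx H S (bx H T X))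
   (bass B H S T (fst X)) (bass RB H S T X)"
  "bass RB H S T X \<in> isos W (bx H (gprod G S T) X) (bx H S (bx H T X))"
proof -
 let ?P = "gprod G S T" and ?x = "fst X" and ?R = "RH H" and ?Y = "bx H T X"
 interpret P: pushforward "lev C H" "RH H" "mR H" "eR H" "sepi H" "lev C H" "RH H" "mR H" "eR H" "sepi H" "box_by G B H S" "nm H S"
   "bx H S" "jb H S" by (rule box_pushforward[OF H S])
 note n = bass_mod[OF H S T]
 have a: "snd X \<in> homs (lev C H) (?R \<box>[H] ?x) ?x" by (simp add: in_homs)
 have f: "P.fact (bobj B H T ?R) (actb T X) = farr (comp_sm (lev C H) (box_by G B H S) (box_by G B H T)) (snd X) oo[H] fmu (comp_sm (lev C H) (box_by G B H S) (box_by G B H T)) ?R ?x"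
  by (simp add: P.fact_def barr_id_comp[OF H] cassoc)
 have "slin ((nm H S oo[H] barr B H (idG H S) (nm H T)) oo[H] bass B H S T ?R) (farr (box_by G B H ?P) (snd X) oo[H] fmu (box_by G B H ?P) ?R ?x)
   (bx H S ?Y) (qb H S (jb H T X) ?Y oo[H] bass B H S T ?x)"
  by (rule mon_nat_slin[OF n level_ctx[OF H] _ a]) (use P.map_slin[OF jb_slin[OF H T X]] in \<open>simp_all add: f qb_def\<close>)
 then have "slin (nm H ?P) (actb ?P X) (bx H S ?Y) (qb H S (jb H T X) ?Y oo[H] bass B H S T ?x)"
  by (simp add: nm_bass[OF H S T] cassoc)
 then obtain h where h: "mor (bx H ?P X) h (bx H S ?Y)" "h oo[H] jb H ?P X = qb H S (jb H T X) ?Y oo[H] bass B H S T ?x"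
  by (rule base_change_descend[OF boxR_base_change(1)[OF H], rotated 3]) simp_all
 have g: "gen (jb H ?P X) (bx H ?P X)" "gen (qb H S (jb H T X) ?Y) (bx H S ?Y)" by (simp_all add: qb_gen[OF H])
 have "ovr (jb H ?P X) (bx H ?P X) (qb H S (jb H T X) ?Y) (bx H S ?Y) (bass B H S T ?x) (bx H ?P X, h, bx H S ?Y)"
  by (rule ovr_of_map[OF h g]) simp_all
 then show o: "ovr (jb H ?P X) (bx H ?P X) (qb H S (jb H T X) ?Y) (bx H S ?Y) (bass B H S T ?x) (bass RB H S T X)"
  unfolding RB_def by simp (rule lft)
 have i: "mon_nat (lev C H) (lev C H) (comp_sm (lev C H) (box_by G B H S) (box_by G B H T)) (box_by G B H ?P) (%x. iv (bass B H S T x))"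
  by (rule mon_nat_inv[OF n]) simp
 have "slin (nm H ?P oo[H] iv (bass B H S T ?R)) (P.fact (bobj B H T ?R) (actb T X)) (bx H ?P X) (jb H ?P X oo[H] iv (bass B H S T ?x))"
  unfolding f by (rule mon_nat_slin[OF i level_ctx[OF H] _ a]) (use jb_slin[OF H, of ?P X] in simp_all)
 moreover have "nm H ?P oo[H] iv (bass B H S T ?R) = nm H S oo[H] barr B H (idG H S) (nm H T)"
  by (simp add: nm_bass[OF H S T, symmetric] cassoc)
 ultimately have "slin (nm H S oo[H] farr (box_by G B H S) (nm H T)) (P.fact (dm (nm H T)) (actb T X)) (bx H ?P X) (jb H ?P X oo[H] iv (bass B H S T ?x))"
  by simp
 then obtain k where k: "mor (bx H S ?Y) k (bx H ?P X)" "k oo[H] jb H S ?Y oo[H] farr (box_by G B H S) (jb H T X) = jb H ?P X oo[H] iv (bass B H S T ?x)"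
  by (rule P.descend_base_change[OF boxR_base_change(1)[OF H T X], rotated 1]) simp_all
 show "bass RB H S T X \<in> isos W (bx H ?P X) (bx H S ?Y)"
  by (rule ovr_isoI[OF g o k(1)]) (use k(2) in \<open>simp_all add: qb_def\<close>)
qed

text \<open>\<open>bmul\<close> and \<open>bone\<close> are the comparison maps of the general
  construction, so their invertibility comes with \<open>indfun\<close>.\<close>

lemma box_indfun:
 assumes T [simp]: "T \<in> \<O> H"
 shows "indfun (lev C H) (RH H) (mR H) (eR H) (sepi H) (lev C H) (RH H) (mR H) (eR H) (sepi H) (box_by G B H T) (box_by G RB H T) (jb H T)"
proof -
 interpret P: pushforward "lev C H" "RH H" "mR H" "eR H" "sepi H" "lev C H" "RH H" "mR H" "eR H" "sepi H" "box_by G B H T" "nm H T"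
   "bx H T" "jb H T" by (rule box_pushforward[OF H T])
 show ?thesis
 proof (rule P.indfunI)
  show "\<exists>h. farr (box_by G RB H T) (X, u, Y) = (bx H T X, h, bx H T Y) & ar h & dm h = fst (bx H T X) &
   mor (bx H T X) h (bx H T Y) & h oo[H] jb H T X = jb H T Y oo[H] farr (box_by G B H T) u" if u: "mor X u Y" for X u Y
  proof -
   note [simp] = morD(1-5)[OF u]
   have "ovr (idt (fst X)) X (idt (fst Y)) Y u (X, u, Y)" using u by (simp add: ovr_def)
   from ovr_ex[OF ovr_barr[OF H gid_oiso[OF H T] this]] show ?thesis by (auto simp: mor_iff)
  qed
  show "\<exists>h. fmu (box_by G RB H T) X Y = (mt (bx H T X) (bx H T Y), h, bx H T (mt X Y)) &
   mor (mt (bx H T X) (bx H T Y)) h (bx H T (mt X Y)) &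
   h oo[H] qt (jb H T X) (bx H T X) (jb H T Y) (bx H T Y) = jb H T (mt X Y) oo[H] farr (box_by G B H T) (cq X Y) oo[H] fmu (box_by G B H T) (fst X) (fst Y)"
   if m [simp]: "md X" "md Y" for X Y
  proof -
   let ?Q = "qt (jb H T X) (bx H T X) (jb H T Y) (bx H T Y)" and ?r = "qb H T (cq X Y) (mt X Y)"
   obtain h where h: "mor (mt (bx H T X) (bx H T Y)) h (bx H T (mt X Y))"
    "h oo[H] ?Q = jb H T (mt X Y) oo[H] farr (box_by G B H T) (cq X Y) oo[H] fmu (box_by G B H T) (fst X) (fst Y)"
    by (rule P.Phi_mu_ex[OF m])
   have c: "gen (cq X Y) (mt X Y)" using gen_tens[OF gen_leaf[OF m(1)] gen_leaf[OF m(2)]] by (simp add: qt_def)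
   have "ovr ?Q (mt (bx H T X) (bx H T Y)) ?r (bx H T (mt X Y)) (bmul B H T (fst X) (fst Y)) (mt (bx H T X) (bx H T Y), h, bx H T (mt X Y))"
    by (rule ovr_of_map[OF h(1) _ gen_tens[OF jb_gen[OF H] jb_gen[OF H]] qb_gen[OF H T c]]) (use h(2) in \<open>simp_all add: qb_def cassoc\<close>)
   then have "ovr ?Q (mt (bx H T X) (bx H T Y)) ?r (bx H T (mt X Y)) (bmul B H T (fst X) (fst Y)) (bmul RB H T X Y)"
    unfolding RB_def by simp (rule lft)
   from ovr_ex[OF this] show ?thesis by (simp add: qb_def cassoc)
  qed
  show "\<exists>h. feps (box_by G RB H T) = ((RH H, mR H), h, bx H T (RH H, mR H)) & mor (RH H, mR H) h (bx H T (RH H, mR H)) &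
   h oo[H] eR H = jb H T (RH H, mR H) oo[H] farr (box_by G B H T) (eR H) oo[H] feps (box_by G B H T)"
  proof -
   note [simp] = md_self
   let ?U = "(RH H, mR H)"
   obtain h where h: "mor ?U h (bx H T ?U)" "h oo[H] eR H = jb H T ?U oo[H] farr (box_by G B H T) (eR H) oo[H] feps (box_by G B H T)"
    by (rule P.Phi_ep_ex)
   have "ovr (eR H) ?U (qb H T (eR H) ?U) (bx H T ?U) (bone B H T) (?U, h, bx H T ?U)"
    by (rule ovr_of_map[OF h(1) _ gen_unit qb_gen[OF H T gen_unit]]) (use h(2) in \<open>simp_all add: qb_def cassoc\<close>)
   then have "ovr (eR H) ?U (qb H T (eR H) ?U) (bx H T ?U) (bone B H T) (bone RB H T)"
    unfolding RB_def by simp (rule lft)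
   from ovr_ex[OF this] show ?thesis by (simp add: qb_def cassoc)
  qed
 qed simp
qed

end

declare box_rules [simp del]

end

section \<open>Comparison with restriction, and general generators\<close>

context O_modules
begin

context
 fixes f K H assumes f: "f \<in> homs (orb G) K H"
begin

interpretation cmon_ctx "lev C K" "RH K" "mR K" "eR K" "sepi K" by (rule level_ctx[OF subs(1)[OF f]])
interpretation c: cmon_ctx "lev C H" "RH H" "mR H" "eR H" "sepi H" by (rule level_ctx[OF subs(2)[OF f]])
interpretation F: sm_functor "lev C H" "lev C K" "res C f" by (rule restriction[OF f])
interpretation P: pushforward "lev C K" "RH K" "mR K" "eR K" "sepi K" "lev C H" "RH H" "mR H" "eR H" "sepi H" "res C f" "iv (rc f)"
  "mod_res_obj G C R f" "jr f"
 by (rule res_pushforward[OF f])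
interpretation I: indfun "lev C K" "RH K" "mR K" "eR K" "sepi K" "lev C H" "RH H" "mR H" "eR H" "sepi H" "res C f" "res RM f" "jr f"
 by (rule res_indfun[OF f])

lemmas res_box_rules = box_rules[OF subs(1)[OF f]] box_rules[OF subs(2)[OF f]] res_rules[OF f] mres_md[OF f] gpull_O'[OF f] bres_ar[OF f] nres_ar[OF f]

declare res_box_rules [simp]

lemma res_gen: "c.gen q X ==> gen (farr (res C f) q) (mres f X)"
 using P.Phi_gen_ex[of q X] c.genD(1-3)[of q X] by (simp add: jr_eq[OF f])

lemma res_qf: "c.md X ==> c.ar q ==> c.cd q = fst X ==> I.qf q X = farr (res C f) q"
 by (simp add: I.qf_def jr_eq[OF f])

lemma ovr_res: "c.ovr q X q' Y g u ==> ovr (farr (res C f) q) (mres f X) (farr (res C f) q') (mres f Y) (farr (res C f) g) (farr (res RM f) u)"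
 using I.ovr_farr[of q X q' Y g u] by (auto elim!: c.ovrE simp: res_qf c.mor_iff)

text \<open>The map \<open>bres\<close> of \<open>C\<close> is monoidal over the restriction of
  \<open>RH H\<close>, while the restricted module has scalars \<open>RH K\<close>. The two are
  exchanged along \<open>rc f\<close> by \<open>slin_pre\<close>, and \<open>nm_res\<close> matches
  the norm maps.\<close>

lemma bres_ex:
 assumes T [simp]: "T \<in> \<O> H" and X [simp]: "c.md X"
 shows "ovr (jb K (gpull G f T) (mres f X)) (bx K (gpull G f T) (mres f X)) (farr (res C f) (jb H T X)) (mres f (bx H T X))
   (bres B f T (fst X)) (bres RB f T X)"
  "bres RB f T X \<in> isos W (bx K (gpull G f T) (mres f X)) (mres f (bx H T X))"
proof -
 let ?T = "gpull G f T" and ?x = "fst X" and ?R = "RH H" and ?Y = "bx H T X" and ?F = "farr (res C f)" and ?r = "rc f"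
 let ?S = "comp_sm (lev C K) (box_by G B K ?T) (res C f)" and ?S' = "comp_sm (lev C K) (res C f) (box_by G B H T)"
 let ?act = "barr B H (idG H T) (snd X) \<bullet>\<^bsub>lev C H\<^esub> bmul B H T (RH H) (fst X)"
 let ?act' = "barr B K (idG K ?T) (snd (mres f X)) oo[K] bmul B K ?T (RH K) (fst (mres f X))"
 interpret b: sm_functor "lev C K" "lev C K" "box_by G B K ?T" by (rule box_by_functor[OF subs(1)[OF f]]) simp
 note n = bres_by[OF f T]
 have a: "snd X \<in> homs (lev C H) (?R \<odot>\<^bsub>lev C H\<^esub> ?x) ?x" by (simp add: in_homs)
 have fa: "P.fact (bobj B H T ?R) ?act = farr ?S' (snd X) oo[K] fmu ?S' ?R ?x"
  by (simp add: P.fact_def F.map_cmp cassoc)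
 have nat: "bmul B K ?T (cd u) (fobj (res C f) ?x) oo[K] (barr B K (idG K ?T) u **[K] idt (bobj B K ?T (fobj (res C f) ?x))) =
   barr B K (idG K ?T) (u **[K] idt (fobj (res C f) ?x)) oo[K] bmul B K ?T (dm u) (fobj (res C f) ?x)" if [simp]: "ar u" for u
  using b.mu_n[of u "idt (fobj (res C f) ?x)" "dm u" "fobj (res C f) ?x"] by (simp add: box_id[OF subs(1)[OF f]])
 have act: "farr ?S (snd X) oo[K] fmu ?S ?R ?x = barr B K (idG K ?T) (?F (snd X) oo[K] fmu (res C f) ?R ?x) oo[K] bmul B K ?T (fobj (res C f) ?R) (fobj (res C f) ?x)"
  by (simp add: barr_id_comp[OF subs(1)[OF f]] cassoc)
 \<comment> \<open>The action \<open>?act'\<close> has scalars from \<open>RH K\<close>, the one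
   belonging to \<open>?S\<close> has scalars from the restriction of \<open>RH H\<close>; they
   differ by \<open>rc f\<close>.\<close>
 have act1: "?act' = (farr ?S (snd X) oo[K] fmu ?S ?R ?x) oo[K] (barr B K (idG K ?T) ?r **[K] idt (bobj B K ?T (fobj (res C f) ?x)))"
  unfolding act using nat[of ?r] by (simp add: mres_snd[OF f] barr_id_comp[OF subs(1)[OF f]] cassoc)
 have ri: "(barr B K (idG K ?T) ?r **[K] idt (bobj B K ?T (fobj (res C f) ?x))) oo[K] (barr B K (idG K ?T) (iv ?r) **[K] idt (bobj B K ?T (fobj (res C f) ?x))) =
   idt (bobj B K ?T (fobj (res C f) ?R) \<box>[K] bobj B K ?T (fobj (res C f) ?x))"
  by (simp add: interchange barr_id_comp[OF subs(1)[OF f], symmetric] box_id[OF subs(1)[OF f]])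
 have act2: "farr ?S (snd X) oo[K] fmu ?S ?R ?x = ?act' oo[K] (barr B K (idG K ?T) (iv ?r) **[K] idt (bobj B K ?T (fobj (res C f) ?x)))"
  unfolding act1 using ri by (simp add: cassoc)
 have nr: "?F (nm H T) oo[K] bres B f T ?R oo[K] barr B K (idG K ?T) ?r = ?r oo[K] nm K ?T"
  using nm_res[OF f T] by (simp add: nres_eq[OF f])
 have "c.slin (nm H T) ?act ?Y (jb H T X)" by (rule jb_slin[OF subs(2)[OF f]]) simp_all
 from P.map_slin[OF this] have "slin (iv ?r oo[K] ?F (nm H T)) (farr ?S' (snd X) oo[K] fmu ?S' ?R ?x) (mres f ?Y) (?F (jb H T X))"
  by (simp add: fa jr_eq[OF f])
 then have "slin ((iv ?r oo[K] ?F (nm H T)) oo[K] bres B f T ?R) (farr ?S (snd X) oo[K] fmu ?S ?R ?x) (mres f ?Y) (?F (jb H T X) oo[K] bres B f T ?x)"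
  by (intro mon_nat_slin[OF n level_ctx[OF subs(1)[OF f]] _ a]) simp_all
 then have "slin (nm K ?T) ?act' (mres f ?Y) (?F (jb H T X) oo[K] bres B f T ?x)"
  by (rule slin_pre[of _ _ _ _ "barr B K (idG K ?T) ?r"]) (use nr act1 in \<open>simp_all add: cassoc\<close>)
 then obtain h where h: "mor (bx K ?T (mres f X)) h (mres f ?Y)" "h oo[K] jb K ?T (mres f X) = ?F (jb H T X) oo[K] bres B f T ?x"
  by (rule base_change_descend[OF boxR_base_change(1)[OF subs(1)[OF f]], rotated 3]) simp_all
 have g: "gen (jb K ?T (mres f X)) (bx K ?T (mres f X))" "gen (?F (jb H T X)) (mres f ?Y)"
  by (simp_all add: res_gen)
 have "ovr (jb K ?T (mres f X)) (bx K ?T (mres f X)) (?F (jb H T X)) (mres f ?Y) (bres B f T ?x) (bx K ?T (mres f X), h, mres f ?Y)"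
  by (rule ovr_of_map[OF h g]) simp_all
 then show o: "ovr (jb K ?T (mres f X)) (bx K ?T (mres f X)) (?F (jb H T X)) (mres f ?Y) (bres B f T ?x) (bres RB f T X)"
  unfolding RB_def by (simp add: Let_def) (rule lft)
 have i: "mon_nat (lev C H) (lev C K) ?S' ?S (%x. iv (bres B f T x))"
  by (rule mon_nat_inv[OF n]) simp
 have "slin (nm K ?T) ?act' (bx K ?T (mres f X)) (jb K ?T (mres f X))" by (rule jb_slin[OF subs(1)[OF f]]) simp_all
 then have "slin (nm K ?T oo[K] barr B K (idG K ?T) (iv ?r)) (farr ?S (snd X) oo[K] fmu ?S ?R ?x) (bx K ?T (mres f X)) (jb K ?T (mres f X))"
  by (rule slin_pre[of _ _ _ _ "barr B K (idG K ?T) (iv ?r)"]) (use act2 in \<open>simp_all add: cassoc\<close>)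
 then have "slin ((nm K ?T oo[K] barr B K (idG K ?T) (iv ?r)) oo[K] iv (bres B f T ?R)) (farr ?S' (snd X) oo[K] fmu ?S' ?R ?x) (bx K ?T (mres f X))
   (jb K ?T (mres f X) oo[K] iv (bres B f T ?x))"
  by (intro mon_nat_slin[OF i level_ctx[OF subs(1)[OF f]] _ a]) simp_all
 moreover have "(nm K ?T oo[K] barr B K (idG K ?T) (iv ?r)) oo[K] iv (bres B f T ?R) = iv ?r oo[K] ?F (nm H T)"
 proof -
  have "iv ?r oo[K] ?F (nm H T) = iv ?r oo[K] ?F (nm H T) oo[K] bres B f T ?R oo[K] (barr B K (idG K ?T) ?r oo[K] barr B K (idG K ?T) (iv ?r)) oo[K] iv (bres B f T ?R)"
   by (simp add: barr_id_comp[OF subs(1)[OF f], symmetric] box_id[OF subs(1)[OF f]])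
  also have "\<dots> = iv ?r oo[K] (?F (nm H T) oo[K] bres B f T ?R oo[K] barr B K (idG K ?T) ?r) oo[K] barr B K (idG K ?T) (iv ?r) oo[K] iv (bres B f T ?R)"
   by (simp add: cassoc)
  also have "\<dots> = (nm K ?T oo[K] barr B K (idG K ?T) (iv ?r)) oo[K] iv (bres B f T ?R)"
   unfolding nr by (simp add: cassoc)
  finally show ?thesis ..
 qed
 ultimately have "slin (iv ?r oo[K] ?F (nm H T)) (P.fact (c.dm (nm H T)) ?act) (bx K ?T (mres f X)) (jb K ?T (mres f X) oo[K] iv (bres B f T ?x))"
  by (simp add: fa)
 then obtain k where k: "mor (mres f ?Y) k (bx K ?T (mres f X))" "k oo[K] jr f ?Y oo[K] ?F (jb H T X) = jb K ?T (mres f X) oo[K] iv (bres B f T ?x)"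
  by (rule P.descend_base_change[OF boxR_base_change(1)[OF subs(2)[OF f] T X], rotated 1]) simp_all
 show "bres RB f T X \<in> isos W (bx K ?T (mres f X)) (mres f ?Y)"
  by (rule ovr_isoI[OF g o k(1)]) (use k(2) in \<open>simp_all add: jr_eq[OF f]\<close>)
qed

lemma ovr_bres:
 assumes T [simp]: "T \<in> \<O> H" and q: "c.gen q X"
 shows "ovr (qb K (gpull G f T) (farr (res C f) q) (mres f X)) (bx K (gpull G f T) (mres f X))
   (farr (res C f) (qb H T q X)) (mres f (bx H T X)) (bres B f T (c.dm q)) (bres RB f T X)"
proof -
 note [simp] = c.genD(1-3)[OF q]
 interpret n: mon_nat "lev C H" "lev C K" "comp_sm (lev C K) (box_by G B K (gpull G f T)) (res C f)"
  "comp_sm (lev C K) (res C f) (box_by G B H T)" "%M. bres B f T M" by (rule bres_by[OF f T])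
 have e: "farr (res C f) (qb H T q X) = farr (res C f) (jb H T X) oo[K] farr (res C f) (barr B H (idG H T) q)"
  by (simp add: qb_def F.map_cmp)
 show ?thesis
  unfolding qb_def[of K] e
  by (rule ovr_pre[OF bres_ex(1)]) (use n.natural[of q "c.dm q" "fst X"] in \<open>simp_all add: in_homs\<close>)
qed

end

declare res_box_rules [simp del]

context
 fixes H assumes H: "subgroup H G"
begin

interpretation cmon_ctx "lev C H" "RH H" "mR H" "eR H" "sepi H" by (rule level_ctx[OF H])

declare box_rules[OF H, simp]

lemma ovr_badd:
 assumes [simp]: "T \<in> \<O> H" "T' \<in> \<O> H" and q: "gen q X"
 shows "ovr (qt (qb H T q X) (bx H T X) (qb H T' q X) (bx H T' X)) (mt (bx H T X) (bx H T' X)) (qb H (gsum G T T') q X) (bx H (gsum G T T') X)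
   (badd B H T T' (dm q)) (badd RB H T T' X)"
proof -
 note [simp] = genD(1-3)[OF q]
 have e: "qt (qb H T q X) (bx H T X) (qb H T' q X) (bx H T' X) = qt (jb H T X) (bx H T X) (jb H T' X) (bx H T' X) oo[H] (barr B H (idG H T) q **[H] barr B H (idG H T') q)"
  by (simp add: qt_def qb_def nf)
 show ?thesis
  unfolding e unfolding qb_def
  by (rule ovr_pre[OF badd_ex(1)[OF H]]) (use badd_nat[OF H, of T T' q] in simp_all)
qed

lemma ovr_bzero:
 assumes q: "gen q X"
 shows "ovr (eR H) (RH H, mR H) (qb H (gempty G) q X) (bx H (gempty G) X) (bzero B H (dm q)) (bzero RB H X)"
proof -
 note [simp] = genD(1-3)[OF q] md_self
 have "ovr (eR H oo[H] idt un) (RH H, mR H) (qb H (gempty G) q X) (bx H (gempty G) X) (bzero B H (dm q)) (bzero RB H X)"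
  unfolding qb_def
  by (rule ovr_pre[OF bzero_ex(1)[OF H]]) (use bzero_nat[OF H, of q] in simp_all)
 then show ?thesis by simp
qed

lemma ovr_bpoint:
 assumes q: "gen q X"
 shows "ovr (qb H (pt H) q X) (bx H (pt H) X) q X (bpoint B H (dm q)) (bpoint RB H X)"
proof -
 note [simp] = genD(1-3)[OF q]
 interpret bp: mon_nat_iso "lev C H" "lev C H" "box_by G B H (pt H)" "id_sm (lev C H)" "bpoint B H" by (rule bpoint_iso[OF H])
 have "ovr (qb H (pt H) q X) (bx H (pt H) X) (idt (fst X) oo[H] q) X (bpoint B H (dm q)) (bpoint RB H X)"
  unfolding qb_def
  by (rule ovr_pre[OF bpoint_ex(1)[OF H]]) (use bp.natural[of q "dm q" "fst X"] in \<open>simp_all add: in_homs\<close>)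
 then show ?thesis by simp
qed

lemma ovr_bass:
 assumes S [simp]: "S \<in> \<O> H" and T [simp]: "T \<in> \<O> H" and q: "gen q X"
 shows "ovr (qb H (gprod G S T) q X) (bx H (gprod G S T) X) (qb H S (qb H T q X) (bx H T X)) (bx H S (bx H T X))
   (bass B H S T (dm q)) (bass RB H S T X)"
proof -
 note [simp] = genD(1-3)[OF q]
 interpret n: mon_nat "lev C H" "lev C H" "box_by G B H (gprod G S T)" "comp_sm (lev C H) (box_by G B H S) (box_by G B H T)" "%M. bass B H S T M"
  by (rule bass_mod[OF H S T])
 have e: "qb H S (qb H T q X) (bx H T X) = qb H S (jb H T X) (bx H T X) oo[H] barr B H (idG H S) (barr B H (idG H T) q)"
  by (simp add: qb_def[of H T] qb_def[of H S] barr_id_comp[OF H] cassoc)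
 show ?thesis
  unfolding e unfolding qb_def[of H "gprod G S T"]
  by (rule ovr_pre[OF bass_ex(1)[OF H]]) (use n.natural[of q "dm q" "fst X"] in \<open>simp_all add: in_homs\<close>)
qed

lemma ovr_bmul:
 assumes T [simp]: "T \<in> \<O> H" and q: "gen q X" and r: "gen r Y"
 shows "ovr (qt (qb H T q X) (bx H T X) (qb H T r Y) (bx H T Y)) (mt (bx H T X) (bx H T Y)) (qb H T (qt q X r Y) (mt X Y)) (bx H T (mt X Y))
   (bmul B H T (dm q) (dm r)) (bmul RB H T X Y)"
proof -
 interpret I: indfun "lev C H" "RH H" "mR H" "eR H" "sepi H" "lev C H" "RH H" "mR H" "eR H" "sepi H" "box_by G B H T" "box_by G RB H T" "jb H T"
  by (rule box_indfun[OF H T])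
 have "I.qf = qb H T" by (simp add: fun_eq_iff I.qf_def qb_def)
 then show ?thesis using I.ovr_mu[OF q r] by simp
qed

lemma ovr_bone:
 assumes T [simp]: "T \<in> \<O> H"
 shows "ovr (eR H) (RH H, mR H) (qb H T (eR H) (RH H, mR H)) (bx H T (RH H, mR H)) (bone B H T) (bone RB H T)"
proof -
 interpret I: indfun "lev C H" "RH H" "mR H" "eR H" "sepi H" "lev C H" "RH H" "mR H" "eR H" "sepi H" "box_by G B H T" "box_by G RB H T" "jb H T"
  by (rule box_indfun[OF H T])
 have "I.qf = qb H T" by (simp add: fun_eq_iff I.qf_def qb_def)
 then show ?thesis using I.ovr_ep by simp
qed

lemma ovr_runit:
 assumes q: "gen q X"
 shows "ovr q X (farr (res C (cid (orb G) H)) q) (mres (cid (orb G) H) X) (runit C H (dm q)) (runit RM H X)"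
proof -
 note [simp] = genD(1-3)[OF q]
 note i = orb_id[OF H]
 interpret u: mon_nat_iso "lev C H" "lev C H" "id_sm (lev C H)" "res C (cid (orb G) H)" "runit C H" by (rule runit_iso[OF H])
 interpret v: mon_nat_iso "MC H" "MC H" "id_sm (MC H)" "res RM (cid (orb G) H)" "runit RM H" by (rule RMod_runit_iso[OF H])
 have t [simp]: "ar (runit C H x)" "dm (runit C H x) = x" "cd (runit C H x) = fobj (res C (cid (orb G) H)) x" if "ob x" for x
  using u.component_iso[OF that] by (auto simp: isos_iff iso_ar)
 have "mor X (runit C H (fst X)) (mres (cid (orb G) H) X)" using v.component[of X] by (simp add: W_homs)
 then show ?thesis
  unfolding RMod_runit by (rule ovr_of_map[OF _ _ q res_gen[OF i q]])
   (use u.natural[of q "dm q" "fst X"] in \<open>simp_all add: in_homs\<close>)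
qed

end

lemma ovr_rcomp:
 assumes h: "h \<in> homs (orb G) L K" and f: "f \<in> homs (orb G) K H" and q: "gn H q X"
 shows "ov L (farr (res C h) (farr (res C f) q)) (mres h (mres f X)) (farr (res C (f \<bullet>\<^bsub>orb G\<^esub> h)) q) (mres (f \<bullet>\<^bsub>orb G\<^esub> h) X)
  (rcomp C f h (cdom (lev C H) q)) (rcomp RM f h X)"
proof -
 let ?fh = "f \<bullet>\<^bsub>orb G\<^esub> h" and ?t = "rcomp C f h"
 note fh = orb_comp[OF f h] and s = subs[OF h] subs(2)[OF f]
 interpret cmon_ctx "lev C L" "RH L" "mR L" "eR L" "sepi L" by (rule level_ctx[OF s(1)])
 interpret c: cmon_ctx "lev C H" "RH H" "mR H" "eR H" "sepi H" by (rule level_ctx[OF s(3)])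
 interpret F: sm_functor "lev C H" "lev C K" "res C f" by (rule restriction[OF f])
 interpret Fh: sm_functor "lev C K" "lev C L" "res C h" by (rule restriction[OF h])
 interpret Ffh: sm_functor "lev C H" "lev C L" "res C ?fh" by (rule restriction[OF fh])
 interpret u: mon_nat_iso "lev C H" "lev C L" "comp_sm (lev C L) (res C h) (res C f)" "res C ?fh" "rcomp C f h" by (rule rcomp_iso[OF h f])
 interpret v: mon_nat_iso "MC H" "MC L" "comp_sm (MC L) (res RM h) (res RM f)" "res RM ?fh" "rcomp RM f h" by (rule RMod_rcomp_iso[OF h f])
 have t [simp]: "ar (?t x)" "dm (?t x) = fobj (res C h) (fobj (res C f) x)" "cd (?t x) = fobj (res C ?fh) x" if "c.ob x" for x
  using u.component_iso[OF that] by (auto simp: isos_iff iso_ar)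
 note [simp] = c.genD(1-3)[OF q]
 have m: "mor (mres h (mres f X)) (?t (fst X)) (mres ?fh X)" using v.component[of X] by (simp add: W_homs)
 show ?thesis
  unfolding RMod_rcomp by (rule ovr_of_map[OF m _ res_gen[OF h res_gen[OF f q]] res_gen[OF fh q]])
   (use u.natural[of q "c.dm q" "fst X"] in \<open>simp_all add: in_homs\<close>)
qed

end

section \<open>Functors lying over functors to \<open>C\<close>\<close>

context cmon_ctx
begin

lemma ovr_mid4:
 assumes q: "gen q1 X1" "gen q2 X2" "gen q3 X3" "gen q4 X4"
 shows "ovr (qt (qt q1 X1 q2 X2) (mt X1 X2) (qt q3 X3 q4 X4) (mt X3 X4)) (mt (mt X1 X2) (mt X3 X4))
  (qt (qt q1 X1 q3 X3) (mt X1 X3) (qt q2 X2 q4 X4) (mt X2 X4)) (mt (mt X1 X3) (mt X2 X4))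
  (mid4 C (dm q1) (dm q2) (dm q3) (dm q4)) (mid4 W X1 X2 X3 X4)"
proof -
 note [simp] = genD(1-3)[OF q(1)] genD(1-3)[OF q(2)] genD(1-3)[OF q(3)] genD(1-3)[OF q(4)]
 \<comment> \<open>The middle interchange contains inverse associators, which lie over inverse
   associators of \<open>C\<close>.\<close>
 have i: "ovr (qt a X (qt b Y c Z) (mt Y Z)) (mt X (mt Y Z)) (qt (qt a X b Y) (mt X Y) c Z) (mt (mt X Y) Z)
   (iv (as (dm a) (dm b) (dm c))) (inv_arr W (assoc W X Y Z))" if "gen a X" "gen b Y" "gen c Z" for a b c X Y Z
  by (rule ovr_inv[OF ovr_assoc[OF that] W_assoc_iso]) (use genD(1-3)[OF that(1)] genD(1-3)[OF that(2)] genD(1-3)[OF that(3)] in simp_all)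
 note A = ovr_assoc[OF q(1,2) gen_tens[OF q(3,4)]]
 note B = ovr_tens[OF ovr_id[OF q(1)] ovr_comp[OF ovr_comp[OF i[OF q(2-4)] ovr_tens[OF ovr_braid[OF q(2,3)] ovr_id[OF q(4)]]] ovr_assoc[OF q(3,2,4)]]]
 note D = i[OF q(1,3) gen_tens[OF q(2,4)]]
 show ?thesis using ovr_comp[OF ovr_comp[OF A B] D] by (simp add: mid4_def)
qed

text \<open>It packages the hypotheses of \<open>transfer_functor\<close>, so that they can be
  carried through a functor of sets before (\<open>lies_over_pre\<close>) and a functor of modules
  after (\<open>lies_over_post\<close>).\<close>

definition lies_over :: "('p, 'b, 'k) smc_scheme => ('p, 'b, 'o, 'a) smfun => ('p, 'b, ('o, 'a) md, ('o, 'a) mdmap) smfun =>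
  ('p => 'a) => bool" where
 "lies_over E F \<Phi> \<gamma> \<longleftrightarrow> sm_functor E C F & (\<forall>x \<in> cobj E. gen (\<gamma> x) (fobj \<Phi> x)) &
  (\<forall>x y. \<forall>f \<in> homs E x y. ovr (\<gamma> x) (fobj \<Phi> x) (\<gamma> y) (fobj \<Phi> y) (farr F f) (farr \<Phi> f)) &
  (\<forall>x \<in> cobj E. \<forall>y \<in> cobj E. ovr (qt (\<gamma> x) (fobj \<Phi> x) (\<gamma> y) (fobj \<Phi> y)) (mt (fobj \<Phi> x) (fobj \<Phi> y))
   (\<gamma> (x \<odot>\<^bsub>E\<^esub> y)) (fobj \<Phi> (x \<odot>\<^bsub>E\<^esub> y)) (fmu F x y) (fmu \<Phi> x y) &
   fmu \<Phi> x y \<in> isos W (mt (fobj \<Phi> x) (fobj \<Phi> y)) (fobj \<Phi> (x \<odot>\<^bsub>E\<^esub> y))) &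
  ovr e (A, m) (\<gamma> (unit_obj E)) (fobj \<Phi> (unit_obj E)) (feps F) (feps \<Phi>) & feps \<Phi> \<in> isos W (A, m) (fobj \<Phi> (unit_obj E))"

lemma lies_overD:
 assumes "lies_over E F \<Phi> \<gamma>"
 shows "sm_functor E C F" "x \<in> cobj E ==> gen (\<gamma> x) (fobj \<Phi> x)"
  "f \<in> homs E x y ==> ovr (\<gamma> x) (fobj \<Phi> x) (\<gamma> y) (fobj \<Phi> y) (farr F f) (farr \<Phi> f)"
  "x \<in> cobj E ==> y \<in> cobj E ==> ovr (qt (\<gamma> x) (fobj \<Phi> x) (\<gamma> y) (fobj \<Phi> y)) (mt (fobj \<Phi> x) (fobj \<Phi> y))
   (\<gamma> (x \<odot>\<^bsub>E\<^esub> y)) (fobj \<Phi> (x \<odot>\<^bsub>E\<^esub> y)) (fmu F x y) (fmu \<Phi> x y)"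
  "x \<in> cobj E ==> y \<in> cobj E ==> fmu \<Phi> x y \<in> isos W (mt (fobj \<Phi> x) (fobj \<Phi> y)) (fobj \<Phi> (x \<odot>\<^bsub>E\<^esub> y))"
  "ovr e (A, m) (\<gamma> (unit_obj E)) (fobj \<Phi> (unit_obj E)) (feps F) (feps \<Phi>)" "feps \<Phi> \<in> isos W (A, m) (fobj \<Phi> (unit_obj E))"
 using assms unfolding lies_over_def by blast+

lemma lies_over_functor: "lies_over E F \<Phi> \<gamma> ==> sm_functor E W \<Phi>"
 by (rule transfer_functor[of E F]) (rule lies_overD; assumption)+

lemma lies_over_nat:
 assumes n: "mon_nat E C F F' \<tau>" and L: "lies_over E F \<Phi> \<gamma>" "lies_over E F' \<Phi>' \<gamma>'"
  and t: "\<And>x. x \<in> cobj E ==> ovr (\<gamma> x) (fobj \<Phi> x) (\<gamma>' x) (fobj \<Phi>' x) (\<tau> x) (\<tau>' x)"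
 shows "mon_nat E W \<Phi> \<Phi>' \<tau>'"
 by (rule transfer_nat[OF n lies_over_functor[OF L(1)] lies_over_functor[OF L(2)], of \<gamma> \<gamma>'])
  (rule lies_overD[OF L(1)] lies_overD[OF L(2)] t; assumption)+

text \<open>\<open>P\<close> is not asked to be a monoidal functor: the coherence laws come from the
  composite with values in \<open>C\<close>, which is \<open>S\<close>. So the coherence of
  pullbacks and products of sets need not be checked.\<close>

lemma lies_over_pre:
 assumes L: "lies_over E F \<Phi> \<gamma>" and S: "sm_functor E' C (comp_sm C F P)"
  and P: "\<And>x. x \<in> cobj E' ==> fobj P x \<in> cobj E" "\<And>f x y. f \<in> homs E' x y ==> farr P f \<in> homs E (fobj P x) (fobj P y)"
   "\<And>x y. x \<in> cobj E' ==> y \<in> cobj E' ==> fmu P x y \<in> isos E (fobj P x \<odot>\<^bsub>E\<^esub> fobj P y) (fobj P (x \<odot>\<^bsub>E'\<^esub> y))"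
   "feps P \<in> isos E (unit_obj E) (fobj P (unit_obj E'))"
 shows "lies_over E' (comp_sm C F P) (comp_sm W \<Phi> P) (%x. \<gamma> (fobj P x))"
proof -
 interpret Ph: sm_functor E W \<Phi> by (rule lies_over_functor[OF L])
 note d = lies_overD[OF L]
 show ?thesis
  unfolding lies_over_def comp_sm_sel
  by (intro conjI ballI allI S d(2) d(3) P(1) ovr_comp[OF d(4) d(3)] ovr_comp[OF d(6) d(3)] Ph.tgt.isos_comp[OF d(5) Ph.map_isos]
   Ph.tgt.isos_comp[OF d(7) Ph.map_isos] P(2) isos_homs[OF P(3)] P(3) isos_homs[OF P(4)] P(4))
qed

end

lemma (in indfun) lies_over_post:
 assumes L: "c.lies_over E F0 \<Phi>0 \<gamma>" and S: "sm_functor E D (comp_sm D F F0)"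
 shows "lies_over E (comp_sm D F F0) (comp_sm W \<Phi> \<Phi>0) (%x. qf (\<gamma> x) (fobj \<Phi>0 x))"
proof -
 interpret F0: sm_functor E C F0 by (rule c.lies_overD(1)[OF L])
 interpret P0: sm_functor E c.W \<Phi>0 by (rule c.lies_over_functor[OF L])
 interpret P: sm_functor c.W W \<Phi> by (rule Phi_sm_functor)
 note d = c.lies_overD[OF L]
 have m [simp]: "c.md (fobj \<Phi>0 x)" "c.ar (\<gamma> x)" "c.cd (\<gamma> x) = fst (fobj \<Phi>0 x)" if "x \<in> cobj E" for x
  using c.genD(1-3)[OF d(2)[OF that]] by auto
 have dg [simp]: "c.dm (\<gamma> x) = fobj F0 x" if "x \<in> cobj E" for x
  using c.gen_dm(1)[OF d(3)[OF F0.src.id_hom[OF that]]] that by simp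
 have mu: "ovr (qt (qf (\<gamma> x) (fobj \<Phi>0 x)) (fobj \<Phi> (fobj \<Phi>0 x)) (qf (\<gamma> y) (fobj \<Phi>0 y)) (fobj \<Phi> (fobj \<Phi>0 y)))
   (mt (fobj \<Phi> (fobj \<Phi>0 x)) (fobj \<Phi> (fobj \<Phi>0 y))) (qf (\<gamma> (x \<odot>\<^bsub>E\<^esub> y)) (fobj \<Phi>0 (x \<odot>\<^bsub>E\<^esub> y))) (fobj \<Phi> (fobj \<Phi>0 (x \<odot>\<^bsub>E\<^esub> y)))
   (Fa (fmu F0 x y) oo mu (fobj F0 x) (fobj F0 y)) (farr \<Phi> (fmu \<Phi>0 x y) \<bullet>\<^bsub>W\<^esub> fmu \<Phi> (fobj \<Phi>0 x) (fobj \<Phi>0 y))"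
  if x: "x \<in> cobj E" "y \<in> cobj E" for x y
  using ovr_comp[OF ovr_mu[OF d(2)[OF x(1)] d(2)[OF x(2)]] ovr_farr[OF d(4)[OF x]]] x by simp
 show ?thesis
  unfolding lies_over_def comp_sm_sel
 proof (intro conjI ballI allI)
  show "sm_functor E D (comp_sm D F F0)" by (rule S)
  show "gen (qf (\<gamma> x) (fobj \<Phi>0 x)) (fobj \<Phi> (fobj \<Phi>0 x))" if "x \<in> cobj E" for x
   by (rule gen_qf[OF d(2)[OF that]])
  show "farr \<Phi> (fmu \<Phi>0 x y) \<bullet>\<^bsub>W\<^esub> fmu \<Phi> (fobj \<Phi>0 x) (fobj \<Phi>0 y) \<in> isos W (mt (fobj \<Phi> (fobj \<Phi>0 x)) (fobj \<Phi> (fobj \<Phi>0 y))) (fobj \<Phi> (fobj \<Phi>0 (x \<odot>\<^bsub>E\<^esub> y)))"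
   if x: "x \<in> cobj E" "y \<in> cobj E" for x y
   by (rule P.tgt.isos_comp[OF Phi_mu_iso P.map_isos[OF d(5)[OF x]]]) (use x in simp_all)
  show "farr \<Phi> (feps \<Phi>0) \<bullet>\<^bsub>W\<^esub> feps \<Phi> \<in> isos W (B, mB) (fobj \<Phi> (fobj \<Phi>0 (unit_obj E)))"
   by (rule P.tgt.isos_comp[OF Phi_ep_iso P.map_isos[OF d(7)]])
  show "ovr eB (B, mB) (qf (\<gamma> (unit_obj E)) (fobj \<Phi>0 (unit_obj E))) (fobj \<Phi> (fobj \<Phi>0 (unit_obj E))) (Fa (feps F0) oo ep) (farr \<Phi> (feps \<Phi>0) \<bullet>\<^bsub>W\<^esub> feps \<Phi>)"
   by (rule ovr_comp[OF ovr_ep ovr_farr[OF d(6)]])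
 qed (rule ovr_farr[OF d(3)] mu; assumption)+
qed

context O_modules
begin

lemma oiso_isos: "subgroup H G ==> t \<in> homs (oiso G \<O> H) X Y ==> t \<in> isos (oiso G \<O> H) X Y"
proof -
 assume H: "subgroup H G" and t: "t \<in> homs (oiso G \<O> H) X Y"
 then obtain s where s: "s \<in> isos (fset G H) Y X" "s \<bullet>\<^bsub>fset G H\<^esub> t = idG H X" "t \<bullet>\<^bsub>fset G H\<^esub> s = idG H Y"
  by (auto simp: oiso_homs isos_def)
 show ?thesis
  by (rule isosI[of _ _ _ _ s]) (use t s in \<open>auto simp: oiso_homs[OF H]\<close>)
qed

lemma box_at_RB_sel [simp]: "fobj (box_at RM RB H X) T = bx H T X"
 "farr (box_at RM RB H X) t = boxR_arr G C B R N H t (cid (MC H) X)"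
 by simp_all

text \<open>The generator is arbitrary because it is also applied to boxed modules generated by
  \<open>qb\<close>, in \<open>RB_bass_left\<close>, and to restricted modules, in
  \<open>RB_bres_at\<close>.\<close>

lemma box_at_lies_over:
 assumes H: "subgroup H G" and q: "gn H q X" and M: "M = cdom (lev C H) q"
 shows "cmon_ctx.lies_over (lev C H) (RH H) (mR H) (eR H) (sepi H) (oiso G \<O> H) (box_at C B H M) (box_at RM RB H X) (%T. qb H T q X)"
proof -
 interpret cmon_ctx "lev C H" "RH H" "mR H" "eR H" "sepi H" by (rule level_ctx[OF H])
 note [simp] = box_rules[OF H] genD(1-3)[OF q] M
 show ?thesis
  unfolding lies_over_def
 proof (intro conjI ballI allI)
  show "sm_functor (oiso G \<O> H) (lev C H) (box_at C B H M)" by (rule box_at_functor[OF H]) simp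
  show "gen (qb H T q X) (fobj (box_at RM RB H X) T)" if "T \<in> cobj (oiso G \<O> H)" for T
   using that q by (simp add: oiso_obj[OF H] qb_gen[OF H])
  show "ovr (qb H T q X) (fobj (box_at RM RB H X) T) (qb H T' q X) (fobj (box_at RM RB H X) T') (farr (box_at C B H M) t) (farr (box_at RM RB H X) t)"
   if "t \<in> homs (oiso G \<O> H) T T'" for t T T'
   using ovr_barr[OF H that ovr_id[OF q]] by simp
  fix T T' assume "T \<in> cobj (oiso G \<O> H)" "T' \<in> cobj (oiso G \<O> H)"
  then have T: "T \<in> \<O> H" "T' \<in> \<O> H" by (simp_all add: oiso_obj[OF H])
  show "ovr (qt (qb H T q X) (fobj (box_at RM RB H X) T) (qb H T' q X) (fobj (box_at RM RB H X) T'))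
   (mt (fobj (box_at RM RB H X) T) (fobj (box_at RM RB H X) T')) (qb H (T \<odot>\<^bsub>oiso G \<O> H\<^esub> T') q X)
   (fobj (box_at RM RB H X) (T \<odot>\<^bsub>oiso G \<O> H\<^esub> T')) (fmu (box_at C B H M) T T') (fmu (box_at RM RB H X) T T')"
   using ovr_badd[OF H T q] by simp
  show "fmu (box_at RM RB H X) T T' \<in> isos W (mt (fobj (box_at RM RB H X) T) (fobj (box_at RM RB H X) T'))
   (fobj (box_at RM RB H X) (T \<odot>\<^bsub>oiso G \<O> H\<^esub> T'))"
   using badd_ex(2)[OF H T, of X] by simp
 next
  show "ovr (eR H) (RH H, mR H) (qb H (unit_obj (oiso G \<O> H)) q X) (fobj (box_at RM RB H X) (unit_obj (oiso G \<O> H)))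
   (feps (box_at C B H M)) (feps (box_at RM RB H X))"
   using ovr_bzero[OF H q] by simp
  show "feps (box_at RM RB H X) \<in> isos W (RH H, mR H) (fobj (box_at RM RB H X) (unit_obj (oiso G \<O> H)))"
   using bzero_ex(2)[OF H, of X] by simp
 qed
qed

end

section \<open>The axioms of the boxed structure on modules\<close>

context O_modules
begin

abbreviation rarr where "rarr H t u \<equiv> boxR_arr G C B R N H t u"

context
 fixes H assumes H: "subgroup H G"
begin

interpretation cmon_ctx "lev C H" "RH H" "mR H" "eR H" "sepi H" by (rule level_ctx[OF H])

declare box_rules[OF H, simp]

lemma boxR_homs: "t \<in> homs (oiso G \<O> H) T T' ==> u \<in> homs W X Y ==> rarr H t u \<in> homs W (bx H T X) (bx H T' Y)"
 by (rule ovr_homs[OF ovr_barr[OF H _ ovr_leaf]])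

lemma boxR_id:
 assumes T [simp]: "T \<in> \<O> H" and X: "X \<in> cobj W" shows "rarr H (idG H T) (cid W X) = cid W (bx H T X)"
proof -
 have X' [simp]: "md X" using X by simp
 note g = gen_leaf[OF X']
 show ?thesis
  by (rule ovr_eq[OF qb_gen[OF H T g] ovr_barr[OF H gid_oiso[OF H T] ovr_id[OF g]] ovr_id[OF qb_gen[OF H T g]]])
   (simp_all add: box_id[OF H])
qed

lemma boxR_comp:
 assumes t: "t \<in> homs (oiso G \<O> H) T T'" "t' \<in> homs (oiso G \<O> H) T' T''" and u: "u \<in> homs W X Y" "v \<in> homs W Y Z"
 shows "rarr H (t' \<bullet>\<^bsub>fset G H\<^esub> t) (v \<bullet>\<^bsub>W\<^esub> u) = rarr H t' v \<bullet>\<^bsub>W\<^esub> rarr H t u"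
proof -
 interpret o: sym_mon_cat "oiso G \<O> H" by (rule oiso_cat[OF H])
 have tt: "t' \<bullet>\<^bsub>fset G H\<^esub> t \<in> homs (oiso G \<O> H) T T''" using o.comp_hom[OF t] by simp
 have T: "T \<in> \<O> H" using t by (auto simp: oiso_homs[OF H])
 have X: "md X" using u unfolding W_homs by (auto simp: mor_iff)
 note l = ovr_leaf[OF u(1)] ovr_leaf[OF u(2)]
 have u': "fst (snd u) \<in> homs (lev C H) (fst X) (fst Y)" "fst (snd v) \<in> homs (lev C H) (fst Y) (fst Z)"
  using u unfolding W_homs by (auto simp: mor_iff in_homs)
 show ?thesis
  by (rule ovr_eq[OF qb_gen[OF H T gen_leaf[OF X]] ovr_barr[OF H tt ovr_comp[OF l]] ovr_comp[OF ovr_barr[OF H t(1) l(1)] ovr_barr[OF H t(2) l(2)]]])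
   (simp_all add: box_comp[OF H t u'])
qed

lemma RB_at:
 assumes X: "X \<in> cobj W" shows "sm_functor (oiso G \<O> H) W (box_at RM RB H X)"
 by (rule lies_over_functor[OF box_at_lies_over[OF H gen_leaf HOL.refl]]) (use X in simp)

lemma RB_by: "T \<in> \<O> H ==> sm_functor W W (box_by G RB H T)"
 by (rule indfun.Phi_sm_functor[OF box_indfun[OF H]])

lemma RB_at_nat:
 assumes u: "u \<in> homs W X Y"
 shows "mon_nat (oiso G \<O> H) W (box_at RM RB H X) (box_at RM RB H Y) (%T. rarr H (idG H T) u)"
proof -
 have X [simp]: "md X" "md Y" and u': "fst (snd u) \<in> homs (lev C H) (fst X) (fst Y)" using u unfolding W_homs by (auto simp: mor_iff in_homs)
 show ?thesis
 proof (rule lies_over_nat[OF box_at_nat[OF H u'] box_at_lies_over[OF H gen_leaf[OF X(1)]] box_at_lies_over[OF H gen_leaf[OF X(2)]]])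
  show "ovr (qb H T (idt (fst X)) X) (fobj (box_at RM RB H X) T) (qb H T (idt (fst Y)) Y) (fobj (box_at RM RB H Y) T)
   (barr B H (idG H T) (fst (snd u))) (rarr H (idG H T) u)" if "T \<in> cobj (oiso G \<O> H)" for T
   using ovr_barr[OF H gid_oiso[OF H] ovr_leaf[OF u], of T] that by (simp add: oiso_obj[OF H])
 qed simp_all
qed

lemma RB_by_nat:
 assumes t: "t \<in> homs (oiso G \<O> H) T T'"
 shows "mon_nat W W (box_by G RB H T) (box_by G RB H T') (%X. rarr H t (cid W X))"
proof -
 have T [simp]: "T \<in> \<O> H" "T' \<in> \<O> H" using t by (auto simp: oiso_homs[OF H])
 show ?thesis
 proof (rule mon_nat_of_indfun[OF box_indfun[OF H T(1)] box_indfun[OF H T(2)] box_by_nat[OF H t]])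
  show "\<exists>h. rarr H t (cid W X) = (fobj (box_by G RB H T) X, h, fobj (box_by G RB H T') X) &
    mor (fobj (box_by G RB H T) X) h (fobj (box_by G RB H T') X) & h oo[H] jb H T X = jb H T' X oo[H] barr B H t (idt (fst X))" if X: "md X" for X
   using ovr_ex[OF ovr_barr[OF H t ovr_id[OF gen_leaf[OF X]]]] X by simp
 qed
qed

lemma RB_add_mul:
 assumes T: "T \<in> \<O> H" "T' \<in> \<O> H" and X: "X \<in> cobj W" "Y \<in> cobj W"
 shows "badd RB H T T' (X \<odot>\<^bsub>W\<^esub> Y) \<bullet>\<^bsub>W\<^esub> (bmul RB H T X Y \<star>\<^bsub>W\<^esub> bmul RB H T' X Y) =
  bmul RB H (gsum G T T') X Y \<bullet>\<^bsub>W\<^esub> (badd RB H T T' X \<star>\<^bsub>W\<^esub> badd RB H T T' Y) \<bullet>\<^bsub>W\<^esub> mid4 W (bx H T X) (bx H T Y) (bx H T' X) (bx H T' Y)"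
proof -
 have X' [simp]: "md X" "md Y" using X by simp_all
 note [simp] = T and g = gen_leaf[OF X'(1)] gen_leaf[OF X'(2)] and S = gsum_O[OF H T]
 note q = qb_gen[OF H T(1) g(1)] qb_gen[OF H T(1) g(2)] qb_gen[OF H T(2) g(1)] qb_gen[OF H T(2) g(2)]
 show ?thesis
  unfolding W_simps
  \<comment> \<open>The three facts are a generator of the common source and, for each side of the
    equation, the arrow of \<open>C\<close> below it. What remains is \<open>add_mul\<close> in
    \<open>C\<close>; the other equations follow the same pattern.\<close>
  by (rule ovr_eq[OF gen_tens[OF gen_tens[OF q(1,2)] gen_tens[OF q(3,4)]]
    ovr_comp[OF ovr_tens[OF ovr_bmul[OF H T(1) g] ovr_bmul[OF H T(2) g]] ovr_badd[OF H T gen_tens[OF g]]]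
    ovr_comp[OF ovr_comp[OF ovr_mid4[OF q] ovr_tens[OF ovr_badd[OF H T g(1)] ovr_badd[OF H T g(2)]]] ovr_bmul[OF H S g]]])
   (simp_all add: add_mul[OF H])
qed

lemma RB_zero_mul:
 assumes X: "X \<in> cobj W" "Y \<in> cobj W"
 shows "bmul RB H (gempty G) X Y \<bullet>\<^bsub>W\<^esub> (bzero RB H X \<star>\<^bsub>W\<^esub> bzero RB H Y) = bzero RB H (X \<odot>\<^bsub>W\<^esub> Y) \<bullet>\<^bsub>W\<^esub> lun W (unit_obj W)"
proof -
 have X' [simp]: "md X" "md Y" using X by simp_all
 note g = gen_leaf[OF X'(1)] gen_leaf[OF X'(2)] and E = gempty_O[OF H]
 show ?thesis
  unfolding W_simps
  by (rule ovr_eq[OF gen_tens[OF gen_unit gen_unit] ovr_comp[OF ovr_tens[OF ovr_bzero[OF H g(1)] ovr_bzero[OF H g(2)]] ovr_bmul[OF H E g]]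
    ovr_comp[OF ovr_lun[OF gen_unit] ovr_bzero[OF H gen_tens[OF g]]]])
   (simp_all add: zero_mul[OF H])
qed

lemma RB_add_one:
 assumes T: "T \<in> \<O> H" "T' \<in> \<O> H"
 shows "badd RB H T T' (unit_obj W) \<bullet>\<^bsub>W\<^esub> (bone RB H T \<star>\<^bsub>W\<^esub> bone RB H T') = bone RB H (gsum G T T') \<bullet>\<^bsub>W\<^esub> lun W (unit_obj W)"
 unfolding W_simps
 by (rule ovr_eq[OF gen_tens[OF gen_unit gen_unit] ovr_comp[OF ovr_tens[OF ovr_bone[OF H T(1)] ovr_bone[OF H T(2)]] ovr_badd[OF H T gen_unit]]
   ovr_comp[OF ovr_lun[OF gen_unit] ovr_bone[OF H gsum_O[OF H T]]]])
  (use T add_one[OF H T] in simp_all)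

lemma RB_zero_one: "bzero RB H (unit_obj W) = bone RB H (gempty G)"
 unfolding W_simps
 by (rule ovr_eq[OF gen_unit ovr_bzero[OF H gen_unit] ovr_bone[OF H gempty_O[OF H]]]) (simp_all add: zero_one[OF H])

lemma RB_bres_unit:
 assumes T: "T \<in> \<O> H" and X: "X \<in> cobj W"
 shows "bres RB (cid (orb G) H) T X \<bullet>\<^bsub>W\<^esub> rarr H (runit (FSet G) H T) (runit RM H X) = runit RM H (bx H T X)"
proof -
 have X' [simp]: "md X" using X by simp
 note [simp] = T and g = gen_leaf[OF X'] and i = orb_id[OF H]
 show ?thesis
  by (rule ovr_eq[OF qb_gen[OF H T g] ovr_comp[OF ovr_barr[OF H runit_oiso[OF H T] ovr_runit[OF H g]] ovr_bres[OF i T g]] ovr_runit[OF H qb_gen[OF H T g]]])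
   (simp_all add: bres_unit[OF H] del: RMod_runit)
qed

lemma RB_bpoint_iso: "mon_nat_iso W W (box_by G RB H (pt H)) (id_sm W) (bpoint RB H)"
proof -
 interpret bp: mon_nat_iso "lev C H" "lev C H" "box_by G B H (pt H)" "id_sm (lev C H)" "bpoint B H" by (rule bpoint_iso[OF H])
 have "mon_nat W W (box_by G RB H (pt H)) (id_sm W) (bpoint RB H)"
 proof (rule mon_nat_of_indfun[OF box_indfun[OF H] indfun_id[OF level_ctx[OF H]] bp.mon_nat_axioms])
  show "\<exists>h. bpoint RB H X = (fobj (box_by G RB H (pt H)) X, h, fobj (id_sm W) X) &
    mor (fobj (box_by G RB H (pt H)) X) h (fobj (id_sm W) X) & h oo[H] jb H (pt H) X = idt (fst X) oo[H] bpoint B H (fst X)" if X: "md X" for X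
   using ovr_ex[OF bpoint_ex(1)[OF H X]] by simp
 qed simp
 then show ?thesis
  by (intro mon_nat_iso.intro mon_nat_iso_axioms.intro) (use bpoint_ex(2)[OF H] in simp_all)
qed

lemma RB_bass_iso:
 "S \<in> \<O> H ==> T \<in> \<O> H ==> X \<in> cobj W ==> bass RB H S T X \<in> isos W (bx H (gprod G S T) X) (bx H S (bx H T X))"
 using bass_ex(2)[OF H] by simp

lemma RB_bass_mod:
 assumes S: "S \<in> \<O> H" and T: "T \<in> \<O> H"
 shows "mon_nat W W (box_by G RB H (gprod G S T)) (comp_sm W (box_by G RB H S) (box_by G RB H T)) (%X. bass RB H S T X)"
proof (rule mon_nat_of_indfun[OF box_indfun[OF H gprod_O[OF H S T]] indfun_comp[OF box_indfun[OF H T] box_indfun[OF H S] mon_nat.axioms(2)[OF bass_mod[OF H S T]]] bass_mod[OF H S T]])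
 show "\<exists>h. bass RB H S T X = (fobj (box_by G RB H (gprod G S T)) X, h, fobj (comp_sm W (box_by G RB H S) (box_by G RB H T)) X) &
   mor (fobj (box_by G RB H (gprod G S T)) X) h (fobj (comp_sm W (box_by G RB H S) (box_by G RB H T)) X) &
   h oo[H] jb H (gprod G S T) X = (jb H S (fobj (box_by G RB H T) X) oo[H] farr (box_by G B H S) (jb H T X)) oo[H] bass B H S T (fst X)" if X: "md X" for X
  using ovr_ex[OF bass_ex(1)[OF H S T X]] by (simp add: qb_def)
qed

text \<open>Both functors of \<open>S\<close> lie over functors to \<open>C\<close>: the source by
  precomposition with the product with \<open>T\<close>, the target as the box with the module
  \<open>bx H T X\<close>, generated by \<open>qb\<close>.\<close>

lemma RB_bass_left:
 assumes T [simp]: "T \<in> \<O> H" and X: "X \<in> cobj W"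
 shows "mon_nat (oiso G \<O> H) W (comp_sm W (box_at RM RB H X) (gprod_left G H T)) (box_at RM RB H (bx H T X)) (%S. bass RB H S T X)"
proof -
 have X' [simp]: "md X" using X by simp
 note g = gen_leaf[OF X']
 interpret n: mon_nat "oiso G \<O> H" "lev C H" "comp_sm (lev C H) (box_at C B H (fst X)) (gprod_left G H T)"
  "box_at C B H (bobj B H T (fst X))" "%S. bass B H S T (fst X)" by (rule bass_left[OF H T]) simp
 have "lies_over (oiso G \<O> H) (box_at C B H (fst X)) (box_at RM RB H X) (%T. qb H T (idt (fst X)) X)"
  by (rule box_at_lies_over[OF H g]) simp
 from lies_over_pre[OF this n.dom.sm_functor_axioms]
 have l: "lies_over (oiso G \<O> H) (comp_sm (lev C H) (box_at C B H (fst X)) (gprod_left G H T)) (comp_sm W (box_at RM RB H X) (gprod_left G H T))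
   (%S. qb H (fobj (gprod_left G H T) S) (idt (fst X)) X)"
  using gproda_oiso[OF H _ gid_oiso[OF H T]] oiso_isos[OF H gprod_fmu_oiso(1)[OF H T]] oiso_isos[OF H gprod_feps_oiso(1)[OF H T]]
  by (simp add: oiso_obj[OF H])
 have l': "lies_over (oiso G \<O> H) (box_at C B H (bobj B H T (fst X))) (box_at RM RB H (bx H T X)) (%S. qb H S (qb H T (idt (fst X)) X) (bx H T X))"
  by (rule box_at_lies_over[OF H qb_gen[OF H T g]]) simp
 show ?thesis
  by (rule lies_over_nat[OF n.mon_nat_axioms l l']) (use ovr_bass[OF H _ T g] in \<open>simp add: oiso_obj[OF H]\<close>)
qed

lemma RB_bass_right:
 assumes S [simp]: "S \<in> \<O> H" and X: "X \<in> cobj W"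
 shows "mon_nat (oiso G \<O> H) W (comp_sm W (box_at RM RB H X) (gprod_right G H S)) (comp_sm W (box_by G RB H S) (box_at RM RB H X)) (%T. bass RB H S T X)"
proof -
 have X' [simp]: "md X" using X by simp
 note g = gen_leaf[OF X']
 interpret n: mon_nat "oiso G \<O> H" "lev C H" "comp_sm (lev C H) (box_at C B H (fst X)) (gprod_right G H S)"
  "comp_sm (lev C H) (box_by G B H S) (box_at C B H (fst X))" "%T. bass B H S T (fst X)" by (rule bass_right[OF H S]) simp
 interpret I: indfun "lev C H" "RH H" "mR H" "eR H" "sepi H" "lev C H" "RH H" "mR H" "eR H" "sepi H" "box_by G B H S" "box_by G RB H S" "jb H S"
  by (rule box_indfun[OF H S])
 have b: "lies_over (oiso G \<O> H) (box_at C B H (fst X)) (box_at RM RB H X) (%T. qb H T (idt (fst X)) X)"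
  by (rule box_at_lies_over[OF H g]) simp
 from lies_over_pre[OF b n.dom.sm_functor_axioms]
 have l: "lies_over (oiso G \<O> H) (comp_sm (lev C H) (box_at C B H (fst X)) (gprod_right G H S)) (comp_sm W (box_at RM RB H X) (gprod_right G H S))
   (%T. qb H (fobj (gprod_right G H S) T) (idt (fst X)) X)"
  using gproda_oiso[OF H gid_oiso[OF H S]] oiso_isos[OF H gprod_fmu_oiso(2)[OF H S]] oiso_isos[OF H gprod_feps_oiso(2)[OF H S]]
  by (simp add: oiso_obj[OF H])
 have qf: "I.qf q Y = qb H S q Y" for q Y by (simp add: I.qf_def qb_def)
 show ?thesis
  by (rule lies_over_nat[OF n.mon_nat_axioms l I.lies_over_post[OF b n.cod.sm_functor_axioms]]) (use ovr_bass[OF H S _ g] in \<open>simp add: oiso_obj[OF H] qf\<close>)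
qed

lemma RB_bass_point_right:
 assumes S: "S \<in> \<O> H" and X: "X \<in> cobj W"
 shows "rarr H (idG H S) (bpoint RB H X) \<bullet>\<^bsub>W\<^esub> bass RB H S (pt H) X = rarr H (mk_gmap (gprod G S (pt H)) (pr_case (%x y. x)) S) (cid W X)"
proof -
 have X' [simp]: "md X" using X by simp
 note [simp] = S and g = gen_leaf[OF X'] and P = gpoint_O[OF H]
 show ?thesis
  by (rule ovr_eq[OF qb_gen[OF H gprod_O[OF H S P] g] ovr_comp[OF ovr_bass[OF H S P g] ovr_barr[OF H gid_oiso[OF H S] ovr_bpoint[OF H g]]]
    ovr_barr[OF H gprod_point_oiso(1)[OF H S] ovr_id[OF g]]])
   (simp_all add: bass_point_right[OF H])
qed

lemma RB_bass_point_left: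
 assumes T: "T \<in> \<O> H" and X: "X \<in> cobj W"
 shows "bpoint RB H (bx H T X) \<bullet>\<^bsub>W\<^esub> bass RB H (pt H) T X = rarr H (mk_gmap (gprod G (pt H) T) (pr_case (%x y. y)) T) (cid W X)"
proof -
 have X' [simp]: "md X" using X by simp
 note [simp] = T and g = gen_leaf[OF X'] and P = gpoint_O[OF H]
 show ?thesis
  by (rule ovr_eq[OF qb_gen[OF H gprod_O[OF H P T] g] ovr_comp[OF ovr_bass[OF H P T g] ovr_bpoint[OF H qb_gen[OF H T g]]]
    ovr_barr[OF H gprod_point_oiso(2)[OF H T] ovr_id[OF g]]])
   (simp_all add: bass_point_left[OF H])
qed

end

context
 fixes f K H assumes f: "f \<in> homs (orb G) K H"
begin

interpretation cmon_ctx "lev C K" "RH K" "mR K" "eR K" "sepi K" by (rule level_ctx[OF subs(1)[OF f]])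
interpretation c: cmon_ctx "lev C H" "RH H" "mR H" "eR H" "sepi H" by (rule level_ctx[OF subs(2)[OF f]])
interpretation F: sm_functor "lev C H" "lev C K" "res C f" by (rule restriction[OF f])
interpretation I: indfun "lev C K" "RH K" "mR K" "eR K" "sepi K" "lev C H" "RH H" "mR H" "eR H" "sepi H" "res C f" "res RM f" "jr f"
 by (rule res_indfun[OF f])

declare res_box_rules[OF f, simp]

lemma RB_bres_iso:
 "T \<in> \<O> H ==> X \<in> cobj c.W ==> bres RB f T X \<in> isos W (bx K (gpull G f T) (mres f X)) (mres f (bx H T X))"
 using bres_ex(2)[OF f] by simp

text \<open>The source precomposes with pullback of sets and the target postcomposes with
  restriction of modules, whence the two closure rules for \<open>lies_over\<close>.\<close>

lemma RB_bres_at: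
 assumes X: "X \<in> cobj c.W"
 shows "mon_nat (oiso G \<O> H) W (comp_sm W (box_at RM RB K (mres f X)) (res (FSet G) f)) (comp_sm W (res RM f) (box_at RM RB H X)) (%T. bres RB f T X)"
proof -
 have X' [simp]: "c.md X" using X by simp
 note g = c.gen_leaf[OF X']
 interpret n: mon_nat "oiso G \<O> H" "lev C K" "comp_sm (lev C K) (box_at C B K (fobj (res C f) (fst X))) (res (FSet G) f)"
  "comp_sm (lev C K) (res C f) (box_at C B H (fst X))" "%T. bres B f T (fst X)" by (rule bres_at[OF f]) simp
 have "lies_over (oiso G \<O> K) (box_at C B K (fobj (res C f) (fst X))) (box_at RM RB K (mres f X)) (%T. qb K T (farr (res C f) (c.idt (fst X))) (mres f X))"
  by (rule box_at_lies_over[OF subs(1)[OF f] res_gen[OF f g]]) simp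
 from lies_over_pre[OF this n.dom.sm_functor_axioms]
 have l: "lies_over (oiso G \<O> H) (comp_sm (lev C K) (box_at C B K (fobj (res C f) (fst X))) (res (FSet G) f))
   (comp_sm W (box_at RM RB K (mres f X)) (res (FSet G) f)) (%T. qb K (fobj (res (FSet G) f) T) (farr (res C f) (c.idt (fst X))) (mres f X))"
  using res_oiso[OF f] oiso_isos[OF subs(1)[OF f] res_fmu_oiso[OF f]] oiso_isos[OF subs(1)[OF f] res_feps_oiso[OF f]] gpull_O[OF f]
  by (simp add: oiso_obj[OF subs(1)[OF f]] oiso_obj[OF subs(2)[OF f]])
 have b: "c.lies_over (oiso G \<O> H) (box_at C B H (fst X)) (box_at RM RB H X) (%T. qb H T (c.idt (fst X)) X)"
  by (rule box_at_lies_over[OF subs(2)[OF f] g]) simp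
 show ?thesis
 proof (rule lies_over_nat[OF n.mon_nat_axioms l I.lies_over_post[OF b n.cod.sm_functor_axioms]])
  fix T assume "T \<in> cobj (oiso G \<O> H)"
  then have T [simp]: "T \<in> \<O> H" by (simp add: oiso_obj[OF subs(2)[OF f]])
  have q: "I.qf (qb H T (c.idt (fst X)) X) (bx H T X) = farr (res C f) (qb H T (c.idt (fst X)) X)"
   by (rule res_qf[OF f]) simp_all
  show "ovr (qb K (fobj (res (FSet G) f) T) (farr (res C f) (c.idt (fst X))) (mres f X)) (fobj (comp_sm W (box_at RM RB K (mres f X)) (res (FSet G) f)) T)
    (I.qf (qb H T (c.idt (fst X)) X) (fobj (box_at RM RB H X) T)) (fobj (comp_sm W (res RM f) (box_at RM RB H X)) T) (bres B f T (fst X)) (bres RB f T X)"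
   using ovr_bres[OF f T g] by (simp add: q[simplified])
 qed
qed

lemma RB_bres_by:
 assumes T [simp]: "T \<in> \<O> H"
 shows "mon_nat c.W W (comp_sm W (box_by G RB K (gpull G f T)) (res RM f)) (comp_sm W (res RM f) (box_by G RB H T)) (%X. bres RB f T X)"
proof (rule mon_nat_of_indfun[OF indfun_comp[OF res_indfun[OF f] box_indfun[OF subs(1)[OF f]] mon_nat.axioms(1)[OF bres_by[OF f T]]]
  indfun_comp[OF box_indfun[OF subs(2)[OF f] T] res_indfun[OF f] mon_nat.axioms(2)[OF bres_by[OF f T]]] bres_by[OF f T]])
 show "\<exists>h. bres RB f T X = (fobj (comp_sm W (box_by G RB K (gpull G f T)) (res RM f)) X, h, fobj (comp_sm W (res RM f) (box_by G RB H T)) X) &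
   mor (fobj (comp_sm W (box_by G RB K (gpull G f T)) (res RM f)) X) h (fobj (comp_sm W (res RM f) (box_by G RB H T)) X) &
   h oo[K] jb K (gpull G f T) (fobj (res RM f) X) oo[K] farr (box_by G B K (gpull G f T)) (jr f X) =
   (jr f (fobj (box_by G RB H T) X) oo[K] farr (res C f) (jb H T X)) oo[K] bres B f T (fst X)" if X [simp]: "c.md X" for X
  using ovr_ex[OF bres_ex(1)[OF f T X]] by (simp add: jr_eq[OF f] box_id[OF subs(1)[OF f]])
qed simp

lemma RB_bpoint_res:
 assumes X: "X \<in> cobj c.W"
 shows "farr (res RM f) (bpoint RB H X) \<bullet>\<^bsub>W\<^esub> bres RB f (pt H) X = bpoint RB K (mres f X) \<bullet>\<^bsub>W\<^esub> rarr K (bang K (gpull G f (pt H))) (cid W (mres f X))"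
proof -
 have X' [simp]: "c.md X" using X by simp
 note g = c.gen_leaf[OF X'] and P = gpoint_O[OF subs(2)[OF f]] and s = subs[OF f]
 note r = res_gen[OF f g]
 show ?thesis
  by (rule ovr_eq[OF qb_gen[OF s(1) gpull_O[OF f P] r] ovr_comp[OF ovr_bres[OF f P g] ovr_res[OF f ovr_bpoint[OF s(2) g]]]
    ovr_comp[OF ovr_barr[OF s(1) gpull_point_oiso[OF f] ovr_id[OF r]] ovr_bpoint[OF s(1) r]]])
   (simp_all add: bpoint_res[OF f])
qed

lemma RB_bass_res:
 assumes S: "S \<in> \<O> H" and T: "T \<in> \<O> H" and X: "X \<in> cobj c.W"
 shows "farr (res RM f) (bass RB H S T X) \<bullet>\<^bsub>W\<^esub> bres RB f (gprod G S T) X =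
   bres RB f S (bx H T X) \<bullet>\<^bsub>W\<^esub> rarr K (idG K (gpull G f S)) (bres RB f T X) \<bullet>\<^bsub>W\<^esub>
   bass RB K (gpull G f S) (gpull G f T) (mres f X) \<bullet>\<^bsub>W\<^esub>
   rarr K (mk_gmap (gpull G f (gprod G S T)) (pr_case (%c. pr_case (%x y. Pr (Pr c x) (Pr c y)))) (gprod G (gpull G f S) (gpull G f T))) (cid W (mres f X))"
proof -
 have X' [simp]: "c.md X" using X by simp
 note [simp] = S T and g = c.gen_leaf[OF X'] and s = subs[OF f] and ST = gprod_O[OF subs(2)[OF f] S T] and fS = gpull_O[OF f S] and fT = gpull_O[OF f T]
 note r = res_gen[OF f g]
 show ?thesis
  by (rule ovr_eq[OF qb_gen[OF s(1) gpull_O[OF f ST] r] ovr_comp[OF ovr_bres[OF f ST g] ovr_res[OF f ovr_bass[OF s(2) S T g]]]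
    ovr_comp[OF ovr_comp[OF ovr_comp[OF ovr_barr[OF s(1) gpull_gprod_oiso[OF f S T] ovr_id[OF r]] ovr_bass[OF s(1) fS fT r]]
     ovr_barr[OF s(1) gid_oiso[OF s(1) fS] ovr_bres[OF f T g]]] ovr_bres[OF f S qb_gen[OF s(2) T g]]]])
   (simp_all add: bass_res[OF f])
qed

end

lemma RB_bres_comp:
 assumes h: "h \<in> homs (orb G) L K" and f: "f \<in> homs (orb G) K H" and T: "T \<in> \<O> H" and X: "X \<in> cobj (MC H)"
 shows "rcomp RM f h (bx H T X) \<bullet>\<^bsub>MC L\<^esub> farr (res RM h) (bres RB f T X) \<bullet>\<^bsub>MC L\<^esub> bres RB h (gpull G f T) (mres f X) =
   bres RB (f \<bullet>\<^bsub>orb G\<^esub> h) T X \<bullet>\<^bsub>MC L\<^esub> rarr L (rcomp (FSet G) f h T) (rcomp RM f h X)"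
proof -
 note fh = orb_comp[OF f h] and s = subs[OF h] subs(2)[OF f] and fT = gpull_O[OF f T]
 interpret cmon_ctx "lev C L" "RH L" "mR L" "eR L" "sepi L" by (rule level_ctx[OF s(1)])
 interpret c: cmon_ctx "lev C H" "RH H" "mR H" "eR H" "sepi H" by (rule level_ctx[OF s(3)])
 interpret F: sm_functor "lev C H" "lev C K" "res C f" by (rule restriction[OF f])
 interpret Fh: sm_functor "lev C K" "lev C L" "res C h" by (rule restriction[OF h])
 have X' [simp]: "c.md X" using X by simp
 note [simp] = T box_rules[OF s(3)] and g = c.gen_leaf[OF X']
 note rf = res_gen[OF f g]
 note rh = res_gen[OF h rf]
 show ?thesis
  by (rule ovr_eq[OF qb_gen[OF s(1) gpull_O[OF h fT] rh]
    ovr_comp[OF ovr_comp[OF ovr_bres[OF h fT rf] ovr_res[OF h ovr_bres[OF f T g]]] ovr_rcomp[OF h f qb_gen[OF s(3) T g]]]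
    ovr_comp[OF ovr_barr[OF s(1) rcomp_oiso[OF h f T] ovr_rcomp[OF h f g]] ovr_bres[OF fh T g]]])
   (simp_all add: bres_comp[OF h f])
qed

lemma RMod_O_sym_mon: "O_sym_mon G \<O> RM RB"
proof (intro O_sym_mon.intro O_sym_mon_axioms.intro indexing_system_axioms RMod_coeff_system, unfold RMod_lev RB_sel RMod_res_obj)
 show "bx H T X \<in> cobj (MC H)" if H: "subgroup H G" "T \<in> \<O> H" "X \<in> cobj (MC H)" for H T X
  using bx_md[OF H(1,2)] H(3) by (simp add: mod_cat_def)
 show "subgroup H G ==> mon_nat_iso (MC H) (MC H) (box_by G RB H (pt H)) (id_sm (MC H)) (bpoint RB H)" for H
  by (rule RB_bpoint_iso)
qed (fact boxR_homs boxR_id boxR_comp RB_at RB_by RB_at_nat RB_by_nat RB_add_mul RB_zero_mul RB_add_one RB_zero_one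
 RB_bres_iso RB_bres_at RB_bres_by RB_bres_unit RB_bres_comp RB_bpoint_res RB_bass_iso RB_bass_mod RB_bass_left RB_bass_right RB_bass_res
 RB_bass_point_right RB_bass_point_left)+

end

text \<open>Reflexive coequalizers are sifted colimits over a small category, so each clause of
  \<open>compatible_colimits\<close> specializes to them.\<close>

lemma O_modules_of_colimits:
 fixes G :: "'g monoid" and C :: "('g, 'o, 'a) coeff"
 assumes fin: "finite (carrier G)" and inf: "infinite (UNIV :: 'j set)" and cc: "compatible_colimits TYPE('j) G \<O> C B"
  and R: "O_comm_monoid G \<O> C B R N"
 shows "O_modules G \<O> C B R N"
proof -
 interpret O_comm_monoid G \<O> C B R N by (rule R)
 have c: "cocomplete TYPE('j) (lev C H)" "T \<in> \<O> H ==> preserves_sifted TYPE('j) (lev C H) (lev C H) (bobj B H T) (barr B H (cid (fset G H) T))"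
  "M \<in> cobj (lev C H) ==> preserves_sifted TYPE('j) (lev C H) (lev C H) (%N. M \<odot>\<^bsub>lev C H\<^esub> N) (%n. cid (lev C H) M \<star>\<^bsub>lev C H\<^esub> n)"
  if "subgroup H G" for H T M
  using cc that unfolding compatible_colimits_def by blast+
 have r: "preserves_sifted TYPE('j) (lev C H) (lev C K) (fobj (res C f)) (farr (res C f))" if "f \<in> homs (orb G) K H" for f K H
  using cc that unfolding compatible_colimits_def by blast
 show ?thesis
 proof (intro O_modules.intro fin_indexing_system.intro fin_indexing_system_axioms.intro O_modules_axioms.intro indexing_system_axioms fin R)
  show "\<exists>q. is_coeq (lev C H) u v q" if H: "subgroup H G" and "reflexive (lev C H) u v" for H u v
  proof -
   interpret c: sym_mon_cat "lev C H" by (rule level[OF H])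
   show ?thesis by (rule reflexive_coeq_exists[OF inf c.category_axioms c(1)[OF H] that(2)])
  qed
  show "rcoeq (lev C H) (cid (lev C H) x \<star>\<^bsub>lev C H\<^esub> u) (cid (lev C H) x \<star>\<^bsub>lev C H\<^esub> v) (cid (lev C H) x \<star>\<^bsub>lev C H\<^esub> q)"
   if H: "subgroup H G" and x: "x \<in> cobj (lev C H)" and q: "rcoeq (lev C H) u v q" for H x u v q
  proof -
   interpret c: sym_mon_cat "lev C H" by (rule level[OF H])
   show ?thesis by (rule func.map_rcoeq[OF c.tens_func[OF x] inf c(3)[OF H x] q])
  qed
  show "rcoeq (lev C H) (barr B H (cid (fset G H) T) u) (barr B H (cid (fset G H) T) v) (barr B H (cid (fset G H) T) q)"
   if H: "subgroup H G" and T: "T \<in> \<O> H" and q: "rcoeq (lev C H) u v q" for H T u v q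
  proof -
   interpret b: sm_functor "lev C H" "lev C H" "box_by G B H T" by (rule box_by_functor[OF H T])
   have "func (lev C H) (lev C H) (bobj B H T) (barr B H (cid (fset G H) T))" using b.func_axioms by simp
   then show ?thesis by (rule func.map_rcoeq[OF _ inf c(2)[OF H T] q])
  qed
  show "rcoeq (lev C K) (farr (res C f) u) (farr (res C f) v) (farr (res C f) q)"
   if f: "f \<in> homs (orb G) K H" and q: "rcoeq (lev C H) u v q" for f K H u v q
  proof -
   interpret b: sm_functor "lev C H" "lev C K" "res C f" by (rule restriction[OF f])
   show ?thesis by (rule b.map_rcoeq[OF inf r[OF f] q])
  qed
 qed
qed

theorem theorem7p6:
  fixes G :: "'g monoid" and \<O> :: "'g set \<Rightarrow> 'g gset set"
    and C :: "('g, 'o, 'a) coeff" and B :: "('g, 'o, 'a) box"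
    and R :: 'o and N :: "'g set \<Rightarrow> 'g gmap \<Rightarrow> 'a"
  assumes "group G" and "finite (carrier G)"
    and "indexing_system G \<O>"
    and "O_sym_mon G \<O> C B"
    and "infinite (UNIV :: 'j set)" and "compatible_colimits TYPE('j) G \<O> C B"
    and "O_comm_monoid G \<O> C B R N"
  shows "\<exists>B'. O_sym_mon G \<O> (RMod G C B R N) B' \<and>
    (\<forall>H. subgroup H G \<longrightarrow>
      (\<forall>T \<in> \<O> H. \<forall>X \<in> cobj (lev (RMod G C B R N) H). bobj B' H T X = boxR_obj G C B R N H T X) \<and>
      (\<forall>t \<in> carr (oiso G \<O> H). \<forall>u \<in> carr (lev (RMod G C B R N) H).
        barr B' H t u = boxR_arr G C B R N H t u))"
proof -
 interpret O_modules G \<O> C B R N by (rule O_modules_of_colimits[OF assms(2,5-7)])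
 show ?thesis by (intro exI[of _ RB] conjI RMod_O_sym_mon) simp
qed

end
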